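(* Let $\mathbf k=\mathbf C$ be the field of complex numbers and let $\mathcal D$ be the sheaf of rings of analytic linear differential operators on $\mathbf C^n$. For $\beta,\beta'\in\mathbf C^d$ put $\mathcal M_A(\beta)=\mathcal D\otimes_DM_A(\beta)$ and $\mathcal M_A(\beta')=\mathcal D\otimes_DM_A(\beta')$. Then the $A$-hypergeometric systems $\mathcal M_A(\beta)$ and $\mathcal M_A(\beta')$ are isomorphic as $\mathcal D$-modules if and only if $E_\tau(\beta)=E_\tau(\beta')$ for all faces $\tau$ of the cone $\mathbf Q_{\ge0}A$.
   Context: Let $\mathbf N=\{0,1,2,\dots\}$. Let $A=(a_1,\dots,a_n)=(a_{ij})$ be a $d\times n$ integer matrix of rank $d$ whose columns all lie on one hyperplane of $\mathbf Q^d$ not containing the origin; $A$ also denotes the set of its columns, $\mathbf NA$ the monoid and $\mathbf Q_{\ge0}A$ the cone they generate. $I_A=\langle \partial^u-\partial^v : u,v\in\mathbf N^n,\ Au=Av\rangle\subset\mathbf C[\partial_1,\dots,\partial_n]$. For $\beta\in\mathbf C^d$, $H_A(\beta)$ is the left ideal of the Weyl algebra $D=\mathbf C\langle x_1,\dots,x_n,\partial_1,\dots,\partial_n\rangle$ generated by $I_A$ and $\sum_{j}a_{ij}x_j\partial_j-\beta_i$ ($i=1,\dots,d$); $M_A(\beta)=D/H_A(\beta)$. For a face $\tau$ of the cone $\mathbf Q_{\ge0}A$ (including $\{0\}$ and the cone itself), $\mathbf Z(A\cap\tau)$ and $\mathbf C(A\cap\tau)$ are the additive group and the $\mathbf C$-vector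 space generated by $A\cap\tau$ (both $\{0\}$ if $A\cap\tau=\emptyset$), and $E_\tau(\beta)=\{\lambda\in\mathbf C(A\cap\tau)/\mathbf Z(A\cap\tau) : \beta-\lambda\in\mathbf NA+\mathbf Z(A\cap\tau)\}$. *)

theory Defs
  imports
    "HOL-Analysis.Analysis"
    "HOL-Algebra.Ring"
    "HOL-Algebra.Module"
    "HOL-Algebra.AbelCoset"
    "HOL-Algebra.Ideal"
    "HOL-Algebra.Generated_Rings"
    "HOL-Algebra.Free_Abelian_Groups"
    "HOL-Library.FuncSet"
    "HOL-Library.Set_Algebras"
    "HOL-Computational_Algebra.Group_Closure"
begin

section \<open>Left ideals and left modules over noncommutative rings\<close>

text \<open>
  Left modules use the record \<^type>\<open>module\<close> of HOL-Algebra, whose fields \<open>mult\<close> and \<open>one\<close> play no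
  role and are left undefined. (The locale of the same name requires a commutative base ring.)
\<close>

definition left_ideal :: "'a set \<Rightarrow> ('a, 'm) ring_scheme \<Rightarrow> bool" where
  "left_ideal I R \<longleftrightarrow>
     additive_subgroup I R \<and> (\<forall>r\<in>carrier R. \<forall>x\<in>I. r \<otimes>\<^bsub>R\<^esub> x \<in> I)"

definition gen_left_ideal :: "('a, 'm) ring_scheme \<Rightarrow> 'a set \<Rightarrow> 'a set" where
  "gen_left_ideal R S = \<Inter> {I. left_ideal I R \<and> S \<subseteq> I}"

definition quotient_left_module ::
    "('a, 'm) ring_scheme \<Rightarrow> 'a set \<Rightarrow> ('a, 'a set) module" where
  "quotient_left_module R I =
     \<lparr>carrier = a_rcosets\<^bsub>R\<^esub> I, mult = undefined, one = undefined,
      ring.zero = I, ring.add = set_add R,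
      smult = (\<lambda>r X. \<Union>x\<in>X. I +>\<^bsub>R\<^esub> (r \<otimes>\<^bsub>R\<^esub> x))\<rparr>"

text \<open>
  The tensor product of \<open>S\<close> with a left \<open>R\<close>-module \<open>M\<close> over \<open>R\<close>, where \<open>S\<close> is a right
  \<open>R\<close>-module through a ring homomorphism \<open>\<phi>\<close> from \<open>R\<close> to \<open>S\<close>: the free abelian group on the pairs
  \<open>(s, m)\<close> modulo the biadditivity and balancing relations.
\<close>

definition tensor_relations ::
    "('r, 'x) ring_scheme \<Rightarrow> ('s, 'y) ring_scheme \<Rightarrow> ('r \<Rightarrow> 's) \<Rightarrow> ('r, 'm, 'z) module_scheme
      \<Rightarrow> ('s \<times> 'm \<Rightarrow>\<^sub>0 int) set" where
  "tensor_relations R S \<phi> M = group_closure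
     ({frag_of (s \<oplus>\<^bsub>S\<^esub> s', m) - frag_of (s, m) - frag_of (s', m) | s s' m.
         s \<in> carrier S \<and> s' \<in> carrier S \<and> m \<in> carrier M} \<union>
      {frag_of (s, m \<oplus>\<^bsub>M\<^esub> m') - frag_of (s, m) - frag_of (s, m') | s m m'.
         s \<in> carrier S \<and> m \<in> carrier M \<and> m' \<in> carrier M} \<union>
      {frag_of (s \<otimes>\<^bsub>S\<^esub> \<phi> r, m) - frag_of (s, r \<odot>\<^bsub>M\<^esub> m) | s r m.
         s \<in> carrier S \<and> r \<in> carrier R \<and> m \<in> carrier M})"

definition tensor_module ::
    "('r, 'x) ring_scheme \<Rightarrow> ('s, 'y) ring_scheme \<Rightarrow> ('r \<Rightarrow> 's) \<Rightarrow> ('r, 'm, 'z) module_scheme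
      \<Rightarrow> ('s, ('s \<times> 'm \<Rightarrow>\<^sub>0 int) set) module" where
  "tensor_module R S \<phi> M =
     \<lparr>carrier = (\<lambda>c. c +o tensor_relations R S \<phi> M) `
                  carrier (free_Abelian_group (carrier S \<times> carrier M)),
      mult = undefined, one = undefined,
      ring.zero = tensor_relations R S \<phi> M, ring.add = (+),
      smult = (\<lambda>a X. \<Union>c\<in>X. frag_extend (\<lambda>(s, m). frag_of (a \<otimes>\<^bsub>S\<^esub> s, m)) c
                            +o tensor_relations R S \<phi> M)\<rparr>"

section \<open>Sheaves of modules over a sheaf of rings\<close>

text \<open>
  In both records \<open>res U V\<close> is the restriction map from \<open>U\<close> to \<open>V\<close>; all data are only meaningful
  for open sets \<open>V \<subseteq> U\<close>.
\<close>

record ('p, 'r) ring_presheaf =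
  rsections :: "'p set \<Rightarrow> 'r ring"
  rres :: "'p set \<Rightarrow> 'p set \<Rightarrow> 'r \<Rightarrow> 'r"

record ('p, 'r, 'm) module_presheaf =
  sections :: "'p set \<Rightarrow> ('r, 'm) module"
  res :: "'p set \<Rightarrow> 'p set \<Rightarrow> 'm \<Rightarrow> 'm"

text \<open>The germ at \<open>x\<close> of a section \<open>s\<close> over \<open>U\<close>, as an equivalence class of local sections.\<close>

definition germ ::
    "('p::topological_space, 'r, 'm) module_presheaf \<Rightarrow> 'p \<Rightarrow> 'p set \<Rightarrow> 'm \<Rightarrow> ('p set \<times> 'm) set"
  where
  "germ F x U s =
     {(V, t). open V \<and> x \<in> V \<and> t \<in> carrier (sections F V) \<and>
        (\<exists>W. open W \<and> x \<in> W \<and> W \<subseteq> U \<inter> V \<and> res F U W s = res F V W t)}"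

definition germ_add ::
    "('p::topological_space, 'r, 'm) module_presheaf \<Rightarrow> 'p
      \<Rightarrow> ('p set \<times> 'm) set \<Rightarrow> ('p set \<times> 'm) set \<Rightarrow> ('p set \<times> 'm) set" where
  "germ_add F x X Y =
     (\<Union>(U, s)\<in>X. \<Union>(V, t)\<in>Y.
        germ F x (U \<inter> V) (res F U (U \<inter> V) s \<oplus>\<^bsub>sections F (U \<inter> V)\<^esub> res F V (U \<inter> V) t))"

definition germ_smult ::
    "('p::topological_space, 'r) ring_presheaf \<Rightarrow> ('p, 'r, 'm) module_presheaf \<Rightarrow> 'p
      \<Rightarrow> 'p set \<Rightarrow> 'r \<Rightarrow> ('p set \<times> 'm) set \<Rightarrow> ('p set \<times> 'm) set" where
  "germ_smult R F x U a X =
     (\<Union>(V, t)\<in>X.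
        germ F x (U \<inter> V) (rres R U (U \<inter> V) a \<odot>\<^bsub>sections F (U \<inter> V)\<^esub> res F V (U \<inter> V) t))"

definition sheafify ::
    "('p::topological_space, 'r) ring_presheaf \<Rightarrow> ('p, 'r, 'm) module_presheaf
      \<Rightarrow> ('p, 'r, 'p \<Rightarrow> ('p set \<times> 'm) set) module_presheaf" where
  "sheafify R F =
     \<lparr>sections = (\<lambda>U.
        \<lparr>carrier = {\<sigma> \<in> extensional U. \<forall>x\<in>U. \<exists>V s. open V \<and> x \<in> V \<and> V \<subseteq> U \<and>
                      s \<in> carrier (sections F V) \<and> (\<forall>y\<in>V. \<sigma> y = germ F y V s)},
         mult = undefined, one = undefined,
         ring.zero = (\<lambda>x\<in>U. germ F x U \<zero>\<^bsub>sections F U\<^esub>),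
         ring.add = (\<lambda>\<sigma> \<tau>. \<lambda>x\<in>U. germ_add F x (\<sigma> x) (\<tau> x)),
         smult = (\<lambda>a \<sigma>. \<lambda>x\<in>U. germ_smult R F x U a (\<sigma> x))\<rparr>),
      res = (\<lambda>U V \<sigma>. restrict \<sigma> V)\<rparr>"

definition isomorphic_modules ::
    "('p::topological_space, 'r) ring_presheaf
      \<Rightarrow> ('p, 'r, 'm) module_presheaf \<Rightarrow> ('p, 'r, 'k) module_presheaf \<Rightarrow> bool" where
  "isomorphic_modules R F G \<longleftrightarrow>
     (\<exists>\<phi> :: 'p set \<Rightarrow> 'm \<Rightarrow> 'k.
        (\<forall>U. open U \<longrightarrow>
           bij_betw (\<phi> U) (carrier (sections F U)) (carrier (sections G U)) \<and>
           (\<forall>s\<in>carrier (sections F U). \<forall>t\<in>carrier (sections F U).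
              \<phi> U (s \<oplus>\<^bsub>sections F U\<^esub> t) = \<phi> U s \<oplus>\<^bsub>sections G U\<^esub> \<phi> U t) \<and>
           (\<forall>a\<in>carrier (rsections R U). \<forall>s\<in>carrier (sections F U).
              \<phi> U (a \<odot>\<^bsub>sections F U\<^esub> s) = a \<odot>\<^bsub>sections G U\<^esub> \<phi> U s)) \<and>
        (\<forall>U V. open U \<longrightarrow> open V \<longrightarrow> V \<subseteq> U \<longrightarrow>
           (\<forall>s\<in>carrier (sections F U). \<phi> V (res F U V s) = res G U V (\<phi> U s))))"

section \<open>Analytic linear differential operators\<close>

text \<open>Holomorphic functions on an open subset of \<open>\<complex>\<^sup>n\<close>, normalised to be undefined outside.\<close>

definition hol_funs :: "(complex^'n) set \<Rightarrow> (complex^'n \<Rightarrow> complex) set" where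
  "hol_funs W =
     {f \<in> extensional W. \<forall>x\<in>W. \<exists>f'. (f has_derivative f') (at x) \<and> (\<forall>c v. f' (c *s v) = c * f' v)}"

definition opens_in :: "'p::topological_space set \<Rightarrow> 'p set set" where
  "opens_in U = {W. open W \<and> W \<subseteq> U}"

text \<open>
  An operator over \<open>U\<close> sends an open \<open>W \<subseteq> U\<close> and a holomorphic function on \<open>W\<close> to a holomorphic
  function on \<open>W\<close>.
\<close>

type_synonym 'n opr = "(complex^'n) set \<Rightarrow> (complex^'n \<Rightarrow> complex) \<Rightarrow> (complex^'n \<Rightarrow> complex)"

text \<open>The ring of \<open>\<complex>\<close>-linear endomorphisms of the sheaf of holomorphic functions on \<open>U\<close>.\<close>

definition End_hol :: "(complex^'n) set \<Rightarrow> 'n opr ring" where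
  "End_hol U =
     \<lparr>carrier = {P \<in> (\<Pi>\<^sub>E W\<in>opens_in U. hol_funs W \<rightarrow>\<^sub>E hol_funs W).
        (\<forall>W\<in>opens_in U. \<forall>f\<in>hol_funs W. \<forall>g\<in>hol_funs W. \<forall>a b.
           P W (\<lambda>x\<in>W. a * f x + b * g x) = (\<lambda>x\<in>W. a * P W f x + b * P W g x)) \<and>
        (\<forall>W\<in>opens_in U. \<forall>V\<in>opens_in W. \<forall>f\<in>hol_funs W.
           P V (restrict f V) = restrict (P W f) V)},
      mult = (\<lambda>P Q. \<lambda>W\<in>opens_in U. compose (hol_funs W) (P W) (Q W)),
      one = (\<lambda>W\<in>opens_in U. \<lambda>f\<in>hol_funs W. f),
      ring.zero = (\<lambda>W\<in>opens_in U. \<lambda>f\<in>hol_funs W. \<lambda>x\<in>W. 0),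
      ring.add = (\<lambda>P Q. \<lambda>W\<in>opens_in U. \<lambda>f\<in>hol_funs W. \<lambda>x\<in>W. P W f x + Q W f x)\<rparr>"

definition mult_op :: "(complex^'n) set \<Rightarrow> (complex^'n \<Rightarrow> complex) \<Rightarrow> 'n opr" where
  "mult_op U g = (\<lambda>W\<in>opens_in U. \<lambda>f\<in>hol_funs W. \<lambda>x\<in>W. g x * f x)"

definition partial_op :: "(complex^'n) set \<Rightarrow> 'n \<Rightarrow> 'n opr" where
  "partial_op U i =
     (\<lambda>W\<in>opens_in U. \<lambda>f\<in>hol_funs W. \<lambda>x\<in>W. deriv (\<lambda>t. f (x + axis i t)) 0)"

text \<open>
  The sheaf \<open>\<D>\<close>: endomorphisms that locally lie in the ring generated by the holomorphic functions
  and the partial derivatives, i.e. locally are finite sums of \<open>a\<^sub>\<alpha> \<partial>\<^sup>\<alpha>\<close>.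
\<close>

definition diff_ops :: "(complex^'n) set \<Rightarrow> 'n opr ring" where
  "diff_ops U = (End_hol U)
     \<lparr>carrier := {P \<in> carrier (End_hol U). \<forall>x\<in>U. \<exists>V\<in>opens_in U. x \<in> V \<and>
        restrict P (opens_in V) \<in>
          generate_ring (End_hol V) (mult_op V ` hol_funs V \<union> range (partial_op V))}\<rparr>"

definition D_sheaf :: "(complex^'n, 'n opr) ring_presheaf" where
  "D_sheaf = \<lparr>rsections = diff_ops, rres = (\<lambda>U V P. restrict P (opens_in V))\<rparr>"

section \<open>The Weyl algebra and hypergeometric systems\<close>

definition const_op :: "complex \<Rightarrow> 'n::finite opr" where
  "const_op c = mult_op (UNIV :: (complex^'n) set) (\<lambda>_. c)"

definition x_op :: "'n::finite \<Rightarrow> 'n opr" where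
  "x_op j = mult_op (UNIV :: (complex^'n) set) (\<lambda>x. x $ j)"

definition d_op :: "'n::finite \<Rightarrow> 'n opr" where
  "d_op j = partial_op (UNIV :: (complex^'n) set) j"

text \<open>
  The Weyl algebra and its subring \<open>\<complex>[\<partial>\<^sub>1,\<dots>,\<partial>\<^sub>n]\<close>, realised inside the ring of global differential
  operators (on which they act faithfully).
\<close>

definition weyl_algebra :: "'n::finite opr ring" where
  "weyl_algebra = (diff_ops UNIV)
     \<lparr>carrier := generate_ring (diff_ops UNIV) (range const_op \<union> range x_op \<union> range d_op)\<rparr>"

definition d_polys :: "'n::finite opr ring" where
  "d_polys = (diff_ops UNIV)
     \<lparr>carrier := generate_ring (diff_ops UNIV) (range const_op \<union> range d_op)\<rparr>"

definition d_monom :: "nat^'n \<Rightarrow> 'n opr" where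
  "d_monom u = finprod d_polys (\<lambda>j. d_op j [^]\<^bsub>d_polys\<^esub> (u $ j)) UNIV"

definition toric_ideal :: "int^'n^'d \<Rightarrow> 'n opr set" where
  "toric_ideal A = genideal d_polys
     {d_monom u \<ominus>\<^bsub>d_polys\<^esub> d_monom v | u v.
        A *v (\<chi> j. int (u $ j)) = A *v (\<chi> j. int (v $ j))}"

definition euler_op :: "int^'n^'d \<Rightarrow> complex^'d \<Rightarrow> 'd \<Rightarrow> 'n opr" where
  "euler_op A \<beta> i =
     finsum weyl_algebra
       (\<lambda>j. const_op (of_int (A $ i $ j)) \<otimes>\<^bsub>weyl_algebra\<^esub> (x_op j \<otimes>\<^bsub>weyl_algebra\<^esub> d_op j)) UNIV
     \<ominus>\<^bsub>weyl_algebra\<^esub> const_op (\<beta> $ i)"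

definition H_ideal :: "int^'n^'d \<Rightarrow> complex^'d \<Rightarrow> 'n opr set" where
  "H_ideal A \<beta> = gen_left_ideal weyl_algebra (toric_ideal A \<union> range (euler_op A \<beta>))"

definition M_alg :: "int^'n^'d \<Rightarrow> complex^'d \<Rightarrow> ('n opr, 'n opr set) module" where
  "M_alg A \<beta> = quotient_left_module weyl_algebra (H_ideal A \<beta>)"

text \<open>\<open>\<D> \<otimes>\<^sub>D M\<close> is the sheafification of \<open>U \<mapsto> \<D>(U) \<otimes>\<^sub>D M\<close>.\<close>

definition D_tensor_presheaf ::
    "('n::finite opr, 'm) module
      \<Rightarrow> (complex^'n, 'n opr, ('n opr \<times> 'm \<Rightarrow>\<^sub>0 int) set) module_presheaf" where
  "D_tensor_presheaf M =
     \<lparr>sections = (\<lambda>U. tensor_module weyl_algebra (rsections D_sheaf U) (rres D_sheaf UNIV U) M),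
      res = (\<lambda>U V X. \<Union>c\<in>X. frag_extend (\<lambda>(P, m). frag_of (rres D_sheaf U V P, m)) c
               +o tensor_relations weyl_algebra (rsections D_sheaf V) (rres D_sheaf UNIV V) M)\<rparr>"

definition D_tensor ::
    "('n::finite opr, 'm) module
      \<Rightarrow> (complex^'n, 'n opr,
           complex^'n \<Rightarrow> ((complex^'n) set \<times> ('n opr \<times> 'm \<Rightarrow>\<^sub>0 int) set) set) module_presheaf" where
  "D_tensor M = sheafify D_sheaf (D_tensor_presheaf M)"

section \<open>Faces of the cone and the sets \<open>E\<^sub>\<tau>(\<beta>)\<close>\<close>

definition mcol :: "int^'n^'d \<Rightarrow> 'n \<Rightarrow> 'a::ring_1^'d" where
  "mcol A j = (\<chi> i. of_int (A $ i $ j))"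

definition cone_of :: "int^'n^'d \<Rightarrow> (rat^'d) set" where
  "cone_of A = {\<Sum>j\<in>UNIV. c j *s mcol A j | c. \<forall>j. 0 \<le> c j}"

text \<open>
  Faces are cut out by rational linear forms that are nonnegative on the cone; the zero form gives
  the cone itself.
\<close>

definition is_face :: "(rat^'d) set \<Rightarrow> (rat^'d) set \<Rightarrow> bool" where
  "is_face \<tau> C \<longleftrightarrow>
     (\<exists>h :: rat^'d. (\<forall>x\<in>C. 0 \<le> (\<Sum>i\<in>UNIV. h $ i * x $ i)) \<and>
                    \<tau> = {x \<in> C. (\<Sum>i\<in>UNIV. h $ i * x $ i) = 0})"

definition face_cols :: "int^'n^'d \<Rightarrow> (rat^'d) set \<Rightarrow> (complex^'d) set" where
  "face_cols A \<tau> = {mcol A j | j. mcol A j \<in> \<tau>}"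

definition face_lattice :: "int^'n^'d \<Rightarrow> (rat^'d) set \<Rightarrow> (complex^'d) set" where
  "face_lattice A \<tau> = group_closure (face_cols A \<tau>)"

definition face_space :: "int^'n^'d \<Rightarrow> (rat^'d) set \<Rightarrow> (complex^'d) set" where
  "face_space A \<tau> = vec.span (face_cols A \<tau>)"

definition col_monoid :: "int^'n^'d \<Rightarrow> (complex^'d) set" where
  "col_monoid A = {\<Sum>j\<in>UNIV. of_nat (u j) *s mcol A j | u. True}"

text \<open>An element of \<open>\<complex>(A \<inter> \<tau>) / \<int>(A \<inter> \<tau>)\<close> is a coset; the condition does not depend on \<open>l\<close>.\<close>

definition E_set :: "int^'n^'d \<Rightarrow> (rat^'d) set \<Rightarrow> complex^'d \<Rightarrow> (complex^'d) set set" where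
  "E_set A \<tau> \<beta> =
     {l +o face_lattice A \<tau> | l. l \<in> face_space A \<tau> \<and> \<beta> - l \<in> col_monoid A + face_lattice A \<tau>}"

end

theory Submission
  imports Defs "HOL-Complex_Analysis.Cauchy_Integral_Formula"
begin

text \<open>
  \<^bold>\<open>If the sets \<open>E\<^sub>\<tau>\<close> agree\<close>, the two systems are already isomorphic over the Weyl algebra. The
  isomorphism and its inverse are right multiplications by operators \<open>P\<close> and \<open>Q\<close> built from
  polynomials \<open>f\<close> and \<open>g\<close> on \<open>\<complex>\<^sup>d\<close>. Since \<open>(x\<^sup>\<alpha>/\<alpha>!) \<partial>\<^sup>\<alpha>\<close> multiplies \<open>x\<^sup>s\<close> by the binomial
  coefficient \<open>s choose \<alpha>\<close>, a sum of terms \<open>(x\<^sup>\<alpha>/\<alpha>!) \<partial>\<^sup>b\<close> with \<open>A b - A \<alpha> = \<xi>\<close> is determined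
  modulo \<open>I\<^sub>A\<close> by \<open>\<xi>\<close> and the polynomial \<open>\<Sum> (s choose \<alpha>)\<close> (\<open>good_unique\<close>). By Newton expansion
  (\<open>good_exists\<close>) a polynomial comes from such an operator once it vanishes at all \<open>k \<in> \<nat>\<^sup>n\<close> with
  \<open>A k + \<xi> \<notin> \<nat>A\<close>. Take \<open>\<xi> = \<beta>' - \<beta>\<close> for \<open>P\<close>, with polynomial \<open>f(A s)\<close>, and
  \<open>\<xi> = \<beta> - \<beta>'\<close> for \<open>Q\<close>, with polynomial \<open>g(A s)\<close>. Right multiplication by \<open>P\<close> then maps
  \<open>H\<^sub>A(\<beta>)\<close> into \<open>H\<^sub>A(\<beta>')\<close>, and \<open>P Q\<close> is modulo \<open>I\<^sub>A\<close> a polynomial in the Euler operators,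
  which acts as the number \<open>f(\<beta>) g(\<beta>')\<close> (\<open>contiguity\<close>). It remains to find \<open>f\<close> with the prescribed zeros
  and \<open>f(\<beta>) \<noteq> 0\<close> (\<open>sep_poly\<close>). The set of bad \<open>k\<close> is closed downwards, hence a finite union of
  slices \<open>w + \<nat>\<^sup>\<sigma>\<close>. On a slice there is a suitable affine linear factor unless \<open>\<beta> - A w\<close> lies in the span
  of the columns in \<open>\<sigma>\<close>; in that case the set \<open>E\<^sub>\<tau>\<close> for a suitable face \<open>\<tau>\<close> through \<open>\<sigma>\<close>, given
  by Farkas' lemma, produces an element of the slice that is not bad (\<open>slice_disjoint\<close>).

  \<^bold>\<open>If the systems are isomorphic\<close>, compare solutions at the origin. A germ of a differential
  operator at \<open>0\<close> acts on the functions \<open>c\<close> on \<open>\<complex>\<^sup>n\<close> whose support lies in a half space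
  \<open>Re (\<Sum>\<^sub>j w\<^sub>j) \<ge> B\<close>, regarded as formal series \<open>\<Sum>\<^sub>w c(w) x\<^sup>w / w!\<close>. In this action \<open>\<partial>\<^sub>j\<close> maps
  \<open>c\<close> to \<open>w \<mapsto> c(w + e\<^sub>j)\<close> and \<open>x\<^sub>j\<close> maps it to \<open>w \<mapsto> w\<^sub>j c(w - e\<^sub>j)\<close>. For a face \<open>\<tau>\<close> and an exponent \<open>v\<close>
  supported on the columns in \<open>\<tau>\<close>, let \<open>S\<close> be the set of exponents that are congruent to \<open>v\<close> modulo
  \<open>\<int>\<close> in these coordinates and lie in \<open>\<nat>\<close> in the others. The coefficients in
  passing out of \<open>S\<close> vanish, so that operators act on functions on \<open>S\<close>, and the indicator function of
  \<open>{w \<in> S. A w = \<beta>}\<close> is a solution of \<open>H\<^sub>A(\<beta>)\<close> on \<open>S\<close>. Homogeneity of \<open>A\<close> places its support in a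
  half space. It is nonzero exactly if \<open>\<beta> - A v \<in> \<nat>A + \<int>(A \<inter> \<tau>)\<close> (\<open>face_exps_hit\<close>), which is
  membership of the class of \<open>A v\<close> in \<open>E\<^sub>\<tau>(\<beta>)\<close>. An isomorphism carries nonzero solutions on \<open>S\<close> to
  nonzero solutions on \<open>S\<close>, and a nonzero solution for the other parameter has an exponent \<open>w \<in> S\<close>
  with \<open>A w\<close> equal to that parameter (\<open>iso_exponents\<close>).
\<close>

section \<open>Holomorphic functions of several variables\<close>

text \<open>
  \<open>f'\<close> is the complex derivative of \<open>f\<close> at \<open>x\<close>: a real derivative that is \<open>\<complex>\<close>-linear.
\<close>

definition cderiv :: "(complex^'n \<Rightarrow> complex) \<Rightarrow> (complex^'n \<Rightarrow> complex) \<Rightarrow> complex^'n \<Rightarrow> bool" where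
  "cderiv f f' x \<longleftrightarrow> (f has_derivative f') (at x) \<and> (\<forall>c v. f' (c *s v) = c * f' v)"

text \<open>
  Complex differentiability at every point of \<open>W\<close>. For open \<open>W\<close> this is holomorphy; nothing is
  required outside \<open>W\<close>.
\<close>

definition chol :: "(complex^'n) set \<Rightarrow> (complex^'n \<Rightarrow> complex) \<Rightarrow> bool" where
  "chol W f \<longleftrightarrow> (\<forall>x\<in>W. \<exists>f'. cderiv f f' x)"

text \<open>
  The partial derivative with respect to the coordinate \<open>x\<^sub>j\<close>.
\<close>

definition pd :: "'n \<Rightarrow> (complex^'n \<Rightarrow> complex) \<Rightarrow> complex^'n \<Rightarrow> complex" where
  "pd j f x = deriv (\<lambda>t. f (x + axis j t)) 0"

lemma hol_funs_iff: "f \<in> hol_funs W \<longleftrightarrow> f \<in> extensional W \<and> chol W f"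
  by (simp add: hol_funs_def chol_def cderiv_def)

lemma axis_eq_smult: "axis j t = t *s axis j (1::complex)"
  by (simp add: vec_eq_iff axis_def)

lemma norm_vector_smult: "norm (t *s (v::complex^'n)) = norm t * norm v"
proof -
  have "norm (t *s v) = sqrt (\<Sum>i\<in>UNIV. (norm t)\<^sup>2 * (norm (v$i))\<^sup>2)"
    by (simp add: norm_vec_def L2_set_def norm_mult power_mult_distrib)
  also have "\<dots> = sqrt ((norm t)\<^sup>2 * (\<Sum>i\<in>UNIV. (norm (v$i))\<^sup>2))"
    by (simp add: sum_distrib_left)
  also have "\<dots> = norm t * norm v"
    by (simp add: norm_vec_def L2_set_def real_sqrt_mult)
  finally show ?thesis .
qed

lemma bounded_linear_smult_vec: "bounded_linear (\<lambda>t::complex. t *s (v::complex^'n))"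
  by (rule bounded_linear_intro[where K = "norm v"])
    (simp_all add: vec_eq_iff norm_vector_smult algebra_simps)

lemma cderiv_line:
  assumes "cderiv f f' (x + t *s v)"
  shows "((\<lambda>s. f (x + s *s v)) has_field_derivative f' v) (at t)"
proof -
  have "((\<lambda>s::complex. x + s *s v) has_derivative (\<lambda>s. s *s v)) (at t)"
    using has_derivative_add[OF has_derivative_const bounded_linear.has_derivative[OF bounded_linear_smult_vec has_derivative_ident]]
    by simp
  moreover have "(f has_derivative f') (at (x + t *s v))"
    using assms by (simp add: cderiv_def)
  ultimately have "((\<lambda>s. f (x + s *s v)) has_derivative (\<lambda>s. f' (s *s v))) (at t)"
    using has_derivative_compose by blast
  moreover have "(\<lambda>s. f' (s *s v)) = (*) (f' v)"
    using assms by (auto simp: cderiv_def mult.commute)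
  ultimately show ?thesis
    by (simp add: has_field_derivative_def)
qed

lemma cderiv_pd: "cderiv f f' x \<Longrightarrow> pd j f x = f' (axis j 1)"
  using cderiv_line[of f f' x 0 "axis j 1"]
  by (subst pd_def, subst axis_eq_smult) (simp add: DERIV_imp_deriv)

lemma cderiv_continuous: "chol W f \<Longrightarrow> open W \<Longrightarrow> continuous_on W f"
  by (auto simp: chol_def cderiv_def continuous_on_eq_continuous_at dest!: has_derivative_continuous)

text \<open>
  Cauchy's formula on a circle in the complex line through \<open>x\<close> in direction \<open>v\<close>, parametrised
  so that \<open>x\<close> and \<open>v\<close> enter as parameters of a real integral.
\<close>

lemma chol_line_integral:
  assumes W: "open W" "chol W f" and r: "0 < r"
    and sub: "\<And>t. norm t \<le> r \<Longrightarrow> x + t *s v \<in> W"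
  shows "deriv (\<lambda>t. f (x + t *s v)) 0 =
    integral {0..1} (\<lambda>s. f (x + (of_real r * exp (2 * of_real pi * \<i> * of_real s)) *s v)
       / (of_real r * exp (2 * of_real pi * \<i> * of_real s)))"
proof -
  let ?g = "\<lambda>t. f (x + t *s v)"
  have fd: "\<exists>D. (?g has_field_derivative D) (at t)" if "norm t \<le> r" for t
    using sub[OF that] W cderiv_line unfolding chol_def by blast
  have hol: "?g holomorphic_on ball 0 r"
    unfolding holomorphic_on_def field_differentiable_def
    using fd by (meson DERIV_subset has_field_derivative_at_within mem_ball_0 less_imp_le)
  have cont: "continuous_on (cball 0 r) ?g"
    using fd by (meson DERIV_continuous continuous_at_imp_continuous_on mem_cball_0)
  have "(?g has_field_derivative (1 / (2 * of_real pi * \<i>) * contour_integral(circlepath 0 r) (\<lambda>u. ?g u / (u-0)^2))) (at 0)"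
    by (rule Cauchy_derivative_integral_circlepath[OF cont hol]) (use r in simp)
  then have "deriv ?g 0 = 1 / (2 * of_real pi * \<i>) * contour_integral(circlepath 0 r) (\<lambda>u. ?g u / u^2)"
    by (simp add: DERIV_imp_deriv)
  also have "\<dots> = integral {0..1} (\<lambda>s. 1 / (2 * of_real pi * \<i>) * (?g (circlepath 0 r s) / (circlepath 0 r s)^2 * vector_derivative (circlepath 0 r) (at s)))"
    unfolding contour_integral_integral integral_mult_right by simp
  also have "\<dots> = integral {0..1} (\<lambda>s. ?g (of_real r * exp (2 * of_real pi * \<i> * of_real s))
       / (of_real r * exp (2 * of_real pi * \<i> * of_real s)))"
    using r by (intro arg_cong[where f = "integral {0..1}"] ext)
      (simp add: vector_derivative_circlepath, simp add: circlepath power2_eq_square field_simps)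
  finally show ?thesis .
qed

lemma chol_continuous_dir:
  assumes W: "open W" "chol W f"
  shows "continuous_on W (\<lambda>y. deriv (\<lambda>t. f (y + t *s v)) 0)"
proof -
  have "continuous (at x) (\<lambda>y. deriv (\<lambda>t. f (y + t *s v)) 0)" if x: "x \<in> W" for x
  proof -
    obtain e where e: "e > 0" "cball x e \<subseteq> W"
      using W x open_contains_cball by blast
    define r where "r = e / (2 * (norm v + 1))"
    have r: "r > 0" using e by (simp add: r_def add_nonneg_pos)
    have "r * norm v \<le> r * (norm v + 1)" using r by simp
    also have "\<dots> = e / 2" by (simp add: r_def field_simps add_nonneg_eq_0_iff)
    finally have rv: "r * norm v \<le> e / 2" .
    have sub: "y + t *s v \<in> W" if "y \<in> ball x (e/2)" "norm t \<le> r" for y t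
    proof -
      have "norm (t *s v) \<le> r * norm v"
        using that by (simp add: norm_vector_smult mult_right_mono)
      then have "dist x (y + t *s v) \<le> e"
        using that rv norm_triangle_ineq[of "y - x" "t *s v"]
        by (simp add: dist_norm norm_minus_commute algebra_simps)
      then show ?thesis using e by auto
    qed
    let ?h = "\<lambda>y s. f (y + (of_real r * exp (2 * of_real pi * \<i> * of_real s)) *s v)
       / (of_real r * exp (2 * of_real pi * \<i> * of_real s))"
    have eq: "deriv (\<lambda>t. f (y + t *s v)) 0 = integral (cbox 0 1) (?h y)" if "y \<in> ball x (e/2)" for y
      using chol_line_integral[OF W r sub[OF that]] by simp
    have "continuous_on (ball x (e/2)) (\<lambda>y. integral (cbox 0 1) (?h y))"
    proof (rule integral_continuous_on_param)
      have "continuous_on (ball x (e/2) \<times> cbox 0 1) (\<lambda>(y,s). f (y + (of_real r * exp (2 * of_real pi * \<i> * of_real s)) *s v))"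
        unfolding case_prod_beta
      proof (rule continuous_on_compose2[OF cderiv_continuous[OF W(2,1)]])
        have "continuous_on UNIV (\<lambda>t::complex. t *s v)"
          by (intro linear_continuous_on bounded_linear_smult_vec)
        then have "continuous_on (ball x (e / 2) \<times> cbox 0 1) (\<lambda>p. (complex_of_real r * exp (2 * complex_of_real pi * \<i> * complex_of_real (snd p))) *s v)"
          by (rule continuous_on_compose2[where g = "\<lambda>t::complex. t *s v"]) (intro continuous_intros, simp)
        then show "continuous_on (ball x (e / 2) \<times> cbox 0 1) (\<lambda>p. fst p + complex_of_real r * exp (2 * complex_of_real pi * \<i> * complex_of_real (snd p)) *s v)"
          by (intro continuous_on_add continuous_on_fst continuous_on_id)
        show "(\<lambda>p. fst p + complex_of_real r * exp (2 * complex_of_real pi * \<i> * complex_of_real (snd p)) *s v) ` (ball x (e / 2) \<times> cbox 0 1) \<subseteq> W"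
          using r by (auto intro!: sub simp: norm_mult)
      qed
      then show "continuous_on (ball x (e/2) \<times> cbox 0 1) (\<lambda>(y,s). ?h y s)"
        using r unfolding case_prod_beta by (intro continuous_on_divide) (auto intro!: continuous_intros)
    qed
    then have "continuous_on (ball x (e/2)) (\<lambda>y. deriv (\<lambda>t. f (y + t *s v)) 0)"
      using eq continuous_on_cong by (metis (no_types, lifting))
    then show ?thesis
      using e by (simp add: continuous_on_eq_continuous_at)
  qed
  then show ?thesis using W by (simp add: continuous_on_eq_continuous_at)
qed

text \<open>
  A partial derivative of a holomorphic function is again holomorphic, by differentiating Cauchy's
  formula under the integral sign. The last part expresses the derivative of \<open>\<partial>\<^sub>j f\<close> by an integral
  over \<open>\<partial>\<^sub>i f\<close>, which gives the symmetry of second derivatives.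
\<close>

lemma chol_pd_deriv:
  assumes W: "open W" "chol W f" and x0: "x0 \<in> W"
  shows "\<exists>f'. cderiv (pd j f) f' x0 \<and> (\<forall>i. chol W (pd i f) \<longrightarrow> f' (axis i 1) = pd j (pd i f) x0)"
proof -
  obtain e where e: "e > 0" "cball x0 e \<subseteq> W"
    using W x0 open_contains_cball by blast
  define r where "r = e / 2"
  have r: "r > 0" using e by (simp add: r_def)
  define E where "E = (\<lambda>s::real. of_real r * exp (2 * of_real pi * \<i> * of_real s) :: complex)"
  have E0: "E s \<noteq> 0" and nE: "norm (E s) = r" for s using r by (auto simp: E_def norm_mult)
  have contE: "continuous_on A (\<lambda>p. E (g p))" if "continuous_on A g" for A and g :: "'z::topological_space \<Rightarrow> real"
    unfolding E_def using that by (intro continuous_intros)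
  have sub: "x + t *s axis j 1 \<in> W" if "x \<in> ball x0 r" "norm t \<le> r" for x t
  proof -
    have "dist x0 (x + t *s axis j 1) \<le> e"
      using that norm_triangle_ineq[of "x - x0" "t *s axis j 1"]
      by (simp add: dist_norm norm_minus_commute algebra_simps norm_vector_smult r_def)
    then show ?thesis using e by auto
  qed
  define Df where "Df = (\<lambda>y. SOME f'. cderiv f f' y)"
  have Df: "cderiv f (Df y) y" if "y \<in> W" for y
    using W that unfolding Df_def chol_def by (metis someI_ex)
  have Dfbl: "bounded_linear (Df y)" if "y \<in> W" for y
    using Df[OF that] by (auto simp: cderiv_def dest: has_derivative_bounded_linear)
  have Dfd: "Df y v = deriv (\<lambda>t. f (y + t *s v)) 0" if "y \<in> W" for y v
    using cderiv_line[of f "Df y" y 0 v] Df[OF that] by (simp add: DERIV_imp_deriv)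
  have Dfc: "continuous_on W (\<lambda>y. Df y v)" for v
    using chol_continuous_dir[OF W, of v] Dfd by (metis (no_types, lifting) continuous_on_cong)
  let ?h = "\<lambda>x s. f (x + E s *s axis j 1) / E s"
  have pdint: "pd j g x = integral (cbox 0 1) (\<lambda>s. g (x + E s *s axis j 1) / E s)"
    if "chol W g" "x \<in> ball x0 r" for g x
    using chol_line_integral[OF W(1) that(1) r sub[OF that(2)]]
    unfolding pd_def E_def by (subst axis_eq_smult) simp
  have pd_i_eq: "pd i f y = Df y (axis i 1)" if "y \<in> W" for y i
    using cderiv_pd[OF Df[OF that]] .
  define fx where "fx = (\<lambda>x s. Blinfun (\<lambda>v. Df (x + E s *s axis j 1) v / E s))"
  have fx: "blinfun_apply (fx x s) = (\<lambda>v. Df (x + E s *s axis j 1) v / E s)" if "x \<in> ball x0 r" for x s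
    unfolding fx_def
    by (rule bounded_linear_Blinfun_apply)
      (intro bounded_linear_compose[OF bounded_linear_divide] Dfbl sub[OF that], simp add: nE)
  have cont1: "continuous_on (ball x0 r \<times> cbox 0 1) (\<lambda>p. fst p + E (snd p) *s axis j 1)"
  proof -
    have "continuous_on UNIV (\<lambda>t::complex. t *s (axis j 1 :: complex^'a))"
      by (intro linear_continuous_on bounded_linear_smult_vec)
    then have "continuous_on (ball x0 r \<times> cbox 0 1) (\<lambda>p. E (snd p) *s (axis j 1 :: complex^'a))"
      by (rule continuous_on_compose2[where f = "\<lambda>p. E (snd p)"]) (simp_all add: contE continuous_on_snd)
    then show ?thesis
      by (intro continuous_on_add continuous_on_fst continuous_on_id)
  qed
  have img1: "(\<lambda>p. fst p + E (snd p) *s axis j 1) ` (ball x0 r \<times> cbox 0 1) \<subseteq> W"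
    by (auto intro!: sub simp: nE)
  have conth: "continuous_on (ball x0 r \<times> cbox 0 1) (\<lambda>(x,s). ?h x s)"
    unfolding case_prod_beta
    by (rule continuous_on_divide[OF continuous_on_compose2[OF cderiv_continuous[OF W(2,1)] cont1 img1] contE])
      (simp_all add: E0 continuous_on_snd)
  have contfx: "continuous_on (ball x0 r \<times> cbox 0 1) (\<lambda>(x,s). fx x s)"
  proof (rule continuous_on_blinfun_componentwise)
    fix v :: "complex^'a" assume "v \<in> Basis"
    have "continuous_on (ball x0 r \<times> cbox 0 1) (\<lambda>p. Df (fst p + E (snd p) *s axis j 1) v / E (snd p))"
      by (rule continuous_on_divide[OF continuous_on_compose2[OF Dfc cont1 img1] contE])
        (simp_all add: E0 continuous_on_snd)
    then show "continuous_on (ball x0 r \<times> cbox 0 1) (\<lambda>p. blinfun_apply (case p of (x, s) \<Rightarrow> fx x s) v)"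
      by (rule continuous_on_eq) (auto simp: fx)
  qed
  have der: "((\<lambda>x. integral (cbox 0 1) (?h x)) has_derivative integral (cbox 0 1) (fx x0)) (at x0 within ball x0 r)"
  proof (rule leibniz_rule)
    show "((\<lambda>x. ?h x s) has_derivative blinfun_apply (fx x s)) (at x within ball x0 r)"
      if "x \<in> ball x0 r" for x s
    proof -
      have "(f has_derivative Df (x + E s *s axis j 1)) (at (x + E s *s axis j 1))"
        using Df[OF sub[OF that]] by (simp add: cderiv_def nE)
      then have "((\<lambda>x. f (x + E s *s axis j 1)) has_derivative Df (x + E s *s axis j 1)) (at x within ball x0 r)"
        by (rule has_derivative_compose[where f = "\<lambda>x. x + E s *s axis j 1", rotated])
          (auto intro!: derivative_eq_intros)
      then show ?thesis
        unfolding fx[OF that] by (rule bounded_linear.has_derivative[OF bounded_linear_divide])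
    qed
    show "?h x integrable_on cbox 0 1" if "x \<in> ball x0 r" for x
    proof (rule integrable_continuous)
      have "continuous_on (cbox 0 1) (\<lambda>s. case (x,s) of (x,s) \<Rightarrow> ?h x s)"
        by (rule continuous_on_compose2[OF conth]) (use that in \<open>auto intro!: continuous_intros\<close>)
      then show "continuous_on (cbox 0 1) (?h x)" by simp
    qed
  qed (use r contfx in auto)
  have int: "fx x0 integrable_on cbox 0 1"
  proof (rule integrable_continuous)
    have "continuous_on (cbox 0 1) (\<lambda>s. case (x0,s) of (x,s) \<Rightarrow> fx x s)"
      by (rule continuous_on_compose2[OF contfx]) (use r in \<open>auto intro!: continuous_intros\<close>)
    then show "continuous_on (cbox 0 1) (fx x0)" by simp
  qed
  define L where "L = blinfun_apply (integral (cbox 0 1) (fx x0))"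
  have Leq: "L v = integral (cbox 0 1) (\<lambda>s. Df (x0 + E s *s axis j 1) v / E s)" for v
    unfolding L_def using r by (subst blinfun_apply_integral[OF int]) (simp add: fx)
  have Llin: "L (c *s v) = c * L v" for c v
  proof -
    have "L (c *s v) = integral (cbox 0 1) (\<lambda>s. c * (Df (x0 + E s *s axis j 1) v / E s))"
      unfolding Leq using Df[OF sub] r by (simp add: cderiv_def nE)
    then show ?thesis unfolding Leq integral_mult_right .
  qed
  have "((\<lambda>x. integral (cbox 0 1) (?h x)) has_derivative L) (at x0)"
    using der r unfolding L_def by (simp add: at_within_open[of x0 "ball x0 r"])
  then have "(pd j f has_derivative L) (at x0)"
    by (rule has_derivative_transform_within_open[of _ _ _ _ "ball x0 r"]) (simp_all add: r pdint[OF W(2)])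
  then have cd: "cderiv (pd j f) L x0"
    by (simp add: cderiv_def Llin)
  have Li: "L (axis i 1) = integral (cbox 0 1) (\<lambda>s. pd i f (x0 + E s *s axis j 1) / E s)" for i
    unfolding Leq using sub r by (simp add: nE pd_i_eq)
  show ?thesis
  proof (intro exI[of _ L] conjI allI impI)
    fix i assume "chol W (pd i f)"
    then have "pd j (pd i f) x0 = integral (cbox 0 1) (\<lambda>s. pd i f (x0 + E s *s axis j 1) / E s)"
      using pdint r by simp
    then show "L (axis i 1) = pd j (pd i f) x0" using Li by simp
  qed (rule cd)
qed

lemma chol_pd: "open W \<Longrightarrow> chol W f \<Longrightarrow> chol W (pd j f)"
  using chol_pd_deriv unfolding chol_def by blast

lemma pd_commute:
  assumes "open W" "chol W f" "x \<in> W"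
  shows "pd i (pd j f) x = pd j (pd i f) x"
proof -
  obtain f' where f': "cderiv (pd j f) f' x" "f' (axis i 1) = pd j (pd i f) x"
    using chol_pd_deriv[OF assms] chol_pd[OF assms(1,2)] by blast
  then show ?thesis using cderiv_pd[OF f'(1), of i] by simp
qed

lemma chol_mono: "chol W f \<Longrightarrow> V \<subseteq> W \<Longrightarrow> chol V f"
  by (auto simp: chol_def)

lemma cderiv_add: "cderiv f f' x \<Longrightarrow> cderiv g g' x \<Longrightarrow> cderiv (\<lambda>x. f x + g x) (\<lambda>v. f' v + g' v) x"
  by (auto simp: cderiv_def algebra_simps intro: has_derivative_add)

lemma cderiv_mult:
  "cderiv f f' x \<Longrightarrow> cderiv g g' x \<Longrightarrow> cderiv (\<lambda>x. f x * g x) (\<lambda>v. f x * g' v + f' v * g x) x"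
  by (auto simp: cderiv_def algebra_simps intro!: has_derivative_mult)

lemma cderiv_const: "cderiv (\<lambda>x. c) (\<lambda>v. 0) x"
  by (simp add: cderiv_def)

lemma cderiv_coord: "cderiv (\<lambda>x. x $ i) (\<lambda>v. v $ i) x"
  unfolding cderiv_def
  by (auto intro: bounded_linear_imp_has_derivative bounded_linear_vec_nth)

lemma chol_const [simp]: "chol W (\<lambda>x. c)"
  using cderiv_const unfolding chol_def by blast

lemma chol_coord [simp]: "chol W (\<lambda>x. x $ i)"
  using cderiv_coord unfolding chol_def by blast

lemma chol_add: "chol W f \<Longrightarrow> chol W g \<Longrightarrow> chol W (\<lambda>x. f x + g x)"
  unfolding chol_def using cderiv_add by blast

lemma chol_mult: "chol W f \<Longrightarrow> chol W g \<Longrightarrow> chol W (\<lambda>x. f x * g x)"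
  unfolding chol_def using cderiv_mult by blast

lemma chol_power: "chol W f \<Longrightarrow> chol W (\<lambda>x. f x ^ n)"
  by (induction n) (simp_all add: chol_mult)

lemma chol_prod: "(\<And>i. i \<in> I \<Longrightarrow> chol W (f i)) \<Longrightarrow> chol W (\<lambda>x. \<Prod>i\<in>I. f i x)"
  by (induction I rule: infinite_finite_induct) (simp_all add: chol_mult)

lemma pd_add:
  assumes "chol W f" "chol W g" "x \<in> W"
  shows "pd j (\<lambda>x. f x + g x) x = pd j f x + pd j g x"
proof -
  obtain f' g' where *: "cderiv f f' x" "cderiv g g' x"
    using assms unfolding chol_def by blast
  show ?thesis
    using cderiv_pd[OF cderiv_add[OF *], of j] cderiv_pd[OF *(1), of j] cderiv_pd[OF *(2), of j] by simp
qed

lemma pd_mult: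
  assumes "chol W f" "chol W g" "x \<in> W"
  shows "pd j (\<lambda>x. f x * g x) x = f x * pd j g x + pd j f x * g x"
proof -
  obtain f' g' where *: "cderiv f f' x" "cderiv g g' x"
    using assms unfolding chol_def by blast
  show ?thesis
    using cderiv_pd[OF cderiv_mult[OF *], of j] cderiv_pd[OF *(1), of j] cderiv_pd[OF *(2), of j] by simp
qed

lemma pd_const [simp]: "pd j (\<lambda>x. c) = (\<lambda>x. 0)"
  by (rule ext) (simp add: cderiv_pd[OF cderiv_const])

lemma pd_cmult: "chol W f \<Longrightarrow> x \<in> W \<Longrightarrow> pd j (\<lambda>x. c * f x) x = c * pd j f x"
  by (subst pd_mult[of W]) simp_all

lemma axis_line_open:
  assumes "open W" "(x :: complex^'n) \<in> W"
  shows "\<forall>\<^sub>F t in nhds 0. x + axis j t \<in> W"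
proof -
  have "continuous_on UNIV (\<lambda>t::complex. x + t *s axis j 1)"
    by (intro continuous_on_add continuous_on_const linear_continuous_on bounded_linear_smult_vec)
  then have "open ((\<lambda>t::complex. x + t *s axis j 1) -` W)"
    using assms by (simp add: open_vimage)
  moreover have "0 \<in> (\<lambda>t::complex. x + t *s axis j 1) -` W" using assms by simp
  ultimately show ?thesis
    by (subst axis_eq_smult) (auto simp: eventually_nhds)
qed

lemma pd_cong:
  assumes "open W" "x \<in> W" "\<And>y. y \<in> W \<Longrightarrow> f y = g y"
  shows "pd j f x = pd j g x"
  unfolding pd_def
  by (rule deriv_cong_ev[OF eventually_mono[OF axis_line_open[OF assms(1,2), of j]]])
    (simp_all add: assms)

lemma chol_cong:
  assumes "open W" "\<And>y. y \<in> W \<Longrightarrow> f y = g y" "chol W f"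
  shows "chol W g"
  unfolding chol_def
proof
  fix x assume x: "x \<in> W"
  then obtain f' where "cderiv f f' x" using assms(3) unfolding chol_def by blast
  then have "cderiv g f' x"
    unfolding cderiv_def using has_derivative_transform_within_open[of f f' x UNIV W g] assms x by auto
  then show "\<exists>f'. cderiv g f' x" by blast
qed

lemma restrict_hol_funs: "open W \<Longrightarrow> chol W f \<Longrightarrow> restrict f W \<in> hol_funs W"
  unfolding hol_funs_iff by (auto intro: chol_cong)

lemma hol_funs_chol: "f \<in> hol_funs W \<Longrightarrow> chol W f"
  by (simp add: hol_funs_iff)

section \<open>Multi-indices\<close>

text \<open>
  Multi-indices regarded as points of \<open>\<complex>\<^sup>n\<close>.
\<close>

definition emb :: "nat^'n \<Rightarrow> complex^'n" where
  "emb k = (\<chi> i. of_nat (k $ i))"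

text \<open>The multi-index with a single entry one in position \<open>j\<close>.\<close>

definition ue :: "'n \<Rightarrow> nat^'n" where
  "ue j = axis j 1"

lemma ue_nth [simp]: "ue j $ i = (if i = j then 1 else 0)"
  by (simp add: ue_def axis_def)

text \<open>
  The total degree of a multi-index.
\<close>

definition msize :: "nat^'n \<Rightarrow> nat" where
  "msize k = (\<Sum>i\<in>UNIV. k $ i)"

text \<open>
  The product of the generalised binomial coefficients \<open>w\<^sub>i choose \<alpha>\<^sub>i\<close>. This is the factor by
  which \<open>(x\<^sup>\<alpha>/\<alpha>!) \<partial>\<^sup>\<alpha>\<close> multiplies \<open>x\<^sup>w\<close>, and a Newton basis of the polynomials in \<open>w\<close>.
\<close>

definition gb :: "complex^'n \<Rightarrow> nat^'n \<Rightarrow> complex" where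
  "gb w \<alpha> = (\<Prod>i\<in>UNIV. (w $ i) gchoose (\<alpha> $ i))"

lemma emb_nth [simp]: "emb k $ i = of_nat (k $ i)" by (simp add: emb_def)
lemma emb_add: "emb (k + l) = emb k + emb l" by (simp add: vec_eq_iff)
lemma emb_0 [simp]: "emb 0 = 0" by (simp add: vec_eq_iff)
lemma emb_axis [simp]: "emb (ue j) = axis j 1" by (simp add: vec_eq_iff axis_def)
lemma emb_inj [simp]: "emb k = emb l \<longleftrightarrow> k = l" by (simp add: vec_eq_iff)
lemma emb_diff: "l \<le> k \<Longrightarrow> emb (k - l) = emb k - emb l"
  by (simp add: vec_eq_iff less_eq_vec_def of_nat_diff)

lemma msize_0 [simp]: "msize 0 = 0" by (simp add: msize_def)
lemma msize_add: "msize (k + l) = msize k + msize l" by (simp add: msize_def sum.distrib)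
lemma msize_axis [simp]: "msize (ue j) = 1" by (simp add: msize_def)

lemma axis_step: "0 < k $ j \<Longrightarrow> k - ue j + ue j = (k :: nat^'n)"
  by (auto simp: vec_eq_iff axis_def)

lemma axis_step': "k + ue j - ue j = (k :: nat^'n)"
  by (auto simp: vec_eq_iff axis_def)

lemma multi_induct [case_names zero step]:
  fixes k :: "nat^'n"
  assumes "P 0" "\<And>k j. P k \<Longrightarrow> P (k + ue j)"
  shows "P k"
proof (induction "msize k" arbitrary: k)
  case 0
  then have "k = 0" by (simp add: msize_def vec_eq_iff)
  then show ?case using assms by simp
next
  case (Suc n)
  have "\<exists>j. 0 < k $ j"
  proof (rule ccontr)
    assume "\<not> (\<exists>j. 0 < k $ j)"
    then have "msize k = 0" by (simp add: msize_def)
    then show False using Suc by simp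
  qed
  then obtain j where j: "0 < k $ j" by blast
  have "msize (k - ue j) + 1 = msize k"
    by (metis axis_step j msize_add msize_axis)
  then have "P (k - ue j)" using Suc by simp
  then have "P (k - ue j + ue j)" by (rule assms(2))
  then show ?case by (simp only: axis_step[OF j])
qed

lemma finite_msize_le: "finite {\<alpha> :: nat^'n. msize \<alpha> \<le> M}"
proof -
  have "{\<alpha> :: nat^'n. msize \<alpha> \<le> M} \<subseteq> vec_lambda ` (UNIV \<rightarrow>\<^sub>E {..M})"
  proof
    fix \<alpha> :: "nat^'n" assume "\<alpha> \<in> {\<alpha>. msize \<alpha> \<le> M}"
    moreover have "\<alpha> $ i \<le> (\<Sum>i\<in>UNIV. \<alpha> $ i)" for i
      by (rule member_le_sum) simp_all
    ultimately have "\<alpha> $ i \<le> M" for i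
      unfolding msize_def using le_trans by blast
    then show "\<alpha> \<in> vec_lambda ` (UNIV \<rightarrow>\<^sub>E {..M})"
      by (intro image_eqI[of _ _ "vec_nth \<alpha>"]) auto
  qed
  then show ?thesis by (rule finite_subset) (auto intro!: finite_PiE)
qed

lemma gb_0 [simp]: "gb w 0 = 1" by (simp add: gb_def)

lemma gb_step:
  "gb (w + axis j 1) \<alpha> = gb w \<alpha> + (if \<alpha> $ j = 0 then 0 else gb w (\<alpha> - ue j))"
proof -
  let ?R = "\<Prod>i\<in>UNIV - {j}. (w $ i) gchoose (\<alpha> $ i)"
  have 1: "gb (w + axis j 1) \<alpha> = ((w $ j + 1) gchoose (\<alpha> $ j)) * ?R"
    unfolding gb_def by (subst prod.remove[of _ j]) (auto simp: axis_def intro!: prod.cong)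
  have 2: "gb w \<alpha> = ((w $ j) gchoose (\<alpha> $ j)) * ?R"
    unfolding gb_def by (subst prod.remove[of _ j]) auto
  have 3: "gb w (\<alpha> - ue j) = ((w $ j) gchoose (\<alpha> $ j - 1)) * ?R"
    unfolding gb_def by (subst prod.remove[of _ j]) (auto simp: axis_def intro!: prod.cong)
  show ?thesis
    by (cases "\<alpha> $ j") (simp_all add: 1 2 3 gbinomial_Suc_Suc distrib_right)
qed

lemma gb_emb: "gb (emb k) \<alpha> = of_nat (\<Prod>i\<in>UNIV. (k $ i) choose (\<alpha> $ i))"
  by (simp add: gb_def binomial_gbinomial)

lemma gb_emb_eq_0: "\<not> \<alpha> \<le> k \<Longrightarrow> gb (emb k) \<alpha> = 0"
  by (auto simp: gb_emb less_eq_vec_def not_le)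

lemma gb_emb_self [simp]: "gb (emb k) k = 1"
  by (simp add: gb_emb)

section \<open>Taylor coefficients at the origin\<close>

text \<open>
  A list of coordinates in which \<open>j\<close> occurs \<open>k\<^sub>j\<close> times; the order is irrelevant because partial
  derivatives commute.
\<close>

definition idx :: "nat^'n \<Rightarrow> 'n list" where
  "idx k = (SOME l. \<forall>j. count (mset l) j = k $ j)"

lemma idx: "count (mset (idx k)) j = k $ j"
proof -
  have "\<exists>l. \<forall>j. count (mset l) j = k $ j"
  proof (induction k rule: multi_induct)
    case zero
    then show ?case by (intro exI[of _ "[]"]) simp
  next
    case (step k j)
    then obtain l where "\<forall>j. count (mset l) j = k $ j" by blast
    then show ?case by (intro exI[of _ "j # l"]) (auto simp: axis_def)
  qed
  from someI_ex[OF this] show ?thesis unfolding idx_def by (rule spec)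
qed

text \<open>
  The derivative \<open>(\<partial>\<^sup>k f)(0)\<close>, that is, the Taylor coefficient with respect to the divided
  monomials \<open>x\<^sup>k/k!\<close>.
\<close>

definition tayl :: "(complex^'n \<Rightarrow> complex) \<Rightarrow> nat^'n \<Rightarrow> complex" where
  "tayl f k = fold pd (idx k) f 0"

lemma fold_pd_cong:
  assumes "open W" "\<And>y. y \<in> W \<Longrightarrow> f y = g y" "x \<in> W"
  shows "fold pd l f x = fold pd l g x"
  using assms(2,3)
proof (induction l arbitrary: f g x)
  case (Cons j l)
  have "fold pd l (pd j f) x = fold pd l (pd j g) x"
  proof (rule Cons.IH)
    fix y assume "y \<in> W"
    then show "pd j f y = pd j g y"
      by (rule pd_cong[OF assms(1)]) (rule Cons.prems(1))
  qed (rule Cons.prems(2))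
  then show ?case by (simp only: fold.simps o_apply)
qed simp

lemma fold_pd_perm:
  assumes "open W" "chol W f" "x \<in> W" "mset l = mset l'"
  shows "fold pd l f x = fold pd l' f x"
proof -
  let ?D = "\<lambda>j f. restrict (pd j f) W"
  have D: "fold pd l f x = fold ?D l (restrict f W) x" if "x \<in> W" for f l x
    using that
  proof (induction l arbitrary: f)
    case (Cons j l)
    have "fold pd l (pd j f) x = fold pd l (pd j (restrict f W)) x"
    proof (rule fold_pd_cong[OF assms(1) _ Cons.prems])
      fix y assume "y \<in> W"
      then show "pd j f y = pd j (restrict f W) y"
        by (rule pd_cong[OF assms(1)]) simp
    qed
    also have "\<dots> = fold ?D l (?D j (restrict f W)) x"
      by (rule Cons.IH[OF Cons.prems])
    finally show ?case by (simp only: fold.simps o_apply)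
  qed simp
  have "fold ?D l (restrict f W) = fold ?D l' (restrict f W)"
  proof (rule fold_permuted_eq[where P = "\<lambda>f. f \<in> hol_funs W"])
    show "restrict f W \<in> hol_funs W" using assms by (simp add: restrict_hol_funs)
    show "restrict (pd j z) W \<in> hol_funs W" if "z \<in> hol_funs W" for j z
      using that assms by (simp add: restrict_hol_funs chol_pd hol_funs_chol)
    show "restrict (pd i (restrict (pd j z) W)) W = restrict (pd j (restrict (pd i z) W)) W"
      if z: "z \<in> hol_funs W" for i j z
    proof (rule ext)
      fix y
      have "pd i (restrict (pd j z) W) y = pd j (restrict (pd i z) W) y" if y: "y \<in> W"
      proof -
        have "pd i (restrict (pd j z) W) y = pd i (pd j z) y"
          by (rule pd_cong[OF assms(1) y]) simp
        also have "\<dots> = pd j (pd i z) y"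
          using pd_commute[OF assms(1) hol_funs_chol[OF z] y] .
        also have "\<dots> = pd j (restrict (pd i z) W) y"
          by (rule pd_cong[OF assms(1) y]) simp
        finally show ?thesis .
      qed
      then show "restrict (pd i (restrict (pd j z) W)) W y = restrict (pd j (restrict (pd i z) W)) W y"
        by simp
    qed
  qed (use assms in auto)
  then show ?thesis using D[OF assms(3)] by metis
qed

lemma tayl_0: "tayl f 0 = f 0"
proof -
  have "mset (idx (0 :: nat^'a)) = {#}" by (rule multiset_eqI) (simp add: idx)
  then show ?thesis by (simp add: tayl_def)
qed

lemma tayl_step:
  assumes "open W" "0 \<in> W" "chol W f"
  shows "tayl f (k + ue j) = tayl (pd j f) k"
proof -
  have "mset (idx (k + ue j)) = mset (j # idx k)"
    by (rule multiset_eqI) (auto simp: idx axis_def)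
  then have "fold pd (idx (k + ue j)) f 0 = fold pd (j # idx k) f 0"
    using fold_pd_perm assms by blast
  then show ?thesis by (simp add: tayl_def)
qed

lemma tayl_cong: "open W \<Longrightarrow> 0 \<in> W \<Longrightarrow> (\<And>y. y \<in> W \<Longrightarrow> f y = g y) \<Longrightarrow> tayl f k = tayl g k"
  unfolding tayl_def by (rule fold_pd_cong)

lemma tayl_add:
  assumes W: "open W" "0 \<in> W" and "chol W f" "chol W g"
  shows "tayl (\<lambda>x. f x + g x) k = tayl f k + tayl g k"
  using assms(3,4)
proof (induction k arbitrary: f g rule: multi_induct)
  case zero then show ?case by (simp add: tayl_0)
next
  case (step k j)
  have "tayl (\<lambda>x. f x + g x) (k + ue j) = tayl (pd j (\<lambda>x. f x + g x)) k"
    by (rule tayl_step[OF W]) (intro chol_add step)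
  also have "\<dots> = tayl (\<lambda>x. pd j f x + pd j g x) k"
    by (rule tayl_cong[OF W]) (use step pd_add in blast)
  also have "\<dots> = tayl (pd j f) k + tayl (pd j g) k"
    by (rule step.IH) (use step W chol_pd in blast)+
  finally show ?case
    using step tayl_step[OF W] by simp
qed

lemma tayl_cmult:
  assumes W: "open W" "0 \<in> W" and "chol W f"
  shows "tayl (\<lambda>x. c * f x) k = c * tayl f k"
  using assms(3)
proof (induction k arbitrary: f rule: multi_induct)
  case zero then show ?case by (simp add: tayl_0)
next
  case (step k j)
  have "tayl (\<lambda>x. c * f x) (k + ue j) = tayl (pd j (\<lambda>x. c * f x)) k"
    by (rule tayl_step[OF W]) (intro chol_mult chol_const step)
  also have "\<dots> = tayl (\<lambda>x. c * pd j f x) k"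
    by (rule tayl_cong[OF W]) (use step pd_cmult in blast)
  also have "\<dots> = c * tayl (pd j f) k"
    by (rule step.IH) (use step W chol_pd in blast)+
  finally show ?case
    using step tayl_step[OF W] by simp
qed

text \<open>
  The Leibniz rule for \<open>(\<partial>\<^sup>k (g f))(0)\<close>. Terms in which \<open>\<alpha> \<le> k\<close> fails vanish through the binomial
  coefficient, so that the truncated subtraction \<open>k - \<alpha>\<close> is harmless and any bound \<open>M\<close> on the
  degree of \<open>k\<close> gives the same sum.
\<close>

lemma tayl_mult:
  assumes W: "open W" "0 \<in> W" and "chol W f" "chol W g" "msize k \<le> M"
  shows "tayl (\<lambda>x. g x * f x) k =
    (\<Sum>\<alpha> | msize \<alpha> \<le> M. tayl g \<alpha> * gb (emb k) \<alpha> * tayl f (k - \<alpha>))"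
  using assms(3-5)
proof (induction k arbitrary: f g M rule: multi_induct)
  case zero
  have z: "gb 0 \<alpha> = (if \<alpha> = 0 then 1 else 0)" for \<alpha> :: "nat^'a"
  proof (cases "\<alpha> = 0")
    case False
    then have "\<not> \<alpha> \<le> 0" by (auto simp: less_eq_vec_def vec_eq_iff)
    from gb_emb_eq_0[OF this] show ?thesis using False by simp
  qed simp
  have "(\<Sum>\<alpha> | msize \<alpha> \<le> M. tayl g \<alpha> * gb (emb 0) \<alpha> * tayl f (0 - \<alpha>))
      = (\<Sum>\<alpha> | msize (\<alpha> :: nat^'a) \<le> M. if \<alpha> = 0 then tayl g 0 * tayl f 0 else 0)"
    by (rule sum.cong) (auto simp: z)
  also have "\<dots> = tayl g 0 * tayl f 0"
    by (subst sum.delta) (auto simp: finite_msize_le)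
  finally show ?case by (simp add: tayl_0)
next
  case (step k j)
  have hol: "chol W (pd j f)" "chol W (pd j g)" using step W chol_pd by blast+
  obtain M' where M': "M = Suc M'" "msize k \<le> M'"
    using step.prems(3) by (cases M) (auto simp: msize_add)
  have "tayl (\<lambda>x. g x * f x) (k + ue j) = tayl (pd j (\<lambda>x. g x * f x)) k"
    by (rule tayl_step[OF W]) (intro chol_mult step)
  also have "\<dots> = tayl (\<lambda>x. g x * pd j f x + pd j g x * f x) k"
    by (rule tayl_cong[OF W]) (use step pd_mult in blast)
  also have "\<dots> = tayl (\<lambda>x. g x * pd j f x) k + tayl (\<lambda>x. pd j g x * f x) k"
    by (rule tayl_add[OF W]) (intro chol_mult step hol)+
  also have "tayl (\<lambda>x. g x * pd j f x) k =
      (\<Sum>\<alpha> | msize \<alpha> \<le> M. tayl g \<alpha> * gb (emb k) \<alpha> * tayl (pd j f) (k - \<alpha>))"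
    using step.IH[OF hol(1) step.prems(2), of M] M' by simp
  also have "\<dots> = (\<Sum>\<alpha> | msize \<alpha> \<le> M. tayl g \<alpha> * gb (emb k) \<alpha> * tayl f (k + ue j - \<alpha>))"
  proof (rule sum.cong)
    fix \<alpha>
    show "tayl g \<alpha> * gb (emb k) \<alpha> * tayl (pd j f) (k - \<alpha>) = tayl g \<alpha> * gb (emb k) \<alpha> * tayl f (k + ue j - \<alpha>)"
    proof (cases "\<alpha> \<le> k")
      case True
      then have "k + ue j - \<alpha> = (k - \<alpha>) + ue j"
        by (auto simp: vec_eq_iff less_eq_vec_def axis_def Suc_diff_le)
      then show ?thesis using tayl_step[OF W step.prems(1)] by simp
    qed (simp add: gb_emb_eq_0)
  qed simp
  also have "tayl (\<lambda>x. pd j g x * f x) k =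
      (\<Sum>\<alpha> | msize \<alpha> \<le> M'. tayl (pd j g) \<alpha> * gb (emb k) \<alpha> * tayl f (k - \<alpha>))"
    using step.IH[OF step.prems(1) hol(2), of M'] M' by simp
  also have "\<dots> = (\<Sum>\<alpha> | msize \<alpha> \<le> M \<and> \<alpha> $ j \<noteq> 0. tayl g \<alpha> * gb (emb k) (\<alpha> - ue j) * tayl f (k + ue j - \<alpha>))"
  proof (rule sum.reindex_bij_witness[where i = "\<lambda>\<alpha>. \<alpha> - ue j" and j = "\<lambda>\<alpha>. \<alpha> + ue j"])
    fix \<alpha> :: "nat^'a" assume a: "\<alpha> \<in> {\<alpha>. msize \<alpha> \<le> M'}"
    show "\<alpha> + ue j - ue j = \<alpha>" by (rule axis_step')
    show "\<alpha> + ue j \<in> {\<alpha>. msize \<alpha> \<le> M \<and> \<alpha> $ j \<noteq> 0}"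
      using a M' by (simp add: msize_add)
    have "k + ue j - (\<alpha> + ue j) = k - \<alpha>" by (simp add: vec_eq_iff)
    then show "tayl g (\<alpha> + ue j) * gb (emb k) (\<alpha> + ue j - ue j) * tayl f (k + ue j - (\<alpha> + ue j)) =
         tayl (pd j g) \<alpha> * gb (emb k) \<alpha> * tayl f (k - \<alpha>)"
      using tayl_step[OF W step.prems(2)] by (simp add: axis_step')
  next
    fix \<alpha> :: "nat^'a" assume a: "\<alpha> \<in> {\<alpha>. msize \<alpha> \<le> M \<and> \<alpha> $ j \<noteq> 0}"
    then show eq: "\<alpha> - ue j + ue j = \<alpha>" using axis_step[of \<alpha> j] by simp
    have "msize (\<alpha> - ue j) + 1 = msize \<alpha>" by (metis eq msize_add msize_axis)
    then show "\<alpha> - ue j \<in> {\<alpha>. msize \<alpha> \<le> M'}" using a M' by simp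
  qed
  also have "\<dots> = (\<Sum>\<alpha> | msize \<alpha> \<le> M. tayl g \<alpha> * (if \<alpha> $ j = 0 then 0 else gb (emb k) (\<alpha> - ue j)) * tayl f (k + ue j - \<alpha>))"
    by (rule sum.mono_neutral_cong_left) (auto simp: finite_msize_le)
  finally show ?case
    by (simp only: emb_add emb_axis gb_step sum.distrib[symmetric] distrib_left distrib_right)
qed

section \<open>Divided monomials\<close>

text \<open>
  The divided monomial \<open>x\<^sup>\<alpha>/\<alpha>!\<close>.
\<close>

definition xm :: "nat^'n \<Rightarrow> complex^'n \<Rightarrow> complex" where
  "xm \<alpha> x = (\<Prod>i\<in>UNIV. (x $ i) ^ (\<alpha> $ i) / fact (\<alpha> $ i))"

lemma chol_xm [simp]: "chol W (xm \<alpha>)"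
  unfolding xm_def divide_inverse by (intro chol_prod chol_mult chol_power chol_coord chol_const)

lemma pd_xm: "pd j (xm \<alpha>) x = (if \<alpha> $ j = 0 then 0 else xm (\<alpha> - ue j) x)"
proof -
  let ?R = "\<Prod>i\<in>UNIV - {j}. (x $ i) ^ (\<alpha> $ i) / fact (\<alpha> $ i)"
  have "xm \<alpha> (x + axis j t) = (x $ j + t) ^ (\<alpha> $ j) / fact (\<alpha> $ j) * ?R" for t
    unfolding xm_def by (subst prod.remove[of _ j]) (auto simp: axis_def intro!: prod.cong)
  moreover have "((\<lambda>t. (x $ j + t) ^ (\<alpha> $ j) / fact (\<alpha> $ j) * ?R) has_field_derivative
     of_nat (\<alpha> $ j) * (x $ j) ^ (\<alpha> $ j - 1) / fact (\<alpha> $ j) * ?R) (at 0)"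
    by (auto intro!: derivative_eq_intros)
  ultimately have 1: "pd j (xm \<alpha>) x = of_nat (\<alpha> $ j) * (x $ j) ^ (\<alpha> $ j - 1) / fact (\<alpha> $ j) * ?R"
    unfolding pd_def by (simp add: DERIV_imp_deriv)
  have 2: "xm (\<alpha> - ue j) x = (x $ j) ^ (\<alpha> $ j - 1) / fact (\<alpha> $ j - 1) * ?R"
    unfolding xm_def by (subst prod.remove[of _ j]) (auto simp: axis_def intro!: prod.cong)
  show ?thesis
  proof (cases "\<alpha> $ j")
    case (Suc n)
    have "of_nat (Suc n) * z / fact (Suc n) = z / (fact n :: complex)" for z
      by (simp add: fact_Suc del: of_nat_Suc)
    then show ?thesis by (simp add: 1 2 Suc del: of_nat_Suc fact_Suc)
  qed (simp add: 1)
qed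

lemma xm_0 [simp]: "xm 0 = (\<lambda>x. 1)" by (rule ext) (simp add: xm_def)

lemma xm_at_0: "xm \<alpha> 0 = (if \<alpha> = 0 then 1 else 0)"
proof (cases "\<alpha> = 0")
  case False
  then obtain i where "\<alpha> $ i \<noteq> 0" by (auto simp: vec_eq_iff)
  then have "xm \<alpha> 0 = 0" unfolding xm_def by (intro prod_zero) (auto intro!: bexI[of _ i])
  then show ?thesis using False by simp
qed simp

lemma tayl_xm: "tayl (xm \<alpha>) k = (if k = \<alpha> then 1 else 0)"
proof (induction k arbitrary: \<alpha> rule: multi_induct)
  case zero then show ?case by (auto simp: tayl_0 xm_at_0)
next
  case (step k j)
  have *: "tayl (xm \<alpha>) (k + ue j) = tayl (pd j (xm \<alpha>)) k"
    by (rule tayl_step[of UNIV]) simp_all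
  have z: "tayl (\<lambda>x. 0) k = 0" for k :: "nat^'a"
    using tayl_cmult[of UNIV "\<lambda>x. 0" 0 k] by simp
  show ?case
  proof (cases "\<alpha> $ j = 0")
    case True
    then have "k + ue j \<noteq> \<alpha>" by (auto simp: vec_eq_iff axis_def)
    then show ?thesis using True by (simp add: * pd_xm[abs_def] z)
  next
    case False
    then have "k + ue j = \<alpha> \<longleftrightarrow> k = \<alpha> - ue j"
      using axis_step[of \<alpha> j] axis_step'[of k j] by auto
    then show ?thesis using False by (simp add: * pd_xm[abs_def] step)
  qed
qed

section \<open>The rings of differential operators\<close>

lemma opens_inD: "W \<in> opens_in U \<Longrightarrow> open W" "W \<in> opens_in U \<Longrightarrow> W \<subseteq> U"
  by (auto simp: opens_in_def)

lemma opens_in_trans: "V \<in> opens_in U \<Longrightarrow> W \<in> opens_in V \<Longrightarrow> W \<in> opens_in U"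
  by (auto simp: opens_in_def)

lemma hol_funs_mult: "open W \<Longrightarrow> chol W g \<Longrightarrow> f \<in> hol_funs W \<Longrightarrow> (\<lambda>x\<in>W. g x * f x) \<in> hol_funs W"
  by (simp add: restrict_hol_funs chol_mult hol_funs_chol)

lemma hol_funs_lin: "open W \<Longrightarrow> f \<in> hol_funs W \<Longrightarrow> g \<in> hol_funs W \<Longrightarrow> (\<lambda>x\<in>W. a * f x + b * g x) \<in> hol_funs W"
  by (intro restrict_hol_funs chol_add chol_mult chol_const hol_funs_chol)

lemma hol_funs_pd: "open W \<Longrightarrow> f \<in> hol_funs W \<Longrightarrow> restrict (pd j f) W \<in> hol_funs W"
  by (intro restrict_hol_funs chol_pd hol_funs_chol)

lemma hol_funs_restrict: "V \<in> opens_in W \<Longrightarrow> f \<in> hol_funs W \<Longrightarrow> restrict f V \<in> hol_funs V"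
  using restrict_hol_funs chol_mono hol_funs_chol opens_inD by metis

lemma hol_funs_eqI: "f \<in> hol_funs W \<Longrightarrow> g \<in> hol_funs W \<Longrightarrow> (\<And>x. x \<in> W \<Longrightarrow> f x = g x) \<Longrightarrow> f = g"
  unfolding hol_funs_iff using extensionalityI by blast

lemma End_hol_carrier_iff:
  "P \<in> carrier (End_hol U) \<longleftrightarrow> P \<in> (\<Pi>\<^sub>E W\<in>opens_in U. hol_funs W \<rightarrow>\<^sub>E hol_funs W) \<and>
        (\<forall>W\<in>opens_in U. \<forall>f\<in>hol_funs W. \<forall>g\<in>hol_funs W. \<forall>a b.
           P W (\<lambda>x\<in>W. a * f x + b * g x) = (\<lambda>x\<in>W. a * P W f x + b * P W g x)) \<and>
        (\<forall>W\<in>opens_in U. \<forall>V\<in>opens_in W. \<forall>f\<in>hol_funs W.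
           P V (restrict f V) = restrict (P W f) V)"
  by (simp add: End_hol_def)

lemma End_hol_maps: "P \<in> carrier (End_hol U) \<Longrightarrow> W \<in> opens_in U \<Longrightarrow> f \<in> hol_funs W \<Longrightarrow> P W f \<in> hol_funs W"
  by (auto simp: End_hol_carrier_iff dest!: PiE_mem)

lemma End_hol_linear:
  "P \<in> carrier (End_hol U) \<Longrightarrow> W \<in> opens_in U \<Longrightarrow> f \<in> hol_funs W \<Longrightarrow> g \<in> hol_funs W \<Longrightarrow>
    P W (\<lambda>x\<in>W. a * f x + b * g x) = (\<lambda>x\<in>W. a * P W f x + b * P W g x)"
  by (simp add: End_hol_carrier_iff)

lemma End_hol_add:
  assumes "P \<in> carrier (End_hol U)" "W \<in> opens_in U" "f \<in> hol_funs W" "g \<in> hol_funs W"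
  shows "P W (\<lambda>x\<in>W. f x + g x) = (\<lambda>x\<in>W. P W f x + P W g x)"
  using End_hol_linear[OF assms, of 1 1] by simp

lemma End_hol_local:
  "P \<in> carrier (End_hol U) \<Longrightarrow> W \<in> opens_in U \<Longrightarrow> V \<in> opens_in W \<Longrightarrow> f \<in> hol_funs W \<Longrightarrow>
    P V (restrict f V) = restrict (P W f) V"
  by (simp add: End_hol_carrier_iff)

lemma End_hol_eqI:
  assumes P: "P \<in> carrier (End_hol U)" and Q: "Q \<in> carrier (End_hol U)"
    and eq: "\<And>W f x. W \<in> opens_in U \<Longrightarrow> f \<in> hol_funs W \<Longrightarrow> x \<in> W \<Longrightarrow> P W f x = Q W f x"
  shows "P = Q"
proof (rule PiE_ext[of _ "opens_in U" "\<lambda>W. hol_funs W \<rightarrow>\<^sub>E hol_funs W"])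
  show "P \<in> (\<Pi>\<^sub>E W\<in>opens_in U. hol_funs W \<rightarrow>\<^sub>E hol_funs W)" "Q \<in> (\<Pi>\<^sub>E W\<in>opens_in U. hol_funs W \<rightarrow>\<^sub>E hol_funs W)"
    using P Q by (simp_all add: End_hol_carrier_iff)
  fix W assume W: "W \<in> opens_in U"
  show "P W = Q W"
  proof (rule PiE_ext[of _ "hol_funs W" "\<lambda>_. hol_funs W"])
    show "P W \<in> hol_funs W \<rightarrow>\<^sub>E hol_funs W" "Q W \<in> hol_funs W \<rightarrow>\<^sub>E hol_funs W"
      using P Q W by (auto simp: End_hol_carrier_iff)
    fix f assume f: "f \<in> hol_funs W"
    show "P W f = Q W f"
      by (rule hol_funs_eqI[of _ W]) (use P Q W f eq in \<open>auto intro: End_hol_maps\<close>)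
  qed
qed

lemma End_hol_carrierI:
  assumes "P \<in> extensional (opens_in U)" "\<And>W. W \<in> opens_in U \<Longrightarrow> P W \<in> extensional (hol_funs W)"
    and "\<And>W f. W \<in> opens_in U \<Longrightarrow> f \<in> hol_funs W \<Longrightarrow> P W f \<in> hol_funs W"
    and "\<And>W f g a b x. W \<in> opens_in U \<Longrightarrow> f \<in> hol_funs W \<Longrightarrow> g \<in> hol_funs W \<Longrightarrow> x \<in> W \<Longrightarrow>
       P W (\<lambda>x\<in>W. a * f x + b * g x) x = a * P W f x + b * P W g x"
    and "\<And>W V f x. W \<in> opens_in U \<Longrightarrow> V \<in> opens_in W \<Longrightarrow> f \<in> hol_funs W \<Longrightarrow> x \<in> V \<Longrightarrow>
       P V (restrict f V) x = P W f x"
  shows "P \<in> carrier (End_hol U)"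
  unfolding End_hol_carrier_iff
proof (intro conjI ballI allI)
  show "P \<in> (\<Pi>\<^sub>E W\<in>opens_in U. hol_funs W \<rightarrow>\<^sub>E hol_funs W)"
    using assms(1-3) by (auto simp: PiE_def extensional_def)
next
  fix W f g a b assume *: "W \<in> opens_in U" "f \<in> hol_funs W" "g \<in> hol_funs W"
  show "P W (\<lambda>x\<in>W. a * f x + b * g x) = (\<lambda>x\<in>W. a * P W f x + b * P W g x)"
    by (rule hol_funs_eqI[of _ W]) (use * assms(3,4) in \<open>simp_all add: hol_funs_lin opens_inD\<close>)
next
  fix W V f assume *: "W \<in> opens_in U" "V \<in> opens_in W" "f \<in> hol_funs W"
  then have V: "V \<in> opens_in U" using opens_in_trans by blast
  show "P V (restrict f V) = restrict (P W f) V"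
    using assms(3)[OF V hol_funs_restrict[OF *(2,3)]] hol_funs_restrict[OF *(2) assms(3)[OF *(1,3)]]
    by (rule hol_funs_eqI) (simp only: assms(5)[OF *] restrict_apply if_True)
qed

lemma End_mult_eval [simp]:
  "W \<in> opens_in U \<Longrightarrow> f \<in> hol_funs W \<Longrightarrow> (P \<otimes>\<^bsub>End_hol U\<^esub> Q) W f = P W (Q W f)"
  by (simp add: End_hol_def compose_def)

lemma End_add_eval [simp]:
  "W \<in> opens_in U \<Longrightarrow> f \<in> hol_funs W \<Longrightarrow> (P \<oplus>\<^bsub>End_hol U\<^esub> Q) W f = (\<lambda>x\<in>W. P W f x + Q W f x)"
  by (simp add: End_hol_def)

lemma End_one_eval [simp]: "W \<in> opens_in U \<Longrightarrow> f \<in> hol_funs W \<Longrightarrow> \<one>\<^bsub>End_hol U\<^esub> W f = f"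
  by (simp add: End_hol_def)

lemma End_zero_eval [simp]: "W \<in> opens_in U \<Longrightarrow> f \<in> hol_funs W \<Longrightarrow> \<zero>\<^bsub>End_hol U\<^esub> W f = (\<lambda>x\<in>W. 0)"
  by (simp add: End_hol_def)

lemma mult_op_eval [simp]: "W \<in> opens_in U \<Longrightarrow> f \<in> hol_funs W \<Longrightarrow> mult_op U g W f = (\<lambda>x\<in>W. g x * f x)"
  by (simp add: mult_op_def)

lemma partial_op_eval [simp]: "W \<in> opens_in U \<Longrightarrow> f \<in> hol_funs W \<Longrightarrow> partial_op U j W f = restrict (pd j f) W"
  by (simp add: partial_op_def pd_def[abs_def])

lemma End_mult_closed:
  assumes P: "P \<in> carrier (End_hol U)" and Q: "Q \<in> carrier (End_hol U)"
  shows "P \<otimes>\<^bsub>End_hol U\<^esub> Q \<in> carrier (End_hol U)"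
proof (rule End_hol_carrierI)
  show "P \<otimes>\<^bsub>End_hol U\<^esub> Q \<in> extensional (opens_in U)" by (simp add: End_hol_def)
  show "W \<in> opens_in U \<Longrightarrow> (P \<otimes>\<^bsub>End_hol U\<^esub> Q) W \<in> extensional (hol_funs W)" for W
    by (simp add: End_hol_def compose_def)
  fix W f assume *: "W \<in> opens_in U" "f \<in> hol_funs W"
  show "(P \<otimes>\<^bsub>End_hol U\<^esub> Q) W f \<in> hol_funs W" using * P Q by (simp add: End_hol_maps)
next
  fix W f g a b x assume *: "W \<in> opens_in U" "f \<in> hol_funs W" "g \<in> hol_funs W" "x \<in> W"
  show "(P \<otimes>\<^bsub>End_hol U\<^esub> Q) W (\<lambda>x\<in>W. a * f x + b * g x) x =
       a * (P \<otimes>\<^bsub>End_hol U\<^esub> Q) W f x + b * (P \<otimes>\<^bsub>End_hol U\<^esub> Q) W g x"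
  proof -
    have l: "(\<lambda>x\<in>W. a * f x + b * g x) \<in> hol_funs W"
      using * hol_funs_lin opens_inD by blast
    show ?thesis
      unfolding End_mult_eval[OF *(1) l] End_mult_eval[OF *(1,2)] End_mult_eval[OF *(1,3)]
        End_hol_linear[OF Q *(1,2,3)]
        End_hol_linear[OF P *(1) End_hol_maps[OF Q *(1,2)] End_hol_maps[OF Q *(1,3)]]
      using *(4) by simp
  qed
next
  fix W V f x assume *: "W \<in> opens_in U" "V \<in> opens_in W" "f \<in> hol_funs W" "x \<in> V"
  show "(P \<otimes>\<^bsub>End_hol U\<^esub> Q) V (restrict f V) x = (P \<otimes>\<^bsub>End_hol U\<^esub> Q) W f x"
    using * P Q opens_in_trans[OF *(1,2)]
    by (simp add: hol_funs_restrict End_hol_local[OF Q] End_hol_local[OF P] End_hol_maps)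
qed

lemma End_lin_closed:
  assumes P: "P \<in> carrier (End_hol U)" and Q: "Q \<in> carrier (End_hol U)"
  shows "(\<lambda>W\<in>opens_in U. \<lambda>f\<in>hol_funs W. \<lambda>x\<in>W. c * P W f x + d * Q W f x) \<in> carrier (End_hol U)"
    (is "?R \<in> _")
proof (rule End_hol_carrierI)
  fix W f assume *: "W \<in> opens_in U" "f \<in> hol_funs W"
  show "?R W f \<in> hol_funs W" using * P Q by (simp add: End_hol_maps hol_funs_lin opens_inD)
next
  fix W f g a b x assume *: "W \<in> opens_in U" "f \<in> hol_funs W" "g \<in> hol_funs W" "x \<in> W"
  show "?R W (\<lambda>x\<in>W. a * f x + b * g x) x = a * ?R W f x + b * ?R W g x"
    using * P Q by (simp add: hol_funs_lin opens_inD End_hol_linear End_hol_maps algebra_simps)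
next
  fix W V f x assume *: "W \<in> opens_in U" "V \<in> opens_in W" "f \<in> hol_funs W" "x \<in> V"
  then have "x \<in> W" using opens_inD by blast
  then show "?R V (restrict f V) x = ?R W f x"
    using * P Q opens_in_trans[OF *(1,2)]
    by (simp add: hol_funs_restrict End_hol_local[OF Q] End_hol_local[OF P] End_hol_maps)
qed auto

lemma End_add_closed:
  assumes P: "P \<in> carrier (End_hol U)" and Q: "Q \<in> carrier (End_hol U)"
  shows "P \<oplus>\<^bsub>End_hol U\<^esub> Q \<in> carrier (End_hol U)"
  using End_lin_closed[OF P Q, of 1 1] by (simp add: End_hol_def)

lemma End_one_closed: "\<one>\<^bsub>End_hol U\<^esub> \<in> carrier (End_hol U)"
  by (rule End_hol_carrierI)
    (auto simp: hol_funs_lin opens_inD hol_funs_restrict opens_in_trans, auto simp: End_hol_def)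

lemma End_zero_closed: "\<zero>\<^bsub>End_hol U\<^esub> \<in> carrier (End_hol U)"
proof -
  have "\<zero>\<^bsub>End_hol U\<^esub> = (\<lambda>W\<in>opens_in U. \<lambda>f\<in>hol_funs W. \<lambda>x\<in>W. 0 * \<one>\<^bsub>End_hol U\<^esub> W f x + 0 * \<one>\<^bsub>End_hol U\<^esub> W f x)"
    by (simp add: End_hol_def)
  then show ?thesis by (simp only: End_lin_closed[OF End_one_closed End_one_closed])
qed

lemma End_hol_ring: "ring (End_hol U)"
proof (rule ringI)
  let ?R = "End_hol U"
  note cl = End_mult_closed End_add_closed End_one_closed End_zero_closed
  show "abelian_group ?R"
  proof (rule abelian_groupI)
    fix P assume P: "P \<in> carrier ?R"
    let ?N = "\<lambda>W\<in>opens_in U. \<lambda>f\<in>hol_funs W. \<lambda>x\<in>W. (-1) * P W f x + 0 * P W f x"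
    show "\<exists>Q\<in>carrier ?R. Q \<oplus>\<^bsub>?R\<^esub> P = \<zero>\<^bsub>?R\<^esub>"
    proof (rule bexI[of _ ?N])
      show N: "?N \<in> carrier ?R" by (rule End_lin_closed[OF P P])
      show "?N \<oplus>\<^bsub>?R\<^esub> P = \<zero>\<^bsub>?R\<^esub>"
        by (rule End_hol_eqI[OF End_add_closed[OF N P] End_zero_closed]) simp
    qed
  qed (auto intro!: cl End_hol_eqI[of _ U] simp: algebra_simps)
  show "monoid ?R"
    by (rule monoidI) (auto intro!: cl End_hol_eqI[of _ U] simp: End_hol_maps)
qed (auto intro!: End_mult_closed End_add_closed End_hol_eqI[of _ U] simp: End_hol_maps End_hol_add)

text \<open>The additive inverse in any ring of operators is the pointwise one.\<close>

lemma a_inv_eval: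
  assumes R: "ring R" "ring.add R = ring.add (End_hol U)" "ring.zero R = ring.zero (End_hol U)"
    and P: "P \<in> carrier R" and W: "W \<in> opens_in U" "f \<in> hol_funs W" "x \<in> W"
  shows "(\<ominus>\<^bsub>R\<^esub> P) W f x = - P W f x"
proof -
  interpret ring R by fact
  have "(\<ominus>\<^bsub>R\<^esub> P) \<oplus>\<^bsub>End_hol U\<^esub> P = \<zero>\<^bsub>End_hol U\<^esub>"
    using l_neg[OF P] R by simp
  then have "((\<ominus>\<^bsub>R\<^esub> P) \<oplus>\<^bsub>End_hol U\<^esub> P) W f x = 0" using W by simp
  then show ?thesis using W by (simp add: add_eq_0_iff)
qed

lemma mult_op_closed:
  assumes g: "chol U g"
  shows "mult_op U g \<in> carrier (End_hol U)"
proof (rule End_hol_carrierI)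
  fix W f assume *: "W \<in> opens_in U" "f \<in> hol_funs W"
  show "mult_op U g W f \<in> hol_funs W"
    using * chol_mono[OF g] by (simp add: hol_funs_mult opens_inD)
next
  fix W f h a b x assume *: "W \<in> opens_in U" "f \<in> hol_funs W" "h \<in> hol_funs W" "x \<in> W"
  show "mult_op U g W (\<lambda>x\<in>W. a * f x + b * h x) x = a * mult_op U g W f x + b * mult_op U g W h x"
    using * by (simp add: hol_funs_lin opens_inD algebra_simps)
next
  fix W V f x assume *: "W \<in> opens_in U" "V \<in> opens_in W" "f \<in> hol_funs W" "x \<in> V"
  then have "x \<in> W" using opens_inD by blast
  then show "mult_op U g V (restrict f V) x = mult_op U g W f x"
    using * opens_in_trans[OF *(1,2)] by (simp add: hol_funs_restrict)
qed (auto simp: mult_op_def)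

lemma partial_op_closed: "partial_op U j \<in> carrier (End_hol U)"
proof (rule End_hol_carrierI)
  fix W f assume *: "W \<in> opens_in U" "f \<in> hol_funs W"
  show "partial_op U j W f \<in> hol_funs W"
    using * by (simp add: hol_funs_pd opens_inD)
next
  fix W f h a b x assume *: "W \<in> opens_in U" "f \<in> hol_funs W" "h \<in> hol_funs W" "x \<in> W"
  have "pd j (\<lambda>x\<in>W. a * f x + b * h x) x = pd j (\<lambda>x. a * f x + b * h x) x"
    by (rule pd_cong[of W]) (use * opens_inD in auto)
  also have "\<dots> = pd j (\<lambda>x. a * f x) x + pd j (\<lambda>x. b * h x) x"
    by (rule pd_add[of W, OF chol_mult[OF chol_const hol_funs_chol[OF *(2)]]
          chol_mult[OF chol_const hol_funs_chol[OF *(3)]] *(4)])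
  also have "\<dots> = a * pd j f x + b * pd j h x"
    using * pd_cmult[OF hol_funs_chol] by metis
  finally show "partial_op U j W (\<lambda>x\<in>W. a * f x + b * h x) x = a * partial_op U j W f x + b * partial_op U j W h x"
    using * by (simp add: hol_funs_lin opens_inD)
next
  fix W V f x assume *: "W \<in> opens_in U" "V \<in> opens_in W" "f \<in> hol_funs W" "x \<in> V"
  then have "x \<in> W" using opens_inD by blast
  moreover have "pd j (restrict f V) x = pd j f x"
    by (rule pd_cong[of V]) (use * opens_inD in auto)
  ultimately show "partial_op U j V (restrict f V) x = partial_op U j W f x"
    using * opens_in_trans[OF *(1,2)] by (simp add: hol_funs_restrict)
qed (auto simp: partial_op_def)

text \<open>
  The operators of which differential operators on \<open>V\<close> are locally composed.
\<close>

abbreviation op_gens :: "(complex^'n) set \<Rightarrow> 'n opr set" where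
  "op_gens V \<equiv> mult_op V ` hol_funs V \<union> range (partial_op V)"

lemma op_gens_closed: "op_gens V \<subseteq> carrier (End_hol V)"
  using mult_op_closed partial_op_closed hol_funs_chol by blast

section \<open>Restriction of operators\<close>

lemma restrict_End_closed:
  assumes P: "P \<in> carrier (End_hol U)" and V: "V \<in> opens_in U"
  shows "restrict P (opens_in V) \<in> carrier (End_hol V)"
proof (rule End_hol_carrierI)
  note U = opens_in_trans[OF V]
  show "restrict P (opens_in V) W \<in> extensional (hol_funs W)" if "W \<in> opens_in V" for W
    using PiE_mem[of P "opens_in U" "\<lambda>W. hol_funs W \<rightarrow>\<^sub>E hol_funs W", OF _ U[OF that]] P that
    by (simp add: End_hol_carrier_iff PiE_def)
next
  fix W f assume "W \<in> opens_in V" "f \<in> hol_funs W"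
  then show "restrict P (opens_in V) W f \<in> hol_funs W"
    using End_hol_maps[OF P opens_in_trans[OF V]] by simp
next
  fix W f g a b x assume *: "W \<in> opens_in V" "f \<in> hol_funs W" "g \<in> hol_funs W" "x \<in> W"
  then show "restrict P (opens_in V) W (\<lambda>x\<in>W. a * f x + b * g x) x =
      a * restrict P (opens_in V) W f x + b * restrict P (opens_in V) W g x"
    using End_hol_linear[OF P opens_in_trans[OF V *(1)] *(2,3), of a b] by simp
next
  fix W W' f x assume *: "W \<in> opens_in V" "W' \<in> opens_in W" "f \<in> hol_funs W" "x \<in> W'"
  then show "restrict P (opens_in V) W' (restrict f W') x = restrict P (opens_in V) W f x"
    using End_hol_local[OF P opens_in_trans[OF V *(1)] *(2,3)] opens_in_trans[OF *(1,2)] by simp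
qed simp

lemma restrict_op_mult:
  assumes "P \<in> carrier (End_hol U)" "Q \<in> carrier (End_hol U)" "V \<in> opens_in U"
  shows "restrict (P \<otimes>\<^bsub>End_hol U\<^esub> Q) (opens_in V) =
    restrict P (opens_in V) \<otimes>\<^bsub>End_hol V\<^esub> restrict Q (opens_in V)"
  by (rule End_hol_eqI[OF restrict_End_closed[OF End_mult_closed[OF assms(1,2)] assms(3)]
        End_mult_closed[OF restrict_End_closed[OF assms(1,3)] restrict_End_closed[OF assms(2,3)]]])
    (use opens_in_trans[OF assms(3)] in simp)

lemma restrict_op_add:
  assumes "P \<in> carrier (End_hol U)" "Q \<in> carrier (End_hol U)" "V \<in> opens_in U"
  shows "restrict (P \<oplus>\<^bsub>End_hol U\<^esub> Q) (opens_in V) =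
    restrict P (opens_in V) \<oplus>\<^bsub>End_hol V\<^esub> restrict Q (opens_in V)"
  by (rule End_hol_eqI[OF restrict_End_closed[OF End_add_closed[OF assms(1,2)] assms(3)]
        End_add_closed[OF restrict_End_closed[OF assms(1,3)] restrict_End_closed[OF assms(2,3)]]])
    (use opens_in_trans[OF assms(3)] in simp)

lemma restrict_op_neg:
  assumes "P \<in> carrier (End_hol U)" "V \<in> opens_in U"
  shows "restrict (\<ominus>\<^bsub>End_hol U\<^esub> P) (opens_in V) = \<ominus>\<^bsub>End_hol V\<^esub> (restrict P (opens_in V))"
proof -
  interpret U: ring "End_hol U" by (rule End_hol_ring)
  interpret V: ring "End_hol V" by (rule End_hol_ring)
  show ?thesis
    by (rule End_hol_eqI[OF restrict_End_closed[OF U.a_inv_closed[OF assms(1)] assms(2)]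
          V.a_inv_closed[OF restrict_End_closed[OF assms]]])
      (use opens_in_trans[OF assms(2)] restrict_End_closed[OF assms] assms in
        \<open>simp add: a_inv_eval[OF End_hol_ring]\<close>)
qed

lemma restrict_op_one: "V \<in> opens_in U \<Longrightarrow> restrict \<one>\<^bsub>End_hol U\<^esub> (opens_in V) = \<one>\<^bsub>End_hol V\<^esub>"
  by (rule End_hol_eqI[OF restrict_End_closed[OF End_one_closed] End_one_closed])
    (simp_all add: opens_in_trans)

lemma opens_in_Int_eq: "W \<in> opens_in V \<Longrightarrow> opens_in V \<inter> opens_in W = opens_in W"
  by (auto intro: opens_in_trans)

lemma restrict_op_restrict:
  "W \<in> opens_in V \<Longrightarrow> restrict (restrict P (opens_in V)) (opens_in W) = restrict P (opens_in W)"
  by (auto simp: restrict_def fun_eq_iff intro: opens_in_trans)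

lemma restrict_mult_op: "V \<in> opens_in U \<Longrightarrow> restrict (mult_op U g) (opens_in V) = mult_op V (restrict g V)"
  unfolding mult_op_def
  by (rule ext) (auto simp: opens_in_trans restrict_def fun_eq_iff dest: opens_inD)

lemma restrict_partial_op: "V \<in> opens_in U \<Longrightarrow> restrict (partial_op U j) (opens_in V) = partial_op V j"
  unfolding partial_op_def by (rule ext) (auto simp: opens_in_trans restrict_def)

text \<open>
  Restriction preserves the polynomial expressions in functions and partial derivatives.
\<close>

lemma restrict_generate:
  assumes P: "P \<in> generate_ring (End_hol U) (op_gens U)" and V: "V \<in> opens_in U"
  shows "restrict P (opens_in V) \<in> generate_ring (End_hol V) (op_gens V)"
  using P
proof (induction rule: generate_ring.induct)
  note U = ring.generate_ring_in_carrier[OF End_hol_ring op_gens_closed]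
  {
    case one then show ?case using generate_ring.one[of "End_hol V"] V by (simp add: restrict_op_one)
  next
    case (incl h)
    then have "restrict h (opens_in V) \<in> op_gens V"
      using V hol_funs_restrict[OF V] by (auto simp: restrict_mult_op restrict_partial_op)
    then show ?case by (rule generate_ring.incl)
  next
    case (a_inv h)
    then show ?case unfolding restrict_op_neg[OF U[OF a_inv.hyps] V] by (intro generate_ring.a_inv)
  next
    case (eng_add h1 h2)
    then show ?case
      unfolding restrict_op_add[OF U[OF eng_add.hyps(1)] U[OF eng_add.hyps(2)] V] by (intro generate_ring.eng_add)
  next
    case (eng_mult h1 h2)
    then show ?case
      unfolding restrict_op_mult[OF U[OF eng_mult.hyps(1)] U[OF eng_mult.hyps(2)] V] by (intro generate_ring.eng_mult)
  }
qed

section \<open>The sheaf of differential operators\<close>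

lemma diff_ops_carrier_iff:
  "P \<in> carrier (diff_ops U) \<longleftrightarrow> P \<in> carrier (End_hol U) \<and> (\<forall>x\<in>U. \<exists>V\<in>opens_in U. x \<in> V \<and>
        restrict P (opens_in V) \<in> generate_ring (End_hol V) (op_gens V))"
  by (simp add: diff_ops_def)

lemma diff_ops_fields [simp]:
  "mult (diff_ops U) = mult (End_hol U)" "ring.add (diff_ops U) = ring.add (End_hol U)"
  "one (diff_ops U) = one (End_hol U)" "ring.zero (diff_ops U) = ring.zero (End_hol U)"
  by (simp_all add: diff_ops_def)

lemma diff_ops_End: "P \<in> carrier (diff_ops U) \<Longrightarrow> P \<in> carrier (End_hol U)"
  by (simp add: diff_ops_carrier_iff)

lemma opens_in_Int: "V \<in> opens_in U \<Longrightarrow> W \<in> opens_in U \<Longrightarrow> V \<inter> W \<in> opens_in V"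
  "V \<in> opens_in U \<Longrightarrow> W \<in> opens_in U \<Longrightarrow> V \<inter> W \<in> opens_in W"
  "V \<in> opens_in U \<Longrightarrow> W \<in> opens_in U \<Longrightarrow> V \<inter> W \<in> opens_in U"
  by (auto simp: opens_in_def)

lemma diff_ops_subring:
  assumes "open U" shows "subring (carrier (diff_ops U)) (End_hol U)"
proof (rule ring.subringI[OF End_hol_ring])
  show "carrier (diff_ops U) \<subseteq> carrier (End_hol U)" by (auto simp: diff_ops_carrier_iff)
  show "\<one>\<^bsub>End_hol U\<^esub> \<in> carrier (diff_ops U)"
    unfolding diff_ops_carrier_iff
  proof (intro conjI ballI bexI[of _ U])
    show U: "U \<in> opens_in U" using assms by (simp add: opens_in_def)
    show "restrict \<one>\<^bsub>End_hol U\<^esub> (opens_in U) \<in> generate_ring (End_hol U) (op_gens U)"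
      unfolding restrict_op_one[OF U] by (rule generate_ring.one)
  qed (auto simp: End_one_closed)
next
  fix P assume P: "P \<in> carrier (diff_ops U)"
  then show "\<ominus>\<^bsub>End_hol U\<^esub> P \<in> carrier (diff_ops U)"
    unfolding diff_ops_carrier_iff
    by (metis restrict_op_neg generate_ring.a_inv abelian_group.a_inv_closed ring.is_abelian_group End_hol_ring)
next
  fix P Q assume P: "P \<in> carrier (diff_ops U)" and Q: "Q \<in> carrier (diff_ops U)"
  note PE = P[THEN diff_ops_End] Q[THEN diff_ops_End]
  have *: "\<exists>V\<in>opens_in U. x \<in> V \<and> restrict P (opens_in V) \<in> generate_ring (End_hol V) (op_gens V) \<and>
      restrict Q (opens_in V) \<in> generate_ring (End_hol V) (op_gens V)" if "x \<in> U" for x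
  proof -
    obtain V where V: "V \<in> opens_in U" "x \<in> V" "restrict P (opens_in V) \<in> generate_ring (End_hol V) (op_gens V)"
      using P \<open>x \<in> U\<close> by (auto simp: diff_ops_carrier_iff)
    obtain W where W: "W \<in> opens_in U" "x \<in> W" "restrict Q (opens_in W) \<in> generate_ring (End_hol W) (op_gens W)"
      using Q \<open>x \<in> U\<close> by (auto simp: diff_ops_carrier_iff)
    note I = opens_in_Int[OF V(1) W(1)]
    show ?thesis
      using restrict_generate[OF V(3) I(1)] restrict_generate[OF W(3) I(2)] V W I
      by (intro bexI[of _ "V \<inter> W"]) (simp_all add: restrict_op_restrict opens_in_Int_eq)
  qed
  show "P \<otimes>\<^bsub>End_hol U\<^esub> Q \<in> carrier (diff_ops U)"
    unfolding diff_ops_carrier_iff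
    using * PE End_mult_closed[OF PE] restrict_op_mult[OF PE] generate_ring.eng_mult by metis
  show "P \<oplus>\<^bsub>End_hol U\<^esub> Q \<in> carrier (diff_ops U)"
    unfolding diff_ops_carrier_iff
    using * PE End_add_closed[OF PE] restrict_op_add[OF PE] generate_ring.eng_add by metis
qed

lemma diff_ops_ring: "open U \<Longrightarrow> ring (diff_ops U)"
  using ring.subring_is_ring[OF End_hol_ring diff_ops_subring]
  by (simp add: diff_ops_def)

lemma generate_diff_ops:
  assumes "open U" "P \<in> generate_ring (End_hol U) (op_gens U)"
  shows "P \<in> carrier (diff_ops U)"
  unfolding diff_ops_carrier_iff
  using assms restrict_generate[OF assms(2)] ring.generate_ring_in_carrier[OF End_hol_ring op_gens_closed]
  by (auto simp: opens_in_def)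

lemma mult_op_diff_ops: "open U \<Longrightarrow> chol U g \<Longrightarrow> mult_op U g \<in> carrier (diff_ops U)"
proof (rule generate_diff_ops, assumption)
  assume U: "open U" "chol U g"
  have "mult_op U g = mult_op U (restrict g U)"
    unfolding mult_op_def by (auto simp: restrict_def fun_eq_iff dest: opens_inD)
  then show "mult_op U g \<in> generate_ring (End_hol U) (op_gens U)"
    using restrict_hol_funs[OF U] by (auto intro: generate_ring.incl)
qed

lemma partial_op_diff_ops: "open U \<Longrightarrow> partial_op U j \<in> carrier (diff_ops U)"
  by (rule generate_diff_ops) (auto intro: generate_ring.incl)

lemma restrict_diff_ops:
  assumes P: "P \<in> carrier (diff_ops U)" and V: "V \<in> opens_in U"
  shows "restrict P (opens_in V) \<in> carrier (diff_ops V)"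
  unfolding diff_ops_carrier_iff
proof (intro conjI ballI)
  show "restrict P (opens_in V) \<in> carrier (End_hol V)"
    using P V restrict_End_closed diff_ops_End by blast
  fix x assume x: "x \<in> V"
  then obtain W where W: "W \<in> opens_in U" "x \<in> W" "restrict P (opens_in W) \<in> generate_ring (End_hol W) (op_gens W)"
    using P V opens_inD(2)[OF V] unfolding diff_ops_carrier_iff by blast
  note I = opens_in_Int[OF V W(1)]
  show "\<exists>Va\<in>opens_in V. x \<in> Va \<and> restrict (restrict P (opens_in V)) (opens_in Va) \<in> generate_ring (End_hol Va) (op_gens Va)"
    using restrict_generate[OF W(3) I(2)] W I x
    by (intro bexI[of _ "V \<inter> W"]) (simp_all add: restrict_op_restrict opens_in_Int_eq)
qed

section \<open>The Weyl algebra\<close>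

abbreviation weyl_gens :: "'n::finite opr set" where
  "weyl_gens \<equiv> range const_op \<union> range x_op \<union> range d_op"

lemma weyl_gens_closed: "weyl_gens \<subseteq> carrier (diff_ops UNIV)"
  unfolding const_op_def x_op_def d_op_def
  using mult_op_diff_ops[OF open_UNIV chol_const] mult_op_diff_ops[OF open_UNIV chol_coord]
    partial_op_diff_ops[OF open_UNIV] by auto

lemma weyl_fields [simp]:
  "mult weyl_algebra = mult (End_hol UNIV)" "ring.add weyl_algebra = ring.add (End_hol UNIV)"
  "one weyl_algebra = one (End_hol UNIV)" "ring.zero weyl_algebra = ring.zero (End_hol UNIV)"
  by (simp_all add: weyl_algebra_def)

lemma weyl_ring: "ring (weyl_algebra :: 'n::finite opr ring)"
  unfolding weyl_algebra_def
  by (rule ring.generate_ring_is_ring[OF diff_ops_ring[OF open_UNIV] weyl_gens_closed])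

lemma weyl_carrier: "carrier weyl_algebra = generate_ring (diff_ops UNIV) weyl_gens"
  by (simp add: weyl_algebra_def)

lemma weyl_diff_ops: "P \<in> carrier weyl_algebra \<Longrightarrow> P \<in> carrier (diff_ops UNIV)"
  unfolding weyl_carrier by (rule ring.generate_ring_in_carrier[OF diff_ops_ring[OF open_UNIV] weyl_gens_closed])

lemma weyl_End: "P \<in> carrier weyl_algebra \<Longrightarrow> P \<in> carrier (End_hol UNIV)"
  by (rule diff_ops_End[OF weyl_diff_ops])

lemma const_op_weyl [simp]: "const_op c \<in> carrier weyl_algebra"
  and x_op_weyl [simp]: "x_op j \<in> carrier weyl_algebra"
  and d_op_weyl [simp]: "d_op j \<in> carrier weyl_algebra"
  unfolding weyl_carrier by (auto intro: generate_ring.incl)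

lemma d_polys_fields [simp]:
  "mult d_polys = mult (End_hol UNIV)" "ring.add d_polys = ring.add (End_hol UNIV)"
  "one d_polys = one (End_hol UNIV)" "ring.zero d_polys = ring.zero (End_hol UNIV)"
  by (simp_all add: d_polys_def)

lemma d_polys_ring: "ring (d_polys :: 'n::finite opr ring)"
  unfolding d_polys_def
  by (rule ring.generate_ring_is_ring[OF diff_ops_ring[OF open_UNIV]])
    (use weyl_gens_closed in auto)

lemma d_polys_weyl: "P \<in> carrier d_polys \<Longrightarrow> P \<in> carrier weyl_algebra"
  unfolding d_polys_def weyl_carrier
  using ring.mono_generate_ring[OF diff_ops_ring[OF open_UNIV] _ weyl_gens_closed, of "range const_op \<union> range d_op"]
  by auto

text \<open>
  Operators in the Weyl algebra act faithfully by definition, hence identities between them are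
  checked on functions.
\<close>

lemma weyl_eqI:
  assumes "P \<in> carrier weyl_algebra" "Q \<in> carrier weyl_algebra"
    and "\<And>W f x. open W \<Longrightarrow> f \<in> hol_funs W \<Longrightarrow> x \<in> W \<Longrightarrow> P W f x = Q W f x"
  shows "P = Q"
  by (rule End_hol_eqI[of _ UNIV]) (use assms weyl_End in \<open>auto simp: opens_in_def\<close>)

lemma opens_in_UNIV [simp]: "W \<in> opens_in UNIV \<longleftrightarrow> open W"
  by (simp add: opens_in_def)

lemma const_op_eval [simp]: "open W \<Longrightarrow> f \<in> hol_funs W \<Longrightarrow> const_op c W f = (\<lambda>x\<in>W. c * f x)"
  by (simp add: const_op_def)

lemma x_op_eval [simp]: "open W \<Longrightarrow> f \<in> hol_funs W \<Longrightarrow> x_op j W f = (\<lambda>x\<in>W. x $ j * f x)"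
  by (simp add: x_op_def)

lemma d_op_eval [simp]: "open W \<Longrightarrow> f \<in> hol_funs W \<Longrightarrow> d_op j W f = restrict (pd j f) W"
  by (simp add: d_op_def)

lemma weyl_maps: "P \<in> carrier weyl_algebra \<Longrightarrow> open W \<Longrightarrow> f \<in> hol_funs W \<Longrightarrow> P W f \<in> hol_funs W"
  using End_hol_maps[OF weyl_End] by simp

lemma const_op_1: "const_op 1 = \<one>\<^bsub>weyl_algebra\<^esub>"
  by (rule weyl_eqI) (use ring.ring_simprules(6)[OF weyl_ring] in \<open>simp_all\<close>)

text \<open>
  A ring generated by commuting elements is commutative.
\<close>

lemma (in ring) generate_ring_commute:
  assumes H: "H \<subseteq> carrier R" and comm: "\<And>a b. a \<in> H \<Longrightarrow> b \<in> H \<Longrightarrow> a \<otimes> b = b \<otimes> a"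
    and a: "a \<in> generate_ring R H" and b: "b \<in> generate_ring R H"
  shows "a \<otimes> b = b \<otimes> a"
proof -
  note in_R = generate_ring_in_carrier[OF H]
  have 1: "a \<otimes> b = b \<otimes> a" if "a \<in> H" "b \<in> generate_ring R H" for a b
    using that(2)
  proof (induction rule: generate_ring.induct)
    case (incl h) then show ?case using comm that by simp
  next
    case (eng_mult h1 h2)
    have c: "a \<in> carrier R" "h1 \<in> carrier R" "h2 \<in> carrier R"
      using that eng_mult in_R H by auto
    have "a \<otimes> (h1 \<otimes> h2) = (h1 \<otimes> a) \<otimes> h2"
      using eng_mult.IH(1) m_assoc[OF c] by simp
    also have "\<dots> = h1 \<otimes> (h2 \<otimes> a)" using eng_mult.IH(2) m_assoc[OF c(2,1,3)] by simp
    also have "\<dots> = (h1 \<otimes> h2) \<otimes> a" using m_assoc[OF c(2,3,1)] by simp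
    finally show ?case .
  qed (use that H in_R in \<open>auto simp: l_minus r_minus l_distr r_distr subset_iff\<close>)
  show ?thesis
    using a
  proof (induction rule: generate_ring.induct)
    case (incl h) then show ?case using 1 b by simp
  next
    case (eng_mult h1 h2)
    have c: "b \<in> carrier R" "h1 \<in> carrier R" "h2 \<in> carrier R"
      using b eng_mult in_R by auto
    have "(h1 \<otimes> h2) \<otimes> b = h1 \<otimes> (b \<otimes> h2)"
      using eng_mult.IH(2) m_assoc[OF c(2,3,1)] by simp
    also have "\<dots> = (b \<otimes> h1) \<otimes> h2" using eng_mult.IH(1) m_assoc[OF c(2,1,3)] by simp
    also have "\<dots> = b \<otimes> (h1 \<otimes> h2)" using m_assoc[OF c] by simp
    finally show ?case .
  qed (use b in_R in \<open>auto simp: l_minus r_minus l_distr r_distr\<close>)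
qed

lemma d_polys_cring: "cring (d_polys :: 'n::finite opr ring)"
proof -
  let ?H = "range const_op \<union> range d_op :: 'n opr set"
  let ?R = "diff_ops (UNIV :: (complex^'n) set)"
  interpret ring ?R by (rule diff_ops_ring[OF open_UNIV])
  have H: "?H \<subseteq> carrier ?R" using weyl_gens_closed by auto
  have cd: "const_op c \<otimes>\<^bsub>?R\<^esub> d_op j = d_op j \<otimes>\<^bsub>?R\<^esub> const_op c" for c j
  proof (rule weyl_eqI)
    show "const_op c \<otimes>\<^bsub>?R\<^esub> d_op j \<in> carrier weyl_algebra" "d_op j \<otimes>\<^bsub>?R\<^esub> const_op c \<in> carrier weyl_algebra"
      using ring.ring_simprules(5)[OF weyl_ring, of "const_op c" "d_op j"]
        ring.ring_simprules(5)[OF weyl_ring, of "d_op j" "const_op c"] by simp_all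
    fix W :: "(complex^'n) set" and f x assume *: "open W" "f \<in> hol_funs W" "x \<in> W"
    have "pd j (\<lambda>x\<in>W. c * f x) x = pd j (\<lambda>x. c * f x) x"
      by (rule pd_cong[OF *(1,3)]) simp
    then show "(const_op c \<otimes>\<^bsub>?R\<^esub> d_op j) W f x = (d_op j \<otimes>\<^bsub>?R\<^esub> const_op c) W f x"
      using * by (simp add: hol_funs_pd hol_funs_mult pd_cmult[OF hol_funs_chol[OF *(2)]])
  qed
  have dd: "d_op i \<otimes>\<^bsub>?R\<^esub> d_op j = d_op j \<otimes>\<^bsub>?R\<^esub> d_op i" for i j
  proof (rule weyl_eqI)
    show "d_op i \<otimes>\<^bsub>?R\<^esub> d_op j \<in> carrier weyl_algebra" "d_op j \<otimes>\<^bsub>?R\<^esub> d_op i \<in> carrier weyl_algebra"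
      using ring.ring_simprules(5)[OF weyl_ring, of "d_op i" "d_op j"]
        ring.ring_simprules(5)[OF weyl_ring, of "d_op j" "d_op i"] by simp_all
    fix W :: "(complex^'n) set" and f x assume *: "open W" "f \<in> hol_funs W" "x \<in> W"
    have "pd i (restrict (pd j f) W) x = pd i (pd j f) x" for i j
      by (rule pd_cong[OF *(1,3)]) simp
    then show "(d_op i \<otimes>\<^bsub>?R\<^esub> d_op j) W f x = (d_op j \<otimes>\<^bsub>?R\<^esub> d_op i) W f x"
      using * pd_commute[OF *(1) hol_funs_chol[OF *(2)] *(3)] by (simp add: hol_funs_pd)
  qed
  have cc: "const_op c \<otimes>\<^bsub>?R\<^esub> const_op d = const_op d \<otimes>\<^bsub>?R\<^esub> const_op c" for c d :: complex
  proof (rule weyl_eqI)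
    show "const_op c \<otimes>\<^bsub>?R\<^esub> const_op d \<in> carrier weyl_algebra" "const_op d \<otimes>\<^bsub>?R\<^esub> const_op c \<in> carrier weyl_algebra"
      using ring.ring_simprules(5)[OF weyl_ring, of "const_op c" "const_op d"]
        ring.ring_simprules(5)[OF weyl_ring, of "const_op d" "const_op c"] by simp_all
  qed (simp add: hol_funs_mult)
  have comm: "a \<otimes>\<^bsub>?R\<^esub> b = b \<otimes>\<^bsub>?R\<^esub> a" if "a \<in> ?H" "b \<in> ?H" for a b
    using that by (elim UnE rangeE; hypsubst) (rule cc cd cd[symmetric] dd)+
  interpret P: ring "d_polys :: 'n opr ring" by (rule d_polys_ring)
  show ?thesis
  proof (rule cringI)
    show "abelian_group (d_polys :: 'n opr ring)" using d_polys_ring by (rule ring.is_abelian_group)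
    show "comm_monoid (d_polys :: 'n opr ring)"
    proof (rule monoid.monoid_comm_monoidI)
      show "monoid (d_polys :: 'n opr ring)" using d_polys_ring by (rule ring.is_monoid)
      fix a b assume "a \<in> carrier (d_polys :: 'n opr ring)" "b \<in> carrier (d_polys :: 'n opr ring)"
      then show "a \<otimes>\<^bsub>(d_polys :: 'n opr ring)\<^esub> b = b \<otimes>\<^bsub>d_polys\<^esub> a"
        using generate_ring_commute[OF H comm] by (simp add: d_polys_def)
    qed
  qed (rule P.l_distr)
qed

lemma const_op_d_polys [simp]: "const_op c \<in> carrier d_polys"
  and d_op_d_polys [simp]: "d_op j \<in> carrier d_polys"
  unfolding d_polys_def by (auto intro: generate_ring.incl)

lemma d_monom_closed [simp]: "d_monom u \<in> carrier d_polys"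
proof -
  interpret cring d_polys by (rule d_polys_cring)
  show ?thesis unfolding d_monom_def by (rule finprod_closed) auto
qed

lemma d_monom_weyl [simp]: "d_monom u \<in> carrier weyl_algebra"
  by (rule d_polys_weyl) simp

lemma d_monom_0 [simp]: "d_monom 0 = \<one>\<^bsub>End_hol UNIV\<^esub>"
proof -
  interpret cring "d_polys :: 'a opr ring" by (rule d_polys_cring)
  show ?thesis unfolding d_monom_def using finprod_one_eqI[of UNIV "\<lambda>i. \<one>\<^bsub>d_polys\<^esub>"] by simp
qed

lemma d_monom_step: "d_monom (u + ue j) = d_op j \<otimes>\<^bsub>End_hol UNIV\<^esub> d_monom u"
proof -
  interpret cring "d_polys :: 'a opr ring" by (rule d_polys_cring)
  have "d_monom (u + ue j) = finprod d_polys (\<lambda>i. (if j = i then d_op i else \<one>\<^bsub>d_polys\<^esub>) \<otimes>\<^bsub>d_polys\<^esub> d_op i [^]\<^bsub>d_polys\<^esub> (u $ i)) UNIV"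
    unfolding d_monom_def
  proof (rule finprod_cong')
    fix i
    show "d_op i [^]\<^bsub>d_polys\<^esub> ((u + ue j) $ i) = (if j = i then d_op i else \<one>\<^bsub>d_polys\<^esub>) \<otimes>\<^bsub>d_polys\<^esub> d_op i [^]\<^bsub>d_polys\<^esub> (u $ i)"
    proof (cases "j = i")
      case True
      have "d_op i [^]\<^bsub>d_polys\<^esub> ((u + ue j) $ i) = d_op i [^]\<^bsub>d_polys\<^esub> (u $ i) \<otimes>\<^bsub>d_polys\<^esub> d_op i"
        using True by (simp add: nat_pow_Suc)
      also have "\<dots> = d_op i \<otimes>\<^bsub>d_polys\<^esub> d_op i [^]\<^bsub>d_polys\<^esub> (u $ i)"
        by (rule m_comm) (rule nat_pow_closed, rule d_op_d_polys, rule d_op_d_polys)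
      finally show ?thesis by (simp only: True if_True refl)
    next
      case False
      have "\<one>\<^bsub>d_polys\<^esub> \<otimes>\<^bsub>d_polys\<^esub> d_op i [^]\<^bsub>d_polys\<^esub> (u $ i) = d_op i [^]\<^bsub>d_polys\<^esub> (u $ i)"
        by (rule l_one) (rule nat_pow_closed, rule d_op_d_polys)
      then show ?thesis using False by (simp add: if_False del: d_polys_fields)
    qed
  qed (auto simp del: d_polys_fields intro!: m_closed nat_pow_closed)
  also have "\<dots> = finprod d_polys (\<lambda>i. if j = i then d_op i else \<one>\<^bsub>d_polys\<^esub>) UNIV \<otimes>\<^bsub>d_polys\<^esub> d_monom u"
    unfolding d_monom_def
    by (rule finprod_multf) (auto simp del: d_polys_fields intro!: nat_pow_closed)
  also have "finprod d_polys (\<lambda>i. if j = i then d_op i else \<one>\<^bsub>d_polys\<^esub>) UNIV = d_op j"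
    by (rule finprod_singleton) auto
  finally show ?thesis by simp
qed

section \<open>Polynomial functions\<close>

text \<open>
  Polynomial functions on \<open>\<complex>\<^sup>n\<close>, as the smallest algebra of functions containing the constants and
  the coordinates.
\<close>

inductive polyfn :: "(complex^'n \<Rightarrow> complex) \<Rightarrow> bool" where
  const: "polyfn (\<lambda>w. c)"
| coord: "polyfn (\<lambda>w. w $ i)"
| add: "polyfn p \<Longrightarrow> polyfn q \<Longrightarrow> polyfn (\<lambda>w. p w + q w)"
| mult: "polyfn p \<Longrightarrow> polyfn q \<Longrightarrow> polyfn (\<lambda>w. p w * q w)"

lemma polyfn_prod: "(\<And>i. i \<in> I \<Longrightarrow> polyfn (f i)) \<Longrightarrow> polyfn (\<lambda>w. \<Prod>i\<in>I. f i w)"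
  by (induction I rule: infinite_finite_induct) (simp_all add: polyfn.intros)

lemma polyfn_sum: "(\<And>i. i \<in> I \<Longrightarrow> polyfn (f i)) \<Longrightarrow> polyfn (\<lambda>w. \<Sum>i\<in>I. f i w)"
  by (induction I rule: infinite_finite_induct) (simp_all add: polyfn.intros)

lemma polyfn_sum_list: "(\<And>x. x \<in> set l \<Longrightarrow> polyfn (f x)) \<Longrightarrow> polyfn (\<lambda>w. \<Sum>x\<leftarrow>l. f x w)"
  by (induction l) (simp_all add: polyfn.intros)

lemma polyfn_compose:
  assumes "polyfn p" "\<And>i. polyfn (\<lambda>w. g w $ i)"
  shows "polyfn (\<lambda>w. p (g w))"
  using assms(1) by induction (use assms(2) in \<open>simp_all add: polyfn.intros\<close>)

lemma polyfn_shift: "polyfn p \<Longrightarrow> polyfn (\<lambda>w. p (w + v))"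
  by (rule polyfn_compose) (simp_all add: polyfn.intros)

lemma polyfn_gb: "polyfn (\<lambda>w. gb w \<alpha>)"
proof -
  have "polyfn (\<lambda>w. (w $ i) gchoose n)" for i n
  proof (induction n)
    case (Suc n)
    have "(a gchoose Suc n) = (a gchoose n) * ((a + (- of_nat n)) * inverse (of_nat (Suc n)))" for a :: complex
      using gbinomial_absorption'[of "Suc n" a] gbinomial_mult_1[of a n]
      by (simp add: field_simps del: of_nat_Suc)
    then show ?case by (simp only:) (intro polyfn.intros Suc)
  qed (simp add: polyfn.intros)
  then show ?thesis unfolding gb_def by (rule polyfn_prod)
qed

lemma polyfn_line:
  assumes "polyfn p"
  shows "\<exists>q. \<forall>t. p (\<chi> j. if j = i then t else w $ j) = poly q t"
  using assms
proof induction
  case (const c) show ?case by (intro exI[of _ "[:c:]"]) simp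
next
  case (coord k)
  show ?case
  proof (cases "k = i")
    case True then show ?thesis by (intro exI[of _ "[:0, 1:]"]) simp
  next
    case False then show ?thesis by (intro exI[of _ "[:w $ k:]"]) simp
  qed
next
  case (add p q)
  then obtain p' q' where "\<forall>t. p (\<chi> j. if j = i then t else w $ j) = poly p' t"
    "\<forall>t. q (\<chi> j. if j = i then t else w $ j) = poly q' t" by blast
  then show ?case by (intro exI[of _ "p' + q'"]) simp
next
  case (mult p q)
  then obtain p' q' where "\<forall>t. p (\<chi> j. if j = i then t else w $ j) = poly p' t"
    "\<forall>t. q (\<chi> j. if j = i then t else w $ j) = poly q' t" by blast
  then show ?case by (intro exI[of _ "p' * q'"]) simp
qed

text \<open>
  The points of \<open>\<nat>\<^sup>n\<close> with all coordinates at least \<open>m\<close> are Zariski dense. The coordinates are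
  freed one at a time, using that a polynomial in one variable has finitely many roots.
\<close>

lemma polyfn_eq_0:
  assumes p: "polyfn p" and z: "\<And>k. (\<And>j. m \<le> k $ j) \<Longrightarrow> p (emb k) = 0"
  shows "p w = 0"
proof -
  have "finite J \<Longrightarrow> (\<And>j. j \<notin> J \<Longrightarrow> \<exists>n\<ge>m. w $ j = of_nat n) \<Longrightarrow> p w = 0" for J w
  proof (induction J arbitrary: w rule: finite_induct)
    case empty
    then obtain k where k: "\<forall>j. m \<le> k j \<and> w $ j = of_nat (k j)" by (metis empty_iff)
    then have "w = emb (\<chi> j. k j)" by (simp add: vec_eq_iff)
    then show ?case using z[of "\<chi> j. k j"] k by simp
  next
    case (insert i J)
    obtain q where q: "\<And>t. p (\<chi> j. if j = i then t else w $ j) = poly q t"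
      using polyfn_line[OF p] by blast
    have "poly q (of_nat n) = 0" if "n \<ge> m" for n
    proof -
      have "p (\<chi> j. if j = i then of_nat n else w $ j) = 0"
        by (rule insert.IH) (use insert.prems that in auto)
      then show ?thesis using q by metis
    qed
    then have "of_nat ` {m..} \<subseteq> {t. poly q t = 0}" by auto
    moreover have "infinite (of_nat ` {m..} :: complex set)"
      using infinite_Ici[of m] by (subst finite_image_iff) (auto intro: inj_onI)
    ultimately have "q = 0" using poly_roots_finite finite_subset by blast
    then have "p (\<chi> j. if j = i then w $ i else w $ j) = 0" using q by simp
    moreover have "(\<chi> j. if j = i then w $ i else w $ j) = w" by (simp add: vec_eq_iff)
    ultimately show ?case by simp
  qed
  from this[of UNIV w] show ?thesis by simp
qed

section \<open>Operators on functions on \<open>\<complex>\<^sup>n\<close> with support bounded below\<close>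

text \<open>
  The real part of the total degree of an exponent.
\<close>

definition wdeg :: "complex^'n \<Rightarrow> real" where
  "wdeg w = Re (\<Sum>i\<in>UNIV. w $ i)"

lemma wdeg_add: "wdeg (w + v) = wdeg w + wdeg v" by (simp add: wdeg_def sum.distrib)
lemma wdeg_diff: "wdeg (w - v) = wdeg w - wdeg v" by (simp add: wdeg_def sum_subtractf)
lemma wdeg_emb: "wdeg (emb k) = of_nat (msize k)" by (simp add: wdeg_def msize_def)
lemma wdeg_axis [simp]: "wdeg (axis j 1) = 1" using wdeg_emb[of "ue j"] by simp

text \<open>
  The support of \<open>c\<close> lies in the half space of degree at least \<open>B\<close>.
\<close>

definition bd :: "real \<Rightarrow> (complex^'n \<Rightarrow> complex) \<Rightarrow> bool" where
  "bd B c \<longleftrightarrow> (\<forall>w. c w \<noteq> 0 \<longrightarrow> B \<le> wdeg w)"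

definition bdd :: "(complex^'n \<Rightarrow> complex) \<Rightarrow> bool" where
  "bdd c \<longleftrightarrow> (\<exists>B. bd B c)"

lemma bd_mono: "bd B c \<Longrightarrow> B' \<le> B \<Longrightarrow> bd B' c" by (force simp: bd_def)
lemma bd_0: "bd B (\<lambda>w. 0)" by (simp add: bd_def)
lemma bd_add: "bd B c \<Longrightarrow> bd B c' \<Longrightarrow> bd B (\<lambda>w. c w + c' w)" by (force simp: bd_def)
lemma bd_cmult: "bd B c \<Longrightarrow> bd B (\<lambda>w. a * c w)" by (force simp: bd_def)
lemma bdd_0 [simp]: "bdd (\<lambda>w. 0)" using bd_0 bdd_def by blast
lemma bdd_add: "bdd c \<Longrightarrow> bdd c' \<Longrightarrow> bdd (\<lambda>w. c w + c' w)"
proof -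
  assume "bdd c" "bdd c'"
  then obtain B B' where "bd B c" "bd B' c'" unfolding bdd_def by blast
  then have "bd (min B B') (\<lambda>w. c w + c' w)" by (intro bd_add) (auto intro: bd_mono)
  then show ?thesis unfolding bdd_def by blast
qed
lemma bdd_cmult: "bdd c \<Longrightarrow> bdd (\<lambda>w. a * c w)"
  unfolding bdd_def using bd_cmult by blast

text \<open>
  A term \<open>(p, \<gamma>)\<close> stands for the operator \<open>c \<mapsto> (w \<mapsto> p(w) c(w + \<gamma>))\<close>. Besides \<open>p\<close> being
  polynomial and \<open>\<gamma>\<close> integral, \<open>p\<close> has to vanish where the shift by \<open>\<gamma>\<close> moves some coordinate
  out of \<open>\<nat>\<close>, as it does for \<open>x\<^sub>j\<close>, given by \<open>(w\<^sub>j, -e\<^sub>j)\<close>.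
\<close>

definition goodterm :: "(complex^'n \<Rightarrow> complex) \<times> (complex^'n) \<Rightarrow> bool" where
  "goodterm t \<longleftrightarrow> polyfn (fst t) \<and> (\<forall>j. snd t $ j \<in> \<int>) \<and>
     (\<forall>w j. w $ j \<in> \<nat> \<longrightarrow> (w + snd t) $ j \<notin> \<nat> \<longrightarrow> fst t w = 0)"

text \<open>
  The operator given by a list of such terms.
\<close>

definition tsum :: "((complex^'n \<Rightarrow> complex) \<times> (complex^'n)) list \<Rightarrow> (complex^'n \<Rightarrow> complex) \<Rightarrow> complex^'n \<Rightarrow> complex" where
  "tsum l c w = (\<Sum>t\<leftarrow>l. fst t w * c (w + snd t))"

text \<open>
  Operators that lower the degree of the support by at most a fixed amount and that, at an exponent at most
  \<open>N\<close> above the lower bound of the support, are given by finitely many terms depending only on \<open>N\<close>.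
  The dependence on \<open>N\<close> allows for multiplication by convergent power series, which involves
  infinitely many shifts.
\<close>

definition LP :: "((complex^'n \<Rightarrow> complex) \<Rightarrow> complex^'n \<Rightarrow> complex) \<Rightarrow> bool" where
  "LP L \<longleftrightarrow> (\<exists>m. \<forall>B c. bd B c \<longrightarrow> bd (B - m) (L c)) \<and>
     (\<forall>N. \<exists>l. (\<forall>t\<in>set l. goodterm t) \<and> (\<forall>w c. bd (wdeg w - N) c \<longrightarrow> L c w = tsum l c w))"

lemma LP_bdd: "LP L \<Longrightarrow> bdd c \<Longrightarrow> bdd (L c)"
  unfolding LP_def bdd_def by meson

lemma LP_tsum:
  assumes "LP L"
  obtains l where "\<forall>t\<in>set l. goodterm t" "\<And>w c. bd (wdeg w - N) c \<Longrightarrow> L c w = tsum l c w"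
  using assms unfolding LP_def by meson

lemma LP_add_fun:
  fixes L :: "(complex^'n \<Rightarrow> complex) \<Rightarrow> complex^'n \<Rightarrow> complex"
  assumes L: "LP L" and c: "bdd c" "bdd c'"
  shows "L (\<lambda>w. c w + c' w) = (\<lambda>w. L c w + L c' w)"
proof
  fix w :: "complex^'n"
  obtain B B' where "bd B c" "bd B' c'" using c unfolding bdd_def by blast
  then have b: "bd (wdeg w - (wdeg w - min B B')) c" "bd (wdeg w - (wdeg w - min B B')) c'"
    by (auto intro: bd_mono)
  obtain l where l: "\<And>w' c. bd (wdeg w' - (wdeg w - min B B')) c \<Longrightarrow> L c w' = tsum l c w'"
    using LP_tsum[OF L] by metis
  have "tsum l (\<lambda>w. c w + c' w) w = tsum l c w + tsum l c' w"
    unfolding tsum_def by (induction l) (simp_all add: algebra_simps)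
  then show "L (\<lambda>w. c w + c' w) w = L c w + L c' w"
    using l b bd_add[OF b] by simp
qed

lemma LP_0:
  assumes L: "LP L" shows "L (\<lambda>w. 0) = (\<lambda>w. 0)"
  using LP_add_fun[OF L bdd_0 bdd_0] by (simp add: fun_eq_iff)

text \<open>
  Sets \<open>S\<close> of exponents that an integral shift leaves only by moving some coordinate out of \<open>\<nat>\<close>.
  The coefficient of the shift vanishes there, so that the values on \<open>S\<close> of the result of an
  operator depend only on the values of the function on \<open>S\<close>.
\<close>

definition stab :: "(complex^'n) set \<Rightarrow> bool" where
  "stab S \<longleftrightarrow> (\<forall>w\<in>S. \<forall>\<gamma>. (\<forall>j. \<gamma> $ j \<in> \<int>) \<longrightarrow> w + \<gamma> \<notin> S \<longrightarrow> (\<exists>j. w $ j \<in> \<nat> \<and> (w + \<gamma>) $ j \<notin> \<nat>))"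

lemma LP_stab:
  assumes L: "LP L" and S: "stab S" and c: "bdd c" "bdd c'" and eq: "\<And>w. w \<in> S \<Longrightarrow> c w = c' w"
    and w: "w \<in> S"
  shows "L c w = L c' w"
proof -
  obtain B B' where "bd B c" "bd B' c'" using c unfolding bdd_def by blast
  then have b: "bd (wdeg w - (wdeg w - min B B')) c" "bd (wdeg w - (wdeg w - min B B')) c'"
    by (auto intro: bd_mono)
  obtain l where l: "\<forall>t\<in>set l. goodterm t" "\<And>w' c. bd (wdeg w' - (wdeg w - min B B')) c \<Longrightarrow> L c w' = tsum l c w'"
    using LP_tsum[OF L] by metis
  have "fst t w * c (w + snd t) = fst t w * c' (w + snd t)" if "t \<in> set l" for t
  proof (cases "w + snd t \<in> S")
    case True then show ?thesis using eq by simp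
  next
    case False
    have g: "goodterm t" using l that by blast
    then obtain j where "w $ j \<in> \<nat>" "(w + snd t) $ j \<notin> \<nat>"
      using S w False unfolding stab_def goodterm_def by blast
    then have "fst t w = 0" using g unfolding goodterm_def by blast
    then show ?thesis by simp
  qed
  then have "tsum l c w = tsum l c' w"
    unfolding tsum_def by (intro arg_cong[where f = sum_list] map_cong) auto
  then show ?thesis using l(2) b by simp
qed

lemma LP_smult:
  assumes "LP L" shows "LP (\<lambda>c w. a * L c w)"
  unfolding LP_def
proof (intro conjI allI)
  show "\<exists>m. \<forall>B c. bd B c \<longrightarrow> bd (B - m) (\<lambda>w. a * L c w)"
    using assms bd_cmult unfolding LP_def by blast
  fix N
  obtain l where l: "\<forall>t\<in>set l. goodterm t" "\<And>w c. bd (wdeg w - N) c \<Longrightarrow> L c w = tsum l c w"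
    using LP_tsum[OF assms] by metis
  let ?l = "map (\<lambda>t. (\<lambda>w. a * fst t w, snd t)) l"
  have "\<forall>t\<in>set ?l. goodterm t"
    using l(1) unfolding goodterm_def by (auto intro: polyfn.intros)
  moreover have "a * tsum l c w = tsum ?l c w" for c w
    unfolding tsum_def by (induction l) (simp_all add: algebra_simps)
  ultimately show "\<exists>l. (\<forall>t\<in>set l. goodterm t) \<and> (\<forall>w c. bd (wdeg w - N) c \<longrightarrow> a * L c w = tsum l c w)"
    using l(2) by (intro exI[of _ ?l]) simp
qed

lemma LP_id: "LP (\<lambda>c. c)"
  unfolding LP_def
  by (auto simp: goodterm_def tsum_def polyfn.intros intro!: exI[of _ 0] exI[of _ "[(\<lambda>w. 1, 0)]"])

lemma LP_add:
  assumes "LP L" "LP L'" shows "LP (\<lambda>c w. L c w + L' c w)"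
  unfolding LP_def
proof (intro conjI allI)
  obtain m m' where m: "\<And>B c. bd B c \<Longrightarrow> bd (B - m) (L c)" "\<And>B c. bd B c \<Longrightarrow> bd (B - m') (L' c)"
    using assms unfolding LP_def by meson
  have "bd (B - max m m') (\<lambda>w. L c w + L' c w)" if "bd B c" for B c
    by (intro bd_add bd_mono[OF m(1)[OF that]] bd_mono[OF m(2)[OF that]]) simp_all
  then show "\<exists>m. \<forall>B c. bd B c \<longrightarrow> bd (B - m) (\<lambda>w. L c w + L' c w)" by blast
  fix N
  obtain l where l: "\<forall>t\<in>set l. goodterm t" "\<And>w c. bd (wdeg w - N) c \<Longrightarrow> L c w = tsum l c w"
    using LP_tsum[OF assms(1)] by metis
  obtain l' where l': "\<forall>t\<in>set l'. goodterm t" "\<And>w c. bd (wdeg w - N) c \<Longrightarrow> L' c w = tsum l' c w"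
    using LP_tsum[OF assms(2)] by metis
  show "\<exists>l. (\<forall>t\<in>set l. goodterm t) \<and> (\<forall>w c. bd (wdeg w - N) c \<longrightarrow> L c w + L' c w = tsum l c w)"
    using l l' by (intro exI[of _ "l @ l'"]) (auto simp: tsum_def)
qed

lemma LP_comp:
  assumes L: "LP L" and L': "LP L'" shows "LP (\<lambda>c. L (L' c))"
  unfolding LP_def
proof (intro conjI allI)
  obtain m m' where m: "\<And>B c. bd B c \<Longrightarrow> bd (B - m) (L c)" "\<And>B c. bd B c \<Longrightarrow> bd (B - m') (L' c)"
    using assms unfolding LP_def by meson
  have "bd (B - (m + m')) (L (L' c))" if "bd B c" for B c
    using m(1)[OF m(2)[OF that]] by (simp add: algebra_simps)
  then show "\<exists>m. \<forall>B c. bd B c \<longrightarrow> bd (B - m) (L (L' c))" by blast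
  fix N
  obtain l where l: "\<forall>t\<in>set l. goodterm t" "\<And>w c. bd (wdeg w - (N + m')) c \<Longrightarrow> L c w = tsum l c w"
    using LP_tsum[OF L] by metis
  have "\<forall>M. \<exists>l. (\<forall>t\<in>set l. goodterm t) \<and> (\<forall>w c. bd (wdeg w - M) c \<longrightarrow> L' c w = tsum l c w)"
    using L' unfolding LP_def by blast
  then obtain F where F: "\<And>M. \<forall>t\<in>set (F M). goodterm t"
    "\<And>M w c. bd (wdeg w - M) c \<Longrightarrow> L' c w = tsum (F M) c w" by metis
  \<comment> \<open>the composition of two terms\<close>
  let ?g = "\<lambda>t s. (\<lambda>w. fst t w * fst s (w + snd t), snd t + snd s)"
  let ?l = "concat (map (\<lambda>t. map (?g t) (F (N + wdeg (snd t)))) l)"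
  have "goodterm (?g t s)" if t: "goodterm t" and s: "goodterm s" for t s
    unfolding goodterm_def
  proof (intro conjI allI impI)
    show "polyfn (fst (?g t s))"
      using t s unfolding goodterm_def by (auto intro!: polyfn.intros(4) intro: polyfn_shift)
    show "snd (?g t s) $ j \<in> \<int>" for j using t s by (auto simp: goodterm_def)
    fix w j assume w: "w $ j \<in> \<nat>" "(w + snd (?g t s)) $ j \<notin> \<nat>"
    show "fst (?g t s) w = 0"
    proof (cases "(w + snd t) $ j \<in> \<nat>")
      case True
      have "(w + snd t + snd s) $ j \<notin> \<nat>" using w by (simp add: algebra_simps)
      then have "fst s (w + snd t) = 0" using s True unfolding goodterm_def by blast
      then show ?thesis by simp
    next
      case False
      then have "fst t w = 0" using t w(1) unfolding goodterm_def by blast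
      then show ?thesis by simp
    qed
  qed
  then have "\<forall>t\<in>set ?l. goodterm t" using l(1) F(1) by (simp add: ball_Un) blast
  moreover have "L (L' c) w = tsum ?l c w" if b: "bd (wdeg w - N) c" for w c
  proof -
    have "bd (wdeg w - (N + m')) (L' c)" using m(2)[OF b] by (simp add: algebra_simps)
    then have "L (L' c) w = tsum l (L' c) w" by (rule l(2))
    also have "\<dots> = (\<Sum>t\<leftarrow>l. fst t w * tsum (F (N + wdeg (snd t))) c (w + snd t))"
    proof -
      have "bd (wdeg (w + snd t) - (N + wdeg (snd t))) c" for t :: "(complex^'a \<Rightarrow> complex) \<times> (complex^'a)"
        using b by (simp add: wdeg_add algebra_simps)
      from F(2)[OF this] show ?thesis unfolding tsum_def[of l] by simp
    qed
    also have "\<dots> = tsum ?l c w"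
    proof (induction l)
      case (Cons t l)
      have "fst t w * tsum k c (w + snd t) = tsum (map (?g t) k) c w" for k
        unfolding tsum_def by (induction k) (simp_all add: algebra_simps)
      then show ?case using Cons by (simp add: tsum_def)
    qed (simp add: tsum_def)
    finally show ?thesis .
  qed
  ultimately show "\<exists>l. (\<forall>t\<in>set l. goodterm t) \<and> (\<forall>w c. bd (wdeg w - N) c \<longrightarrow> L (L' c) w = tsum l c w)"
    by blast
qed

lemma LP_shift: "LP (\<lambda>c w. c (w + axis j 1))"
  unfolding LP_def
proof (intro conjI allI)
  have "bd (B - 1) (\<lambda>w. c (w + axis j 1))" if "bd B c" for B and c :: "complex^'a \<Rightarrow> complex"
    using that unfolding bd_def by (force simp: wdeg_add dest: spec[of _ "_ + axis j 1"])
  then show "\<exists>m. \<forall>B (c :: complex^'a \<Rightarrow> complex). bd B c \<longrightarrow> bd (B - m) (\<lambda>w. c (w + axis j 1))" by blast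
  fix N :: real
  have "goodterm ((\<lambda>w. 1), axis j 1)"
    by (auto simp: goodterm_def polyfn.intros axis_def)
  then show "\<exists>l. (\<forall>t\<in>set l. goodterm t) \<and> (\<forall>w c. bd (wdeg w - N) c \<longrightarrow> c (w + axis j 1) = tsum l c w)"
    by (intro exI[of _ "[((\<lambda>w. 1), axis j 1)]"]) (simp add: tsum_def)
qed

text \<open>
  Multiplication by the power series \<open>\<Sum>\<^sub>\<alpha> a(\<alpha>) x\<^sup>\<alpha>/\<alpha>!\<close> on functions of exponents. The sum is
  finite if the support of \<open>c\<close> is bounded below.
\<close>

definition hat :: "(nat^'n \<Rightarrow> complex) \<Rightarrow> (complex^'n \<Rightarrow> complex) \<Rightarrow> complex^'n \<Rightarrow> complex" where
  "hat a c w = (\<Sum>\<alpha> | c (w - emb \<alpha>) \<noteq> 0. a \<alpha> * gb w \<alpha> * c (w - emb \<alpha>))"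

lemma hat_eq:
  assumes "bd (wdeg w - N) c" "N \<le> real M"
  shows "hat a c w = (\<Sum>\<alpha> | msize \<alpha> \<le> M. a \<alpha> * gb w \<alpha> * c (w - emb \<alpha>))"
  unfolding hat_def
proof (rule sum.mono_neutral_left)
  show "{\<alpha>. c (w - emb \<alpha>) \<noteq> 0} \<subseteq> {\<alpha>. msize \<alpha> \<le> M}"
    using assms by (force simp: bd_def wdeg_diff wdeg_emb)
qed (auto simp: finite_msize_le)

lemma gb_not_Nats:
  assumes "w $ j \<in> \<nat>" "w $ j - of_nat (\<alpha> $ j) \<notin> \<nat>"
  shows "gb w \<alpha> = 0"
proof -
  obtain n where n: "w $ j = of_nat n" using assms(1) by (auto elim: Nats_cases)
  have "n < \<alpha> $ j"
  proof (rule ccontr)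
    assume "\<not> n < \<alpha> $ j"
    then have "w $ j - of_nat (\<alpha> $ j) = of_nat (n - \<alpha> $ j)" using n by (simp add: of_nat_diff)
    then show False using assms(2) by simp
  qed
  then have "(w $ j) gchoose (\<alpha> $ j) = 0" by (simp add: n flip: binomial_gbinomial)
  then show ?thesis unfolding gb_def by (intro prod_zero) auto
qed

lemma LP_hat: "LP (hat a)"
  unfolding LP_def
proof (intro conjI allI)
  have "bd (B - 0) (hat a c)" if "bd B c" for B c
    unfolding bd_def
  proof (intro allI impI)
    fix w assume "hat a c w \<noteq> 0"
    then obtain \<alpha> where "c (w - emb \<alpha>) \<noteq> 0"
      unfolding hat_def by (metis (mono_tags, lifting) mem_Collect_eq sum.neutral)
    then have "B \<le> wdeg (w - emb \<alpha>)" using that by (auto simp: bd_def)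
    then show "B - 0 \<le> wdeg w" by (simp add: wdeg_diff wdeg_emb)
  qed
  then show "\<exists>m. \<forall>B c. bd B c \<longrightarrow> bd (B - m) (hat a c)" by blast
  fix N :: real
  obtain M :: nat where M: "N \<le> real M" using real_arch_simple by blast
  obtain al where al: "set al = {\<alpha> :: nat^'a. msize \<alpha> \<le> M}" "distinct al"
    using finite_distinct_list[OF finite_msize_le] by blast
  let ?l = "map (\<lambda>\<alpha>. (\<lambda>w. a \<alpha> * gb w \<alpha>, - emb \<alpha>)) al"
  have "goodterm (\<lambda>w. a \<alpha> * gb w \<alpha>, - emb \<alpha>)" for \<alpha>
    unfolding goodterm_def using gb_not_Nats by (auto intro!: polyfn.intros polyfn_gb)
  then have "\<forall>t\<in>set ?l. goodterm t" by auto
  moreover have "hat a c w = tsum ?l c w" if "bd (wdeg w - N) c" for w c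
    unfolding hat_eq[OF that M] tsum_def al(1)[symmetric]
    by (simp add: sum_list_distinct_conv_sum_set[OF al(2), symmetric] comp_def)
  ultimately show "\<exists>l. (\<forall>t\<in>set l. goodterm t) \<and> (\<forall>w c. bd (wdeg w - N) c \<longrightarrow> hat a c w = tsum l c w)"
    by blast
qed

section \<open>The action of germs of differential operators\<close>

text \<open>
  The Taylor coefficients of \<open>f\<close> at the origin as a function of exponents, extended by zero.
\<close>

definition tayf :: "(complex^'n \<Rightarrow> complex) \<Rightarrow> complex^'n \<Rightarrow> complex" where
  "tayf f w = (if w \<in> range emb then tayl f (inv_into UNIV emb w) else 0)"

lemma tayf_emb [simp]: "tayf f (emb k) = tayl f k"
proof -
  have "inv_into UNIV emb (emb k) = k" by (rule inv_f_f) (auto intro: injI)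
  then show ?thesis by (simp add: tayf_def)
qed

lemma tayf_bd: "bd 0 (tayf f)"
  by (auto simp: bd_def tayf_def wdeg_emb)

lemma tayf_bdd: "bdd (tayf f)" using tayf_bd bdd_def by blast

lemma stab_emb: "stab (range emb)"
  unfolding stab_def
proof (intro ballI allI impI)
  fix w \<gamma> :: "complex^'a" assume w: "w \<in> range emb" and "w + \<gamma> \<notin> range emb"
  have "\<exists>j. (w + \<gamma>) $ j \<notin> \<nat>"
  proof (rule ccontr)
    assume "\<not> (\<exists>j. (w + \<gamma>) $ j \<notin> \<nat>)"
    then have "\<forall>j. \<exists>n. (w + \<gamma>) $ j = of_nat n" by (metis Nats_cases)
    then obtain n where "\<forall>j. (w + \<gamma>) $ j = of_nat (n j)" by metis
    then have "w + \<gamma> = emb (\<chi> j. n j)" by (simp add: vec_eq_iff)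
    then show False using \<open>w + \<gamma> \<notin> range emb\<close> by blast
  qed
  then show "\<exists>j. w $ j \<in> \<nat> \<and> (w + \<gamma>) $ j \<notin> \<nat>" using w by auto
qed

text \<open>
  \<open>L\<close> describes the effect of \<open>P\<close> on Taylor coefficients at the origin, for functions near the
  origin.
\<close>

definition repon :: "(complex^'n) set \<Rightarrow> 'n opr \<Rightarrow> ((complex^'n \<Rightarrow> complex) \<Rightarrow> complex^'n \<Rightarrow> complex) \<Rightarrow> bool" where
  "repon V P L \<longleftrightarrow> open V \<and> 0 \<in> V \<and>
     (\<forall>W f k. open W \<longrightarrow> W \<subseteq> V \<longrightarrow> 0 \<in> W \<longrightarrow> f \<in> hol_funs W \<longrightarrow> tayl (P W f) k = L (tayf f) (emb k))"

text \<open>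
  \<open>L\<close> represents the germ of \<open>P\<close> at the origin. The condition \<open>LP L\<close> extends the operation from
  functions supported on \<open>\<nat>\<^sup>n\<close> to arbitrary exponents, uniquely by the next result.
\<close>

definition rep :: "'n opr \<Rightarrow> ((complex^'n \<Rightarrow> complex) \<Rightarrow> complex^'n \<Rightarrow> complex) \<Rightarrow> bool" where
  "rep P L \<longleftrightarrow> LP L \<and> (\<exists>V. repon V P L)"

lemma repon_mono: "repon V P L \<Longrightarrow> open V' \<Longrightarrow> 0 \<in> V' \<Longrightarrow> V' \<subseteq> V \<Longrightarrow> repon V' P L"
  unfolding repon_def by (meson order_trans)

lemma reponD: "repon V P L \<Longrightarrow> open W \<Longrightarrow> W \<subseteq> V \<Longrightarrow> 0 \<in> W \<Longrightarrow> f \<in> hol_funs W \<Longrightarrow> tayl (P W f) k = L (tayf f) (emb k)"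
  unfolding repon_def by metis

lemma repon_open: "repon V P L \<Longrightarrow> open V" "repon V P L \<Longrightarrow> 0 \<in> V"
  by (simp_all add: repon_def)

text \<open>
  The coefficients of \<open>L\<close> are polynomials, and they are known at all large points of \<open>\<nat>\<^sup>n\<close> because
  \<open>L\<close> is known on the Taylor coefficients of monomials. Hence they are determined by \<open>P\<close>.
\<close>

lemma rep_unique:
  fixes L :: "(complex^'n \<Rightarrow> complex) \<Rightarrow> complex^'n \<Rightarrow> complex"
  assumes "rep P L" "rep P L'" "bdd c"
  shows "L c = L' c"
proof
  fix w :: "complex^'n"
  obtain V V' where VV: "repon V P L" "repon V' P L'"
    using assms(1,2) unfolding rep_def by blast
  note V = repon_open[OF VV(1)] and V' = repon_open[OF VV(2)]
  have eq: "L (tayf f) (emb k) = L' (tayf f) (emb k)" if "f \<in> hol_funs (V \<inter> V')" for f k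
    using reponD[OF VV(1) _ _ _ that, of k] reponD[OF VV(2) _ _ _ that, of k] V V' by (simp add: open_Int)
  obtain B where B: "bd B c" using assms(3) unfolding bdd_def by blast
  define N where "N = max 0 (wdeg w - B)"
  have N: "bd (wdeg w - N) c" by (rule bd_mono[OF B]) (simp add: N_def)
  obtain l where l: "\<forall>t\<in>set l. goodterm t" "\<And>w c. bd (wdeg w - N) c \<Longrightarrow> L c w = tsum l c w"
    using LP_tsum assms(1) unfolding rep_def by metis
  obtain l' where l': "\<forall>t\<in>set l'. goodterm t" "\<And>w c. bd (wdeg w - N) c \<Longrightarrow> L' c w = tsum l' c w"
    using LP_tsum assms(2) unfolding rep_def by metis
  \<comment> \<open>the total coefficient of the shift by \<open>\<gamma>\<close>\<close>
  define p :: "((complex^'n \<Rightarrow> complex) \<times> (complex^'n)) list \<Rightarrow> complex^'n \<Rightarrow> complex^'n \<Rightarrow> complex"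
    where "p = (\<lambda>l \<gamma> w. (\<Sum>t\<leftarrow>filter (\<lambda>t. snd t = \<gamma>) l. fst t w))"
  have poly: "polyfn (p l \<gamma>)" if "\<forall>t\<in>set l. goodterm t" for l and \<gamma> :: "complex^'n"
    unfolding p_def using that by (intro polyfn_sum_list) (auto simp: goodterm_def)
  have tsum: "tsum l c w = (\<Sum>\<gamma>\<in>G. p l \<gamma> w * c (w + \<gamma>))" if "finite G" "snd ` set l \<subseteq> G" for l c w and G :: "(complex^'n) set"
    using that(2)
  proof (induction l)
    case (Cons t l)
    have "(\<Sum>\<gamma>\<in>G. p (t # l) \<gamma> w * c (w + \<gamma>)) = (\<Sum>\<gamma>\<in>G. (if snd t = \<gamma> then fst t w * c (w + \<gamma>) else 0) + p l \<gamma> w * c (w + \<gamma>))"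
      by (rule sum.cong) (auto simp: p_def algebra_simps)
    also have "\<dots> = fst t w * c (w + snd t) + (\<Sum>\<gamma>\<in>G. p l \<gamma> w * c (w + \<gamma>))"
      using Cons.prems that(1) by (simp add: sum.distrib)
    finally show ?case using Cons by (simp add: tsum_def)
  qed (simp add: tsum_def p_def)
  define G where "G = snd ` set (l @ l')"
  have G: "finite G" "snd ` set l \<subseteq> G" "snd ` set l' \<subseteq> G" by (auto simp: G_def)
  \<comment> \<open>shifts of degree below \<open>-N\<close> leave the support and are irrelevant\<close>
  have key: "p l \<gamma> w = p l' \<gamma> w" if g: "\<gamma> \<in> G" "- N \<le> wdeg \<gamma>" for \<gamma> w
  proof -
    have int: "\<gamma> $ j \<in> \<int>" for j using g l l' unfolding G_def goodterm_def by auto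
    then have "\<forall>j. \<exists>i::int. \<gamma> $ j = of_int i" by (metis Ints_cases)
    then obtain gi where gi: "\<And>j. \<gamma> $ j = of_int (gi j)" by metis
    define m where "m = nat (Max (range (\<lambda>j. \<bar>gi j\<bar>)))"
    have m: "\<bar>gi j\<bar> \<le> int m" for j
    proof -
      have "\<bar>gi j\<bar> \<le> Max (range (\<lambda>j. \<bar>gi j\<bar>))" by (rule Max_ge) auto
      then show ?thesis unfolding m_def by linarith
    qed
    have "p l \<gamma> w + (-1) * p l' \<gamma> w = 0"
    proof (rule polyfn_eq_0[where m = m])
      show "polyfn (\<lambda>w. p l \<gamma> w + (-1) * p l' \<gamma> w)"
        by (intro polyfn.intros poly l l')
      fix k :: "nat^'n" assume k: "\<And>j. m \<le> k $ j"
      have ge: "0 \<le> int (k $ j) + gi j" for j using m[of j] k[of j] by linarith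
      define u where "u = (\<chi> j. nat (int (k $ j) + gi j))"
      have u: "emb u = emb k + \<gamma>"
      proof -
        have "(of_nat (nat (int (k $ j) + gi j)) :: complex) = of_nat (k $ j) + of_int (gi j)" for j
          using ge[of j] by (metis of_int_add of_int_of_nat_eq of_nat_nat)
        then show ?thesis by (simp add: vec_eq_iff u_def gi)
      qed
      \<comment> \<open>evaluation at \<open>x\<^sup>u/u!\<close> with \<open>u = k + \<gamma>\<close> isolates the coefficient of the shift by \<open>\<gamma>\<close> at \<open>k\<close>\<close>
      let ?f = "restrict (xm u) (V \<inter> V')"
      have f: "?f \<in> hol_funs (V \<inter> V')" using V V' by (intro restrict_hol_funs) auto
      have tf: "tayf ?f (emb k') = (if k' = u then 1 else 0)" for k'
      proof -
        have "tayl ?f k' = tayl (xm u) k'"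
          by (rule tayl_cong[of "V \<inter> V'"]) (use V V' in auto)
        then show ?thesis by (simp add: tayl_xm)
      qed
      have "wdeg (emb k) - N \<le> wdeg (emb u)" using g(2) by (simp add: u wdeg_add)
      then have b: "bd (wdeg (emb k) - N) (tayf ?f)"
        unfolding bd_def by (metis rangeE tayf_def tf)
      have s: "tsum l (tayf ?f) (emb k) = p l \<gamma> (emb k)" if "snd ` set l \<subseteq> G" for l
      proof -
        have "\<forall>t\<in>set l. snd t \<noteq> \<gamma> \<longrightarrow> tayf ?f (emb k + snd t) = 0"
        proof (intro ballI impI)
          fix t assume "snd t \<noteq> \<gamma>"
          then have "emb k + snd t \<noteq> emb u" by (simp add: u)
          then show "tayf ?f (emb k + snd t) = 0" by (metis rangeE tayf_def tf)
        qed
        then show ?thesis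
          unfolding tsum_def p_def using tf[of u] u by (induction l) auto
      qed
      have "tsum l (tayf ?f) (emb k) = tsum l' (tayf ?f) (emb k)"
        using eq[OF f] l(2)[OF b] l'(2)[OF b] by simp
      then show "p l \<gamma> (emb k) + (-1) * p l' \<gamma> (emb k) = 0" using s G by simp
    qed
    then show ?thesis by simp
  qed
  have "p l \<gamma> w * c (w + \<gamma>) = p l' \<gamma> w * c (w + \<gamma>)" if "\<gamma> \<in> G" for \<gamma>
  proof (cases "- N \<le> wdeg \<gamma>")
    case True then show ?thesis using key that by simp
  next
    case False
    then have "c (w + \<gamma>) = 0" using N by (force simp: bd_def wdeg_add)
    then show ?thesis by simp
  qed
  then show "L c w = L' c w"
    unfolding l(2)[OF N] l'(2)[OF N] tsum[OF G(1,2)] tsum[OF G(1,3)] by (rule sum.cong[OF refl])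
qed

lemma repI:
  assumes "LP L" "open V" "0 \<in> V"
    "\<And>W f k. open W \<Longrightarrow> W \<subseteq> V \<Longrightarrow> 0 \<in> W \<Longrightarrow> f \<in> hol_funs W \<Longrightarrow> tayl (P W f) k = L (tayf f) (emb k)"
  shows "rep P L"
  unfolding rep_def repon_def using assms by blast

lemma rep_LP: "rep P L \<Longrightarrow> LP L"
  by (simp add: rep_def)

lemma rep_restrict:
  assumes "open V" "0 \<in> V"
  shows "rep (restrict P (opens_in V)) L \<longleftrightarrow> rep P L"
proof -
  have eq: "repon V' (restrict P (opens_in V)) L \<longleftrightarrow> repon V' P L" if "V' \<subseteq> V" for V'
    using that unfolding repon_def opens_in_def by auto
  have "\<exists>V'. V' \<subseteq> V \<and> repon V' Q L" if "repon U Q L" for U Q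
    using repon_mono[OF that, of "U \<inter> V"] assms repon_open[OF that] by auto
  then show ?thesis unfolding rep_def using eq by metis
qed

lemma rep_one: "0 \<in> U \<Longrightarrow> open U \<Longrightarrow> rep \<one>\<^bsub>End_hol U\<^esub> (\<lambda>c. c)"
  by (rule repI[where V = U]) (auto simp: LP_id opens_in_def)

lemma tayl_restrict: "open W \<Longrightarrow> 0 \<in> W \<Longrightarrow> tayl (restrict f W) k = tayl f k"
  by (rule tayl_cong[of W]) auto

lemma rep_cmult:
  assumes U: "open U" "0 \<in> U" and P: "P \<in> carrier (End_hol U)" and r: "rep P L"
    and Q: "\<And>W f x. W \<in> opens_in U \<Longrightarrow> f \<in> hol_funs W \<Longrightarrow> x \<in> W \<Longrightarrow> Q W f x = a * P W f x"
  shows "rep Q (\<lambda>c w. a * L c w)"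
proof -
  obtain V where V: "repon V P L" using r unfolding rep_def by blast
  show ?thesis
  proof (rule repI[where V = "U \<inter> V"])
    show "LP (\<lambda>c w. a * L c w)" using LP_smult rep_LP[OF r] by blast
    fix W f k assume W: "open W" "W \<subseteq> U \<inter> V" "0 \<in> W" "f \<in> hol_funs W"
    then have WU: "W \<in> opens_in U" by (auto simp: opens_in_def)
    have "tayl (Q W f) k = tayl (\<lambda>x. a * P W f x) k"
      by (rule tayl_cong[OF W(1,3)]) (rule Q[OF WU W(4)])
    also have "\<dots> = a * tayl (P W f) k"
      by (rule tayl_cmult[OF W(1,3) hol_funs_chol[OF End_hol_maps[OF P WU W(4)]]])
    finally show "tayl (Q W f) k = a * L (tayf f) (emb k)"
      using reponD[OF V W(1) _ W(3,4)] W(2) by simp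
  qed (use U V repon_open in auto)
qed

lemma rep_add:
  assumes U: "open U" "0 \<in> U" and P: "P \<in> carrier (End_hol U)" "P' \<in> carrier (End_hol U)"
    and r: "rep P L" "rep P' L'"
  shows "rep (P \<oplus>\<^bsub>End_hol U\<^esub> P') (\<lambda>c w. L c w + L' c w)"
proof -
  obtain V V' where V: "repon V P L" "repon V' P' L'" using r unfolding rep_def by blast
  show ?thesis
  proof (rule repI[where V = "U \<inter> V \<inter> V'"])
    show "LP (\<lambda>c w. L c w + L' c w)" using LP_add rep_LP[OF r(1)] rep_LP[OF r(2)] by blast
    fix W f k assume W: "open W" "W \<subseteq> U \<inter> V \<inter> V'" "0 \<in> W" "f \<in> hol_funs W"
    then have WU: "W \<in> opens_in U" by (auto simp: opens_in_def)
    have "tayl ((P \<oplus>\<^bsub>End_hol U\<^esub> P') W f) k = tayl (\<lambda>x. P W f x + P' W f x) k"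
      using WU W by (simp add: tayl_restrict)
    also have "\<dots> = tayl (P W f) k + tayl (P' W f) k"
      by (rule tayl_add[OF W(1,3)]) (rule hol_funs_chol[OF End_hol_maps[OF _ WU W(4)]], rule P)+
    finally show "tayl ((P \<oplus>\<^bsub>End_hol U\<^esub> P') W f) k = L (tayf f) (emb k) + L' (tayf f) (emb k)"
      using reponD[OF V(1) W(1) _ W(3,4)] reponD[OF V(2) W(1) _ W(3,4)] W(2) by simp
  qed (use U repon_open[OF V(1)] repon_open[OF V(2)] in auto)
qed

lemma rep_mult:
  assumes U: "open U" "0 \<in> U" and P: "P \<in> carrier (End_hol U)" "P' \<in> carrier (End_hol U)"
    and r: "rep P L" "rep P' L'"
  shows "rep (P \<otimes>\<^bsub>End_hol U\<^esub> P') (\<lambda>c. L (L' c))"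
proof -
  obtain V V' where V: "repon V P L" "repon V' P' L'" using r unfolding rep_def by blast
  note LP = rep_LP[OF r(1)] rep_LP[OF r(2)]
  show ?thesis
  proof (rule repI[where V = "U \<inter> V \<inter> V'"])
    show "LP (\<lambda>c. L (L' c))" using LP_comp[OF LP] .
    fix W f k assume W: "open W" "W \<subseteq> U \<inter> V \<inter> V'" "0 \<in> W" "f \<in> hol_funs W"
    then have WU: "W \<in> opens_in U" by (auto simp: opens_in_def)
    have f': "P' W f \<in> hol_funs W" by (rule End_hol_maps[OF P(2) WU W(4)])
    have "tayl ((P \<otimes>\<^bsub>End_hol U\<^esub> P') W f) k = tayl (P W (P' W f)) k"
      using WU W by simp
    also have "\<dots> = L (tayf (P' W f)) (emb k)"
      using reponD[OF V(1) W(1) _ W(3) f'] W(2) by simp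
    also have "\<dots> = L (L' (tayf f)) (emb k)"
    proof (rule LP_stab[OF LP(1) stab_emb tayf_bdd LP_bdd[OF LP(2) tayf_bdd]])
      fix w :: "complex^'a" assume "w \<in> range emb"
      then obtain k' where "w = emb k'" by blast
      then show "tayf (P' W f) w = L' (tayf f) w"
        using reponD[OF V(2) W(1) _ W(3,4)] W(2) by simp
    qed simp
    finally show "tayl ((P \<otimes>\<^bsub>End_hol U\<^esub> P') W f) k = L (L' (tayf f)) (emb k)" .
  qed (use U repon_open[OF V(1)] repon_open[OF V(2)] in auto)
qed

lemma rep_mult_op:
  assumes U: "open U" "0 \<in> U" and g: "chol U g"
  shows "rep (mult_op U g) (hat (tayl g))"
proof (rule repI[OF LP_hat U])
  fix W f k assume W: "open W" "W \<subseteq> U" "0 \<in> W" "f \<in> hol_funs W"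
  then have WU: "W \<in> opens_in U" by (auto simp: opens_in_def)
  have "tayl (mult_op U g W f) k = tayl (\<lambda>x. g x * f x) k"
    using WU W by (simp add: tayl_restrict)
  also have "\<dots> = (\<Sum>\<alpha> | msize \<alpha> \<le> msize k. tayl g \<alpha> * gb (emb k) \<alpha> * tayl f (k - \<alpha>))"
    by (rule tayl_mult[OF W(1,3) hol_funs_chol[OF W(4)] chol_mono[OF g W(2)] order_refl])
  also have "\<dots> = (\<Sum>\<alpha> | msize \<alpha> \<le> msize k. tayl g \<alpha> * gb (emb k) \<alpha> * tayf f (emb k - emb \<alpha>))"
  proof (rule sum.cong)
    fix \<alpha>
    show "tayl g \<alpha> * gb (emb k) \<alpha> * tayl f (k - \<alpha>) = tayl g \<alpha> * gb (emb k) \<alpha> * tayf f (emb k - emb \<alpha>)"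
      by (cases "\<alpha> \<le> k") (simp_all add: gb_emb_eq_0 flip: emb_diff)
  qed simp
  also have "\<dots> = hat (tayl g) (tayf f) (emb k)"
    by (rule hat_eq[where N = "msize k", symmetric]) (simp_all add: wdeg_emb tayf_bd)
  finally show "tayl (mult_op U g W f) k = hat (tayl g) (tayf f) (emb k)" .
qed

lemma rep_partial_op:
  assumes U: "open U" "0 \<in> U"
  shows "rep (partial_op U j) (\<lambda>c w. c (w + axis j 1))"
proof (rule repI[OF LP_shift U])
  fix W f k assume W: "open W" "W \<subseteq> U" "0 \<in> W" "f \<in> hol_funs W"
  then have WU: "W \<in> opens_in U" by (auto simp: opens_in_def)
  have "tayl (partial_op U j W f) k = tayl (pd j f) k"
    using WU W by (simp add: tayl_restrict)
  also have "\<dots> = tayl f (k + ue j)"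
    using tayl_step[OF W(1,3) hol_funs_chol[OF W(4)]] by simp
  also have "\<dots> = tayf f (emb (k + ue j))" by simp
  finally show "tayl (partial_op U j W f) k = tayf f (emb k + axis j 1)"
    by (simp add: emb_add)
qed

lemma rep_exists:
  assumes U: "open U" "0 \<in> U" and P: "P \<in> carrier (diff_ops U)"
  shows "\<exists>L. rep P L"
proof -
  obtain V where V: "V \<in> opens_in U" "0 \<in> V"
    "restrict P (opens_in V) \<in> generate_ring (End_hol V) (op_gens V)"
    using P U unfolding diff_ops_carrier_iff by blast
  note VV = opens_inD(1)[OF V(1)] V(2)
  note in_E = ring.generate_ring_in_carrier[OF End_hol_ring op_gens_closed]
  have "\<exists>L. rep Q L" if "Q \<in> generate_ring (End_hol V) (op_gens V)" for Q
    using that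
  proof (induction rule: generate_ring.induct)
    case one then show ?case using rep_one[OF VV(2,1)] by blast
  next
    case (incl h)
    then show ?case
      using rep_mult_op[OF VV hol_funs_chol] rep_partial_op[OF VV] by blast
  next
    case (a_inv h)
    then obtain L where L: "rep h L" by blast
    have h: "h \<in> carrier (End_hol V)" using a_inv.hyps in_E by blast
    have "rep (\<ominus>\<^bsub>End_hol V\<^esub> h) (\<lambda>c w. (-1) * L c w)"
      by (rule rep_cmult[OF VV h L]) (simp add: a_inv_eval[OF End_hol_ring refl refl h])
    then show ?case by blast
  next
    case (eng_add h1 h2)
    then show ?case using rep_add[OF VV in_E in_E] by blast
  next
    case (eng_mult h1 h2)
    then show ?case using rep_mult[OF VV in_E in_E] by blast
  qed
  then show ?thesis using V(3) rep_restrict[OF VV] by blast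
qed

text \<open>
  The action of the germ of \<open>P\<close> at the origin on functions of exponents with support bounded below.
  Only its values on such functions are meaningful.
\<close>

definition act :: "'n opr \<Rightarrow> (complex^'n \<Rightarrow> complex) \<Rightarrow> complex^'n \<Rightarrow> complex" where
  "act P = (SOME L. rep P L)"

lemma act_eq: "rep P L \<Longrightarrow> bdd c \<Longrightarrow> act P c = L c"
  unfolding act_def by (rule rep_unique[OF someI[of "rep P"]])

context
  fixes U :: "(complex^'n) set"
  assumes U: "open U" "0 \<in> U"
begin

lemma rep_act: "P \<in> carrier (diff_ops U) \<Longrightarrow> rep P (act P)"
  unfolding act_def by (rule someI_ex[OF rep_exists[OF U]])

lemma act_bdd: "P \<in> carrier (diff_ops U) \<Longrightarrow> bdd c \<Longrightarrow> bdd (act P c)"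
  by (rule LP_bdd[OF rep_LP[OF rep_act]])

lemma act_add_fun: "P \<in> carrier (diff_ops U) \<Longrightarrow> bdd c \<Longrightarrow> bdd c' \<Longrightarrow>
    act P (\<lambda>w. c w + c' w) = (\<lambda>w. act P c w + act P c' w)"
  by (rule LP_add_fun[OF rep_LP[OF rep_act]])

lemma act_stab:
  "P \<in> carrier (diff_ops U) \<Longrightarrow> stab S \<Longrightarrow> bdd c \<Longrightarrow> bdd c' \<Longrightarrow> (\<And>w. w \<in> S \<Longrightarrow> c w = c' w) \<Longrightarrow>
    w \<in> S \<Longrightarrow> act P c w = act P c' w"
  by (rule LP_stab[OF rep_LP[OF rep_act]])

lemma act_add: "P \<in> carrier (diff_ops U) \<Longrightarrow> Q \<in> carrier (diff_ops U) \<Longrightarrow> bdd c \<Longrightarrow>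
    act (P \<oplus>\<^bsub>End_hol U\<^esub> Q) c = (\<lambda>w. act P c w + act Q c w)"
  by (rule act_eq[OF rep_add[OF U diff_ops_End diff_ops_End rep_act rep_act]])

lemma act_mult: "P \<in> carrier (diff_ops U) \<Longrightarrow> Q \<in> carrier (diff_ops U) \<Longrightarrow> bdd c \<Longrightarrow>
    act (P \<otimes>\<^bsub>End_hol U\<^esub> Q) c = act P (act Q c)"
  by (rule act_eq[OF rep_mult[OF U diff_ops_End diff_ops_End rep_act rep_act]])

lemma act_one: "bdd c \<Longrightarrow> act \<one>\<^bsub>End_hol U\<^esub> c = c"
  by (rule act_eq[OF rep_one[OF U(2,1)]])

lemma act_restrict: "P \<in> carrier (diff_ops U) \<Longrightarrow> open V \<Longrightarrow> 0 \<in> V \<Longrightarrow> bdd c \<Longrightarrow>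
    act (restrict P (opens_in V)) c = act P c"
  by (rule act_eq) (simp_all only: rep_restrict rep_act)

lemma act_zero: "bdd c \<Longrightarrow> act \<zero>\<^bsub>End_hol U\<^esub> c = (\<lambda>w. 0)"
proof -
  assume c: "bdd c"
  interpret ring "diff_ops U" by (rule diff_ops_ring[OF U(1)])
  have z: "\<zero>\<^bsub>End_hol U\<^esub> \<in> carrier (diff_ops U)" using zero_closed by simp
  have "\<zero>\<^bsub>End_hol U\<^esub> \<oplus>\<^bsub>End_hol U\<^esub> \<zero>\<^bsub>End_hol U\<^esub> = \<zero>\<^bsub>End_hol U\<^esub>"
    using l_zero[OF zero_closed] by simp
  then show ?thesis using act_add[OF z z c] by (metis (no_types, lifting) add_cancel_right_left ext)
qed

end

lemma act_const_op: "bdd c \<Longrightarrow> act (const_op a) c = (\<lambda>w. a * c w)"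
proof (rule act_eq)
  show "rep (const_op a) (\<lambda>c w. a * c w)"
    by (rule rep_cmult[where P = "\<one>\<^bsub>End_hol UNIV\<^esub>" and U = UNIV])
      (simp_all add: End_one_closed rep_one)
qed

lemma act_d_op: "bdd c \<Longrightarrow> act (d_op j) c = (\<lambda>w. c (w + axis j 1))"
  unfolding d_op_def by (rule act_eq[OF rep_partial_op]) auto

lemma tayl_coord: "tayl (\<lambda>x. x $ j) \<alpha> = (if \<alpha> = ue j then 1 else 0)"
proof -
  have "xm (ue j) = (\<lambda>x. x $ j)"
  proof
    fix x :: "complex^'a"
    have "xm (ue j) x = (\<Prod>i\<in>UNIV. if i = j then x $ i else 1)"
      unfolding xm_def by (rule prod.cong) auto
    then show "xm (ue j) x = x $ j" by simp
  qed
  then show ?thesis using tayl_xm[of "ue j" \<alpha>] by simp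
qed

lemma gb_ue: "gb w (ue j) = w $ j"
proof -
  have "gb w (ue j) = (\<Prod>i\<in>UNIV. if i = j then w $ i else 1)"
    unfolding gb_def by (rule prod.cong) auto
  then show ?thesis by simp
qed

lemma act_x_op: "bdd c \<Longrightarrow> act (x_op j) c = (\<lambda>w. w $ j * c (w - axis j 1))"
proof -
  assume c: "bdd c"
  have "act (x_op j) c = hat (tayl (\<lambda>x. x $ j)) c"
    unfolding x_op_def by (rule act_eq[OF rep_mult_op c]) auto
  moreover have "hat (tayl (\<lambda>x. x $ j)) c w = w $ j * c (w - axis j 1)" for w
  proof -
    obtain B where B: "bd B c" using c unfolding bdd_def by blast
    obtain M :: nat where M: "wdeg w - B + 1 \<le> real M" using real_arch_simple by blast
    have "hat (tayl (\<lambda>x. x $ j)) c w = (\<Sum>\<alpha> | msize \<alpha> \<le> M + 1. tayl (\<lambda>x. x $ j) \<alpha> * gb w \<alpha> * c (w - emb \<alpha>))"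
      by (rule hat_eq[where N = "wdeg w - B"]) (use B M in auto)
    also have "\<dots> = (\<Sum>\<alpha> | msize \<alpha> \<le> M + 1. if \<alpha> = ue j then w $ j * c (w - axis j 1) else 0)"
      by (rule sum.cong) (auto simp: tayl_coord gb_ue)
    also have "\<dots> = w $ j * c (w - axis j 1)"
      by (subst sum.delta) (auto simp: finite_msize_le)
    finally show ?thesis .
  qed
  ultimately show ?thesis by auto
qed

lemma act_d_monom:
  assumes "bdd c"
  shows "act (d_monom u) c = (\<lambda>w. c (w + emb u))"
  using assms
proof (induction u arbitrary: c rule: multi_induct)
  case zero
  then show ?case using act_one[OF open_UNIV] by simp
next
  case (step u j)
  note d = weyl_diff_ops[OF d_op_weyl] weyl_diff_ops[OF d_monom_weyl]
  have "act (d_monom (u + ue j)) c = act (d_op j) (act (d_monom u) c)"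
    unfolding d_monom_step by (rule act_mult[OF open_UNIV _ d step.prems]) simp
  also have "\<dots> = (\<lambda>w. act (d_monom u) c (w + axis j 1))"
    by (rule act_d_op) (rule act_bdd[OF open_UNIV _ d(2) step.prems], simp)
  finally show ?case using step by (simp add: emb_add algebra_simps)
qed

section \<open>Calculus in the Weyl algebra\<close>

abbreviation W :: "'n::finite opr ring" where "W \<equiv> weyl_algebra"

declare weyl_fields [simp del]

interpretation weyl: ring "W :: 'n::finite opr ring" by (rule weyl_ring)

lemma weyl_mult_eval: "open V \<Longrightarrow> f \<in> hol_funs V \<Longrightarrow> (P \<otimes>\<^bsub>W\<^esub> Q) V f = P V (Q V f)"
  by (simp add: weyl_fields)

lemma weyl_add_eval: "open V \<Longrightarrow> f \<in> hol_funs V \<Longrightarrow> (P \<oplus>\<^bsub>W\<^esub> Q) V f = (\<lambda>x\<in>V. P V f x + Q V f x)"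
  by (simp add: weyl_fields)

lemma weyl_one_eval: "open V \<Longrightarrow> f \<in> hol_funs V \<Longrightarrow> \<one>\<^bsub>W\<^esub> V f = f"
  by (simp add: weyl_fields)

lemma weyl_zero_eval: "open V \<Longrightarrow> f \<in> hol_funs V \<Longrightarrow> \<zero>\<^bsub>W\<^esub> V f = (\<lambda>x\<in>V. 0)"
  by (simp add: weyl_fields)

lemma weyl_neg_eval: "open V \<Longrightarrow> f \<in> hol_funs V \<Longrightarrow> x \<in> V \<Longrightarrow> P \<in> carrier W \<Longrightarrow> (\<ominus>\<^bsub>W\<^esub> P) V f x = - P V f x"
  by (rule a_inv_eval[OF weyl_ring, where U = UNIV]) (simp_all add: weyl_fields)

lemmas weyl_eval = weyl_mult_eval weyl_add_eval weyl_one_eval weyl_zero_eval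

lemma const_op_central:
  assumes P: "P \<in> carrier W"
  shows "P \<otimes>\<^bsub>W\<^esub> const_op c = const_op c \<otimes>\<^bsub>W\<^esub> P"
proof (rule weyl_eqI)
  fix V :: "(complex^'a) set" and f x assume *: "open V" "f \<in> hol_funs V" "x \<in> V"
  have "P V (\<lambda>x\<in>V. c * f x + 0 * f x) = (\<lambda>x\<in>V. c * P V f x + 0 * P V f x)"
    using End_hol_linear[OF weyl_End[OF P], of V f f c 0] * by (simp only: opens_in_UNIV)
  then show "(P \<otimes>\<^bsub>W\<^esub> const_op c) V f x = (const_op c \<otimes>\<^bsub>W\<^esub> P) V f x"
    using * P by (simp add: weyl_eval weyl_maps)
qed (use P in simp_all)

lemma const_op_mult: "const_op a \<otimes>\<^bsub>W\<^esub> const_op b = const_op (a * b)"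
  by (rule weyl_eqI) (simp_all add: weyl_eval hol_funs_mult mult.assoc)

lemma const_op_add: "const_op a \<oplus>\<^bsub>W\<^esub> const_op b = const_op (a + b)"
  by (rule weyl_eqI) (simp_all add: weyl_eval algebra_simps)

lemma const_op_0: "const_op 0 = \<zero>\<^bsub>W\<^esub>"
  by (rule weyl_eqI) (simp_all add: weyl_eval)

lemma const_op_neg: "\<ominus>\<^bsub>W\<^esub> const_op a = const_op (- a)"
  by (rule weyl_eqI) (simp_all add: weyl_neg_eval)

text \<open>
  Multiplication by the divided monomial \<open>x\<^sup>\<alpha>/\<alpha>!\<close>.
\<close>

definition xd :: "nat^'n \<Rightarrow> 'n::finite opr" where
  "xd \<alpha> = mult_op UNIV (xm \<alpha>)"

lemma xd_eval [simp]: "open V \<Longrightarrow> f \<in> hol_funs V \<Longrightarrow> xd \<alpha> V f = (\<lambda>x\<in>V. xm \<alpha> x * f x)"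
  by (simp add: xd_def)

lemma xd_End: "xd \<alpha> \<in> carrier (End_hol UNIV)"
  unfolding xd_def by (rule mult_op_closed) simp

lemma xm_step: "x $ j * xm \<alpha> x = of_nat (\<alpha> $ j + 1) * xm (\<alpha> + ue j) x"
proof -
  let ?R = "\<Prod>i\<in>UNIV - {j}. (x $ i) ^ (\<alpha> $ i) / fact (\<alpha> $ i)"
  have 1: "xm \<alpha> x = (x $ j) ^ (\<alpha> $ j) / fact (\<alpha> $ j) * ?R"
    unfolding xm_def by (subst prod.remove[of _ j]) auto
  have 2: "xm (\<alpha> + ue j) x = (x $ j) ^ (\<alpha> $ j + 1) / fact (\<alpha> $ j + 1) * ?R"
    unfolding xm_def by (subst prod.remove[of _ j]) (auto intro!: prod.cong)
  have 3: "of_nat (n + 1) * (y / fact (n + 1)) = (y :: complex) / fact n" for n y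
    by (simp add: fact_Suc del: of_nat_Suc)
  have "of_nat (\<alpha> $ j + 1) * xm (\<alpha> + ue j) x = (of_nat (\<alpha> $ j + 1) * ((x $ j) ^ (\<alpha> $ j + 1) / fact (\<alpha> $ j + 1))) * ?R"
    unfolding 2 by (simp only: mult.assoc)
  also have "\<dots> = x $ j * xm \<alpha> x" unfolding 3 1 by simp
  finally show ?thesis by simp
qed

lemma xd_weyl [simp]: "xd \<alpha> \<in> carrier W"
proof (induction \<alpha> rule: multi_induct)
  case zero
  have "xd 0 = \<one>\<^bsub>End_hol (UNIV :: (complex^'a) set)\<^esub>"
    by (rule End_hol_eqI[OF xd_End End_one_closed]) simp
  then show ?case using weyl.one_closed by (simp add: weyl_fields)
next
  case (step \<alpha> j)
  let ?Q = "const_op (1 / of_nat (\<alpha> $ j + 1)) \<otimes>\<^bsub>W\<^esub> (x_op j \<otimes>\<^bsub>W\<^esub> xd \<alpha>)"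
  have Q: "?Q \<in> carrier W" using step by simp
  have "xd (\<alpha> + ue j) = ?Q"
  proof (rule End_hol_eqI[OF xd_End weyl_End[OF Q]])
    fix V f x assume *: "V \<in> opens_in UNIV" "f \<in> hol_funs V" "(x :: complex^'a) \<in> V"
    have e: "(x_op j \<otimes>\<^bsub>W\<^esub> xd \<alpha>) V f = (\<lambda>x\<in>V. (x $ j * xm \<alpha> x) * f x)"
    proof -
      have m: "xd \<alpha> V f \<in> hol_funs V" using * by (simp add: hol_funs_mult)
      have V: "open V" using * by simp
      have "(x_op j \<otimes>\<^bsub>W\<^esub> xd \<alpha>) V f = (\<lambda>x\<in>V. x $ j * xd \<alpha> V f x)"
        unfolding weyl_mult_eval[OF V *(2)] by (rule x_op_eval[OF V m])
      also have "\<dots> = (\<lambda>x\<in>V. (x $ j * xm \<alpha> x) * f x)"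
        by (rule restrict_ext) (use * in \<open>simp add: mult.assoc\<close>)
      finally show ?thesis .
    qed
    have "(\<lambda>x\<in>V. (x $ j * xm \<alpha> x) * f x) \<in> hol_funs V"
      using * by (intro hol_funs_mult chol_mult) auto
    then have "?Q V f x = 1 / of_nat (\<alpha> $ j + 1) * ((x $ j * xm \<alpha> x) * f x)"
      using * weyl_mult_eval[of V f "const_op (1 / of_nat (\<alpha> $ j + 1))" "x_op j \<otimes>\<^bsub>W\<^esub> xd \<alpha>"]
      by (simp add: e del: of_nat_Suc)
    then have "?Q V f x = 1 / of_nat (\<alpha> $ j + 1) * (x $ j * xm \<alpha> x) * f x"
      by (simp only: mult.assoc)
    also have "\<dots> = (1 / of_nat (\<alpha> $ j + 1) * of_nat (\<alpha> $ j + 1)) * xm (\<alpha> + ue j) x * f x"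
      unfolding xm_step by (simp only: mult.assoc)
    also have "1 / of_nat (\<alpha> $ j + 1) * of_nat (\<alpha> $ j + 1) = (1 :: complex)"
      by (simp del: of_nat_Suc)
    finally show "xd (\<alpha> + ue j) V f x = ?Q V f x" using * by simp
  qed
  then show ?case using Q by simp
qed

lemma xd_0: "xd 0 = \<one>\<^bsub>W\<^esub>"
  by (rule weyl_eqI) (simp_all add: weyl_eval)

lemma xd_ue: "xd (ue j) = x_op j"
  by (rule weyl_eqI) (use xm_step[where \<alpha> = 0 and j = j] in \<open>simp_all\<close>)

lemma d_monom_0_weyl: "d_monom 0 = \<one>\<^bsub>W\<^esub>"
  unfolding d_monom_0 by (simp add: weyl_fields)

lemma d_monom_ue: "d_monom (ue j) = d_op j"
proof -
  have "d_monom (0 + ue j) = d_op j \<otimes>\<^bsub>W\<^esub> \<one>\<^bsub>W\<^esub>"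
    unfolding d_monom_step by (simp add: weyl_fields)
  then show ?thesis by simp
qed

lemma d_op_xd:
  "d_op j \<otimes>\<^bsub>W\<^esub> xd \<alpha> = xd \<alpha> \<otimes>\<^bsub>W\<^esub> d_op j \<oplus>\<^bsub>W\<^esub> (if \<alpha> $ j = 0 then \<zero>\<^bsub>W\<^esub> else xd (\<alpha> - ue j))"
proof (rule weyl_eqI)
  fix V :: "(complex^'a) set" and f x assume *: "open V" "f \<in> hol_funs V" "x \<in> V"
  have "pd j (\<lambda>x\<in>V. xm \<alpha> x * f x) x = pd j (\<lambda>x. xm \<alpha> x * f x) x"
    by (rule pd_cong[OF *(1,3)]) simp
  also have "\<dots> = xm \<alpha> x * pd j f x + pd j (xm \<alpha>) x * f x"
    by (rule pd_mult[OF _ hol_funs_chol[OF *(2)] *(3)]) simp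
  finally show "(d_op j \<otimes>\<^bsub>W\<^esub> xd \<alpha>) V f x =
      (xd \<alpha> \<otimes>\<^bsub>W\<^esub> d_op j \<oplus>\<^bsub>W\<^esub> (if \<alpha> $ j = 0 then \<zero>\<^bsub>W\<^esub> else xd (\<alpha> - ue j))) V f x"
    using * by (simp add: weyl_eval hol_funs_mult hol_funs_pd pd_xm)
qed simp_all

lemma xd_mult: "xd \<beta> \<otimes>\<^bsub>W\<^esub> xd \<alpha> = const_op (gb (emb (\<alpha> + \<beta>)) \<beta>) \<otimes>\<^bsub>W\<^esub> xd (\<alpha> + \<beta>)"
proof (rule weyl_eqI)
  have 1: "(of_nat (a + b) gchoose b) * (z ^ (a + b) / fact (a + b)) = (z ^ b / fact b) * (z ^ a / fact a)"
    for a b :: nat and z :: complex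
    by (simp add: binomial_fact power_add del: of_nat_add flip: binomial_gbinomial)
  have "xm \<beta> x * xm \<alpha> x = gb (emb (\<alpha> + \<beta>)) \<beta> * xm (\<alpha> + \<beta>) x" for x
    unfolding xm_def gb_def prod.distrib[symmetric] emb_nth plus_vec_def vec_lambda_beta 1 ..
  then show "(xd \<beta> \<otimes>\<^bsub>W\<^esub> xd \<alpha>) V f x = (const_op (gb (emb (\<alpha> + \<beta>)) \<beta>) \<otimes>\<^bsub>W\<^esub> xd (\<alpha> + \<beta>)) V f x"
    if "open V" "f \<in> hol_funs V" "x \<in> V" for V f x
    using that by (simp add: weyl_eval hol_funs_mult mult.assoc[symmetric])
qed simp_all

lemma gb_mult: "gb s \<beta> * gb (s - emb \<beta>) \<alpha> = gb (emb (\<alpha> + \<beta>)) \<beta> * gb s (\<alpha> + \<beta>)"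
proof -
  have "(a gchoose k) * ((a - of_nat k) gchoose l) = (of_nat (l + k) gchoose k) * (a gchoose (l + k))"
    for a :: complex and k l
    using gbinomial_trinomial_revision[of k "l + k" a] by (simp add: mult.commute)
  then show ?thesis
    unfolding gb_def prod.distrib[symmetric] by (simp only: emb_nth vector_minus_component vector_add_component)
qed

section \<open>Operators attached to polynomials\<close>

text \<open>
  The linear map \<open>s \<mapsto> A s\<close> on \<open>\<complex>\<^sup>n\<close>.
\<close>

definition amap :: "int^'n^'d \<Rightarrow> complex^'n \<Rightarrow> complex^'d" where
  "amap A s = (\<chi> i. \<Sum>j\<in>UNIV. of_int (A $ i $ j) * s $ j)"

lemma amap_add: "amap A (s + t) = amap A s + amap A t"
  by (simp add: amap_def vec_eq_iff sum.distrib distrib_left)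
lemma amap_diff: "amap A (s - t) = amap A s - amap A t"
  by (simp add: amap_def vec_eq_iff sum_subtractf right_diff_distrib)
lemma amap_0 [simp]: "amap A 0 = 0" by (simp add: amap_def vec_eq_iff)

text \<open>
  The operator \<open>q (x\<^sup>\<alpha>/\<alpha>!) \<partial>\<^sup>b\<close> of a triple \<open>(q, \<alpha>, b)\<close>.
\<close>

definition tmop :: "complex \<times> (nat^'n) \<times> (nat^'n) \<Rightarrow> 'n::finite opr" where
  "tmop t = const_op (fst t) \<otimes>\<^bsub>W\<^esub> (xd (fst (snd t)) \<otimes>\<^bsub>W\<^esub> d_monom (snd (snd t)))"

definition opsum :: "(complex \<times> (nat^'n) \<times> (nat^'n)) list \<Rightarrow> 'n::finite opr" where
  "opsum l = foldr (\<lambda>t P. tmop t \<oplus>\<^bsub>W\<^esub> P) l \<zero>\<^bsub>W\<^esub>"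

text \<open>
  The polynomial attached to a list of triples, which ignores the exponents \<open>b\<close> of the derivatives.
\<close>

definition fsum :: "(complex \<times> (nat^'n) \<times> (nat^'n)) list \<Rightarrow> complex^'n \<Rightarrow> complex" where
  "fsum l s = (\<Sum>t\<leftarrow>l. fst t * gb s (fst (snd t)))"

text \<open>
  \<open>P\<close> is a sum of terms \<open>q (x\<^sup>\<alpha>/\<alpha>!) \<partial>\<^sup>b\<close> of the weight \<open>A b - A \<alpha> = \<xi>\<close>, with attached
  polynomial \<open>F\<close>.
\<close>

definition good :: "int^'n^'d \<Rightarrow> complex^'d \<Rightarrow> 'n::finite opr \<Rightarrow> (complex^'n \<Rightarrow> complex) \<Rightarrow> bool" where
  "good A \<xi> P F \<longleftrightarrow> (\<exists>l. (\<forall>t\<in>set l. amap A (emb (snd (snd t))) - amap A (emb (fst (snd t))) = \<xi>) \<and>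
     P = opsum l \<and> F = fsum l)"

lemma tmop_weyl [simp]: "tmop t \<in> carrier W" by (simp add: tmop_def)

lemma opsum_Nil [simp]: "opsum [] = \<zero>\<^bsub>W\<^esub>" and opsum_Cons [simp]: "opsum (t # l) = tmop t \<oplus>\<^bsub>W\<^esub> opsum l"
  by (simp_all add: opsum_def)

lemma opsum_weyl [simp]: "opsum l \<in> carrier W" by (induction l) simp_all

lemma opsum_append: "opsum (l @ l') = opsum l \<oplus>\<^bsub>W\<^esub> opsum l'"
  by (induction l) (simp_all add: weyl.a_assoc)

lemma opsum_filter: "opsum l = opsum (filter p l) \<oplus>\<^bsub>W\<^esub> opsum (filter (\<lambda>t. \<not> p t) l)"
  by (induction l) (simp_all add: weyl.a_assoc weyl.a_lcomm)

lemma fsum_filter: "fsum l s = fsum (filter p l) s + fsum (filter (\<lambda>t. \<not> p t) l) s"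
  unfolding fsum_def by (induction l) simp_all

lemma good_weyl: "good A \<xi> P F \<Longrightarrow> P \<in> carrier W" by (auto simp: good_def)

lemma good_zero: "good A \<xi> \<zero>\<^bsub>W\<^esub> (\<lambda>s. 0)"
  unfolding good_def by (rule exI[of _ "[]"]) (simp add: fsum_def fun_eq_iff)

lemma good_top: "amap A (emb b) - amap A (emb \<alpha>) = \<xi> \<Longrightarrow> good A \<xi> (tmop (q, \<alpha>, b)) (\<lambda>s. q * gb s \<alpha>)"
  unfolding good_def by (rule exI[of _ "[(q, \<alpha>, b)]"]) (simp add: fsum_def fun_eq_iff)

lemma good_add: "good A \<xi> P F \<Longrightarrow> good A \<xi> Q G \<Longrightarrow> good A \<xi> (P \<oplus>\<^bsub>W\<^esub> Q) (\<lambda>s. F s + G s)"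
proof -
  assume "good A \<xi> P F" "good A \<xi> Q G"
  then obtain l l' where "\<forall>t\<in>set l. amap A (emb (snd (snd t))) - amap A (emb (fst (snd t))) = \<xi>" "P = opsum l" "F = fsum l"
    "\<forall>t\<in>set l'. amap A (emb (snd (snd t))) - amap A (emb (fst (snd t))) = \<xi>" "Q = opsum l'" "G = fsum l'"
    unfolding good_def by blast
  then show ?thesis
    unfolding good_def by (intro exI[of _ "l @ l'"]) (auto simp: opsum_append fsum_def)
qed

lemma good_ind [consumes 1, case_names zero top add]:
  assumes "good A \<xi> P F" and z: "\<Phi> \<zero>\<^bsub>W\<^esub> (\<lambda>s. 0)"
    and t: "\<And>q \<alpha> b. amap A (emb b) - amap A (emb \<alpha>) = \<xi> \<Longrightarrow> \<Phi> (tmop (q, \<alpha>, b)) (\<lambda>s. q * gb s \<alpha>)"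
    and a: "\<And>P Q F G. P \<in> carrier W \<Longrightarrow> Q \<in> carrier W \<Longrightarrow> \<Phi> P F \<Longrightarrow> \<Phi> Q G \<Longrightarrow> \<Phi> (P \<oplus>\<^bsub>W\<^esub> Q) (\<lambda>s. F s + G s)"
  shows "\<Phi> P F"
proof -
  have "(\<forall>t\<in>set l. amap A (emb (snd (snd t))) - amap A (emb (fst (snd t))) = \<xi>) \<Longrightarrow> \<Phi> (opsum l) (fsum l)" for l
  proof (induction l)
    case Nil
    have "fsum [] = (\<lambda>s::complex^'a. 0)" by (simp add: fsum_def fun_eq_iff)
    then show ?case using z by simp
  next
    case (Cons t l)
    obtain q \<alpha> b where tt: "t = (q, \<alpha>, b)" by (cases t)
    have "fsum (t # l) = (\<lambda>s. q * gb s \<alpha> + fsum l s)" by (simp add: fsum_def fun_eq_iff tt)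
    moreover have "\<Phi> (tmop (q, \<alpha>, b) \<oplus>\<^bsub>W\<^esub> opsum l) (\<lambda>s. q * gb s \<alpha> + fsum l s)"
      using Cons tt by (intro a t) simp_all
    ultimately show ?case by (simp add: tt)
  qed
  then show ?thesis using assms(1) unfolding good_def by blast
qed

lemma tmop_smult: "const_op c \<otimes>\<^bsub>W\<^esub> tmop (q, \<alpha>, b) = tmop (c * q, \<alpha>, b)"
  by (simp add: tmop_def const_op_mult[symmetric] weyl.m_assoc)

lemma good_smult: "good A \<xi> P F \<Longrightarrow> good A \<xi> (const_op c \<otimes>\<^bsub>W\<^esub> P) (\<lambda>s. c * F s)"
proof (induction rule: good_ind)
  case zero then show ?case by (simp add: good_zero)
next
  case (top q \<alpha> b)
  then show ?case using good_top[OF top, of "c * q"] by (simp add: tmop_smult mult.assoc)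
next
  case (add P Q F G)
  then show ?case using good_add[OF add(3,4)] by (simp add: weyl.r_distr distrib_left)
qed

lemma good_d:
  "good A \<xi> P F \<Longrightarrow> good A (\<xi> + amap A (axis j 1)) (d_op j \<otimes>\<^bsub>W\<^esub> P) (\<lambda>s. F (s + axis j 1))"
proof (induction rule: good_ind)
  case zero then show ?case by (simp add: good_zero)
next
  case (top q \<alpha> b)
  have 1: "good A (\<xi> + amap A (axis j 1)) (tmop (q, \<alpha>, b + ue j)) (\<lambda>s. q * gb s \<alpha>)"
    by (rule good_top) (simp add: emb_add amap_add flip: top)
  have 2: "good A (\<xi> + amap A (axis j 1)) (if \<alpha> $ j = 0 then \<zero>\<^bsub>W\<^esub> else tmop (q, \<alpha> - ue j, b))
      (\<lambda>s. q * (if \<alpha> $ j = 0 then 0 else gb s (\<alpha> - ue j)))"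
  proof (cases "\<alpha> $ j = 0")
    case True then show ?thesis by (simp add: good_zero)
  next
    case False
    then have "emb (\<alpha> - ue j) = emb \<alpha> - axis j 1"
      by (subst emb_diff) (auto simp: less_eq_vec_def)
    then show ?thesis using False
      by simp (rule good_top, simp add: amap_diff flip: top)
  qed
  have "d_op j \<otimes>\<^bsub>W\<^esub> tmop (q, \<alpha>, b) = const_op q \<otimes>\<^bsub>W\<^esub> ((d_op j \<otimes>\<^bsub>W\<^esub> xd \<alpha>) \<otimes>\<^bsub>W\<^esub> d_monom b)"
    by (simp add: tmop_def weyl.m_assoc[symmetric] const_op_central)
  also have "\<dots> = tmop (q, \<alpha>, b + ue j) \<oplus>\<^bsub>W\<^esub> (if \<alpha> $ j = 0 then \<zero>\<^bsub>W\<^esub> else tmop (q, \<alpha> - ue j, b))"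
    unfolding d_op_xd
    by (simp add: tmop_def weyl.m_assoc weyl.l_distr weyl.r_distr d_monom_step weyl_fields(1)[symmetric])
  finally show ?case using good_add[OF 1 2] by (simp add: gb_step distrib_left)
next
  case (add P Q F G)
  then show ?case using good_add[OF add(3,4)] by (simp add: weyl.r_distr)
qed

lemma good_dm:
  assumes "good A \<xi> P F"
  shows "good A (\<xi> + amap A (emb b)) (d_monom b \<otimes>\<^bsub>W\<^esub> P) (\<lambda>s. F (s + emb b))"
proof (induction b rule: multi_induct)
  case zero
  show ?case using assms good_weyl[OF assms] by (simp add: d_monom_0_weyl del: d_monom_0)
next
  case (step b j)
  have "d_monom (b + ue j) = d_op j \<otimes>\<^bsub>W\<^esub> d_monom b" by (simp add: d_monom_step weyl_fields)
  then show ?case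
    using good_d[OF step, of j] good_weyl[OF assms]
    by (simp add: weyl.m_assoc emb_add amap_add add.assoc) (simp add: add.commute add.left_commute)
qed

lemma good_xd:
  "good A \<xi> P F \<Longrightarrow> good A (\<xi> - amap A (emb \<beta>)) (xd \<beta> \<otimes>\<^bsub>W\<^esub> P) (\<lambda>s. gb s \<beta> * F (s - emb \<beta>))"
proof (induction rule: good_ind)
  case zero then show ?case by (simp add: good_zero)
next
  case (top q \<alpha> b)
  let ?c = "gb (emb (\<alpha> + \<beta>)) \<beta>"
  have 1: "good A (\<xi> - amap A (emb \<beta>)) (tmop (?c * q, \<alpha> + \<beta>, b)) (\<lambda>s. (?c * q) * gb s (\<alpha> + \<beta>))"
    by (rule good_top) (simp add: emb_add amap_add flip: top)
  have "xd \<beta> \<otimes>\<^bsub>W\<^esub> tmop (q, \<alpha>, b) = const_op q \<otimes>\<^bsub>W\<^esub> ((xd \<beta> \<otimes>\<^bsub>W\<^esub> xd \<alpha>) \<otimes>\<^bsub>W\<^esub> d_monom b)"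
    by (simp add: tmop_def weyl.m_assoc[symmetric] const_op_central)
  also have "\<dots> = tmop (?c * q, \<alpha> + \<beta>, b)"
    unfolding xd_mult
    by (simp add: tmop_def weyl.m_assoc[symmetric] const_op_mult mult.commute)
  finally show ?case using 1 gb_mult[of _ \<beta> \<alpha>] by (simp add: mult_ac)
next
  case (add P Q F G)
  then show ?case using good_add[OF add(3,4)] by (simp add: weyl.r_distr distrib_left)
qed

text \<open>
  In the product \<open>P Q\<close> the polynomial of \<open>Q\<close> is shifted by the weight \<open>\<xi>\<close> of \<open>P\<close>; for this it has to
  depend on \<open>s\<close> only through \<open>A s\<close>.
\<close>

lemma good_mult:
  assumes P: "good A \<xi> P F" and Q: "good A \<xi>' Q (\<lambda>s. g (amap A s))"
  shows "good A (\<xi> + \<xi>') (P \<otimes>\<^bsub>W\<^esub> Q) (\<lambda>s. F s * g (amap A s + \<xi>))"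
  using P
proof (induction rule: good_ind)
  case zero then show ?case using good_weyl[OF Q] by (simp add: good_zero)
next
  case (top q \<alpha> b)
  have "good A (\<xi>' + amap A (emb b) - amap A (emb \<alpha>))
     (const_op q \<otimes>\<^bsub>W\<^esub> (xd \<alpha> \<otimes>\<^bsub>W\<^esub> (d_monom b \<otimes>\<^bsub>W\<^esub> Q)))
     (\<lambda>s. q * (gb s \<alpha> * g (amap A (s - emb \<alpha> + emb b))))"
    by (rule good_smult[OF good_xd[OF good_dm[OF Q]]])
  moreover have "\<xi>' + amap A (emb b) - amap A (emb \<alpha>) = \<xi> + \<xi>'" using top by (simp add: algebra_simps)
  moreover have "amap A (s - emb \<alpha> + emb b) = amap A s + \<xi>" for s
    using top by (simp add: amap_add amap_diff algebra_simps)
  ultimately show ?case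
    using good_weyl[OF Q] by (simp add: tmop_def weyl.m_assoc mult.assoc)
next
  case (add P' Q' F G)
  then show ?case using good_add[OF add(3,4)] good_weyl[OF Q] by (simp add: weyl.l_distr distrib_right)
qed

section \<open>Operators whose polynomial vanishes\<close>

lemma left_idealD:
  assumes "left_ideal H W"
  shows "H \<subseteq> carrier W" "\<zero>\<^bsub>W\<^esub> \<in> H" "\<And>x y. x \<in> H \<Longrightarrow> y \<in> H \<Longrightarrow> x \<oplus>\<^bsub>W\<^esub> y \<in> H"
    "\<And>x. x \<in> H \<Longrightarrow> \<ominus>\<^bsub>W\<^esub> x \<in> H" "\<And>r x. r \<in> carrier W \<Longrightarrow> x \<in> H \<Longrightarrow> r \<otimes>\<^bsub>W\<^esub> x \<in> H"
    "\<And>x y. x \<in> H \<Longrightarrow> y \<in> H \<Longrightarrow> x \<ominus>\<^bsub>W\<^esub> y \<in> H"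
proof -
  interpret additive_subgroup H W using assms by (simp add: left_ideal_def)
  show "H \<subseteq> carrier W" by (rule a_subset)
  show "\<zero>\<^bsub>W\<^esub> \<in> H" by (rule zero_closed)
  show a: "\<And>x y. x \<in> H \<Longrightarrow> y \<in> H \<Longrightarrow> x \<oplus>\<^bsub>W\<^esub> y \<in> H" by (rule a_closed)
  show n: "\<And>x. x \<in> H \<Longrightarrow> \<ominus>\<^bsub>W\<^esub> x \<in> H" by (rule a_inv_closed) (simp_all add: weyl.abelian_group_axioms)
  show "\<And>r x. r \<in> carrier W \<Longrightarrow> x \<in> H \<Longrightarrow> r \<otimes>\<^bsub>W\<^esub> x \<in> H"
    using assms by (simp add: left_ideal_def)
  show "\<And>x y. x \<in> H \<Longrightarrow> y \<in> H \<Longrightarrow> x \<ominus>\<^bsub>W\<^esub> y \<in> H"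
    using a n by (simp add: a_minus_def)
qed

text \<open>
  A left ideal containing the binomials \<open>\<partial>\<^sup>u - \<partial>\<^sup>v\<close> that generate \<open>I\<^sub>A\<close>.
\<close>

definition toric_left :: "int^'n^'d \<Rightarrow> 'n::finite opr set \<Rightarrow> bool" where
  "toric_left A H \<longleftrightarrow> left_ideal H W \<and>
     (\<forall>u v. amap A (emb u) = amap A (emb v) \<longrightarrow> d_monom u \<ominus>\<^bsub>W\<^esub> d_monom v \<in> H)"

lemma opsum_same:
  assumes H: "toric_left A H"
    and l: "\<And>t. t \<in> set l \<Longrightarrow> fst (snd t) = \<alpha> \<and> amap A (emb (snd (snd t))) = amap A (emb b)"
  shows "opsum l \<ominus>\<^bsub>W\<^esub> const_op (\<Sum>t\<leftarrow>l. fst t) \<otimes>\<^bsub>W\<^esub> (xd \<alpha> \<otimes>\<^bsub>W\<^esub> d_monom b) \<in> H"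
  using l
proof (induction l)
  case Nil
  have "left_ideal H W" using H by (simp add: toric_left_def)
  then have "\<zero>\<^bsub>W\<^esub> \<in> H" by (rule left_idealD(2))
  then show ?case by (simp add: const_op_0 a_minus_def)
next
  case (Cons t l)
  obtain q b' where t: "t = (q, \<alpha>, b')" using Cons.prems[of t] by (cases t) auto
  have HL: "left_ideal H W" using H by (simp add: toric_left_def)
  let ?c = "const_op (\<Sum>t\<leftarrow>l. fst t)" and ?x = "xd \<alpha>"
  have "d_monom b' \<ominus>\<^bsub>W\<^esub> d_monom b \<in> H"
    using H Cons.prems[of t] unfolding toric_left_def t by simp
  then have "const_op q \<otimes>\<^bsub>W\<^esub> (?x \<otimes>\<^bsub>W\<^esub> (d_monom b' \<ominus>\<^bsub>W\<^esub> d_monom b)) \<in> H"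
    by (intro left_idealD(5)[OF HL]) simp_all
  moreover have "opsum l \<ominus>\<^bsub>W\<^esub> ?c \<otimes>\<^bsub>W\<^esub> (?x \<otimes>\<^bsub>W\<^esub> d_monom b) \<in> H"
    by (rule Cons.IH) (use Cons.prems in auto)
  ultimately have "const_op q \<otimes>\<^bsub>W\<^esub> (?x \<otimes>\<^bsub>W\<^esub> (d_monom b' \<ominus>\<^bsub>W\<^esub> d_monom b)) \<oplus>\<^bsub>W\<^esub>
      (opsum l \<ominus>\<^bsub>W\<^esub> ?c \<otimes>\<^bsub>W\<^esub> (?x \<otimes>\<^bsub>W\<^esub> d_monom b)) \<in> H"
    by (rule left_idealD(3)[OF HL])
  moreover have "const_op q \<otimes>\<^bsub>W\<^esub> (?x \<otimes>\<^bsub>W\<^esub> (d_monom b' \<ominus>\<^bsub>W\<^esub> d_monom b)) \<oplus>\<^bsub>W\<^esub>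
      (opsum l \<ominus>\<^bsub>W\<^esub> ?c \<otimes>\<^bsub>W\<^esub> (?x \<otimes>\<^bsub>W\<^esub> d_monom b)) =
      opsum (t # l) \<ominus>\<^bsub>W\<^esub> const_op (\<Sum>t\<leftarrow>t # l. fst t) \<otimes>\<^bsub>W\<^esub> (?x \<otimes>\<^bsub>W\<^esub> d_monom b)"
    by (simp add: t tmop_def a_minus_def const_op_add[symmetric] weyl.l_distr weyl.r_distr weyl.r_minus
        weyl.l_minus weyl.minus_add weyl.a_assoc weyl.a_comm weyl.a_lcomm)
  ultimately show ?case by simp
qed

lemma fsum_same:
  "(\<And>t. t \<in> set l \<Longrightarrow> fst (snd t) = \<alpha>) \<Longrightarrow> fsum l s = (\<Sum>t\<leftarrow>l. fst t) * gb s \<alpha>"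
  unfolding fsum_def by (induction l) (simp_all add: distrib_right)

text \<open>
  If the Newton expansion vanishes at a multi-index \<open>\<alpha>\<close> below which no other term lives, the
  coefficient of \<open>gb s \<alpha>\<close> is zero, because the other binomial coefficients vanish at \<open>\<alpha>\<close>.
\<close>

lemma fsum_minimal:
  assumes "fsum l (emb \<alpha>) = 0" and min: "\<And>t. t \<in> set l \<Longrightarrow> fst (snd t) \<le> \<alpha> \<Longrightarrow> msize \<alpha> \<le> msize (fst (snd t))"
  shows "(\<Sum>t\<leftarrow>filter (\<lambda>t. fst (snd t) = \<alpha>) l. fst t) = 0"
proof -
  have le: "\<gamma> = \<alpha>" if "\<gamma> \<le> \<alpha>" "msize \<alpha> \<le> msize \<gamma>" for \<gamma>
  proof -
    have "\<gamma> + (\<alpha> - \<gamma>) = \<alpha>" using that by (simp add: vec_eq_iff less_eq_vec_def)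
    then have "msize \<alpha> = msize \<gamma> + msize (\<alpha> - \<gamma>)" by (metis msize_add)
    then have "msize (\<alpha> - \<gamma>) = 0" using that by simp
    then have "\<alpha> - \<gamma> = 0" by (simp add: msize_def vec_eq_iff)
    then show ?thesis using \<open>\<gamma> + (\<alpha> - \<gamma>) = \<alpha>\<close> by simp
  qed
  have "fst t * gb (emb \<alpha>) (fst (snd t)) = 0" if "t \<in> set l" "fst (snd t) \<noteq> \<alpha>" for t
    using le min that gb_emb_eq_0 by (metis mult_zero_right)
  then have "fsum (filter (\<lambda>t. fst (snd t) \<noteq> \<alpha>) l) (emb \<alpha>) = 0"
    unfolding fsum_def by (intro sum_list_0 | induction l) auto
  then have "fsum (filter (\<lambda>t. fst (snd t) = \<alpha>) l) (emb \<alpha>) = 0"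
    using assms(1) fsum_filter[of l "emb \<alpha>" "\<lambda>t. fst (snd t) = \<alpha>"] by simp
  then show ?thesis by (subst (asm) fsum_same[where \<alpha> = \<alpha>]) auto
qed

lemma exists_minimal_term:
  assumes "\<exists>t\<in>set l. Q t"
  shows "\<exists>t. (t \<in> set l \<and> Q t) \<and> (\<forall>t'. t' \<in> set l \<and> Q t' \<longrightarrow> msize (fst (snd t)) \<le> msize (fst (snd t')))"
proof -
  obtain t where "t \<in> set l \<and> Q t" using assms by blast
  then show ?thesis by (rule ex_has_least_nat)
qed

text \<open>
  Terms with the same \<open>\<alpha>\<close> and the same weight differ only by binomials of \<open>I\<^sub>A\<close> in the derivatives.
  If the polynomial is zero the coefficients of each \<open>\<alpha>\<close> add up to zero, so that the whole operator is in
  the ideal; the terms are removed in order of the size of \<open>\<alpha>\<close>.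
\<close>

lemma opsum_vanish:
  assumes H: "toric_left A H"
    and l: "\<And>t. t \<in> set l \<Longrightarrow> amap A (emb (snd (snd t))) - amap A (emb (fst (snd t))) = \<xi>"
    and z: "\<And>k. fsum l (emb k) = 0"
  shows "opsum l \<in> H"
  using l z
proof (induction "length l" arbitrary: l rule: less_induct)
  case less
  have HL: "left_ideal H W" using H by (simp add: toric_left_def)
  show ?case
  proof (cases "l = []")
    case True then show ?thesis using left_idealD(2)[OF HL] by simp
  next
    case False
    then have "\<exists>t\<in>set l. True" using hd_in_set by blast
    from exists_minimal_term[OF this]
    obtain t where t: "t \<in> set l" "\<And>t'. t' \<in> set l \<Longrightarrow> msize (fst (snd t)) \<le> msize (fst (snd t'))"
      by blast
    define \<alpha> where "\<alpha> = fst (snd t)"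
    let ?l1 = "filter (\<lambda>t. fst (snd t) = \<alpha>) l" and ?l2 = "filter (\<lambda>t. \<not> fst (snd t) = \<alpha>) l"
    have s0: "(\<Sum>t\<leftarrow>?l1. fst t) = 0"
      by (rule fsum_minimal) (use less.prems t in \<open>auto simp: \<alpha>_def\<close>)
    have "opsum ?l1 \<ominus>\<^bsub>W\<^esub> const_op (\<Sum>t\<leftarrow>?l1. fst t) \<otimes>\<^bsub>W\<^esub> (xd \<alpha> \<otimes>\<^bsub>W\<^esub> d_monom (snd (snd t))) \<in> H"
    proof (rule opsum_same[OF H])
      fix t' assume t': "t' \<in> set ?l1"
      then have "amap A (emb (snd (snd t'))) - amap A (emb \<alpha>) = amap A (emb (snd (snd t))) - amap A (emb \<alpha>)"
        using less.prems(1)[of t'] less.prems(1)[OF t(1)] \<alpha>_def by simp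
      then show "fst (snd t') = \<alpha> \<and> amap A (emb (snd (snd t'))) = amap A (emb (snd (snd t)))"
        using t' by simp
    qed
    then have 1: "opsum ?l1 \<in> H" unfolding s0 by (simp add: const_op_0 a_minus_def)
    have "opsum ?l2 \<in> H"
    proof (rule less.hyps)
      show "length ?l2 < length l" using t(1) by (intro length_filter_less[of t]) (simp_all add: \<alpha>_def)
      show "fsum ?l2 (emb k) = 0" for k
        using less.prems(2)[of k] fsum_filter[of l "emb k" "\<lambda>t. fst (snd t) = \<alpha>"] fsum_same[of ?l1 \<alpha> "emb k"] s0
        by simp
    qed (use less.prems in auto)
    then show ?thesis
      using left_idealD(3)[OF HL 1] opsum_filter[of l "\<lambda>t. fst (snd t) = \<alpha>"] by simp
  qed
qed

lemma good_vanish: "toric_left A H \<Longrightarrow> good A \<xi> P F \<Longrightarrow> (\<And>k. F (emb k) = 0) \<Longrightarrow> P \<in> H"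
  unfolding good_def using opsum_vanish by blast

lemma good_unique:
  assumes "toric_left A H" "good A \<xi> P F" "good A \<xi> Q F"
  shows "P \<ominus>\<^bsub>W\<^esub> Q \<in> H"
proof (rule good_vanish[OF assms(1)])
  have "\<ominus>\<^bsub>W\<^esub> Q = const_op (-1) \<otimes>\<^bsub>W\<^esub> Q"
    using good_weyl[OF assms(3)] by (simp add: const_op_neg[symmetric] const_op_1 weyl.l_minus)
  then show "good A \<xi> (P \<ominus>\<^bsub>W\<^esub> Q) (\<lambda>s. F s + (-1) * F s)"
    unfolding a_minus_def using good_add[OF assms(2) good_smult[OF assms(3), of "-1"]] by simp
qed simp

section \<open>Newton expansion\<close>

text \<open>
  Finite linear combinations of the Newton basis, which by the next results are all polynomials.
\<close>

definition newt :: "(complex^'n \<Rightarrow> complex) \<Rightarrow> bool" where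
  "newt F \<longleftrightarrow> (\<exists>l. F = fsum l)"

lemma newt_add: "newt F \<Longrightarrow> newt G \<Longrightarrow> newt (\<lambda>s. F s + G s)"
proof -
  assume "newt F" "newt G"
  then obtain l l' where "F = fsum l" "G = fsum l'" unfolding newt_def by blast
  then show ?thesis unfolding newt_def by (intro exI[of _ "l @ l'"]) (simp add: fsum_def fun_eq_iff)
qed

lemma newt_gb: "newt (\<lambda>s. q * gb s \<alpha>)"
  unfolding newt_def by (intro exI[of _ "[(q, \<alpha>, 0)]"]) (simp add: fsum_def fun_eq_iff)

lemma newt_ind [consumes 1, case_names zero gb add]:
  assumes "newt F" "\<Phi> (\<lambda>s. 0)" "\<And>q \<alpha>. \<Phi> (\<lambda>s. q * gb s \<alpha>)" "\<And>F G. \<Phi> F \<Longrightarrow> \<Phi> G \<Longrightarrow> \<Phi> (\<lambda>s. F s + G s)"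
  shows "\<Phi> F"
proof -
  have "\<Phi> (fsum l)" for l
  proof (induction l)
    case Nil
    then show ?case using assms(2) by (simp add: fsum_def[abs_def])
  next
    case (Cons t l)
    have "fsum (t # l) = (\<lambda>s. fst t * gb s (fst (snd t)) + fsum l s)" by (simp add: fsum_def fun_eq_iff)
    then show ?case using assms(4)[OF assms(3) Cons] by simp
  qed
  then show ?thesis using assms(1) unfolding newt_def by blast
qed

lemma gb_coord: "s $ i * gb s \<alpha> = of_nat (\<alpha> $ i) * gb s \<alpha> + of_nat (\<alpha> $ i + 1) * gb s (\<alpha> + ue i)"
proof -
  let ?R = "\<Prod>k\<in>UNIV - {i}. (s $ k) gchoose (\<alpha> $ k)"
  have 1: "gb s \<alpha> = ((s $ i) gchoose (\<alpha> $ i)) * ?R"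
    unfolding gb_def by (subst prod.remove[of _ i]) auto
  have 2: "gb s (\<alpha> + ue i) = ((s $ i) gchoose (Suc (\<alpha> $ i))) * ?R"
    unfolding gb_def by (subst prod.remove[of _ i]) (auto intro!: prod.cong)
  have "s $ i * ((s $ i) gchoose (\<alpha> $ i)) = of_nat (\<alpha> $ i) * ((s $ i) gchoose (\<alpha> $ i))
      + of_nat (Suc (\<alpha> $ i)) * ((s $ i) gchoose (Suc (\<alpha> $ i)))"
    by (rule gbinomial_mult_1)
  then have "(s $ i * ((s $ i) gchoose (\<alpha> $ i))) * ?R = (of_nat (\<alpha> $ i) * ((s $ i) gchoose (\<alpha> $ i))
      + of_nat (Suc (\<alpha> $ i)) * ((s $ i) gchoose (Suc (\<alpha> $ i)))) * ?R" by simp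
  then show ?thesis unfolding 1 2 by (simp add: distrib_right mult.assoc del: of_nat_Suc)
qed

lemma newt_polyfn:
  assumes "polyfn p" "newt F" shows "newt (\<lambda>s. p s * F s)"
  using assms
proof (induction arbitrary: F)
  case (const c)
  from const show ?case
  proof (induction rule: newt_ind)
    case zero then show ?case using newt_gb[of 0 0] by simp
  next
    case (gb q \<alpha>) then show ?case using newt_gb[of "c * q" \<alpha>] by (simp add: mult.assoc)
  next
    case (add F G) then show ?case using newt_add by (simp add: distrib_left)
  qed
next
  case (coord i)
  from coord show ?case
  proof (induction rule: newt_ind)
    case zero then show ?case using newt_gb[of 0 0] by simp
  next
    case (gb q \<alpha>)
    have "newt (\<lambda>s. (q * of_nat (\<alpha> $ i)) * gb s \<alpha> + (q * of_nat (\<alpha> $ i + 1)) * gb s (\<alpha> + ue i))"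
      by (intro newt_add newt_gb)
    moreover have "s $ i * (q * gb s \<alpha>) = (q * of_nat (\<alpha> $ i)) * gb s \<alpha> + (q * of_nat (\<alpha> $ i + 1)) * gb s (\<alpha> + ue i)" for s
      using gb_coord[of s i \<alpha>] by (simp only: mult.left_commute[of "s $ i" q]) (simp add: distrib_left mult.assoc)
    ultimately show ?case by simp
  next
    case (add F G) then show ?case using newt_add by (simp add: distrib_left)
  qed
next
  case (add p q)
  then show ?case using newt_add[OF add.IH(1)[OF add.prems] add.IH(2)[OF add.prems]] by (simp add: distrib_right)
next
  case (mult p q) then show ?case by (simp add: mult.assoc)
qed

text \<open>
  The Newton expansion of a polynomial that vanishes on a set of multi-indices closed downwards needs
  no basis element from that set.
\<close>

lemma newt_vanish:
  assumes D: "\<And>k \<alpha>. \<alpha> \<in> D \<Longrightarrow> k \<le> \<alpha> \<Longrightarrow> k \<in> D" and z: "\<And>k. k \<in> D \<Longrightarrow> fsum l (emb k) = 0"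
  shows "\<exists>l'. fsum l' = fsum l \<and> (\<forall>t\<in>set l'. fst (snd t) \<notin> D)"
  using z
proof (induction "length l" arbitrary: l rule: less_induct)
  case less
  show ?case
  proof (cases "\<exists>t\<in>set l. fst (snd t) \<in> D")
    case False then show ?thesis by blast
  next
    case True
    from exists_minimal_term[OF this]
    obtain t where t: "t \<in> set l" "fst (snd t) \<in> D"
      "\<And>t'. t' \<in> set l \<Longrightarrow> fst (snd t') \<in> D \<Longrightarrow> msize (fst (snd t)) \<le> msize (fst (snd t'))"
      by blast
    define \<alpha> where "\<alpha> = fst (snd t)"
    let ?l1 = "filter (\<lambda>t. fst (snd t) = \<alpha>) l" and ?l2 = "filter (\<lambda>t. \<not> fst (snd t) = \<alpha>) l"
    have s0: "(\<Sum>t\<leftarrow>?l1. fst t) = 0"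
      by (rule fsum_minimal) (use less.prems t D in \<open>auto simp: \<alpha>_def\<close>)
    have eq: "fsum ?l2 = fsum l"
      using fsum_filter[of l _ "\<lambda>t. fst (snd t) = \<alpha>"] fsum_same[of ?l1 \<alpha>] s0 by (simp add: fun_eq_iff)
    have "\<exists>l'. fsum l' = fsum ?l2 \<and> (\<forall>t\<in>set l'. fst (snd t) \<notin> D)"
    proof (rule less.hyps)
      show "length ?l2 < length l" using t(1) by (intro length_filter_less[of t]) (simp_all add: \<alpha>_def)
      show "fsum ?l2 (emb k) = 0" if "k \<in> D" for k using less.prems that eq by simp
    qed
    then show ?thesis using eq by simp
  qed
qed

text \<open>
  A polynomial vanishing wherever the shift by \<open>\<xi>\<close> leads out of \<open>\<nat>A\<close> comes from an operator of
  weight \<open>\<xi>\<close>: the remaining \<open>\<alpha>\<close> in its Newton expansion admit \<open>b\<close> with \<open>A b = A \<alpha> + \<xi>\<close>.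
\<close>

lemma good_exists:
  assumes F: "polyfn F"
    and z: "\<And>k. \<not> (\<exists>b. amap A (emb b) = amap A (emb k) + \<xi>) \<Longrightarrow> F (emb k) = 0"
  shows "\<exists>P. good A \<xi> P F"
proof -
  have "newt (\<lambda>s. F s * (1 * gb s 0))" by (rule newt_polyfn[OF F newt_gb])
  then obtain l where l: "F = fsum l" unfolding newt_def by auto
  define D where "D = {k. \<not> (\<exists>b. amap A (emb b) = amap A (emb k) + \<xi>)}"
  have "\<exists>l'. fsum l' = fsum l \<and> (\<forall>t\<in>set l'. fst (snd t) \<notin> D)"
  proof (rule newt_vanish)
    fix k \<alpha> :: "nat^'a" assume *: "\<alpha> \<in> D" "k \<le> \<alpha>"
    show "k \<in> D"
    proof (rule ccontr)
      assume "k \<notin> D"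
      then obtain b where b: "amap A (emb b) = amap A (emb k) + \<xi>" unfolding D_def by blast
      \<comment> \<open>enlarging \<open>k\<close> keeps \<open>A k + \<xi>\<close> in \<open>\<nat>A\<close>, so that the complement is closed downwards\<close>
      have "amap A (emb (b + (\<alpha> - k))) = amap A (emb \<alpha>) + \<xi>"
        using b by (simp add: emb_add amap_add emb_diff[OF *(2)] amap_diff)
      then show False using * unfolding D_def by blast
    qed
  qed (use z l in \<open>auto simp: D_def\<close>)
  then obtain l' where l': "fsum l' = F" "\<forall>t\<in>set l'. fst (snd t) \<notin> D" using l by blast
  then have "\<forall>t\<in>set l'. \<exists>b. amap A (emb b) = amap A (emb (fst (snd t))) + \<xi>"
    unfolding D_def by blast
  then obtain bf where bf: "\<And>t. t \<in> set l' \<Longrightarrow> amap A (emb (bf t)) = amap A (emb (fst (snd t))) + \<xi>"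
    by metis
  let ?l = "map (\<lambda>t. (fst t, fst (snd t), bf t)) l'"
  have "fsum ?l = F" unfolding l'(1)[symmetric] by (simp add: fsum_def[abs_def] comp_def)
  then show ?thesis unfolding good_def using bf by (intro exI[of _ "opsum ?l"] exI[of _ ?l]) auto
qed

section \<open>The hypergeometric left ideal\<close>

lemma subgroup_of_ring:
  assumes R: "ring R" and "H \<subseteq> carrier R" "\<zero>\<^bsub>R\<^esub> \<in> H" "\<And>x y. x \<in> H \<Longrightarrow> y \<in> H \<Longrightarrow> x \<oplus>\<^bsub>R\<^esub> y \<in> H"
    "\<And>x. x \<in> H \<Longrightarrow> \<ominus>\<^bsub>R\<^esub> x \<in> H"
  shows "subgroup H (add_monoid R)"
  using assms(2-5) by (auto simp: subgroup_def a_inv_def)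

lemma weyl_neg: "P \<in> carrier W \<Longrightarrow> \<ominus>\<^bsub>W\<^esub> P = const_op (-1) \<otimes>\<^bsub>W\<^esub> P"
  by (simp add: const_op_neg[symmetric] const_op_1 weyl.l_minus)

lemma left_idealI:
  assumes "H \<subseteq> carrier W" "\<zero>\<^bsub>W\<^esub> \<in> H" "\<And>x y. x \<in> H \<Longrightarrow> y \<in> H \<Longrightarrow> x \<oplus>\<^bsub>W\<^esub> y \<in> H"
    "\<And>r x. r \<in> carrier W \<Longrightarrow> x \<in> H \<Longrightarrow> r \<otimes>\<^bsub>W\<^esub> x \<in> H"
  shows "left_ideal H W"
  unfolding left_ideal_def
proof (intro conjI ballI)
  show "additive_subgroup H W"
  proof (rule additive_subgroupI, rule subgroup_of_ring[OF weyl_ring])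
    fix x assume "x \<in> H"
    then show "\<ominus>\<^bsub>W\<^esub> x \<in> H"
      using assms(4)[of "const_op (-1)" x] weyl_neg[OF subsetD[OF assms(1)]] by simp
  qed (use assms in auto)
qed (use assms in auto)

lemma gen_left_ideal_left_ideal:
  assumes "S \<subseteq> carrier W" shows "left_ideal (gen_left_ideal W S) W"
proof (rule left_idealI)
  have "left_ideal (carrier W) W" by (rule left_idealI) auto
  then show "gen_left_ideal W S \<subseteq> carrier W" unfolding gen_left_ideal_def using assms by blast
  show "\<zero>\<^bsub>W\<^esub> \<in> gen_left_ideal W S"
    unfolding gen_left_ideal_def using left_idealD(2) by blast
  show "x \<oplus>\<^bsub>W\<^esub> y \<in> gen_left_ideal W S" if "x \<in> gen_left_ideal W S" "y \<in> gen_left_ideal W S" for x y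
    using that left_idealD(3) unfolding gen_left_ideal_def by blast
  show "r \<otimes>\<^bsub>W\<^esub> x \<in> gen_left_ideal W S" if "r \<in> carrier W" "x \<in> gen_left_ideal W S" for r x
    using that left_idealD(5) unfolding gen_left_ideal_def by blast
qed

lemma gen_left_ideal_superset: "S \<subseteq> gen_left_ideal W S"
  unfolding gen_left_ideal_def by blast

lemma gen_left_ideal_minimal: "left_ideal I W \<Longrightarrow> S \<subseteq> I \<Longrightarrow> gen_left_ideal W S \<subseteq> I"
  unfolding gen_left_ideal_def by blast

interpretation dp: cring "d_polys :: 'n::finite opr ring" by (rule d_polys_cring)

lemma amap_emb_int: "amap A (emb u) $ i = of_int ((A *v (\<chi> j. int (u $ j))) $ i)"
  by (simp add: amap_def matrix_vector_mult_def)

lemma amap_emb_eq: "A *v (\<chi> j. int (u $ j)) = A *v (\<chi> j. int (v $ j)) \<longleftrightarrow> amap A (emb u) = amap A (emb v)"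
  by (simp add: vec_eq_iff amap_emb_int)

abbreviation binomials :: "int^'n^'d \<Rightarrow> 'n::finite opr set" where
  "binomials A \<equiv> {d_monom u \<ominus>\<^bsub>d_polys\<^esub> d_monom v | u v.
        A *v (\<chi> j. int (u $ j)) = A *v (\<chi> j. int (v $ j))}"

lemma binomials_closed: "binomials A \<subseteq> carrier d_polys"
  by auto

lemma toric_ideal_ideal: "ideal (toric_ideal A) d_polys"
  unfolding toric_ideal_def by (rule dp.genideal_ideal[OF binomials_closed])

lemma toric_ideal_weyl: "toric_ideal A \<subseteq> carrier W"
proof -
  interpret ideal "toric_ideal A" d_polys by (rule toric_ideal_ideal)
  show ?thesis using a_subset d_polys_weyl by blast
qed

lemma d_polys_minus_weyl:
  assumes "P \<in> carrier d_polys" "Q \<in> carrier d_polys"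
  shows "P \<ominus>\<^bsub>d_polys\<^esub> Q = P \<ominus>\<^bsub>W\<^esub> Q"
proof (rule weyl_eqI)
  show "P \<ominus>\<^bsub>d_polys\<^esub> Q \<in> carrier W" "P \<ominus>\<^bsub>W\<^esub> Q \<in> carrier W"
    using assms d_polys_weyl dp.minus_closed by auto
  fix V :: "(complex^'a) set" and f x assume *: "open V" "f \<in> hol_funs V" "x \<in> V"
  have n: "(\<ominus>\<^bsub>d_polys\<^esub> Q) V f x = - Q V f x"
    by (rule a_inv_eval[OF d_polys_ring, where U = UNIV]) (use * assms in simp_all)
  have "(P \<ominus>\<^bsub>d_polys\<^esub> Q) V f x = P V f x + (\<ominus>\<^bsub>d_polys\<^esub> Q) V f x"
    using * by (simp add: a_minus_def)
  also have "\<dots> = (P \<ominus>\<^bsub>W\<^esub> Q) V f x"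
    using * n weyl_neg_eval[OF * d_polys_weyl[OF assms(2)]] by (simp add: a_minus_def weyl_add_eval)
  finally show "(P \<ominus>\<^bsub>d_polys\<^esub> Q) V f x = (P \<ominus>\<^bsub>W\<^esub> Q) V f x" .
qed

text \<open>
  The \<open>i\<close>-th Euler operator without the parameter.
\<close>

definition Eop :: "int^'n^'d \<Rightarrow> 'd \<Rightarrow> 'n::finite opr" where
  "Eop A i = finsum W (\<lambda>j. const_op (of_int (A $ i $ j)) \<otimes>\<^bsub>W\<^esub> (x_op j \<otimes>\<^bsub>W\<^esub> d_op j)) UNIV"

lemma euler_op_eq: "euler_op A \<beta> i = Eop A i \<ominus>\<^bsub>W\<^esub> const_op (\<beta> $ i)"
  by (simp add: euler_op_def Eop_def)

lemma Eop_weyl [simp]: "Eop A i \<in> carrier W"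
  unfolding Eop_def by (rule weyl.finsum_closed) auto

lemma euler_op_weyl [simp]: "euler_op A \<beta> i \<in> carrier W"
  by (simp add: euler_op_eq)

lemma H_ideal_gens: "toric_ideal A \<union> range (euler_op A \<beta>) \<subseteq> carrier W"
  using toric_ideal_weyl by auto

lemma H_ideal_left: "left_ideal (H_ideal A \<beta>) W"
  unfolding H_ideal_def by (rule gen_left_ideal_left_ideal[OF H_ideal_gens])

lemma euler_in_H: "euler_op A \<beta> i \<in> H_ideal A \<beta>"
  unfolding H_ideal_def by (rule subsetD[OF gen_left_ideal_superset]) simp

lemma H_ideal_toric: "toric_left A (H_ideal A \<beta>)"
  unfolding toric_left_def
proof (intro conjI allI impI H_ideal_left)
  fix u v :: "nat^'a" assume "amap A (emb u) = amap A (emb v)"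
  then have "d_monom u \<ominus>\<^bsub>d_polys\<^esub> d_monom v \<in> binomials A"
    using amap_emb_eq by blast
  then have "d_monom u \<ominus>\<^bsub>d_polys\<^esub> d_monom v \<in> toric_ideal A"
    unfolding toric_ideal_def using dp.genideal_self[OF binomials_closed] by blast
  then show "d_monom u \<ominus>\<^bsub>W\<^esub> d_monom v \<in> H_ideal A \<beta>"
    unfolding H_ideal_def using gen_left_ideal_superset[of "toric_ideal A \<union> range (euler_op A \<beta>)"]
    by (auto simp: d_polys_minus_weyl)
qed

text \<open>
  \<open>H\<^sub>A(\<beta>)\<close> is generated as a left ideal by the binomials and the Euler operators. The point is
  that \<open>I\<^sub>A\<close> is generated as an ideal of the polynomial ring; as that ring is commutative, its
  intersection with a left ideal of the Weyl algebra is an ideal.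
\<close>

lemma H_ideal_least:
  assumes I: "left_ideal I W"
    and b: "\<And>u v. amap A (emb u) = amap A (emb v) \<Longrightarrow> d_monom u \<ominus>\<^bsub>W\<^esub> d_monom v \<in> I"
    and e: "\<And>i. euler_op A \<beta> i \<in> I"
  shows "H_ideal A \<beta> \<subseteq> I"
  unfolding H_ideal_def
proof (rule gen_left_ideal_minimal[OF I])
  let ?J = "carrier d_polys \<inter> I"
  have "ideal ?J d_polys"
  proof (rule idealI)
    show "ring (d_polys :: 'a opr ring)" by (rule d_polys_ring)
    show "subgroup ?J (add_monoid d_polys)"
    proof (rule subgroup_of_ring[OF d_polys_ring])
      show "\<zero>\<^bsub>d_polys\<^esub> \<in> ?J" using left_idealD(2)[OF I] dp.zero_closed by (simp add: weyl_fields)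
      show "x \<oplus>\<^bsub>d_polys\<^esub> y \<in> ?J" if "x \<in> ?J" "y \<in> ?J" for x y
        using that left_idealD(3)[OF I, of x y] dp.a_closed[of x y] by (simp add: weyl_fields)
      show "\<ominus>\<^bsub>d_polys\<^esub> x \<in> ?J" if x: "x \<in> ?J" for x
      proof -
        have "\<zero>\<^bsub>d_polys\<^esub> \<ominus>\<^bsub>d_polys\<^esub> x = \<zero>\<^bsub>W\<^esub> \<ominus>\<^bsub>W\<^esub> x"
          using d_polys_minus_weyl[of "\<zero>\<^bsub>d_polys\<^esub>" x] x dp.zero_closed by (simp add: weyl_fields)
        moreover have "\<zero>\<^bsub>d_polys\<^esub> \<ominus>\<^bsub>d_polys\<^esub> x = \<ominus>\<^bsub>d_polys\<^esub> x"
          unfolding a_minus_def using x by (intro dp.l_zero dp.a_inv_closed) simp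
        moreover have "\<zero>\<^bsub>W\<^esub> \<ominus>\<^bsub>W\<^esub> x \<in> I"
          using left_idealD(6)[OF I left_idealD(2)[OF I]] x by simp
        ultimately show ?thesis using x dp.a_inv_closed by simp
      qed
    qed auto
    show l: "x \<otimes>\<^bsub>d_polys\<^esub> a \<in> ?J" if "a \<in> ?J" "x \<in> carrier d_polys" for a x
      using that left_idealD(5)[OF I d_polys_weyl[OF that(2)], of a] dp.m_closed[of x a] by (simp add: weyl_fields)
    show "a \<otimes>\<^bsub>d_polys\<^esub> x \<in> ?J" if "a \<in> ?J" "x \<in> carrier d_polys" for a x
      using l[OF that] dp.m_comm[of a x] that by simp
  qed
  then have "toric_ideal A \<subseteq> ?J"
    unfolding toric_ideal_def
  proof (rule dp.genideal_minimal)
    show "binomials A \<subseteq> ?J"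
    proof
      fix x assume "x \<in> binomials A"
      then obtain u v where x: "x = d_monom u \<ominus>\<^bsub>d_polys\<^esub> d_monom v" "amap A (emb u) = amap A (emb v)"
        using amap_emb_eq by blast
      have "x \<in> I" using b[OF x(2)] x(1) by (simp add: d_polys_minus_weyl)
      moreover have "x \<in> carrier d_polys" using x(1) by simp
      ultimately show "x \<in> ?J" by blast
    qed
  qed
  then show "toric_ideal A \<union> range (euler_op A \<beta>) \<subseteq> I" using e by blast
qed

section \<open>Contiguity operators\<close>

lemma good_finsum:
  assumes "finite J" "\<And>j. j \<in> J \<Longrightarrow> good A \<xi> (f j) (F j)"
  shows "good A \<xi> (finsum W f J) (\<lambda>s. \<Sum>j\<in>J. F j s)"
  using assms
proof (induction J rule: finite_induct)
  case empty then show ?case by (simp add: good_zero)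
next
  case (insert j J)
  have "f \<in> J \<rightarrow> carrier W" "f j \<in> carrier W" using insert.prems good_weyl by blast+
  moreover have "good A \<xi> (f j \<oplus>\<^bsub>W\<^esub> finsum W f J) (\<lambda>s. F j s + (\<Sum>j\<in>J. F j s))"
    by (rule good_add) (use insert in auto)
  ultimately show ?case using insert by simp
qed

lemma good_Eop: "good A 0 (Eop A i) (\<lambda>s. amap A s $ i)"
proof -
  have "good A 0 (const_op (of_int (A $ i $ j)) \<otimes>\<^bsub>W\<^esub> (x_op j \<otimes>\<^bsub>W\<^esub> d_op j)) (\<lambda>s. of_int (A $ i $ j) * s $ j)" for j
    using good_top[of A "ue j" "ue j" 0 "of_int (A $ i $ j)"] by (simp add: tmop_def xd_ue d_monom_ue gb_ue)
  then show ?thesis unfolding Eop_def amap_def by (simp add: good_finsum)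
qed

lemma good_one: "good A 0 (const_op c) (\<lambda>s. c)"
  using good_top[of A 0 0 0 c] by (simp add: tmop_def xd_0 d_monom_0_weyl del: d_monom_0)

lemma weyl_minus_telescope:
  assumes "x \<in> carrier W" "y \<in> carrier W" "z \<in> carrier W"
  shows "(x \<ominus>\<^bsub>W\<^esub> y) \<oplus>\<^bsub>W\<^esub> (y \<ominus>\<^bsub>W\<^esub> z) = x \<ominus>\<^bsub>W\<^esub> z"
proof -
  have "(x \<ominus>\<^bsub>W\<^esub> y) \<oplus>\<^bsub>W\<^esub> (y \<ominus>\<^bsub>W\<^esub> z) = x \<oplus>\<^bsub>W\<^esub> ((\<ominus>\<^bsub>W\<^esub> y \<oplus>\<^bsub>W\<^esub> y) \<oplus>\<^bsub>W\<^esub> \<ominus>\<^bsub>W\<^esub> z)"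
    using assms by (simp add: a_minus_def weyl.a_assoc)
  also have "\<dots> = x \<ominus>\<^bsub>W\<^esub> z" using assms by (simp add: weyl.l_neg a_minus_def)
  finally show ?thesis .
qed

text \<open>
  Modulo \<open>H\<^sub>A(\<beta>)\<close>, a polynomial in the Euler operators is congruent to its value at \<open>\<beta>\<close>.
\<close>

lemma euler_poly_exists:
  assumes "polyfn f"
  shows "\<exists>R. good A 0 R (\<lambda>s. f (amap A s)) \<and> R \<ominus>\<^bsub>W\<^esub> const_op (f \<beta>) \<in> H_ideal A \<beta>"
  using assms
proof induction
  case (const c)
  have "const_op c \<ominus>\<^bsub>W\<^esub> const_op c = \<zero>\<^bsub>W\<^esub>" by (simp add: a_minus_def weyl.r_neg)
  then show ?case using good_one left_idealD(2)[OF H_ideal_left] by metis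
next
  case (coord i)
  show ?case using good_Eop euler_in_H[of A \<beta> i] unfolding euler_op_eq by blast
next
  case (add f g)
  then obtain R S where R: "good A 0 R (\<lambda>s. f (amap A s))" "R \<ominus>\<^bsub>W\<^esub> const_op (f \<beta>) \<in> H_ideal A \<beta>"
    and S: "good A 0 S (\<lambda>s. g (amap A s))" "S \<ominus>\<^bsub>W\<^esub> const_op (g \<beta>) \<in> H_ideal A \<beta>" by blast
  have c: "R \<in> carrier W" "S \<in> carrier W" using R S good_weyl by blast+
  have "(R \<ominus>\<^bsub>W\<^esub> const_op (f \<beta>)) \<oplus>\<^bsub>W\<^esub> (S \<ominus>\<^bsub>W\<^esub> const_op (g \<beta>)) = (R \<oplus>\<^bsub>W\<^esub> S) \<ominus>\<^bsub>W\<^esub> const_op (f \<beta> + g \<beta>)"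
    using c by (simp add: a_minus_def const_op_add[symmetric] weyl.minus_add weyl.a_assoc weyl.a_lcomm weyl.a_comm)
  then have "(R \<oplus>\<^bsub>W\<^esub> S) \<ominus>\<^bsub>W\<^esub> const_op (f \<beta> + g \<beta>) \<in> H_ideal A \<beta>"
    using left_idealD(3)[OF H_ideal_left R(2) S(2)] by simp
  then show ?case using good_add[OF R(1) S(1)] by blast
next
  case (mult f g)
  then obtain R S where R: "good A 0 R (\<lambda>s. f (amap A s))" "R \<ominus>\<^bsub>W\<^esub> const_op (f \<beta>) \<in> H_ideal A \<beta>"
    and S: "good A 0 S (\<lambda>s. g (amap A s))" "S \<ominus>\<^bsub>W\<^esub> const_op (g \<beta>) \<in> H_ideal A \<beta>" by blast
  have c: "R \<in> carrier W" "S \<in> carrier W" using R S good_weyl by blast+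
  have "R \<otimes>\<^bsub>W\<^esub> (S \<ominus>\<^bsub>W\<^esub> const_op (g \<beta>)) \<oplus>\<^bsub>W\<^esub> const_op (g \<beta>) \<otimes>\<^bsub>W\<^esub> (R \<ominus>\<^bsub>W\<^esub> const_op (f \<beta>)) \<in> H_ideal A \<beta>"
    by (intro left_idealD(3,5)[OF H_ideal_left] R S c) simp
  moreover have "R \<otimes>\<^bsub>W\<^esub> (S \<ominus>\<^bsub>W\<^esub> const_op (g \<beta>)) \<oplus>\<^bsub>W\<^esub> const_op (g \<beta>) \<otimes>\<^bsub>W\<^esub> (R \<ominus>\<^bsub>W\<^esub> const_op (f \<beta>))
      = (R \<otimes>\<^bsub>W\<^esub> S \<ominus>\<^bsub>W\<^esub> const_op (g \<beta>) \<otimes>\<^bsub>W\<^esub> R) \<oplus>\<^bsub>W\<^esub> (const_op (g \<beta>) \<otimes>\<^bsub>W\<^esub> R \<ominus>\<^bsub>W\<^esub> const_op (f \<beta> * g \<beta>))"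
    using c by (simp add: a_minus_def weyl.r_distr weyl.r_minus const_op_central const_op_mult mult.commute)
  ultimately have "R \<otimes>\<^bsub>W\<^esub> S \<ominus>\<^bsub>W\<^esub> const_op (f \<beta> * g \<beta>) \<in> H_ideal A \<beta>"
    using c by (simp add: weyl_minus_telescope)
  moreover have "good A (0 + 0) (R \<otimes>\<^bsub>W\<^esub> S) (\<lambda>s. f (amap A s) * g (amap A s + 0))"
    by (rule good_mult[OF R(1) S(1)])
  ultimately show ?case by auto
qed

lemma euler_poly_value:
  assumes "polyfn f" "good A 0 R (\<lambda>s. f (amap A s))"
  shows "R \<ominus>\<^bsub>W\<^esub> const_op (f \<beta>) \<in> H_ideal A \<beta>"
proof -
  obtain R' where R': "good A 0 R' (\<lambda>s. f (amap A s))" "R' \<ominus>\<^bsub>W\<^esub> const_op (f \<beta>) \<in> H_ideal A \<beta>"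
    using euler_poly_exists[OF assms(1)] by blast
  have "(R \<ominus>\<^bsub>W\<^esub> R') \<oplus>\<^bsub>W\<^esub> (R' \<ominus>\<^bsub>W\<^esub> const_op (f \<beta>)) \<in> H_ideal A \<beta>"
    by (rule left_idealD(3)[OF H_ideal_left good_unique[OF H_ideal_toric assms(2) R'(1)] R'(2)])
  then show ?thesis
    using good_weyl[OF assms(2)] good_weyl[OF R'(1)] by (simp add: weyl_minus_telescope)
qed

text \<open>
  Right multiplication by an operator of weight \<open>\<beta>' - \<beta>\<close> whose polynomial depends only on \<open>A s\<close> is
  a homomorphism from \<open>M\<^sub>A(\<beta>)\<close> to \<open>M\<^sub>A(\<beta>')\<close>.
\<close>

lemma good_hom:
  assumes P: "good A (\<beta>' - \<beta>) P (\<lambda>s. f (amap A s))" and h: "h \<in> H_ideal A \<beta>"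
  shows "h \<otimes>\<^bsub>W\<^esub> P \<in> H_ideal A \<beta>'"
proof -
  note H = H_ideal_left[of A \<beta>']
  have Pc: "P \<in> carrier W" using good_weyl[OF P] .
  define I where "I = {r \<in> carrier W. r \<otimes>\<^bsub>W\<^esub> P \<in> H_ideal A \<beta>'}"
  have I: "left_ideal I W"
    unfolding I_def
    by (rule left_idealI)
      (use Pc left_idealD[OF H] in \<open>auto simp: weyl.l_distr weyl.m_assoc\<close>)
  have "H_ideal A \<beta> \<subseteq> I"
  proof (rule H_ideal_least[OF I])
    fix u v :: "nat^'a" assume uv: "amap A (emb u) = amap A (emb v)"
    have 1: "good A (\<beta>' - \<beta> + amap A (emb u)) (d_monom u \<otimes>\<^bsub>W\<^esub> P) (\<lambda>s. f (amap A s + amap A (emb u)))"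
      using good_dm[OF P, of u] by (simp add: amap_add)
    have 2: "good A (\<beta>' - \<beta> + amap A (emb u)) (d_monom v \<otimes>\<^bsub>W\<^esub> P) (\<lambda>s. f (amap A s + amap A (emb u)))"
      using good_dm[OF P, of v] by (simp add: amap_add uv)
    have "(d_monom u \<ominus>\<^bsub>W\<^esub> d_monom v) \<otimes>\<^bsub>W\<^esub> P \<in> H_ideal A \<beta>'"
      using good_unique[OF H_ideal_toric 1 2] Pc by (simp add: a_minus_def weyl.l_distr weyl.l_minus)
    then show "d_monom u \<ominus>\<^bsub>W\<^esub> d_monom v \<in> I" unfolding I_def by simp
  next
    fix i
    have "good A (0 + (\<beta>' - \<beta>)) (Eop A i \<otimes>\<^bsub>W\<^esub> P) (\<lambda>s. amap A s $ i * f (amap A s + 0))"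
      by (rule good_mult[OF good_Eop P])
    then have 1: "good A (\<beta>' - \<beta>) (Eop A i \<otimes>\<^bsub>W\<^esub> P) (\<lambda>s. amap A s $ i * f (amap A s))" by simp
    have "good A (\<beta>' - \<beta> + 0) (P \<otimes>\<^bsub>W\<^esub> Eop A i) (\<lambda>s. f (amap A s) * (amap A s + (\<beta>' - \<beta>)) $ i)"
      using good_mult[OF P, of 0 "Eop A i" "\<lambda>a. a $ i"] good_Eop by blast
    then have "good A (\<beta>' - \<beta>) (P \<otimes>\<^bsub>W\<^esub> Eop A i \<oplus>\<^bsub>W\<^esub> const_op (\<beta> $ i - \<beta>' $ i) \<otimes>\<^bsub>W\<^esub> P)
        (\<lambda>s. f (amap A s) * (amap A s + (\<beta>' - \<beta>)) $ i + (\<beta> $ i - \<beta>' $ i) * f (amap A s))"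
      using good_add[OF _ good_smult[OF P]] by simp
    moreover have "f (amap A s) * (amap A s + (\<beta>' - \<beta>)) $ i + (\<beta> $ i - \<beta>' $ i) * f (amap A s) = amap A s $ i * f (amap A s)" for s
      by (simp add: algebra_simps)
    ultimately have 2: "good A (\<beta>' - \<beta>) (P \<otimes>\<^bsub>W\<^esub> Eop A i \<oplus>\<^bsub>W\<^esub> const_op (\<beta> $ i - \<beta>' $ i) \<otimes>\<^bsub>W\<^esub> P)
        (\<lambda>s. amap A s $ i * f (amap A s))" by simp
    have d: "Eop A i \<otimes>\<^bsub>W\<^esub> P \<ominus>\<^bsub>W\<^esub> (P \<otimes>\<^bsub>W\<^esub> Eop A i \<oplus>\<^bsub>W\<^esub> const_op (\<beta> $ i - \<beta>' $ i) \<otimes>\<^bsub>W\<^esub> P) \<in> H_ideal A \<beta>'"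
      by (rule good_unique[OF H_ideal_toric 1 2])
    have e: "P \<otimes>\<^bsub>W\<^esub> (Eop A i \<ominus>\<^bsub>W\<^esub> const_op (\<beta>' $ i)) \<in> H_ideal A \<beta>'"
      using left_idealD(5)[OF H Pc euler_in_H] by (simp add: euler_op_eq)
    have c1: "const_op (\<beta> $ i - \<beta>' $ i) \<otimes>\<^bsub>W\<^esub> P = const_op (\<beta> $ i) \<otimes>\<^bsub>W\<^esub> P \<oplus>\<^bsub>W\<^esub> (\<ominus>\<^bsub>W\<^esub> (const_op (\<beta>' $ i) \<otimes>\<^bsub>W\<^esub> P))"
    proof -
      have "const_op (\<beta> $ i - \<beta>' $ i) = const_op (\<beta> $ i) \<oplus>\<^bsub>W\<^esub> (\<ominus>\<^bsub>W\<^esub> const_op (\<beta>' $ i) :: 'a opr)"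
        by (simp add: const_op_neg const_op_add)
      then show ?thesis using Pc by (simp add: weyl.l_distr weyl.l_minus)
    qed
    have c2: "P \<otimes>\<^bsub>W\<^esub> (Eop A i \<ominus>\<^bsub>W\<^esub> const_op (\<beta>' $ i)) = P \<otimes>\<^bsub>W\<^esub> Eop A i \<oplus>\<^bsub>W\<^esub> \<ominus>\<^bsub>W\<^esub> (const_op (\<beta>' $ i) \<otimes>\<^bsub>W\<^esub> P)"
      using Pc by (simp add: a_minus_def weyl.r_distr weyl.r_minus const_op_central)
    let ?x = "Eop A i \<otimes>\<^bsub>W\<^esub> P" and ?y = "P \<otimes>\<^bsub>W\<^esub> Eop A i" and ?b = "const_op (\<beta> $ i) \<otimes>\<^bsub>W\<^esub> P" and ?b' = "const_op (\<beta>' $ i) \<otimes>\<^bsub>W\<^esub> P"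
    have cl: "?x \<in> carrier W" "?y \<in> carrier W" "?b \<in> carrier W" "?b' \<in> carrier W" using Pc by simp_all
    have alg: "(x \<ominus>\<^bsub>W\<^esub> (y \<oplus>\<^bsub>W\<^esub> (b \<oplus>\<^bsub>W\<^esub> \<ominus>\<^bsub>W\<^esub> b'))) \<oplus>\<^bsub>W\<^esub> (y \<oplus>\<^bsub>W\<^esub> \<ominus>\<^bsub>W\<^esub> b') = x \<ominus>\<^bsub>W\<^esub> b"
      if "x \<in> carrier W" "y \<in> carrier W" "b \<in> carrier W" "b' \<in> carrier W" for x y b b' :: "'a opr"
    proof -
      have t: "y \<oplus>\<^bsub>W\<^esub> (b \<oplus>\<^bsub>W\<^esub> \<ominus>\<^bsub>W\<^esub> b') = (y \<oplus>\<^bsub>W\<^esub> \<ominus>\<^bsub>W\<^esub> b') \<oplus>\<^bsub>W\<^esub> b"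
        using that by (simp add: weyl.a_assoc weyl.a_comm weyl.a_lcomm)
      define u where "u = y \<oplus>\<^bsub>W\<^esub> \<ominus>\<^bsub>W\<^esub> b'"
      have u: "u \<in> carrier W" using that by (simp add: u_def)
      have "x \<ominus>\<^bsub>W\<^esub> (u \<oplus>\<^bsub>W\<^esub> b) = x \<oplus>\<^bsub>W\<^esub> (\<ominus>\<^bsub>W\<^esub> b \<oplus>\<^bsub>W\<^esub> \<ominus>\<^bsub>W\<^esub> u)"
        unfolding a_minus_def weyl.minus_add[OF u that(3)]
        by (simp only: weyl.a_comm[OF weyl.a_inv_closed[OF u] weyl.a_inv_closed[OF that(3)]])
      also have "\<dots> = (x \<ominus>\<^bsub>W\<^esub> b) \<oplus>\<^bsub>W\<^esub> \<ominus>\<^bsub>W\<^esub> u"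
        unfolding a_minus_def
        by (rule weyl.a_assoc[OF that(1) weyl.a_inv_closed[OF that(3)] weyl.a_inv_closed[OF u], symmetric])
      finally have "(x \<ominus>\<^bsub>W\<^esub> (u \<oplus>\<^bsub>W\<^esub> b)) \<oplus>\<^bsub>W\<^esub> u = (x \<ominus>\<^bsub>W\<^esub> b) \<oplus>\<^bsub>W\<^esub> (\<ominus>\<^bsub>W\<^esub> u \<oplus>\<^bsub>W\<^esub> u)"
        using that u by (simp add: weyl.a_assoc)
      then show ?thesis unfolding t u_def[symmetric] using that u by (simp add: weyl.l_neg)
    qed
    have "?x \<ominus>\<^bsub>W\<^esub> ?b \<in> H_ideal A \<beta>'"
      using left_idealD(3)[OF H d e] unfolding c1 c2 alg[OF cl] .
    moreover have "euler_op A \<beta> i \<otimes>\<^bsub>W\<^esub> P = ?x \<ominus>\<^bsub>W\<^esub> ?b"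
      using Pc by (simp add: euler_op_eq a_minus_def weyl.l_distr weyl.l_minus)
    ultimately show "euler_op A \<beta> i \<in> I" unfolding I_def by simp
  qed
  then show ?thesis using h unfolding I_def by blast
qed

text \<open>
  Contiguity operators: two such homomorphisms in opposite directions compose to the scalar
  \<open>f(\<beta>) g(\<beta>')\<close>.
\<close>

lemma contiguity:
  fixes A :: "int^'n^'d"
  assumes f: "polyfn f" "\<And>k. \<not> (\<exists>b. amap A (emb b) = amap A (emb k) + (\<beta>' - \<beta>)) \<Longrightarrow> f (amap A (emb k)) = 0"
    and g: "polyfn g" "\<And>k. \<not> (\<exists>b. amap A (emb b) = amap A (emb k) + (\<beta> - \<beta>')) \<Longrightarrow> g (amap A (emb k)) = 0"
    and 1: "f \<beta> * g \<beta>' = 1"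
  shows "\<exists>P Q. P \<in> carrier W \<and> Q \<in> carrier W \<and>
    (\<forall>h\<in>H_ideal A \<beta>. h \<otimes>\<^bsub>W\<^esub> P \<in> H_ideal A \<beta>') \<and> (\<forall>h\<in>H_ideal A \<beta>'. h \<otimes>\<^bsub>W\<^esub> Q \<in> H_ideal A \<beta>) \<and>
    P \<otimes>\<^bsub>W\<^esub> Q \<ominus>\<^bsub>W\<^esub> \<one>\<^bsub>W\<^esub> \<in> H_ideal A \<beta> \<and> Q \<otimes>\<^bsub>W\<^esub> P \<ominus>\<^bsub>W\<^esub> \<one>\<^bsub>W\<^esub> \<in> H_ideal A \<beta>'"
proof -
  have pa: "polyfn (\<lambda>s. p (amap A s))" if "polyfn p" for p :: "complex^'d \<Rightarrow> complex"
    by (rule polyfn_compose[OF that]) (auto simp: amap_def intro!: polyfn_sum polyfn.intros)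
  obtain P where P: "good A (\<beta>' - \<beta>) P (\<lambda>s. f (amap A s))"
    using good_exists[OF pa[OF f(1)] f(2)] by blast
  obtain Q where Q: "good A (\<beta> - \<beta>') Q (\<lambda>s. g (amap A s))"
    using good_exists[OF pa[OF g(1)] g(2)] by blast
  have PQ: "good A 0 (P \<otimes>\<^bsub>W\<^esub> Q) (\<lambda>s. f (amap A s) * g (amap A s + (\<beta>' - \<beta>)))"
    using good_mult[OF P Q] by simp
  have QP: "good A 0 (Q \<otimes>\<^bsub>W\<^esub> P) (\<lambda>s. g (amap A s) * f (amap A s + (\<beta> - \<beta>')))"
    using good_mult[OF Q P] by simp
  have "P \<otimes>\<^bsub>W\<^esub> Q \<ominus>\<^bsub>W\<^esub> const_op (f \<beta> * g (\<beta> + (\<beta>' - \<beta>))) \<in> H_ideal A \<beta>"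
    by (rule euler_poly_value[OF _ PQ]) (intro polyfn.intros f polyfn_shift g)
  moreover have "Q \<otimes>\<^bsub>W\<^esub> P \<ominus>\<^bsub>W\<^esub> const_op (g \<beta>' * f (\<beta>' + (\<beta> - \<beta>'))) \<in> H_ideal A \<beta>'"
    by (rule euler_poly_value[OF _ QP]) (intro polyfn.intros f polyfn_shift g)
  ultimately show ?thesis
    using 1 good_hom[OF P] good_hom[OF Q] good_weyl[OF P] good_weyl[OF Q]
    by (intro exI[of _ P] exI[of _ Q]) (simp add: const_op_1 mult.commute)
qed

section \<open>Farkas' lemma over the rationals\<close>

text \<open>
  The standard bilinear form on \<open>\<rat>\<^sup>d\<close>.
\<close>

definition dotq :: "rat^'d \<Rightarrow> rat^'d \<Rightarrow> rat" where
  "dotq h x = (\<Sum>i\<in>UNIV. h $ i * x $ i)"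

lemma dotq_add_left: "dotq (h + h') x = dotq h x + dotq h' x"
  and dotq_add_right: "dotq h (x + y) = dotq h x + dotq h y"
  and dotq_smult_left: "dotq (c *s h) x = c * dotq h x"
  and dotq_smult_right: "dotq h (c *s x) = c * dotq h x"
  and dotq_0_right [simp]: "dotq h 0 = 0"
  and dotq_0_left [simp]: "dotq 0 x = 0"
  by (simp_all add: dotq_def sum.distrib algebra_simps sum_distrib_left)

lemma dotq_sum_right: "dotq h (\<Sum>i\<in>I. f i) = (\<Sum>i\<in>I. dotq h (f i))"
  by (induction I rule: infinite_finite_induct) (simp_all add: dotq_add_right)
lemma dotq_sum_left: "dotq (\<Sum>i\<in>I. f i) x = (\<Sum>i\<in>I. dotq (f i) x)"
  by (induction I rule: infinite_finite_induct) (simp_all add: dotq_add_left)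
lemma dotq_minus_right: "dotq h (- x) = - dotq h x"
  by (simp add: dotq_def sum_negf)

lemma dotq_commute: "dotq x y = dotq y x"
  by (simp add: dotq_def mult.commute)

lemma dotq_axis: "dotq b (axis i 1) = b $ i"
proof -
  have "dotq b (axis i 1) = (\<Sum>k\<in>UNIV. if k = i then b $ k else 0)"
    unfolding dotq_def axis_def by (rule sum.cong) auto
  then show ?thesis by simp
qed

text \<open>
  Farkas' lemma, by elimination of one generator: if \<open>b\<close> is not nonnegative on the dual cone of the
  others, a point \<open>x\<close> of that dual cone with \<open>a\<^sub>k \<cdot> x = -1\<close> projects the problem along
  \<open>a\<^sub>k\<close>.
\<close>

lemma farkas:
  assumes "finite I" "\<And>x. (\<And>i. i \<in> I \<Longrightarrow> 0 \<le> dotq (a i) x) \<Longrightarrow> 0 \<le> dotq b x"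
  shows "\<exists>c. (\<forall>i\<in>I. 0 \<le> c i) \<and> b = (\<Sum>i\<in>I. c i *s a i)"
  using assms
proof (induction I arbitrary: a b rule: finite_induct)
  case empty
  have "b $ i = 0" for i
  proof -
    have "0 \<le> dotq b (axis i 1)" "0 \<le> dotq b (- axis i 1)" using empty by blast+
    then show ?thesis unfolding dotq_minus_right dotq_axis by simp
  qed
  then show ?case by (simp add: vec_eq_iff)
next
  case (insert k I)
  show ?case
  proof (cases "\<forall>x. (\<forall>i\<in>I. 0 \<le> dotq (a i) x) \<longrightarrow> 0 \<le> dotq b x")
    case True
    then obtain c where c: "\<forall>i\<in>I. 0 \<le> c i" "b = (\<Sum>i\<in>I. c i *s a i)"
      using insert.IH[of a b] by blast
    have "(\<Sum>i\<in>I. (c(k := 0)) i *s a i) = (\<Sum>i\<in>I. c i *s a i)"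
      by (rule sum.cong) (use insert.hyps in auto)
    then have "(\<Sum>i\<in>insert k I. (c(k := 0)) i *s a i) = b"
      using insert.hyps c by simp
    then show ?thesis using c by (intro exI[of _ "c(k := 0)"]) auto
  next
    case False
    then obtain x0 where x0: "\<forall>i\<in>I. 0 \<le> dotq (a i) x0" "dotq b x0 < 0" by force
    then have neg: "dotq (a k) x0 < 0" using insert.prems[of x0] by force
    define m0 where "m0 = 1 / - dotq (a k) x0"
    have m0: "m0 > 0" "m0 * dotq (a k) x0 = -1" using neg by (simp_all add: m0_def)
    define x where "x = m0 *s x0"
    have xd: "dotq h x = m0 * dotq h x0" for h by (simp add: x_def dotq_smult_right)
    have x: "\<And>i. i \<in> I \<Longrightarrow> 0 \<le> dotq (a i) x" "dotq b x < 0" "dotq (a k) x = -1"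
      using x0 m0 unfolding xd by (simp_all add: mult_pos_neg)
    define a' where "a' = (\<lambda>i. a i + dotq (a i) x *s a k)"
    define b' where "b' = b + dotq b x *s a k"
    have "\<exists>c. (\<forall>i\<in>I. 0 \<le> c i) \<and> b' = (\<Sum>i\<in>I. c i *s a' i)"
    proof (rule insert.IH)
      fix y assume y: "\<And>i. i \<in> I \<Longrightarrow> 0 \<le> dotq (a' i) y"
      define z where "z = y + dotq (a k) y *s x"
      have z: "dotq h z = dotq (h + dotq h x *s a k) y" for h
        by (simp add: z_def dotq_add_left dotq_add_right dotq_smult_left dotq_smult_right mult.commute)
      have "0 \<le> dotq (a i) z" if "i \<in> insert k I" for i
      proof (cases "i = k")
        case True
        then show ?thesis by (simp add: z dotq_add_left dotq_smult_left x)
      next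
        case False
        then show ?thesis using y[of i] that by (simp add: z a'_def)
      qed
      then have "0 \<le> dotq b z" using insert.prems by blast
      then show "0 \<le> dotq b' y" by (simp add: z b'_def)
    qed
    then obtain c where c: "\<forall>i\<in>I. 0 \<le> c i" "b' = (\<Sum>i\<in>I. c i *s a' i)" by blast
    define m where "m = (\<Sum>i\<in>I. c i * dotq (a i) x) - dotq b x"
    have "0 \<le> (\<Sum>i\<in>I. c i * dotq (a i) x)" by (intro sum_nonneg mult_nonneg_nonneg) (use c x in auto)
    then have m: "0 \<le> m" using x(2) by (simp add: m_def)
    have "b = (\<Sum>i\<in>I. c i *s a i) + m *s a k"
    proof -
      have "(\<Sum>i\<in>I. c i *s a' i) = (\<Sum>i\<in>I. c i *s a i) + (\<Sum>i\<in>I. c i * dotq (a i) x) *s a k"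
        by (simp add: a'_def vec_eq_iff sum.distrib algebra_simps sum_distrib_left)
      then show ?thesis using c(2) by (simp add: b'_def m_def vec_eq_iff algebra_simps)
    qed
    moreover have "(\<Sum>i\<in>I. (c(k := m)) i *s a i) = (\<Sum>i\<in>I. c i *s a i)"
      by (rule sum.cong) (use insert.hyps in auto)
    ultimately have "(\<Sum>i\<in>insert k I. (c(k := m)) i *s a i) = b"
      using insert.hyps by (simp add: add.commute)
    then show ?thesis using c m by (intro exI[of _ "c(k := m)"]) auto
  qed
qed

lemma rat_clear_denominators:
  assumes "finite I" "\<And>i. i \<in> I \<Longrightarrow> 0 \<le> (c i :: rat)"
  shows "\<exists>N>0. \<exists>n :: 'i \<Rightarrow> nat. \<forall>i\<in>I. of_nat N * c i = of_nat (n i)"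
  using assms
proof (induction I rule: finite_induct)
  case empty then show ?case by auto
next
  case (insert k I)
  then obtain N n where N: "N > 0" "\<forall>i\<in>I. of_nat N * c i = of_nat (n i)" by auto
  obtain p q where pq: "quotient_of (c k) = (p, q)" by (cases "quotient_of (c k)")
  have q: "q > 0" using quotient_of_denom_pos[OF pq] .
  have ck: "c k = of_int p / of_int q" using quotient_of_div[OF pq] .
  then have p: "p \<ge> 0" using insert.prems[of k] q by (simp add: zero_le_divide_iff)
  have 1: "of_nat (N * nat q) * c k = (of_nat (N * nat p) :: rat)"
    using p q by (simp add: ck)
  have 2: "of_nat (N * nat q) * c i = (of_nat (nat q * n i) :: rat)" if "i \<in> I" for i
    using N(2) that by (simp add: mult_ac)
  show ?case
  proof (intro exI[of _ "N * nat q"] conjI exI[of _ "\<lambda>i. if i = k then N * nat p else nat q * n i"] ballI)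
    show "0 < N * nat q" using N(1) q by simp
    fix i assume "i \<in> insert k I"
    then show "of_nat (N * nat q) * c i = of_nat (if i = k then N * nat p else nat q * n i)"
      using 1 2 insert.hyps by (cases "i = k") (simp_all only: if_True if_False, auto)
  qed
qed

section \<open>Faces\<close>

lemma amap_axis:
  fixes A :: "int^'n^'d"
  shows "amap A (axis j 1) = mcol A j"
proof -
  have "(\<Sum>k\<in>UNIV. of_int (A $ i $ k) * (axis j 1 :: complex^'n) $ k) = (\<Sum>k\<in>UNIV. if k = j then of_int (A $ i $ k) else 0)" for i
    by (rule sum.cong) (auto simp: axis_def)
  then show ?thesis by (simp add: amap_def mcol_def vec_eq_iff)
qed

lemma amap_smult: "amap A (c *s s) = c *s amap A s"
  by (simp add: amap_def vec_eq_iff sum_distrib_left mult_ac)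

lemma amap_eq_sum: "amap A s = (\<Sum>j\<in>UNIV. s $ j *s mcol A j)"
  by (simp add: amap_def mcol_def vec_eq_iff mult.commute)

text \<open>
  The smallest face containing the columns in \<open>\<sigma>\<close>, characterised by what is used of it: every column
  \<open>a\<^sub>j\<close> on it satisfies \<open>M s - a\<^sub>j \<in> \<nat>A\<close> for some \<open>M\<close>, where \<open>s\<close> is the sum of the columns in \<open>\<sigma>\<close>.
\<close>

lemma face_exists:
  fixes A :: "int^'n^'d"
  shows "\<exists>\<tau>. is_face \<tau> (cone_of A) \<and> (\<forall>j\<in>\<sigma>. mcol A j \<in> \<tau>) \<and>
    (\<forall>j. mcol A j \<in> \<tau> \<longrightarrow> (\<exists>M b. of_nat M *s (\<Sum>i\<in>\<sigma>. mcol A i) = mcol A j + amap A (emb b)))"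
proof -
  define s :: "rat^'d" where "s = (\<Sum>i\<in>\<sigma>. mcol A i)"
  define R where "R = (\<lambda>j. \<exists>M b. of_nat M *s (\<Sum>i\<in>\<sigma>. mcol A i) = mcol A j + amap A (emb b))"
  \<comment> \<open>a column without this property is separated by a form vanishing on \<open>\<sigma>\<close>; these forms are added up below\<close>
  have sep: "\<exists>h. (\<forall>i. 0 \<le> dotq h (mcol A i)) \<and> dotq h s \<le> 0 \<and> 0 < dotq h (mcol A j)" if "\<not> R j" for j
  proof (rule ccontr)
    assume no: "\<not> ?thesis"
    \<comment> \<open>Farkas' lemma for the columns together with \<open>-s\<close>\<close>
    define a where "a = case_option (- s) (\<lambda>i. mcol A i)"
    have "\<exists>c. (\<forall>i\<in>UNIV. 0 \<le> c i) \<and> - mcol A j = (\<Sum>i\<in>UNIV. c i *s a i)"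
    proof (rule farkas)
      fix x :: "rat^'d" assume x: "\<And>i. i \<in> UNIV \<Longrightarrow> 0 \<le> dotq (a i) x"
      have 1: "0 \<le> dotq x (mcol A i)" for i using x[of "Some i"] by (simp add: a_def dotq_commute)
      have "0 \<le> dotq (- s) x" using x[of None] by (simp add: a_def)
      then have "dotq x s \<le> 0" by (subst (asm) dotq_commute) (simp add: dotq_minus_right)
      then have "\<not> 0 < dotq x (mcol A j)" using no 1 by blast
      then show "0 \<le> dotq (- mcol A j) x" by (subst dotq_commute) (simp add: dotq_minus_right)
    qed simp
    then obtain c where c: "\<And>i. 0 \<le> c i" "- mcol A j = (\<Sum>i\<in>UNIV. c i *s a i)" by auto
    obtain N n where N: "N > 0" "\<And>i. of_nat N * c i = of_nat (n i)"
      using rat_clear_denominators[of UNIV c] c(1) by auto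
    have eq: "- mcol A j = (\<Sum>i\<in>UNIV. c (Some i) *s mcol A i) - c None *s s"
      unfolding c(2) by (simp add: UNIV_option_conv sum.reindex a_def)
    define b :: "nat^'n" where "b = (\<chi> i. n (Some i) + (if i = j then N - 1 else 0))"
    have "R j"
      unfolding R_def
    proof (intro exI[of _ "n None"] exI[of _ b])
      have key: "int (n None) * (\<Sum>i\<in>\<sigma>. A $ k $ i) = A $ k $ j + (\<Sum>i\<in>UNIV. A $ k $ i * int (b $ i))" for k
      proof -
        have "- of_int (A $ k $ j) = (\<Sum>i\<in>UNIV. c (Some i) * of_int (A $ k $ i)) - c None * (\<Sum>i\<in>\<sigma>. of_int (A $ k $ i))"
          using arg_cong[OF eq, of "\<lambda>v. v $ k"] by (simp add: mcol_def s_def)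
        then have "of_nat N * (c None * (\<Sum>i\<in>\<sigma>. of_int (A $ k $ i))) =
            of_nat N * of_int (A $ k $ j) + of_nat N * (\<Sum>i\<in>UNIV. c (Some i) * of_int (A $ k $ i))"
          by (simp add: algebra_simps)
        then have 1: "of_nat (n None) * (\<Sum>i\<in>\<sigma>. of_int (A $ k $ i)) =
            of_nat N * of_int (A $ k $ j) + (\<Sum>i\<in>UNIV. (of_nat (n (Some i)) :: rat) * of_int (A $ k $ i))"
          by (simp add: mult.assoc[symmetric] N sum_distrib_left)
        have "of_int (int (n None) * (\<Sum>i\<in>\<sigma>. A $ k $ i)) =
            (of_int (int N * A $ k $ j + (\<Sum>i\<in>UNIV. int (n (Some i)) * A $ k $ i)) :: rat)"
          using 1 by simp
        then have 2: "int (n None) * (\<Sum>i\<in>\<sigma>. A $ k $ i) = int N * A $ k $ j + (\<Sum>i\<in>UNIV. int (n (Some i)) * A $ k $ i)"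
          by (simp only: of_int_eq_iff)
        have "(\<Sum>i\<in>UNIV. A $ k $ i * int (b $ i)) = (\<Sum>i\<in>UNIV. int (n (Some i)) * A $ k $ i + (if i = j then (int N - 1) * A $ k $ i else 0))"
          by (rule sum.cong) (use N(1) in \<open>auto simp: b_def algebra_simps of_nat_diff\<close>)
        also have "\<dots> = (\<Sum>i\<in>UNIV. int (n (Some i)) * A $ k $ i) + (int N - 1) * A $ k $ j"
          by (simp add: sum.distrib)
        finally show ?thesis using 2 by (simp add: algebra_simps)
      qed
      have "(of_nat (n None) *s (\<Sum>i\<in>\<sigma>. mcol A i :: complex^'d)) $ k = (mcol A j + amap A (emb b)) $ k" for k
      proof -
        have "of_int (int (n None) * (\<Sum>i\<in>\<sigma>. A $ k $ i)) = (of_int (A $ k $ j + (\<Sum>i\<in>UNIV. A $ k $ i * int (b $ i))) :: complex)"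
          using key[of k] by (simp only:)
        then show ?thesis by (simp add: mcol_def amap_def)
      qed
      then show "of_nat (n None) *s (\<Sum>i\<in>\<sigma>. mcol A i :: complex^'d) = mcol A j + amap A (emb b)"
        by (simp add: vec_eq_iff)
    qed
    then show False using that by blast
  qed
  then obtain h where h: "\<And>j. \<not> R j \<Longrightarrow> (\<forall>i. 0 \<le> dotq (h j) (mcol A i)) \<and> dotq (h j) s \<le> 0 \<and> 0 < dotq (h j) (mcol A j)"
    by metis
  define H where "H = (\<Sum>j | \<not> R j. h j)"
  have Hnn: "0 \<le> dotq H (mcol A i)" for i
    unfolding H_def dotq_sum_left by (rule sum_nonneg) (use h in auto)
  have Hs: "dotq H (mcol A i) = 0" if "i \<in> \<sigma>" for i
  proof -
    have "dotq H s \<le> 0" unfolding H_def dotq_sum_left by (rule sum_nonpos) (use h in auto)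
    then have "(\<Sum>i\<in>\<sigma>. dotq H (mcol A i)) \<le> 0" by (simp add: s_def dotq_sum_right)
    then have "(\<Sum>i\<in>\<sigma>. dotq H (mcol A i)) = 0" using sum_nonneg[of \<sigma> "\<lambda>i. dotq H (mcol A i)"] Hnn by force
    then show ?thesis using that Hnn by (subst (asm) sum_nonneg_eq_0_iff) auto
  qed
  have Hpos: "0 < dotq H (mcol A j)" if "\<not> R j" for j
    unfolding H_def dotq_sum_left by (rule sum_pos2[of _ j]) (use h that in auto)
  define \<tau> where "\<tau> = {x \<in> cone_of A. dotq H x = 0}"
  have col: "mcol A j \<in> cone_of A" for j
  proof -
    have "(\<Sum>k\<in>UNIV. (if k = j then 1 else 0) *s mcol A k) = (\<Sum>k\<in>UNIV. if k = j then mcol A k else (0::rat^'d))"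
      by (rule sum.cong) (auto simp: vec_eq_iff)
    then have "mcol A j = (\<Sum>k\<in>UNIV. (if k = j then 1 else 0) *s mcol A k :: rat^'d)" by simp
    then show ?thesis
      unfolding cone_of_def by (intro CollectI exI[of _ "\<lambda>k. if k = j then 1 else 0"] conjI) auto
  qed
  have "is_face \<tau> (cone_of A)"
    unfolding is_face_def
  proof (intro exI[of _ H] conjI ballI)
    fix x assume "x \<in> cone_of A"
    then obtain c where "x = (\<Sum>j\<in>UNIV. c j *s mcol A j)" "\<forall>j. 0 \<le> c j" unfolding cone_of_def by blast
    then have "0 \<le> dotq H x"
      by (simp add: dotq_sum_right dotq_smult_right sum_nonneg Hnn)
    then show "0 \<le> (\<Sum>i\<in>UNIV. H $ i * x $ i)" by (simp add: dotq_def)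
  qed (simp add: \<tau>_def dotq_def)
  moreover have "\<forall>j\<in>\<sigma>. mcol A j \<in> \<tau>" using col Hs by (simp add: \<tau>_def)
  moreover have "R j" if "mcol A j \<in> \<tau>" for j using Hpos[of j] that by (force simp: \<tau>_def)
  ultimately show ?thesis unfolding R_def by blast
qed

lemma col_monoid_eq: "col_monoid A = range (\<lambda>b. amap A (emb b))"
proof -
  have 1: "(\<Sum>j\<in>UNIV. of_nat (u j) *s mcol A j) = amap A (emb (\<chi> j. u j))" for u
    by (simp add: amap_eq_sum)
  have 2: "amap A (emb b) \<in> {amap A (emb (\<chi> j. u j)) | u. True}" for b
    by (intro CollectI exI[of _ "vec_nth b"]) simp
  show ?thesis unfolding col_monoid_def 1 using 2 by auto
qed

lemma group_closure_coset:
  "l + z \<in> l +o group_closure S \<longleftrightarrow> z \<in> group_closure S" for l :: "'a::ab_group_add"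
  by (auto simp: elt_set_plus_def)

text \<open>
  Suppose that \<open>A k + (\<beta>' - \<beta>) \<notin> \<nat>A\<close> for all \<open>k\<close> in the slice \<open>w0 + \<int>\<^sup>\<sigma>\<close> of \<open>\<nat>\<^sup>n\<close>. Then
  \<open>\<beta>\<close> is not in the complex affine hull of the image of the slice. Otherwise \<open>l = \<beta> - A w0\<close> would
  represent an element of \<open>E\<^sub>\<tau>(\<beta>) = E\<^sub>\<tau>(\<beta>')\<close> for the face \<open>\<tau>\<close> spanned by \<open>\<sigma>\<close>, so that
  \<open>\<beta>' - l \<in> \<nat>A + \<int>(A \<inter> \<tau>)\<close>, and adding a large multiple of the columns in \<open>\<sigma>\<close> would lead into \<open>\<nat>A\<close>.
\<close>

lemma slice_disjoint:
  fixes A :: "int^'n^'d"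
  assumes E: "\<And>\<tau>. is_face \<tau> (cone_of A) \<Longrightarrow> E_set A \<tau> \<beta> = E_set A \<tau> \<beta>'"
    and D: "\<And>k. (\<And>j. j \<notin> \<sigma> \<Longrightarrow> k $ j = w0 $ j) \<Longrightarrow> \<not> (\<exists>b. amap A (emb b) = amap A (emb k) + (\<beta>' - \<beta>))"
  shows "\<beta> - amap A (emb w0) \<notin> vec.span ((\<lambda>j. mcol A j) ` \<sigma>)"
proof
  assume sp: "\<beta> - amap A (emb w0) \<in> vec.span ((\<lambda>j. mcol A j) ` \<sigma>)"
  define l where "l = \<beta> - amap A (emb w0)"
  obtain \<tau> where \<tau>: "is_face \<tau> (cone_of A)" "\<And>j. j \<in> \<sigma> \<Longrightarrow> mcol A j \<in> \<tau>"
    "\<And>j. mcol A j \<in> \<tau> \<Longrightarrow> \<exists>M b. of_nat M *s (\<Sum>i\<in>\<sigma>. mcol A i) = mcol A j + amap A (emb b)"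
    using face_exists[of A \<sigma>] by blast
  let ?L = "face_lattice A \<tau>"
  define s :: "complex^'d" where "s = (\<Sum>i\<in>\<sigma>. mcol A i)"
  have z0: "0 \<in> ?L" unfolding face_lattice_def by simp
  have lsp: "l \<in> face_space A \<tau>"
  proof -
    have "(\<lambda>j. mcol A j) ` \<sigma> \<subseteq> face_cols A \<tau>" using \<tau>(2) unfolding face_cols_def by blast
    then show ?thesis using sp vec.span_mono unfolding face_space_def l_def by blast
  qed
  have "(\<beta> - l) + 0 \<in> col_monoid A + ?L"
    by (rule set_plus_intro[OF _ z0]) (simp add: l_def col_monoid_eq)
  then have "\<beta> - l \<in> col_monoid A + ?L" by simp
  then have "l +o ?L \<in> E_set A \<tau> \<beta>" using lsp unfolding E_set_def by blast
  then have "l +o ?L \<in> E_set A \<tau> \<beta>'" using E[OF \<tau>(1)] by simp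
  then obtain l' where l': "l +o ?L = l' +o ?L" "\<beta>' - l' \<in> col_monoid A + ?L"
    unfolding E_set_def by blast
  have "l' \<in> l +o ?L" unfolding l'(1) using group_closure_coset[of l' 0] z0 by (simp add: face_lattice_def)
  then obtain z1 where z1: "z1 \<in> ?L" "l' = l + z1" by (auto simp: elt_set_plus_def)
  obtain b0 z2 where z2: "\<beta>' - l' = amap A (emb b0) + z2" "z2 \<in> ?L"
    using l'(2) unfolding set_plus_def col_monoid_eq by blast
  \<comment> \<open>a multiple of \<open>s\<close> moves any element of \<open>\<int>(A \<inter> \<tau>)\<close> into \<open>\<nat>A\<close>; the sign is included for the induction\<close>
  have L: "(\<exists>M b. z + of_nat M *s s = amap A (emb b)) \<and> (\<exists>M b. - z + of_nat M *s s = amap A (emb b))" if "z \<in> ?L" for z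
    using that unfolding face_lattice_def
  proof (induction rule: group_closure.induct)
    case (base z)
    show ?case
    proof (cases "z = 0")
      case True
      have "0 + of_nat 0 *s s = amap A (emb 0)" by (simp add: vec_eq_iff amap_def)
      then show ?thesis using True by (metis minus_zero)
    next
      case False
      then obtain j where j: "z = mcol A j" "mcol A j \<in> \<tau>" using base unfolding face_cols_def by blast
      have "z + of_nat 0 *s s = amap A (emb (ue j))" by (simp add: j amap_axis)
      moreover obtain M b where "of_nat M *s s = mcol A j + amap A (emb b)" using \<tau>(3)[OF j(2)] unfolding s_def by blast
      then have "- z + of_nat M *s s = amap A (emb b)" by (simp add: j)
      ultimately show ?thesis by blast
    qed
  next
    case (diff z t)
    then obtain M1 b1 M2 b2 M3 b3 M4 b4 where *: "z + of_nat M1 *s s = amap A (emb b1)" "- z + of_nat M2 *s s = amap A (emb b2)"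
      "t + of_nat M3 *s s = amap A (emb b3)" "- t + of_nat M4 *s s = amap A (emb b4)" by blast
    have "(z - t) + of_nat (M1 + M4) *s s = amap A (emb (b1 + b4))"
      unfolding emb_add amap_add *(1,4)[symmetric] by (simp add: vec_eq_iff algebra_simps)
    moreover have "- (z - t) + of_nat (M2 + M3) *s s = amap A (emb (b2 + b3))"
      unfolding emb_add amap_add *(2,3)[symmetric] by (simp add: vec_eq_iff algebra_simps)
    ultimately show ?case by blast
  qed
  have "z1 + z2 \<in> ?L" using z1 z2 unfolding face_lattice_def by (simp add: group_closure_add)
  then obtain M b where Mb: "z1 + z2 + of_nat M *s s = amap A (emb b)" using L by blast
  define k where "k = w0 + (\<chi> j. if j \<in> \<sigma> then M else 0)"
  have ind: "amap A (emb (\<chi> j. if j \<in> \<sigma> then M else 0)) = of_nat M *s s"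
  proof -
    have "amap A (emb (\<chi> j. if j \<in> \<sigma> then M else 0)) = (\<Sum>j\<in>UNIV. if j \<in> \<sigma> then of_nat M *s mcol A j else 0)"
      unfolding amap_eq_sum by (rule sum.cong) auto
    also have "\<dots> = (\<Sum>j\<in>\<sigma>. of_nat M *s mcol A j)" by (simp add: sum.If_cases)
    also have "\<dots> = of_nat M *s s" by (simp add: s_def vec_eq_iff sum_distrib_left)
    finally show ?thesis .
  qed
  have "amap A (emb (b0 + b)) = amap A (emb k) + (\<beta>' - \<beta>)"
  proof -
    have "amap A (emb (b0 + b)) = amap A (emb b0) + (z1 + z2 + of_nat M *s s)"
      by (simp add: emb_add amap_add Mb)
    also have "\<dots> = (\<beta>' - l') + z1 + of_nat M *s s" by (simp add: z2(1) algebra_simps)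
    also have "\<dots> = amap A (emb k) + (\<beta>' - \<beta>)"
      unfolding k_def emb_add amap_add ind z1(2) l_def by (simp add: algebra_simps)
    finally show ?thesis .
  qed
  moreover have "\<And>j. j \<notin> \<sigma> \<Longrightarrow> k $ j = w0 $ j" by (simp add: k_def)
  ultimately show False using D by blast
qed

section \<open>A separating polynomial\<close>

text \<open>
  A linear form vanishing on a subspace but not at a given point outside it.
\<close>

lemma span_separation:
  fixes x :: "complex^'d"
  assumes "x \<notin> vec.span S"
  shows "\<exists>f. polyfn f \<and> (\<forall>y\<in>vec.span S. f y = 0) \<and> f x \<noteq> 0 \<and> (\<forall>y z. f (y - z) = f y - f z)"
proof -
  obtain B where B: "B \<subseteq> S" "vec.independent B" "S \<subseteq> vec.span B"
    using vec.maximal_independent_subset by blast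
  have span: "vec.span S = vec.span B"
    using B vec.span_eq vec.span_superset by (meson order_trans vec.span_mono subset_antisym vec.span_minimal vec.subspace_span)
  then have ind: "vec.independent (insert x B)" using assms B(2) vec.independent_insertI by metis
  obtain g where g: "Vector_Spaces.linear (*s) (*s) g" "\<forall>y\<in>insert x B. g y = (if y = x then x else (0::complex^'d))"
    using vec.linear_independent_extend[OF ind, of "\<lambda>y. if y = x then x else (0::complex^'d)"] by auto
  have xB: "x \<notin> B" using assms span vec.span_base by blast
  interpret g: Vector_Spaces.linear "(*s)" "(*s)" g by fact
  have gB: "g y = 0" if "y \<in> vec.span B" for y
  proof -
    have "\<And>y. y \<in> B \<Longrightarrow> g y = 0" using g(2) xB by auto
    then show ?thesis using that g.eq_0_on_span by blast
  qed
  have "x \<noteq> 0" using assms vec.span_zero by blast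
  then obtain i where i: "x $ i \<noteq> 0" by (auto simp: vec_eq_iff)
  define f where "f = (\<lambda>y. g y $ i)"
  have "f y = (\<Sum>j\<in>UNIV. matrix g $ i $ j * y $ j)" for y
    using matrix_works[OF g(1), of y] unfolding f_def matrix_vector_mult_def by (metis (no_types, lifting) vec_lambda_beta)
  then have "f = (\<lambda>y. \<Sum>j\<in>UNIV. matrix g $ i $ j * y $ j)" by blast
  then have "polyfn f" by (simp only:) (intro polyfn_sum polyfn.intros)
  moreover have "f x \<noteq> 0" using g(2) i by (simp add: f_def)
  moreover have "\<forall>y\<in>vec.span S. f y = 0" using gB span by (simp add: f_def)
  moreover have "f (y - z) = f y - f z" for y z by (simp add: f_def g.diff)
  ultimately show ?thesis by blast
qed

text \<open>
  A polynomial with value one at \<open>\<beta>\<close> that vanishes at \<open>A k\<close> for all \<open>k\<close> in the set \<open>D\<close> of those with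
  \<open>A k + (\<beta>' - \<beta>) \<notin> \<nat>A\<close>. It is constructed slice by slice, by induction on the number of free
  coordinates \<open>\<sigma>\<close>: if the slice is contained in \<open>D\<close>, a linear form does; otherwise it contains some
  \<open>k1 \<notin> D\<close>, and as \<open>D\<close> is closed downwards the part of \<open>D\<close> in the slice is covered by the
  finitely many smaller slices with one more coordinate \<open>j\<close> fixed to a value below \<open>k1\<^sub>j\<close>.
\<close>

lemma sep_poly:
  fixes A :: "int^'n^'d"
  assumes E: "\<And>\<tau>. is_face \<tau> (cone_of A) \<Longrightarrow> E_set A \<tau> \<beta> = E_set A \<tau> \<beta>'"
  shows "\<exists>f. polyfn f \<and> f \<beta> = 1 \<and>
    (\<forall>k. \<not> (\<exists>b. amap A (emb b) = amap A (emb k) + (\<beta>' - \<beta>)) \<longrightarrow> f (amap A (emb k)) = 0)"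
proof -
  define D where "D = {k :: nat^'n. \<not> (\<exists>b. amap A (emb b) = amap A (emb k) + (\<beta>' - \<beta>))}"
  have down: "k \<in> D" if "\<alpha> \<in> D" "k \<le> \<alpha>" for k \<alpha>
  proof (rule ccontr)
    assume "k \<notin> D"
    then obtain b where b: "amap A (emb b) = amap A (emb k) + (\<beta>' - \<beta>)" unfolding D_def by blast
    have "amap A (emb (b + (\<alpha> - k))) = amap A (emb \<alpha>) + (\<beta>' - \<beta>)"
      using b by (simp add: emb_add amap_add emb_diff[OF that(2)] amap_diff)
    then show False using that unfolding D_def by blast
  qed
  have "\<exists>f. polyfn f \<and> f \<beta> \<noteq> 0 \<and> (\<forall>k\<in>D. (\<forall>j. j \<notin> \<sigma> \<longrightarrow> k $ j = w0 $ j) \<longrightarrow> f (amap A (emb k)) = 0)"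
    if "finite \<sigma>" for \<sigma> :: "'n set" and w0
    using that
  proof (induction \<sigma> arbitrary: w0 rule: finite_psubset_induct)
    case (psubset \<sigma>)
    show ?case
    proof (cases "\<forall>k. (\<forall>j. j \<notin> \<sigma> \<longrightarrow> k $ j = w0 $ j) \<longrightarrow> k \<in> D")
      case True
      have "\<beta> - amap A (emb w0) \<notin> vec.span ((\<lambda>j. mcol A j) ` \<sigma>)"
        by (rule slice_disjoint[OF E]) (use True in \<open>auto simp: D_def\<close>)
      then obtain f where f: "polyfn f" "\<And>y. y \<in> vec.span ((\<lambda>j. mcol A j) ` \<sigma>) \<Longrightarrow> f y = 0"
        "f (\<beta> - amap A (emb w0)) \<noteq> 0"
        using span_separation by blast
      have "f (amap A (emb k) + - amap A (emb w0)) = 0" if k: "\<forall>j. j \<notin> \<sigma> \<longrightarrow> k $ j = w0 $ j" for k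
      proof (rule f(2))
        have "amap A (emb k) + - amap A (emb w0) = (\<Sum>j\<in>UNIV. (emb k - emb w0) $ j *s mcol A j)"
          by (simp add: amap_eq_sum sum_subtractf vec.scale_left_diff_distrib)
        also have "\<dots> = (\<Sum>j\<in>\<sigma>. (emb k - emb w0) $ j *s mcol A j)"
          by (rule sum.mono_neutral_right) (use k in auto)
        also have "\<dots> \<in> vec.span ((\<lambda>j. mcol A j) ` \<sigma>)"
          by (intro vec.span_sum vec.span_scale vec.span_base) auto
        finally show "amap A (emb k) + - amap A (emb w0) \<in> vec.span ((\<lambda>j. mcol A j) ` \<sigma>)" .
      qed
      then show ?thesis using f(3)
        by (intro exI[of _ "\<lambda>a. f (a + - amap A (emb w0))"] conjI polyfn_shift f(1)) auto
    next
      case False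
      then obtain k1 where k1: "\<forall>j. j \<notin> \<sigma> \<longrightarrow> k1 $ j = w0 $ j" "k1 \<notin> D" by blast
      define Q where "Q = (\<lambda>j v f. polyfn f \<and> f \<beta> \<noteq> 0 \<and>
          (\<forall>k\<in>D. (\<forall>i. i \<notin> \<sigma> - {j} \<longrightarrow> k $ i = (\<chi> i. if i = j then v else w0 $ i) $ i) \<longrightarrow> f (amap A (emb k)) = 0))"
      have "\<exists>f. j \<in> \<sigma> \<longrightarrow> Q j v f" for j v
      proof (cases "j \<in> \<sigma>")
        case True
        then have "\<sigma> - {j} \<subset> \<sigma>" by blast
        from psubset.IH[OF this, of "\<chi> i. if i = j then v else w0 $ i"] show ?thesis
          unfolding Q_def by blast
      qed simp
      then obtain F where F: "\<And>j v. j \<in> \<sigma> \<Longrightarrow> Q j v (F j v)" by metis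
      note F = F[unfolded Q_def]
      let ?f = "\<lambda>a. \<Prod>j\<in>\<sigma>. \<Prod>v<k1 $ j. F j v a"
      have "polyfn ?f" using F by (intro polyfn_prod) auto
      moreover have "?f \<beta> \<noteq> 0" using F psubset.hyps by simp
      moreover have "?f (amap A (emb k)) = 0" if k: "k \<in> D" "\<forall>j. j \<notin> \<sigma> \<longrightarrow> k $ j = w0 $ j" for k
      proof -
        have "\<not> k1 \<le> k" using down k(1) k1(2) by blast
        then obtain j where j: "k $ j < k1 $ j" by (auto simp: less_eq_vec_def not_le)
        then have js: "j \<in> \<sigma>" using k(2) k1(1) by force
        have "F j (k $ j) (amap A (emb k)) = 0" using F[OF js] k by auto
        then have "(\<Prod>v<k1 $ j. F j v (amap A (emb k))) = 0" using j by (intro prod_zero) auto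
        then show ?thesis using js psubset.hyps by (intro prod_zero) auto
      qed
      ultimately show ?thesis by blast
    qed
  qed
  from this[of UNIV 0] obtain f where f: "polyfn f" "f \<beta> \<noteq> 0" "\<And>k. k \<in> D \<Longrightarrow> f (amap A (emb k)) = 0" by auto
  have "polyfn (\<lambda>a. (1 / f \<beta>) * f a)" by (intro polyfn.intros f)
  then show ?thesis using f unfolding D_def by (intro exI[of _ "\<lambda>a. (1 / f \<beta>) * f a"]) auto
qed

section \<open>Germs and sheafification\<close>

lemma D_sheaf_simps [simp]: "rsections D_sheaf U = diff_ops U" "rres D_sheaf U V P = restrict P (opens_in V)"
  by (simp_all add: D_sheaf_def)

text \<open>
  Presheaves of \<open>\<D>\<close>-modules, reduced to the closure and compatibility properties that the
  calculations with germs need.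
\<close>

locale psh =
  fixes F :: "(complex^'n, 'n opr, 'm) module_presheaf"
  assumes add_cl: "open U \<Longrightarrow> s \<in> carrier (sections F U) \<Longrightarrow> t \<in> carrier (sections F U) \<Longrightarrow>
      s \<oplus>\<^bsub>sections F U\<^esub> t \<in> carrier (sections F U)"
    and smult_cl: "open U \<Longrightarrow> a \<in> carrier (diff_ops U) \<Longrightarrow> s \<in> carrier (sections F U) \<Longrightarrow>
      a \<odot>\<^bsub>sections F U\<^esub> s \<in> carrier (sections F U)"
    and res_cl: "open U \<Longrightarrow> open V \<Longrightarrow> V \<subseteq> U \<Longrightarrow> s \<in> carrier (sections F U) \<Longrightarrow> res F U V s \<in> carrier (sections F V)"
    and res_res: "open U \<Longrightarrow> open V \<Longrightarrow> open X \<Longrightarrow> X \<subseteq> V \<Longrightarrow> V \<subseteq> U \<Longrightarrow> s \<in> carrier (sections F U) \<Longrightarrow>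
      res F V X (res F U V s) = res F U X s"
    and res_smult: "open U \<Longrightarrow> open V \<Longrightarrow> V \<subseteq> U \<Longrightarrow> a \<in> carrier (diff_ops U) \<Longrightarrow> s \<in> carrier (sections F U) \<Longrightarrow>
      res F U V (a \<odot>\<^bsub>sections F U\<^esub> s) = restrict a (opens_in V) \<odot>\<^bsub>sections F V\<^esub> res F U V s"
begin

abbreviation "sec \<equiv> sections (sheafify D_sheaf F)"

lemma germ_iff: "(V, t) \<in> germ F x U s \<longleftrightarrow> open V \<and> x \<in> V \<and> t \<in> carrier (sections F V) \<and>
    (\<exists>X. open X \<and> x \<in> X \<and> X \<subseteq> U \<inter> V \<and> res F U X s = res F V X t)"
  by (simp add: germ_def)

lemma germ_self: "open U \<Longrightarrow> x \<in> U \<Longrightarrow> s \<in> carrier (sections F U) \<Longrightarrow> (U, s) \<in> germ F x U s"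
  by (auto simp: germ_iff)

lemma germ_mono:
  assumes "open U" "open V" "V \<subseteq> U" "x \<in> V" and s: "s \<in> carrier (sections F U)"
  shows "germ F x V (res F U V s) \<subseteq> germ F x U s"
proof
  fix Zt assume "Zt \<in> germ F x V (res F U V s)"
  then obtain Z t X where Zt: "Zt = (Z, t)" "open Z" "x \<in> Z" "t \<in> carrier (sections F Z)"
    "open X" "x \<in> X" "X \<subseteq> V \<inter> Z" "res F V X (res F U V s) = res F Z X t"
    by (cases Zt) (auto simp: germ_iff)
  have "res F U X s = res F Z X t" using Zt(8) res_res[of U V X s] assms Zt by simp
  then show "Zt \<in> germ F x U s" using Zt assms by (auto simp: germ_iff intro!: exI[of _ X])
qed

lemma germ_res:
  assumes U: "open U" "open V" "V \<subseteq> U" "x \<in> V" and s: "s \<in> carrier (sections F U)"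
  shows "germ F x V (res F U V s) = germ F x U s"
proof
  show "germ F x V (res F U V s) \<subseteq> germ F x U s" by (rule germ_mono[OF assms])
  show "germ F x U s \<subseteq> germ F x V (res F U V s)"
  proof
    fix Zt assume "Zt \<in> germ F x U s"
    then obtain Z t X where Zt: "Zt = (Z, t)" "open Z" "x \<in> Z" "t \<in> carrier (sections F Z)"
      "open X" "x \<in> X" "X \<subseteq> U \<inter> Z" "res F U X s = res F Z X t"
      by (cases Zt) (auto simp: germ_iff)
    let ?X = "X \<inter> V"
    have o: "open ?X" "?X \<subseteq> X" "?X \<subseteq> V" "X \<subseteq> U" "X \<subseteq> Z" using Zt U by auto
    have "res F V ?X (res F U V s) = res F U ?X s" by (rule res_res[OF U(1,2) o(1,3) U(3) s])
    also have "\<dots> = res F X ?X (res F U X s)" by (rule res_res[OF U(1) Zt(5) o(1,2,4) s, symmetric])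
    also have "\<dots> = res F Z ?X t" unfolding Zt(8) by (rule res_res[OF Zt(2,5) o(1,2,5) Zt(4)])
    finally show "Zt \<in> germ F x V (res F U V s)"
      using Zt o U by (auto simp: germ_iff intro!: exI[of _ ?X])
  qed
qed

lemma germ_eqI:
  assumes U: "open U" "s \<in> carrier (sections F U)" and V: "open V" "t \<in> carrier (sections F V)"
    and X: "open X" "x \<in> X" "X \<subseteq> U" "X \<subseteq> V" "res F U X s = res F V X t"
  shows "germ F x U s = germ F x V t"
  using germ_res[OF U(1) X(1,3,2) U(2)] germ_res[OF V(1) X(1,4,2) V(2)] X(5) by simp

lemma germ_smult_germ:
  assumes U: "open U" "x \<in> U" "a \<in> carrier (diff_ops U)" and V: "open V" "x \<in> V" "t \<in> carrier (sections F V)"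
  shows "germ_smult D_sheaf F x U a (germ F x V t) =
    germ F x (U \<inter> V) (restrict a (opens_in (U \<inter> V)) \<odot>\<^bsub>sections F (U \<inter> V)\<^esub> res F V (U \<inter> V) t)"
proof -
  have a: "restrict a (opens_in X) \<in> carrier (diff_ops X)" if "open X" "X \<subseteq> U" for X
    using restrict_diff_ops[OF U(3)] that by (simp add: opens_in_def)
  have "germ F x (U \<inter> Z) (restrict a (opens_in (U \<inter> Z)) \<odot>\<^bsub>sections F (U \<inter> Z)\<^esub> res F Z (U \<inter> Z) t') =
      germ F x (U \<inter> V) (restrict a (opens_in (U \<inter> V)) \<odot>\<^bsub>sections F (U \<inter> V)\<^esub> res F V (U \<inter> V) t)"
    if Zt: "(Z, t') \<in> germ F x V t" for Z t'
  proof -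
    obtain X where Z: "open Z" "x \<in> Z" "t' \<in> carrier (sections F Z)"
      "open X" "x \<in> X" "X \<subseteq> V" "X \<subseteq> Z" "res F V X t = res F Z X t'"
      using Zt by (auto simp: germ_iff)
    have key: "res F (U \<inter> Y) (U \<inter> X) (restrict a (opens_in (U \<inter> Y)) \<odot>\<^bsub>sections F (U \<inter> Y)\<^esub> res F Y (U \<inter> Y) u)
        = restrict a (opens_in (U \<inter> X)) \<odot>\<^bsub>sections F (U \<inter> X)\<^esub> res F X (U \<inter> X) (res F Y X u)"
      and cl: "restrict a (opens_in (U \<inter> Y)) \<odot>\<^bsub>sections F (U \<inter> Y)\<^esub> res F Y (U \<inter> Y) u \<in> carrier (sections F (U \<inter> Y))"
      if Y: "open Y" "X \<subseteq> Y" "u \<in> carrier (sections F Y)" for Y u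
    proof -
      have o: "open (U \<inter> Y)" "open (U \<inter> X)" "U \<inter> X \<subseteq> U \<inter> Y" "U \<inter> Y \<subseteq> Y" "U \<inter> X \<subseteq> X" "U \<inter> X \<subseteq> Y"
        using U Y Z by auto
      have r: "res F Y (U \<inter> Y) u \<in> carrier (sections F (U \<inter> Y))" by (rule res_cl[OF Y(1) o(1,4) Y(3)])
      have "res F (U \<inter> Y) (U \<inter> X) (restrict a (opens_in (U \<inter> Y)) \<odot>\<^bsub>sections F (U \<inter> Y)\<^esub> res F Y (U \<inter> Y) u)
        = restrict (restrict a (opens_in (U \<inter> Y))) (opens_in (U \<inter> X)) \<odot>\<^bsub>sections F (U \<inter> X)\<^esub> res F (U \<inter> Y) (U \<inter> X) (res F Y (U \<inter> Y) u)"
        by (rule res_smult[OF o(1,2,3) a[OF o(1)] r]) simp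
      also have "restrict (restrict a (opens_in (U \<inter> Y))) (opens_in (U \<inter> X)) = restrict a (opens_in (U \<inter> X))"
        by (rule restrict_op_restrict) (use o in \<open>simp add: opens_in_def\<close>)
      also have "res F (U \<inter> Y) (U \<inter> X) (res F Y (U \<inter> Y) u) = res F Y (U \<inter> X) u"
        by (rule res_res[OF Y(1) o(1,2,3,4) Y(3)])
      also have "\<dots> = res F X (U \<inter> X) (res F Y X u)"
        by (rule res_res[OF Y(1) Z(4) o(2,5) Y(2,3), symmetric])
      finally show "res F (U \<inter> Y) (U \<inter> X) (restrict a (opens_in (U \<inter> Y)) \<odot>\<^bsub>sections F (U \<inter> Y)\<^esub> res F Y (U \<inter> Y) u)
        = restrict a (opens_in (U \<inter> X)) \<odot>\<^bsub>sections F (U \<inter> X)\<^esub> res F X (U \<inter> X) (res F Y X u)" .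
      show "restrict a (opens_in (U \<inter> Y)) \<odot>\<^bsub>sections F (U \<inter> Y)\<^esub> res F Y (U \<inter> Y) u \<in> carrier (sections F (U \<inter> Y))"
        by (rule smult_cl[OF o(1) a[OF o(1)] r]) simp
    qed
    show ?thesis
    proof (rule germ_eqI[OF _ cl[OF Z(1,7,3)] _ cl[OF V(1) Z(6) V(3)], of "U \<inter> X"])
      show "res F (U \<inter> Z) (U \<inter> X) (restrict a (opens_in (U \<inter> Z)) \<odot>\<^bsub>sections F (U \<inter> Z)\<^esub> res F Z (U \<inter> Z) t') =
        res F (U \<inter> V) (U \<inter> X) (restrict a (opens_in (U \<inter> V)) \<odot>\<^bsub>sections F (U \<inter> V)\<^esub> res F V (U \<inter> V) t)"
        unfolding key[OF Z(1,7,3)] key[OF V(1) Z(6) V(3)] Z(8) ..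
    qed (use U V Z in auto)
  qed
  moreover have "(V, t) \<in> germ F x V t" using germ_self V by blast
  ultimately show ?thesis unfolding germ_smult_def D_sheaf_simps by blast
qed

lemma sec_carrier: "\<sigma> \<in> carrier (sec U) \<longleftrightarrow> \<sigma> \<in> extensional U \<and> (\<forall>x\<in>U. \<exists>V s. open V \<and> x \<in> V \<and> V \<subseteq> U \<and>
                      s \<in> carrier (sections F V) \<and> (\<forall>y\<in>V. \<sigma> y = germ F y V s))"
  by (simp add: sheafify_def)

lemma sec_smult: "a \<odot>\<^bsub>sec U\<^esub> \<sigma> = (\<lambda>x\<in>U. germ_smult D_sheaf F x U a (\<sigma> x))"
  by (simp add: sheafify_def)

lemma sec_add: "\<sigma> \<oplus>\<^bsub>sec U\<^esub> \<rho> = (\<lambda>x\<in>U. germ_add F x (\<sigma> x) (\<rho> x))"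
  by (simp add: sheafify_def)

lemma sec_res: "res (sheafify D_sheaf F) U V \<sigma> = restrict \<sigma> V"
  by (simp add: sheafify_def)

lemma sec_smult_germ:
  assumes U: "open U" "a \<in> carrier (diff_ops U)" and V: "open V" "V \<subseteq> U" "y \<in> V" "s \<in> carrier (sections F V)"
    and \<sigma>: "\<sigma> y = germ F y V s"
  shows "(a \<odot>\<^bsub>sec U\<^esub> \<sigma>) y = germ F y V (restrict a (opens_in V) \<odot>\<^bsub>sections F V\<^esub> s)"
proof -
  have eq: "U \<inter> V = V" using V by auto
  have rVV: "germ F y V (restrict a (opens_in V) \<odot>\<^bsub>sections F V\<^esub> res F V V s) = germ F y V (restrict a (opens_in V) \<odot>\<^bsub>sections F V\<^esub> s)"
  proof -
    have a: "restrict a (opens_in V) \<in> carrier (diff_ops V)"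
      using restrict_diff_ops[OF U(2)] V by (simp add: opens_in_def)
    have r: "res F V V s \<in> carrier (sections F V)" using res_cl V by blast
    have "res F V V (restrict a (opens_in V) \<odot>\<^bsub>sections F V\<^esub> res F V V s) = res F V V (restrict a (opens_in V) \<odot>\<^bsub>sections F V\<^esub> s)"
      using res_smult[OF V(1,1) order_refl a r] res_smult[OF V(1,1) order_refl a V(4)] res_res[OF V(1,1,1) order_refl order_refl V(4)] by simp
    then show ?thesis
      using germ_eqI[OF V(1) smult_cl[OF V(1) a r] V(1) smult_cl[OF V(1) a V(4)] V(1,3)] by blast
  qed
  show ?thesis
    unfolding sec_smult using V U germ_smult_germ[OF U(1) _ U(2) V(1,3,4)] \<sigma> rVV by (auto simp: eq)
qed

lemma sec_smult_cl:
  assumes U: "open U" "a \<in> carrier (diff_ops U)" and \<sigma>: "\<sigma> \<in> carrier (sec U)"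
  shows "a \<odot>\<^bsub>sec U\<^esub> \<sigma> \<in> carrier (sec U)"
  unfolding sec_carrier
proof (intro conjI ballI)
  show "a \<odot>\<^bsub>sec U\<^esub> \<sigma> \<in> extensional U" by (simp add: sec_smult)
  fix x assume "x \<in> U"
  then obtain V s where V: "open V" "x \<in> V" "V \<subseteq> U" "s \<in> carrier (sections F V)" "\<forall>y\<in>V. \<sigma> y = germ F y V s"
    using \<sigma> unfolding sec_carrier by blast
  have a: "restrict a (opens_in V) \<in> carrier (diff_ops V)"
    using restrict_diff_ops[OF U(2)] V by (simp add: opens_in_def)
  show "\<exists>V s. open V \<and> x \<in> V \<and> V \<subseteq> U \<and> s \<in> carrier (sections F V) \<and> (\<forall>y\<in>V. (a \<odot>\<^bsub>sec U\<^esub> \<sigma>) y = germ F y V s)"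
    using V sec_smult_germ[OF U V(1,3)] smult_cl[OF V(1) a V(4)]
    by (intro exI[of _ V] exI[of _ "restrict a (opens_in V) \<odot>\<^bsub>sections F V\<^esub> s"]) auto
qed

lemma sec_res_cl:
  assumes U: "open U" "open V" "V \<subseteq> U" and \<sigma>: "\<sigma> \<in> carrier (sec U)"
  shows "restrict \<sigma> V \<in> carrier (sec V)"
  unfolding sec_carrier
proof (intro conjI ballI)
  fix x assume x: "x \<in> V"
  then obtain X s where X: "open X" "x \<in> X" "X \<subseteq> U" "s \<in> carrier (sections F X)" "\<forall>y\<in>X. \<sigma> y = germ F y X s"
    using \<sigma> U unfolding sec_carrier by blast
  have o: "open (X \<inter> V)" "X \<inter> V \<subseteq> X" using X U by auto
  show "\<exists>X s. open X \<and> x \<in> X \<and> X \<subseteq> V \<and> s \<in> carrier (sections F X) \<and> (\<forall>y\<in>X. restrict \<sigma> V y = germ F y X s)"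
    using X x o res_cl[OF X(1) o X(4)] germ_res[OF X(1) o _ X(4)]
    by (intro exI[of _ "X \<inter> V"] exI[of _ "res F X (X \<inter> V) s"]) auto
qed simp

text \<open>
  The section of the sheafification defined by a section of the presheaf.
\<close>

definition gsec :: "(complex^'n) set \<Rightarrow> 'm \<Rightarrow> complex^'n \<Rightarrow> ((complex^'n) set \<times> 'm) set" where
  "gsec U s = (\<lambda>x\<in>U. germ F x U s)"

lemma gsec_carrier: "open U \<Longrightarrow> s \<in> carrier (sections F U) \<Longrightarrow> gsec U s \<in> carrier (sec U)"
  unfolding sec_carrier gsec_def by auto

lemma gsec_smult:
  assumes "open U" "a \<in> carrier (diff_ops U)" "s \<in> carrier (sections F U)"
  shows "a \<odot>\<^bsub>sec U\<^esub> gsec U s = gsec U (a \<odot>\<^bsub>sections F U\<^esub> s)"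
proof
  fix x
  have "restrict a (opens_in U) = a"
  proof -
    have "a \<in> extensional (opens_in U)"
      using diff_ops_End[OF assms(2)] by (simp add: End_hol_carrier_iff PiE_def)
    then show ?thesis by (rule extensional_restrict)
  qed
  then show "(a \<odot>\<^bsub>sec U\<^esub> gsec U s) x = gsec U (a \<odot>\<^bsub>sections F U\<^esub> s) x"
    using sec_smult_germ[OF assms(1,2) assms(1) order_refl _ assms(3), of x "gsec U s"]
    by (cases "x \<in> U") (auto simp: gsec_def sec_smult)
qed

lemma gsec_res:
  assumes "open U" "open V" "V \<subseteq> U" "s \<in> carrier (sections F U)"
  shows "restrict (gsec U s) V = gsec V (res F U V s)"
  using assms germ_res[OF assms(1,2,3) _ assms(4)] by (auto simp: gsec_def fun_eq_iff)

end

section \<open>Transport along an isomorphism of presheaves\<close>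

text \<open>
  An isomorphism \<open>\<Phi>\<close> of presheaves of \<open>\<D>\<close>-modules with inverse \<open>\<Phi>'\<close>.
\<close>

locale piso = F: psh F + G: psh G
  for F :: "(complex^'n, 'n opr, 'm) module_presheaf" and G :: "(complex^'n, 'n opr, 'k) module_presheaf" +
  fixes \<Phi> :: "(complex^'n) set \<Rightarrow> 'm \<Rightarrow> 'k" and \<Phi>' :: "(complex^'n) set \<Rightarrow> 'k \<Rightarrow> 'm"
  assumes cl: "open U \<Longrightarrow> s \<in> carrier (sections F U) \<Longrightarrow> \<Phi> U s \<in> carrier (sections G U)"
    and cl': "open U \<Longrightarrow> u \<in> carrier (sections G U) \<Longrightarrow> \<Phi>' U u \<in> carrier (sections F U)"
    and inv1: "open U \<Longrightarrow> s \<in> carrier (sections F U) \<Longrightarrow> \<Phi>' U (\<Phi> U s) = s"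
    and inv2: "open U \<Longrightarrow> u \<in> carrier (sections G U) \<Longrightarrow> \<Phi> U (\<Phi>' U u) = u"
    and hom_add: "open U \<Longrightarrow> s \<in> carrier (sections F U) \<Longrightarrow> t \<in> carrier (sections F U) \<Longrightarrow>
      \<Phi> U (s \<oplus>\<^bsub>sections F U\<^esub> t) = \<Phi> U s \<oplus>\<^bsub>sections G U\<^esub> \<Phi> U t"
    and hom_smult: "open U \<Longrightarrow> a \<in> carrier (diff_ops U) \<Longrightarrow> s \<in> carrier (sections F U) \<Longrightarrow>
      \<Phi> U (a \<odot>\<^bsub>sections F U\<^esub> s) = a \<odot>\<^bsub>sections G U\<^esub> \<Phi> U s"
    and hom_res: "open U \<Longrightarrow> open V \<Longrightarrow> V \<subseteq> U \<Longrightarrow> s \<in> carrier (sections F U) \<Longrightarrow>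
      \<Phi> V (res F U V s) = res G U V (\<Phi> U s)"
begin

text \<open>
  The induced map on germs. A germ is the set of all its
  representatives, so that its image under \<open>\<Phi>\<close> is elementwise.
\<close>

definition tr :: "((complex^'n) set \<times> 'm) set \<Rightarrow> ((complex^'n) set \<times> 'k) set" where
  "tr X = (\<lambda>(V, t). (V, \<Phi> V t)) ` X"

text \<open>
  The induced map on sections of the sheafification, which are families of germs.
\<close>

definition trs :: "(complex^'n) set \<Rightarrow> (complex^'n \<Rightarrow> ((complex^'n) set \<times> 'm) set) \<Rightarrow> complex^'n \<Rightarrow> ((complex^'n) set \<times> 'k) set" where
  "trs U \<sigma> = (\<lambda>x\<in>U. tr (\<sigma> x))"

lemma tr_germ:
  assumes U: "open U" and s: "s \<in> carrier (sections F U)"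
  shows "tr (germ F x U s) = germ G x U (\<Phi> U s)"
proof (intro Set.set_eqI iffI)
  fix Zt assume "Zt \<in> tr (germ F x U s)"
  then obtain Z t X where Z: "Zt = (Z, \<Phi> Z t)" "open Z" "x \<in> Z" "t \<in> carrier (sections F Z)"
    "open X" "x \<in> X" "X \<subseteq> U" "X \<subseteq> Z" "res F U X s = res F Z X t"
    unfolding tr_def by (auto simp: F.germ_iff)
  have "res G U X (\<Phi> U s) = res G Z X (\<Phi> Z t)"
    using hom_res[OF U Z(5,7) s] hom_res[OF Z(2,5,8,4)] Z(9) by simp
  then show "Zt \<in> germ G x U (\<Phi> U s)" using Z cl[OF Z(2,4)] by (auto simp: G.germ_iff)
next
  fix Zt assume "Zt \<in> germ G x U (\<Phi> U s)"
  then obtain Z t X where Z: "Zt = (Z, t)" "open Z" "x \<in> Z" "t \<in> carrier (sections G Z)"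
    "open X" "x \<in> X" "X \<subseteq> U" "X \<subseteq> Z" "res G U X (\<Phi> U s) = res G Z X t"
    by (cases Zt) (auto simp: G.germ_iff)
  define t' where "t' = \<Phi>' Z t"
  have t': "t' \<in> carrier (sections F Z)" "\<Phi> Z t' = t" unfolding t'_def using cl' inv2 Z by auto
  have "\<Phi> X (res F U X s) = \<Phi> X (res F Z X t')"
    using hom_res[OF U Z(5,7) s] hom_res[OF Z(2,5,8) t'(1)] Z(9) t'(2) by simp
  then have "res F U X s = res F Z X t'"
    using inv1[OF Z(5) F.res_cl[OF U Z(5,7) s]] inv1[OF Z(5) F.res_cl[OF Z(2,5,8) t'(1)]] by metis
  then have "(Z, t') \<in> germ F x U s" using Z t' by (auto simp: F.germ_iff)
  then show "Zt \<in> tr (germ F x U s)" unfolding tr_def using Z t' by force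
qed

lemma trs_carrier:
  assumes U: "open U" and \<sigma>: "\<sigma> \<in> carrier (F.sec U)"
  shows "trs U \<sigma> \<in> carrier (G.sec U)"
  unfolding G.sec_carrier
proof (intro conjI ballI)
  fix x assume x: "x \<in> U"
  then obtain V s where V: "open V" "x \<in> V" "V \<subseteq> U" "s \<in> carrier (sections F V)" "\<forall>y\<in>V. \<sigma> y = germ F y V s"
    using \<sigma> unfolding F.sec_carrier by blast
  then show "\<exists>V s. open V \<and> x \<in> V \<and> V \<subseteq> U \<and> s \<in> carrier (sections G V) \<and> (\<forall>y\<in>V. trs U \<sigma> y = germ G y V s)"
    using cl[OF V(1,4)] tr_germ[OF V(1,4)] by (intro exI[of _ V] exI[of _ "\<Phi> V s"]) (auto simp: trs_def)
qed (simp add: trs_def)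

lemma sec_valid:
  assumes \<sigma>: "\<sigma> \<in> carrier (F.sec U)" and x: "x \<in> U"
  shows "\<exists>V s. open V \<and> x \<in> V \<and> V \<subseteq> U \<and> s \<in> carrier (sections F V) \<and> \<sigma> x = germ F x V s"
proof -
  obtain V s where "open V" "x \<in> V" "V \<subseteq> U" "s \<in> carrier (sections F V)" "\<forall>y\<in>V. \<sigma> y = germ F y V s"
    using conjunct2[OF iffD1[OF F.sec_carrier \<sigma>], rule_format, OF x] by (elim exE conjE)
  then show ?thesis by (intro exI[of _ V] exI[of _ s] conjI) simp_all
qed

lemma valid_elt: "\<sigma> \<in> carrier (F.sec U) \<Longrightarrow> x \<in> U \<Longrightarrow> (V, t) \<in> \<sigma> x \<Longrightarrow> open V \<and> x \<in> V \<and> t \<in> carrier (sections F V)"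
  by (drule (1) sec_valid, elim exE conjE) (simp add: F.germ_iff)

lemma tr_add:
  assumes X: "\<And>V t. (V, t) \<in> X \<Longrightarrow> open V \<and> t \<in> carrier (sections F V)"
    and Y: "\<And>V t. (V, t) \<in> Y \<Longrightarrow> open V \<and> t \<in> carrier (sections F V)"
  shows "tr (germ_add F x X Y) = germ_add G x (tr X) (tr Y)"
proof -
  have *: "tr (germ F x (U \<inter> V) (res F U (U \<inter> V) s \<oplus>\<^bsub>sections F (U \<inter> V)\<^esub> res F V (U \<inter> V) t))
      = germ G x (U \<inter> V) (res G U (U \<inter> V) (\<Phi> U s) \<oplus>\<^bsub>sections G (U \<inter> V)\<^esub> res G V (U \<inter> V) (\<Phi> V t))"
    if "(U, s) \<in> X" "(V, t) \<in> Y" for U s V t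
  proof -
    have o: "open U" "open V" "s \<in> carrier (sections F U)" "t \<in> carrier (sections F V)" "open (U \<inter> V)"
      using X[OF that(1)] Y[OF that(2)] by auto
    have r: "res F U (U \<inter> V) s \<in> carrier (sections F (U \<inter> V))" "res F V (U \<inter> V) t \<in> carrier (sections F (U \<inter> V))"
      using F.res_cl o by auto
    show ?thesis
      using tr_germ[OF o(5) F.add_cl[OF o(5) r]] hom_add[OF o(5) r] hom_res[OF o(1,5) _ o(3)] hom_res[OF o(2,5) _ o(4)] by simp
  qed
  have "tr (germ_add F x X Y) = (\<Union>(U, s)\<in>X. \<Union>(V, t)\<in>Y. tr (germ F x (U \<inter> V) (res F U (U \<inter> V) s \<oplus>\<^bsub>sections F (U \<inter> V)\<^esub> res F V (U \<inter> V) t)))"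
    unfolding germ_add_def tr_def by (simp add: image_UN case_prod_beta)
  also have "\<dots> = (\<Union>(U, s)\<in>X. \<Union>(V, t)\<in>Y. germ G x (U \<inter> V) (res G U (U \<inter> V) (\<Phi> U s) \<oplus>\<^bsub>sections G (U \<inter> V)\<^esub> res G V (U \<inter> V) (\<Phi> V t)))"
    using * by (intro SUP_cong refl) (auto intro!: SUP_cong simp: case_prod_beta)
  also have "\<dots> = germ_add G x (tr X) (tr Y)"
    unfolding germ_add_def tr_def by (simp add: case_prod_beta)
  finally show ?thesis .
qed

end

lemma piso_sym: assumes "piso F G \<Phi> \<Phi>'" shows "piso G F \<Phi>' \<Phi>"
proof -
  interpret piso F G \<Phi> \<Phi>' by fact
  show ?thesis
  proof (unfold_locales, goal_cases)
    case (5 U s t)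
    then show ?case using hom_add[OF 5(1) cl' cl'] inv1 inv2 cl' F.add_cl by metis
  next
    case (6 U a s)
    then show ?case using hom_smult[OF 6(1,2) cl'] inv1 inv2 cl' F.smult_cl by metis
  next
    case (7 U V s)
    then show ?case using hom_res[OF 7(1,2,3) cl'] inv1 inv2 cl' F.res_cl by metis
  qed (simp_all add: cl cl' inv1 inv2)
qed

lemma (in piso) trs_inverse:
  assumes U: "open U" and \<sigma>: "\<sigma> \<in> carrier (F.sec U)"
  shows "piso.trs \<Phi>' U (trs U \<sigma>) = \<sigma>"
proof
  interpret S: piso G F \<Phi>' \<Phi> by (rule piso_sym) (rule piso_axioms)
  fix x show "S.trs U (trs U \<sigma>) x = \<sigma> x"
  proof (cases "x \<in> U")
    case True
    then obtain V s where V: "open V" "s \<in> carrier (sections F V)" "\<sigma> x = germ F x V s"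
      using sec_valid[OF \<sigma>] by blast
    have "S.trs U (trs U \<sigma>) x = germ F x V (\<Phi>' V (\<Phi> V s))"
      using True V by (simp add: S.trs_def trs_def tr_germ S.tr_germ cl)
    then show ?thesis using V inv1 by simp
  next
    case False
    then show ?thesis using \<sigma> unfolding F.sec_carrier by (simp add: S.trs_def extensional_def)
  qed
qed

lemma (in piso) sheafify_iso: "isomorphic_modules D_sheaf (sheafify D_sheaf F) (sheafify D_sheaf G)"
  unfolding isomorphic_modules_def
proof (intro exI[of _ trs] conjI allI impI ballI)
  interpret S: piso G F \<Phi>' \<Phi> by (rule piso_sym) (rule piso_axioms)
  fix U :: "(complex^'n) set" assume U: "open U"
  show "bij_betw (trs U) (carrier (F.sec U)) (carrier (G.sec U))"
  proof (rule bij_betw_byWitness[where f' = "S.trs U"])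
    show "\<forall>\<sigma>\<in>carrier (F.sec U). S.trs U (trs U \<sigma>) = \<sigma>"
      by (rule ballI) (rule trs_inverse[OF U])
    show "\<forall>\<sigma>\<in>carrier (G.sec U). trs U (S.trs U \<sigma>) = \<sigma>"
      by (rule ballI) (rule S.trs_inverse[OF U])
    show "trs U ` carrier (F.sec U) \<subseteq> carrier (G.sec U)"
      by (rule image_subsetI) (rule trs_carrier[OF U])
    show "S.trs U ` carrier (G.sec U) \<subseteq> carrier (F.sec U)"
      by (rule image_subsetI) (rule S.trs_carrier[OF U])
  qed
  {
    fix \<sigma> \<rho> assume s: "\<sigma> \<in> carrier (F.sec U)" "\<rho> \<in> carrier (F.sec U)"
    show "trs U (\<sigma> \<oplus>\<^bsub>F.sec U\<^esub> \<rho>) = trs U \<sigma> \<oplus>\<^bsub>G.sec U\<^esub> trs U \<rho>"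
      unfolding F.sec_add G.sec_add trs_def
    proof (rule restrict_ext)
      fix x assume x: "x \<in> U"
      have v: "open V \<and> t \<in> carrier (sections F V)" if "(V, t) \<in> \<sigma> x" for V t
        using valid_elt[OF s(1) x that] by simp
      have w: "open V \<and> t \<in> carrier (sections F V)" if "(V, t) \<in> \<rho> x" for V t
        using valid_elt[OF s(2) x that] by simp
      show "tr ((\<lambda>x\<in>U. germ_add F x (\<sigma> x) (\<rho> x)) x) = germ_add G x ((\<lambda>x\<in>U. tr (\<sigma> x)) x) ((\<lambda>x\<in>U. tr (\<rho> x)) x)"
        using x tr_add[OF v w] by (simp only: restrict_apply if_True)
    qed
  next
    fix a \<sigma> assume a: "a \<in> carrier (rsections D_sheaf U)" and s: "\<sigma> \<in> carrier (F.sec U)"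
    have a: "a \<in> carrier (diff_ops U)" using a by simp
    show "trs U (a \<odot>\<^bsub>F.sec U\<^esub> \<sigma>) = a \<odot>\<^bsub>G.sec U\<^esub> trs U \<sigma>"
    proof
      fix x show "trs U (a \<odot>\<^bsub>F.sec U\<^esub> \<sigma>) x = (a \<odot>\<^bsub>G.sec U\<^esub> trs U \<sigma>) x"
      proof (cases "x \<in> U")
        case True
        then obtain V t where V: "open V" "x \<in> V" "V \<subseteq> U" "t \<in> carrier (sections F V)" "\<sigma> x = germ F x V t"
          using sec_valid[OF s] by blast
        have aV: "restrict a (opens_in V) \<in> carrier (diff_ops V)"
          using restrict_diff_ops[OF a] V by (simp add: opens_in_def)
        have t: "trs U \<sigma> x = germ G x V (\<Phi> V t)" using True V tr_germ by (simp add: trs_def)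
        have "trs U (a \<odot>\<^bsub>F.sec U\<^esub> \<sigma>) x = tr (germ F x V (restrict a (opens_in V) \<odot>\<^bsub>sections F V\<^esub> t))"
          using True F.sec_smult_germ[where \<sigma> = \<sigma>, OF U a V(1,3,2,4,5)] by (simp add: trs_def)
        also have "\<dots> = germ G x V (restrict a (opens_in V) \<odot>\<^bsub>sections G V\<^esub> \<Phi> V t)"
          using tr_germ[OF V(1) F.smult_cl[OF V(1) aV V(4)]] hom_smult[OF V(1) aV V(4)] by simp
        also have "\<dots> = (a \<odot>\<^bsub>G.sec U\<^esub> trs U \<sigma>) x"
          using G.sec_smult_germ[where \<sigma> = "trs U \<sigma>", OF U a V(1,3,2) cl[OF V(1,4)] t] by simp
        finally show ?thesis .
      qed (simp add: trs_def G.sec_smult)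
    qed
  }
next
  fix U V :: "(complex^'n) set" and \<sigma> assume *: "open U" "open V" "V \<subseteq> U" "\<sigma> \<in> carrier (F.sec U)"
  show "trs V (res (sheafify D_sheaf F) U V \<sigma>) = res (sheafify D_sheaf G) U V (trs U \<sigma>)"
    unfolding F.sec_res G.sec_res trs_def using * by (auto simp: fun_eq_iff)
qed

section \<open>Tensor products with the sheaf of differential operators\<close>

lemma group_closure_map:
  fixes g :: "'a::ab_group_add \<Rightarrow> 'b::ab_group_add"
  assumes g: "\<And>a b. g (a - b) = g a - g b" and S: "\<And>c. c \<in> S \<Longrightarrow> g c \<in> group_closure S'"
    and c: "c \<in> group_closure S"
  shows "g c \<in> group_closure S'"
  using c
proof (induction rule: group_closure.induct)
  case (base s)
  have "g 0 = 0" using g[of 0 0] by simp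
  then show ?case using base S by auto
next
  case (diff s t)
  show ?case unfolding g by (rule group_closure.diff[OF diff.IH])
qed

lemma coset_eq_iff: "(a :: 'a::ab_group_add) +o group_closure S = b +o group_closure S \<longleftrightarrow> a - b \<in> group_closure S"
proof
  assume "a +o group_closure S = b +o group_closure S"
  moreover have "a \<in> a +o group_closure S" using group_closure_coset[of a 0 S] by simp
  ultimately obtain k where "a = b + k" "k \<in> group_closure S" by (auto simp: elt_set_plus_def)
  then show "a - b \<in> group_closure S" by simp
next
  assume ab: "a - b \<in> group_closure S"
  have "a +o group_closure S \<subseteq> b +o group_closure S" if "a - b \<in> group_closure S" for a b :: 'a
  proof
    fix x assume "x \<in> a +o group_closure S"
    then obtain k where k: "x = a + k" "k \<in> group_closure S" by (auto simp: elt_set_plus_def)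
    then have "x = b + ((a - b) + k)" by simp
    then show "x \<in> b +o group_closure S" using that k group_closure_add by (blast intro: set_plus_intro2)
  qed
  then show "a +o group_closure S = b +o group_closure S"
    using ab group_closure_minus_iff[of "a - b" S] by (metis minus_diff_eq subset_antisym)
qed

lemma coset_add: "(a +o group_closure S) + (b +o group_closure S) = (a + b) +o group_closure S"
  for a :: "'a::ab_group_add"
proof (intro Set.set_eqI iffI)
  fix x assume "x \<in> (a +o group_closure S) + (b +o group_closure S)"
  then obtain k l where "x = (a + k) + (b + l)" "k \<in> group_closure S" "l \<in> group_closure S"
    by (auto simp: elt_set_plus_def set_plus_def)
  then have "x = (a + b) + (k + l)" "k + l \<in> group_closure S" by (simp_all add: group_closure_add)
  then show "x \<in> (a + b) +o group_closure S" by (auto simp: elt_set_plus_def)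
next
  fix x assume "x \<in> (a + b) +o group_closure S"
  then obtain k where k: "x = (a + k) + (b + 0)" "k \<in> group_closure S" by (auto simp: elt_set_plus_def algebra_simps)
  have "a + k \<in> a +o group_closure S" "b + 0 \<in> b +o group_closure S"
    using group_closure_coset[of a k S] group_closure_coset[of b 0 S] k(2) zero_in_group_closure[of S] by blast+
  then show "x \<in> (a +o group_closure S) + (b +o group_closure S)" unfolding k(1) by (rule set_plus_intro)
qed

text \<open>
  An additive map that respects the relations is well defined on cosets, in the form of the union
  over all representatives.
\<close>

lemma coset_map:
  fixes g :: "'a::ab_group_add \<Rightarrow> 'b::ab_group_add"
  assumes g: "\<And>a b. g (a - b) = g a - g b" and S: "\<And>c. c \<in> group_closure S \<Longrightarrow> g c \<in> group_closure S'"
  shows "(\<Union>c\<in>c0 +o group_closure S. g c +o group_closure S') = g c0 +o group_closure S'"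
proof -
  have "g c +o group_closure S' = g c0 +o group_closure S'" if "c \<in> c0 +o group_closure S" for c
  proof -
    have "c - c0 \<in> group_closure S" using that by (auto simp: elt_set_plus_def)
    then show ?thesis unfolding coset_eq_iff g[symmetric] by (rule S)
  qed
  moreover have "c0 \<in> c0 +o group_closure S" using group_closure_coset[of c0 0 S] by simp
  ultimately show ?thesis by blast
qed

text \<open>The map of free abelian groups induced by maps of the two tensor factors.\<close>

definition mp :: "('s \<Rightarrow> 't) \<Rightarrow> ('m \<Rightarrow> 'k) \<Rightarrow> ('s \<times> 'm \<Rightarrow>\<^sub>0 int) \<Rightarrow> ('t \<times> 'k \<Rightarrow>\<^sub>0 int)" where
  "mp \<alpha> f = frag_extend (\<lambda>(s, m). frag_of (\<alpha> s, f m))"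

lemma mp_diff: "mp \<alpha> f (a - b) = mp \<alpha> f a - mp \<alpha> f b" by (simp add: mp_def frag_extend_diff)
lemma mp_add: "mp \<alpha> f (a + b) = mp \<alpha> f a + mp \<alpha> f b" by (simp add: mp_def frag_extend_add)
lemma mp_of [simp]: "mp \<alpha> f (frag_of (s, m)) = frag_of (\<alpha> s, f m)" by (simp add: mp_def)

lemma mp_mp: "mp \<alpha> f (mp \<beta> g c) = mp (\<lambda>s. \<alpha> (\<beta> s)) (\<lambda>m. f (g m)) c"
  using subset_UNIV
proof (induction c rule: frag_induction)
  case (one x)
  then show ?case by (cases x rule: prod.exhaust) simp
next
  case (diff a b)
  then show ?case by (simp add: mp_diff)
qed (simp add: mp_def)

lemma mp_cong: "(\<And>s m. (s, m) \<in> Poly_Mapping.keys c \<Longrightarrow> \<alpha> s = \<beta> s \<and> f m = g m) \<Longrightarrow> mp \<alpha> f c = mp \<beta> g c"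
  unfolding mp_def by (rule frag_extend_eq) auto

lemma mp_keys: "Poly_Mapping.keys (mp \<alpha> f c) \<subseteq> (\<lambda>(s, m). (\<alpha> s, f m)) ` Poly_Mapping.keys c"
proof -
  have "Poly_Mapping.keys (mp \<alpha> f c) \<subseteq> (\<Union>x\<in>Poly_Mapping.keys c. Poly_Mapping.keys (case x of (s, m) \<Rightarrow> frag_of (\<alpha> s, f m)))"
    unfolding mp_def by (rule keys_frag_extend)
  also have "\<dots> \<subseteq> (\<lambda>(s, m). (\<alpha> s, f m)) ` Poly_Mapping.keys c" by auto
  finally show ?thesis .
qed

lemma mp_keys_Times:
  assumes c: "Poly_Mapping.keys c \<subseteq> S \<times> T" and "\<And>s. s \<in> S \<Longrightarrow> \<alpha> s \<in> S'" "\<And>m. m \<in> T \<Longrightarrow> f m \<in> T'"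
  shows "Poly_Mapping.keys (mp \<alpha> f c) \<subseteq> S' \<times> T'"
proof
  fix k assume "k \<in> Poly_Mapping.keys (mp \<alpha> f c)"
  from subsetD[OF mp_keys this]
  obtain p where p: "p \<in> Poly_Mapping.keys c" "k = (case p of (s, m) \<Rightarrow> (\<alpha> s, f m))"
    by (elim imageE)
  then have "fst p \<in> S" "snd p \<in> T" using c by auto
  then show "k \<in> S' \<times> T'" using p(2) assms(2,3) by (simp add: case_prod_beta)
qed

lemma mp_id: "mp (\<lambda>s. s) (\<lambda>m. m) c = c"
proof -
  have "(\<lambda>(s, m). frag_of (s, m)) = (frag_of :: ('a \<times> 'b) \<Rightarrow> _)" by auto
  then show ?thesis unfolding mp_def using frag_expansion[of c] by simp
qed

text \<open>
  The closure properties of a module over the Weyl algebra that make \<open>U \<mapsto> \<D>(U) \<otimes>\<^sub>D M\<close> a presheaf.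
\<close>

locale wmod =
  fixes M :: "('n::finite opr, 'm) module"
  assumes madd: "m \<in> carrier M \<Longrightarrow> m' \<in> carrier M \<Longrightarrow> m \<oplus>\<^bsub>M\<^esub> m' \<in> carrier M"
    and msm: "r \<in> carrier W \<Longrightarrow> m \<in> carrier M \<Longrightarrow> r \<odot>\<^bsub>M\<^esub> m \<in> carrier M"
begin

text \<open>
  The generating relations of \<open>\<D>(U) \<otimes>\<^sub>D M\<close>. Below, \<open>rel U\<close> is the group of relations,
  \<open>FG U\<close> the free abelian group on the pairs, and \<open>PF\<close> the presheaf of tensor products.
\<close>

definition relgen :: "(complex^'n) set \<Rightarrow> ('n opr \<times> 'm \<Rightarrow>\<^sub>0 int) set" where
  "relgen U = {frag_of (s \<oplus>\<^bsub>End_hol U\<^esub> s', m) - frag_of (s, m) - frag_of (s', m) | s s' m.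
         s \<in> carrier (diff_ops U) \<and> s' \<in> carrier (diff_ops U) \<and> m \<in> carrier M} \<union>
      {frag_of (s, m \<oplus>\<^bsub>M\<^esub> m') - frag_of (s, m) - frag_of (s, m') | s m m'.
         s \<in> carrier (diff_ops U) \<and> m \<in> carrier M \<and> m' \<in> carrier M} \<union>
      {frag_of (s \<otimes>\<^bsub>End_hol U\<^esub> restrict r (opens_in U), m) - frag_of (s, r \<odot>\<^bsub>M\<^esub> m) | s r m.
         s \<in> carrier (diff_ops U) \<and> r \<in> carrier W \<and> m \<in> carrier M}"

abbreviation "rel U \<equiv> group_closure (relgen U)"

abbreviation "FG U \<equiv> carrier (free_Abelian_group (carrier (diff_ops U) \<times> carrier M))"

abbreviation "PF \<equiv> D_tensor_presheaf M"

lemma tensor_rel: "tensor_relations W (diff_ops U) (\<lambda>P. restrict P (opens_in U)) M = rel U"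
  by (simp add: tensor_relations_def relgen_def)

lemma FG_iff: "c \<in> FG U \<longleftrightarrow> Poly_Mapping.keys c \<subseteq> carrier (diff_ops U) \<times> carrier M"
  by (simp add: carrier_free_Abelian_group_iff)

lemma rres_fun: "rres D_sheaf U V = (\<lambda>P. restrict P (opens_in V))"
  by (simp add: D_sheaf_def)

lemma PF_carrier: "carrier (sections PF U) = (\<lambda>c. c +o rel U) ` FG U"
  by (simp add: D_tensor_presheaf_def tensor_module_def rres_fun tensor_rel)

lemma PF_add: "X \<oplus>\<^bsub>sections PF U\<^esub> Y = X + Y"
  by (simp add: D_tensor_presheaf_def tensor_module_def)

lemma PF_smult: "a \<odot>\<^bsub>sections PF U\<^esub> X = (\<Union>c\<in>X. mp (\<lambda>s. a \<otimes>\<^bsub>End_hol U\<^esub> s) (\<lambda>m. m) c +o rel U)"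
  by (simp add: D_tensor_presheaf_def tensor_module_def rres_fun tensor_rel mp_def)

lemma PF_res: "res PF U V X = (\<Union>c\<in>X. mp (\<lambda>P. restrict P (opens_in V)) (\<lambda>m. m) c +o rel V)"
  by (simp add: D_tensor_presheaf_def rres_fun tensor_rel mp_def)

end

text \<open>
  A map of the first factors that is compatible with addition and with right multiplication by the Weyl
  algebra, together with a homomorphism of the second factors, respects the relations. This covers left
  multiplication, restriction and change of the module.
\<close>

lemma mp_rel:
  assumes M: "wmod M" and N: "wmod N"
    and \<alpha>: "\<And>s. s \<in> carrier (diff_ops U) \<Longrightarrow> \<alpha> s \<in> carrier (diff_ops V)"
      "\<And>s s'. s \<in> carrier (diff_ops U) \<Longrightarrow> s' \<in> carrier (diff_ops U) \<Longrightarrow> \<alpha> (s \<oplus>\<^bsub>End_hol U\<^esub> s') = \<alpha> s \<oplus>\<^bsub>End_hol V\<^esub> \<alpha> s'"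
      "\<And>s r. s \<in> carrier (diff_ops U) \<Longrightarrow> r \<in> carrier W \<Longrightarrow> \<alpha> (s \<otimes>\<^bsub>End_hol U\<^esub> restrict r (opens_in U)) = \<alpha> s \<otimes>\<^bsub>End_hol V\<^esub> restrict r (opens_in V)"
    and f: "\<And>m. m \<in> carrier M \<Longrightarrow> f m \<in> carrier N"
      "\<And>m m'. m \<in> carrier M \<Longrightarrow> m' \<in> carrier M \<Longrightarrow> f (m \<oplus>\<^bsub>M\<^esub> m') = f m \<oplus>\<^bsub>N\<^esub> f m'"
      "\<And>r m. r \<in> carrier W \<Longrightarrow> m \<in> carrier M \<Longrightarrow> f (r \<odot>\<^bsub>M\<^esub> m) = r \<odot>\<^bsub>N\<^esub> f m"
    and c: "c \<in> group_closure (wmod.relgen M U)"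
  shows "mp \<alpha> f c \<in> group_closure (wmod.relgen N V)"
proof (rule group_closure_map[OF mp_diff _ c])
  interpret M: wmod M by fact
  interpret N: wmod N by fact
  fix c assume "c \<in> M.relgen U"
  then consider s s' m where "c = frag_of (s \<oplus>\<^bsub>End_hol U\<^esub> s', m) - frag_of (s, m) - frag_of (s', m)"
      "s \<in> carrier (diff_ops U)" "s' \<in> carrier (diff_ops U)" "m \<in> carrier M"
    | s m m' where "c = frag_of (s, m \<oplus>\<^bsub>M\<^esub> m') - frag_of (s, m) - frag_of (s, m')"
      "s \<in> carrier (diff_ops U)" "m \<in> carrier M" "m' \<in> carrier M"
    | s r m where "c = frag_of (s \<otimes>\<^bsub>End_hol U\<^esub> restrict r (opens_in U), m) - frag_of (s, r \<odot>\<^bsub>M\<^esub> m)"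
      "s \<in> carrier (diff_ops U)" "r \<in> carrier W" "m \<in> carrier M"
    unfolding M.relgen_def by (elim UnE CollectE exE conjE) simp_all
  then have "mp \<alpha> f c \<in> N.relgen V"
  proof cases
    case 1
    then have "mp \<alpha> f c = frag_of (\<alpha> s \<oplus>\<^bsub>End_hol V\<^esub> \<alpha> s', f m) - frag_of (\<alpha> s, f m) - frag_of (\<alpha> s', f m)"
      by (simp add: mp_diff \<alpha>)
    then show ?thesis unfolding N.relgen_def using 1 \<alpha>(1) f(1) by blast
  next
    case 2
    then have "mp \<alpha> f c = frag_of (\<alpha> s, f m \<oplus>\<^bsub>N\<^esub> f m') - frag_of (\<alpha> s, f m) - frag_of (\<alpha> s, f m')"
      by (simp add: mp_diff f)
    then show ?thesis unfolding N.relgen_def using 2 \<alpha>(1) f(1) by blast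
  next
    case 3
    then have "mp \<alpha> f c = frag_of (\<alpha> s \<otimes>\<^bsub>End_hol V\<^esub> restrict r (opens_in V), f m) - frag_of (\<alpha> s, r \<odot>\<^bsub>N\<^esub> f m)"
      by (simp only: mp_diff mp_of \<alpha>(3) f(3))
    then show ?thesis unfolding N.relgen_def using 3 \<alpha>(1) f(1) by blast
  qed
  then show "mp \<alpha> f c \<in> N.rel V" by (intro group_closure.base) simp
qed

context wmod
begin

lemma wmod: "wmod M" by (rule wmod_axioms)

lemma sm_rel:
  assumes U: "open U" and a: "a \<in> carrier (diff_ops U)" and c: "c \<in> rel U"
  shows "mp (\<lambda>s. a \<otimes>\<^bsub>End_hol U\<^esub> s) (\<lambda>m. m) c \<in> rel U"
proof -
  interpret ring "diff_ops U" by (rule diff_ops_ring[OF U])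
  have r: "restrict r (opens_in U) \<in> carrier (diff_ops U)" if "r \<in> carrier W" for r
    using restrict_diff_ops[OF weyl_diff_ops[OF that], of U] U by simp
  show ?thesis
  proof (rule mp_rel[OF wmod wmod _ _ _ _ _ _ c])
    fix s s' assume "s \<in> carrier (diff_ops U)" "s' \<in> carrier (diff_ops U)"
    then show "a \<otimes>\<^bsub>End_hol U\<^esub> (s \<oplus>\<^bsub>End_hol U\<^esub> s') = a \<otimes>\<^bsub>End_hol U\<^esub> s \<oplus>\<^bsub>End_hol U\<^esub> a \<otimes>\<^bsub>End_hol U\<^esub> s'"
      using r_distr[OF _ _ a] by simp
  next
    fix s and r' :: "'n opr" assume "s \<in> carrier (diff_ops U)" "r' \<in> carrier W"
    then show "a \<otimes>\<^bsub>End_hol U\<^esub> (s \<otimes>\<^bsub>End_hol U\<^esub> restrict r' (opens_in U)) = a \<otimes>\<^bsub>End_hol U\<^esub> s \<otimes>\<^bsub>End_hol U\<^esub> restrict r' (opens_in U)"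
      using m_assoc[OF a _ r] by simp
  next
    fix s assume "s \<in> carrier (diff_ops U)"
    then show "a \<otimes>\<^bsub>End_hol U\<^esub> s \<in> carrier (diff_ops U)" using m_closed[OF a] by simp
  qed simp_all
qed

lemma rs_rel:
  assumes U: "open U" "open V" "V \<subseteq> U" and c: "c \<in> rel U"
  shows "mp (\<lambda>P. restrict P (opens_in V)) (\<lambda>m. m) c \<in> rel V"
proof -
  have V: "V \<in> opens_in U" using U by (simp add: opens_in_def)
  have r: "restrict r (opens_in U) \<in> carrier (End_hol U)" if "r \<in> carrier W" for r
    using restrict_End_closed[OF weyl_End[OF that], of U] U by simp
  show ?thesis
  proof (rule mp_rel[OF wmod wmod _ _ _ _ _ _ c])
    fix s assume s: "s \<in> carrier (diff_ops U)"
    then show "restrict s (opens_in V) \<in> carrier (diff_ops V)" by (rule restrict_diff_ops[OF _ V])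
    show "restrict (s \<oplus>\<^bsub>End_hol U\<^esub> s') (opens_in V) = restrict s (opens_in V) \<oplus>\<^bsub>End_hol V\<^esub> restrict s' (opens_in V)"
      if "s' \<in> carrier (diff_ops U)" for s'
      by (rule restrict_op_add[OF diff_ops_End[OF s] diff_ops_End[OF that] V])
    show "restrict (s \<otimes>\<^bsub>End_hol U\<^esub> restrict r' (opens_in U)) (opens_in V) = restrict s (opens_in V) \<otimes>\<^bsub>End_hol V\<^esub> restrict r' (opens_in V)"
      if "r' \<in> carrier W" for r'
      using restrict_op_mult[OF diff_ops_End[OF s] r[OF that] V] restrict_op_restrict[OF V, of r'] by (simp only:)
  qed simp_all
qed

lemma smult_coset:
  "open U \<Longrightarrow> a \<in> carrier (diff_ops U) \<Longrightarrow>
    a \<odot>\<^bsub>sections PF U\<^esub> (c +o rel U) = mp (\<lambda>s. a \<otimes>\<^bsub>End_hol U\<^esub> s) (\<lambda>m. m) c +o rel U"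
  unfolding PF_smult by (rule coset_map[OF mp_diff sm_rel])

lemma res_coset:
  "open U \<Longrightarrow> open V \<Longrightarrow> V \<subseteq> U \<Longrightarrow>
    res PF U V (c +o rel U) = mp (\<lambda>P. restrict P (opens_in V)) (\<lambda>m. m) c +o rel V"
  unfolding PF_res by (rule coset_map[OF mp_diff rs_rel])

lemma sm_FG:
  assumes U: "open U" and a: "a \<in> carrier (diff_ops U)" and c: "c \<in> FG U"
  shows "mp (\<lambda>s. a \<otimes>\<^bsub>End_hol U\<^esub> s) (\<lambda>m. m) c \<in> FG U"
proof -
  interpret ring "diff_ops U" by (rule diff_ops_ring[OF U])
  have *: "a \<otimes>\<^bsub>End_hol U\<^esub> s \<in> carrier (diff_ops U)" if "s \<in> carrier (diff_ops U)" for s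
    using m_closed[OF a that] by simp
  show ?thesis using c unfolding FG_iff by (rule mp_keys_Times) (rule *)
qed

lemma rs_FG:
  assumes U: "open U" "open V" "V \<subseteq> U" and c: "c \<in> FG U"
  shows "mp (\<lambda>P. restrict P (opens_in V)) (\<lambda>m. m) c \<in> FG V"
proof -
  have *: "restrict s (opens_in V) \<in> carrier (diff_ops V)" if "s \<in> carrier (diff_ops U)" for s
    by (rule restrict_diff_ops[OF that]) (use U in \<open>simp add: opens_in_def\<close>)
  show ?thesis using c unfolding FG_iff by (rule mp_keys_Times) (rule *)
qed

lemma PF_psh: "psh PF"
proof
  fix U s t assume "s \<in> carrier (sections PF U)" "t \<in> carrier (sections PF U)"
  then obtain c d where c: "c \<in> FG U" "s = c +o rel U" "d \<in> FG U" "t = d +o rel U" unfolding PF_carrier by blast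
  then have "s \<oplus>\<^bsub>sections PF U\<^esub> t = (c + d) +o rel U" by (simp add: PF_add coset_add)
  moreover have "c + d \<in> FG U" using c keys_add[of c d] unfolding FG_iff by blast
  ultimately show "s \<oplus>\<^bsub>sections PF U\<^esub> t \<in> carrier (sections PF U)" unfolding PF_carrier by blast
next
  fix U a s assume U: "open U" and a: "a \<in> carrier (diff_ops U)" and "s \<in> carrier (sections PF U)"
  then obtain c where c: "c \<in> FG U" "s = c +o rel U" unfolding PF_carrier by blast
  show "a \<odot>\<^bsub>sections PF U\<^esub> s \<in> carrier (sections PF U)"
    unfolding c(2) smult_coset[OF U a] PF_carrier using sm_FG[OF U a c(1)] by blast
next
  fix U V s assume U: "open U" "open V" "V \<subseteq> U" and "s \<in> carrier (sections PF U)"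
  then obtain c where c: "c \<in> FG U" "s = c +o rel U" unfolding PF_carrier by blast
  show "res PF U V s \<in> carrier (sections PF V)"
    unfolding c(2) res_coset[OF U] PF_carrier using rs_FG[OF U c(1)] by blast
  {
    fix X assume X: "open X" "X \<subseteq> V"
    then have XV: "X \<in> opens_in V" "X \<subseteq> U" using U by (auto simp: opens_in_def)
    show "res PF V X (res PF U V s) = res PF U X s"
      unfolding c(2) res_coset[OF U] res_coset[OF U(2) X] res_coset[OF U(1) X(1) XV(2)] mp_mp restrict_op_restrict[OF XV(1)] ..
  next
    fix a assume a: "a \<in> carrier (diff_ops U)"
    have V: "V \<in> opens_in U" using U by (simp add: opens_in_def)
    have aV: "restrict a (opens_in V) \<in> carrier (diff_ops V)" by (rule restrict_diff_ops[OF a V])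
    show "res PF U V (a \<odot>\<^bsub>sections PF U\<^esub> s) = restrict a (opens_in V) \<odot>\<^bsub>sections PF V\<^esub> res PF U V s"
      unfolding c(2) res_coset[OF U] smult_coset[OF U(1) a] smult_coset[OF U(2) aV] mp_mp
    proof (rule arg_cong[where f = "\<lambda>c. c +o rel V"], rule mp_cong)
      fix s m assume "(s, m) \<in> Poly_Mapping.keys c"
      then have "s \<in> carrier (diff_ops U)" using c(1) unfolding FG_iff by blast
      then show "restrict (a \<otimes>\<^bsub>End_hol U\<^esub> s) (opens_in V) = restrict a (opens_in V) \<otimes>\<^bsub>End_hol V\<^esub> restrict s (opens_in V) \<and> m = m"
        using restrict_op_mult[OF diff_ops_End[OF a] diff_ops_End V] by blast
    qed
  }
qed

end

text \<open>An isomorphism of modules over the Weyl algebra induces one of the sheaves.\<close>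

lemma tensor_piso:
  assumes M: "wmod M" and N: "wmod N"
    and f: "\<And>m. m \<in> carrier M \<Longrightarrow> f m \<in> carrier N"
      "\<And>m m'. m \<in> carrier M \<Longrightarrow> m' \<in> carrier M \<Longrightarrow> f (m \<oplus>\<^bsub>M\<^esub> m') = f m \<oplus>\<^bsub>N\<^esub> f m'"
      "\<And>r m. r \<in> carrier W \<Longrightarrow> m \<in> carrier M \<Longrightarrow> f (r \<odot>\<^bsub>M\<^esub> m) = r \<odot>\<^bsub>N\<^esub> f m"
    and g: "\<And>m. m \<in> carrier N \<Longrightarrow> g m \<in> carrier M"
      "\<And>m. m \<in> carrier M \<Longrightarrow> g (f m) = m" "\<And>m. m \<in> carrier N \<Longrightarrow> f (g m) = m"
  shows "isomorphic_modules D_sheaf (D_tensor M) (D_tensor N)"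
proof -
  interpret M: wmod M by fact
  interpret N: wmod N by fact
  define \<Phi> where "\<Phi> = (\<lambda>U X. \<Union>c\<in>X. mp (\<lambda>s. s) f c +o N.rel U)"
  define \<Phi>' where "\<Phi>' = (\<lambda>U X. \<Union>c\<in>X. mp (\<lambda>s. s) g c +o M.rel U)"
  have fr: "mp (\<lambda>s. s) f c \<in> N.rel U" if "c \<in> M.rel U" for c U
    by (rule mp_rel[OF M N _ _ _ f that]) auto
  have g_add: "g (m \<oplus>\<^bsub>N\<^esub> m') = g m \<oplus>\<^bsub>M\<^esub> g m'" if "m \<in> carrier N" "m' \<in> carrier N" for m m'
    using f(2)[OF g(1)[OF that(1)] g(1)[OF that(2)]] g M.madd that by metis
  have g_sm: "g (r \<odot>\<^bsub>N\<^esub> m) = r \<odot>\<^bsub>M\<^esub> g m" if "r \<in> carrier W" "m \<in> carrier N" for r m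
    using f(3)[OF that(1) g(1)[OF that(2)]] g M.msm that by metis
  have gr: "mp (\<lambda>s. s) g c \<in> M.rel U" if "c \<in> N.rel U" for c U
    by (rule mp_rel[OF N M _ _ _ g(1) g_add g_sm that]) auto
  have \<Phi>: "\<Phi> U (c +o M.rel U) = mp (\<lambda>s. s) f c +o N.rel U" for U c
    unfolding \<Phi>_def by (rule coset_map[OF mp_diff fr])
  have \<Phi>': "\<Phi>' U (c +o N.rel U) = mp (\<lambda>s. s) g c +o M.rel U" for U c
    unfolding \<Phi>'_def by (rule coset_map[OF mp_diff gr])
  have fFG: "mp (\<lambda>s. s) f c \<in> N.FG U" if "c \<in> M.FG U" for c U
    using that unfolding M.FG_iff N.FG_iff by (rule mp_keys_Times) (simp_all add: f(1))
  have gFG: "mp (\<lambda>s. s) g c \<in> M.FG U" if "c \<in> N.FG U" for c U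
    using that unfolding M.FG_iff N.FG_iff by (rule mp_keys_Times) (simp_all add: g(1))
  have "piso M.PF N.PF \<Phi> \<Phi>'"
  proof (rule piso.intro[OF M.PF_psh N.PF_psh], unfold_locales, goal_cases)
    case (1 U s)
    then obtain c where c: "c \<in> M.FG U" "s = c +o M.rel U" unfolding M.PF_carrier by blast
    show ?case unfolding c(2) \<Phi> N.PF_carrier using fFG[OF c(1)] by blast
  next
    case (2 U s)
    then obtain c where c: "c \<in> N.FG U" "s = c +o N.rel U" unfolding N.PF_carrier by blast
    show ?case unfolding c(2) \<Phi>' M.PF_carrier using gFG[OF c(1)] by blast
  next
    case (3 U s)
    then obtain c where c: "c \<in> M.FG U" "s = c +o M.rel U" unfolding M.PF_carrier by blast
    have "mp (\<lambda>s. s) (\<lambda>m. g (f m)) c = mp (\<lambda>s. s) (\<lambda>m. m) c"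
      by (rule mp_cong) (use c(1) g(2) in \<open>auto simp: M.FG_iff\<close>)
    then show ?case unfolding c(2) \<Phi> \<Phi>' mp_mp by (simp add: mp_id)
  next
    case (4 U s)
    then obtain c where c: "c \<in> N.FG U" "s = c +o N.rel U" unfolding N.PF_carrier by blast
    have "mp (\<lambda>s. s) (\<lambda>m. f (g m)) c = mp (\<lambda>s. s) (\<lambda>m. m) c"
      by (rule mp_cong) (use c(1) g(3) in \<open>auto simp: N.FG_iff\<close>)
    then show ?case unfolding c(2) \<Phi> \<Phi>' mp_mp by (simp add: mp_id)
  next
    case (5 U s t)
    then obtain c d where c: "s = c +o M.rel U" "t = d +o M.rel U" unfolding M.PF_carrier by blast
    show ?case unfolding c M.PF_add N.PF_add coset_add \<Phi> mp_add ..
  next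
    case (6 U a s)
    then obtain c where c: "s = c +o M.rel U" unfolding M.PF_carrier by blast
    show ?case unfolding c M.smult_coset[OF 6(1,2)] \<Phi> N.smult_coset[OF 6(1,2)] mp_mp ..
  next
    case (7 U V s)
    then obtain c where c: "s = c +o M.rel U" unfolding M.PF_carrier by blast
    show ?case unfolding c M.res_coset[OF 7(1-3)] \<Phi> N.res_coset[OF 7(1-3)] mp_mp ..
  qed
  then interpret piso M.PF N.PF \<Phi> \<Phi>' .
  show ?thesis unfolding D_tensor_def by (rule sheafify_iso)
qed

section \<open>Cyclic modules over the Weyl algebra\<close>

context
  fixes H :: "'n::finite opr set"
  assumes H: "left_ideal H W"
begin

lemma H_abelian: "abelian_subgroup H W"
  using H weyl.is_abelian_group by (intro abelian_subgroupI3) (simp_all add: left_ideal_def)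

lemma coset_memI: "x \<in> carrier W \<Longrightarrow> y \<in> carrier W \<Longrightarrow> y \<ominus>\<^bsub>W\<^esub> x \<in> H \<Longrightarrow> y \<in> H +>\<^bsub>W\<^esub> x"
proof -
  assume *: "x \<in> carrier W" "y \<in> carrier W" "y \<ominus>\<^bsub>W\<^esub> x \<in> H"
  have "y = (y \<ominus>\<^bsub>W\<^esub> x) \<oplus>\<^bsub>W\<^esub> x" using * by (simp add: a_minus_def weyl.a_assoc weyl.l_neg)
  then show ?thesis using * unfolding a_r_coset_def' by blast
qed

lemma coset_memD: "x \<in> carrier W \<Longrightarrow> y \<in> H +>\<^bsub>W\<^esub> x \<Longrightarrow> y \<in> carrier W \<and> y \<ominus>\<^bsub>W\<^esub> x \<in> H"
proof -
  assume *: "x \<in> carrier W" "y \<in> H +>\<^bsub>W\<^esub> x"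
  then obtain h where h: "h \<in> H" "y = h \<oplus>\<^bsub>W\<^esub> x" unfolding a_r_coset_def' by blast
  have hc: "h \<in> carrier W" using h left_idealD(1)[OF H] by blast
  then have "y \<ominus>\<^bsub>W\<^esub> x = h" using h * by (simp add: a_minus_def weyl.a_assoc weyl.r_neg)
  then show ?thesis using h hc * by simp
qed

lemma coset_eqI: "x \<in> carrier W \<Longrightarrow> y \<in> carrier W \<Longrightarrow> y \<ominus>\<^bsub>W\<^esub> x \<in> H \<Longrightarrow> H +>\<^bsub>W\<^esub> x = H +>\<^bsub>W\<^esub> y"
proof -
  assume *: "x \<in> carrier W" "y \<in> carrier W" "y \<ominus>\<^bsub>W\<^esub> x \<in> H"
  have "additive_subgroup H W" using H by (simp add: left_ideal_def)
  from weyl.a_repr_independence[OF coset_memI[OF *] *(1) additive_subgroup.a_subgroup[OF this]]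
  show ?thesis .
qed

lemma coset_self: "x \<in> carrier W \<Longrightarrow> x \<in> H +>\<^bsub>W\<^esub> x"
  by (rule coset_memI) (simp_all add: a_minus_def weyl.r_neg left_idealD(2)[OF H])

lemma coset_zero: "h \<in> H \<Longrightarrow> H +>\<^bsub>W\<^esub> h = H"
proof -
  assume h: "h \<in> H"
  then have "h \<in> carrier W" using left_idealD(1)[OF H] by blast
  then have "H +>\<^bsub>W\<^esub> \<zero>\<^bsub>W\<^esub> = H +>\<^bsub>W\<^esub> h"
    using h by (intro coset_eqI) (simp_all add: a_minus_def weyl.r_zero)
  moreover have "H +>\<^bsub>W\<^esub> \<zero>\<^bsub>W\<^esub> = H"
    using left_idealD(1)[OF H] unfolding a_r_coset_def' by force
  ultimately show ?thesis by simp
qed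

end

lemma a_r_coset_rmult:
  assumes H: "left_ideal H W" and H': "left_ideal H' W"
    and P: "P \<in> carrier W" "\<And>h. h \<in> H \<Longrightarrow> h \<otimes>\<^bsub>W\<^esub> P \<in> H'" and a: "a \<in> carrier W"
  shows "(\<Union>r\<in>H +>\<^bsub>W\<^esub> a. H' +>\<^bsub>W\<^esub> (r \<otimes>\<^bsub>W\<^esub> P)) = H' +>\<^bsub>W\<^esub> (a \<otimes>\<^bsub>W\<^esub> P)"
proof -
  have "H' +>\<^bsub>W\<^esub> (r \<otimes>\<^bsub>W\<^esub> P) = H' +>\<^bsub>W\<^esub> (a \<otimes>\<^bsub>W\<^esub> P)" if "r \<in> H +>\<^bsub>W\<^esub> a" for r
  proof -
    have r: "r \<in> carrier W" "r \<ominus>\<^bsub>W\<^esub> a \<in> H" using coset_memD[OF H a that] by auto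
    have "r \<otimes>\<^bsub>W\<^esub> P \<ominus>\<^bsub>W\<^esub> a \<otimes>\<^bsub>W\<^esub> P = (r \<ominus>\<^bsub>W\<^esub> a) \<otimes>\<^bsub>W\<^esub> P"
      using r(1) a P(1) by (simp add: a_minus_def weyl.l_distr weyl.l_minus)
    then have "r \<otimes>\<^bsub>W\<^esub> P \<ominus>\<^bsub>W\<^esub> a \<otimes>\<^bsub>W\<^esub> P \<in> H'" using P(2)[OF r(2)] by simp
    from coset_eqI[OF H' weyl.m_closed[OF a P(1)] weyl.m_closed[OF r(1) P(1)] this]
    show ?thesis by (rule sym)
  qed
  moreover have "a \<in> H +>\<^bsub>W\<^esub> a" by (rule coset_self[OF H a])
  ultimately show ?thesis by blast
qed

lemma a_r_coset_lmult:
  assumes H: "left_ideal H W" and r: "r \<in> carrier W" and a: "a \<in> carrier W"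
  shows "(\<Union>x\<in>H +>\<^bsub>W\<^esub> a. H +>\<^bsub>W\<^esub> (r \<otimes>\<^bsub>W\<^esub> x)) = H +>\<^bsub>W\<^esub> (r \<otimes>\<^bsub>W\<^esub> a)"
proof -
  have "H +>\<^bsub>W\<^esub> (r \<otimes>\<^bsub>W\<^esub> x) = H +>\<^bsub>W\<^esub> (r \<otimes>\<^bsub>W\<^esub> a)" if "x \<in> H +>\<^bsub>W\<^esub> a" for x
  proof -
    have x: "x \<in> carrier W" "x \<ominus>\<^bsub>W\<^esub> a \<in> H" using coset_memD[OF H a that] by auto
    have "r \<otimes>\<^bsub>W\<^esub> x \<ominus>\<^bsub>W\<^esub> r \<otimes>\<^bsub>W\<^esub> a = r \<otimes>\<^bsub>W\<^esub> (x \<ominus>\<^bsub>W\<^esub> a)"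
      using x(1) a r by (simp add: a_minus_def weyl.r_distr weyl.r_minus)
    then have "r \<otimes>\<^bsub>W\<^esub> x \<ominus>\<^bsub>W\<^esub> r \<otimes>\<^bsub>W\<^esub> a \<in> H" using left_idealD(5)[OF H r x(2)] by simp
    from coset_eqI[OF H weyl.m_closed[OF r a] weyl.m_closed[OF r x(1)] this]
    show ?thesis by (rule sym)
  qed
  moreover have "a \<in> H +>\<^bsub>W\<^esub> a" by (rule coset_self[OF H a])
  ultimately show ?thesis by blast
qed

lemma M_alg_carrier: "carrier (M_alg A \<beta>) = (\<lambda>a. H_ideal A \<beta> +>\<^bsub>W\<^esub> a) ` carrier W"
  by (auto simp: M_alg_def quotient_left_module_def A_RCOSETS_def')

lemma M_alg_add:
  assumes "a \<in> carrier W" "b \<in> carrier W"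
  shows "(H_ideal A \<beta> +>\<^bsub>W\<^esub> a) \<oplus>\<^bsub>M_alg A \<beta>\<^esub> (H_ideal A \<beta> +>\<^bsub>W\<^esub> b) = H_ideal A \<beta> +>\<^bsub>W\<^esub> (a \<oplus>\<^bsub>W\<^esub> b)"
  using abelian_subgroup.a_rcos_sum[OF H_abelian[OF H_ideal_left] assms]
  by (simp add: M_alg_def quotient_left_module_def)

lemma M_alg_smult:
  assumes "r \<in> carrier W" "a \<in> carrier W"
  shows "r \<odot>\<^bsub>M_alg A \<beta>\<^esub> (H_ideal A \<beta> +>\<^bsub>W\<^esub> a) = H_ideal A \<beta> +>\<^bsub>W\<^esub> (r \<otimes>\<^bsub>W\<^esub> a)"
  using a_r_coset_lmult[OF H_ideal_left assms] by (simp add: M_alg_def quotient_left_module_def)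

lemma M_alg_wmod: "wmod (M_alg A \<beta>)"
proof
  fix m m' assume "m \<in> carrier (M_alg A \<beta>)" "m' \<in> carrier (M_alg A \<beta>)"
  then obtain a b where "a \<in> carrier W" "m = H_ideal A \<beta> +>\<^bsub>W\<^esub> a" "b \<in> carrier W" "m' = H_ideal A \<beta> +>\<^bsub>W\<^esub> b"
    unfolding M_alg_carrier by blast
  then show "m \<oplus>\<^bsub>M_alg A \<beta>\<^esub> m' \<in> carrier (M_alg A \<beta>)"
    using weyl.a_closed[of a b] by (simp add: M_alg_add) (simp add: M_alg_carrier)
next
  fix r :: "'a opr" and m :: "'a opr set" assume r: "r \<in> carrier W" and "m \<in> carrier (M_alg A \<beta>)"
  then obtain a where "a \<in> carrier W" "m = H_ideal A \<beta> +>\<^bsub>W\<^esub> a" unfolding M_alg_carrier by blast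
  then show "r \<odot>\<^bsub>M_alg A \<beta>\<^esub> m \<in> carrier (M_alg A \<beta>)"
    using weyl.m_closed[of r a] r by (simp add: M_alg_smult) (simp add: M_alg_carrier)
qed

text \<open>
  If \<open>P\<close> and \<open>Q\<close> are inverse to each other modulo the two left ideals, right multiplication by them
  gives mutually inverse maps between the modules and hence between the sheaves.
\<close>

lemma M_alg_iso:
  assumes P: "P \<in> carrier W" "\<And>h. h \<in> H_ideal A \<beta> \<Longrightarrow> h \<otimes>\<^bsub>W\<^esub> P \<in> H_ideal A \<beta>'"
    and Q: "Q \<in> carrier W" "\<And>h. h \<in> H_ideal A \<beta>' \<Longrightarrow> h \<otimes>\<^bsub>W\<^esub> Q \<in> H_ideal A \<beta>"
    and PQ: "P \<otimes>\<^bsub>W\<^esub> Q \<ominus>\<^bsub>W\<^esub> \<one>\<^bsub>W\<^esub> \<in> H_ideal A \<beta>" and QP: "Q \<otimes>\<^bsub>W\<^esub> P \<ominus>\<^bsub>W\<^esub> \<one>\<^bsub>W\<^esub> \<in> H_ideal A \<beta>'"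
  shows "isomorphic_modules D_sheaf (D_tensor (M_alg A \<beta>)) (D_tensor (M_alg A \<beta>'))"
proof -
  let ?H = "H_ideal A \<beta>" and ?H' = "H_ideal A \<beta>'"
  define f where "f = (\<lambda>X. \<Union>r\<in>X. ?H' +>\<^bsub>W\<^esub> (r \<otimes>\<^bsub>W\<^esub> P))"
  define g where "g = (\<lambda>X. \<Union>r\<in>X. ?H +>\<^bsub>W\<^esub> (r \<otimes>\<^bsub>W\<^esub> Q))"
  have f: "f (?H +>\<^bsub>W\<^esub> a) = ?H' +>\<^bsub>W\<^esub> (a \<otimes>\<^bsub>W\<^esub> P)" if "a \<in> carrier W" for a
    unfolding f_def by (rule a_r_coset_rmult[OF H_ideal_left H_ideal_left P that])
  have g: "g (?H' +>\<^bsub>W\<^esub> a) = ?H +>\<^bsub>W\<^esub> (a \<otimes>\<^bsub>W\<^esub> Q)" if "a \<in> carrier W" for a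
    unfolding g_def by (rule a_r_coset_rmult[OF H_ideal_left H_ideal_left Q that])
  have inv: "K +>\<^bsub>W\<^esub> (a \<otimes>\<^bsub>W\<^esub> R \<otimes>\<^bsub>W\<^esub> R') = K +>\<^bsub>W\<^esub> a"
    if K: "left_ideal K W" and R: "R \<in> carrier W" "R' \<in> carrier W" "R \<otimes>\<^bsub>W\<^esub> R' \<ominus>\<^bsub>W\<^esub> \<one>\<^bsub>W\<^esub> \<in> K" and a: "a \<in> carrier W" for K R R' and a :: "'a opr"
  proof (rule coset_eqI[OF K a, symmetric])
    have "a \<otimes>\<^bsub>W\<^esub> R \<otimes>\<^bsub>W\<^esub> R' \<ominus>\<^bsub>W\<^esub> a = a \<otimes>\<^bsub>W\<^esub> (R \<otimes>\<^bsub>W\<^esub> R' \<ominus>\<^bsub>W\<^esub> \<one>\<^bsub>W\<^esub>)"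
      using R a by (simp add: a_minus_def weyl.r_distr weyl.r_minus weyl.m_assoc)
    then show "a \<otimes>\<^bsub>W\<^esub> R \<otimes>\<^bsub>W\<^esub> R' \<ominus>\<^bsub>W\<^esub> a \<in> K" using left_idealD(5)[OF K a R(3)] by simp
  qed (use R a in simp)
  show ?thesis
  proof (rule tensor_piso[OF M_alg_wmod M_alg_wmod, where f = f and g = g], goal_cases)
    case (1 m) then show ?case using P(1) by (auto simp: M_alg_carrier f)
  next
    case (2 m m')
    then obtain a b where ab: "a \<in> carrier W" "m = ?H +>\<^bsub>W\<^esub> a" "b \<in> carrier W" "m' = ?H +>\<^bsub>W\<^esub> b"
      unfolding M_alg_carrier by blast
    then show ?case using P(1) by (simp add: M_alg_add f weyl.l_distr)
  next
    case (3 r m)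
    then obtain a where "a \<in> carrier W" "m = ?H +>\<^bsub>W\<^esub> a" unfolding M_alg_carrier by blast
    then show ?case using 3 P(1) by (simp add: M_alg_smult f weyl.m_assoc)
  next
    case (4 m) then show ?case using Q(1) by (auto simp: M_alg_carrier g)
  next
    case (5 m)
    then obtain a where "a \<in> carrier W" "m = ?H +>\<^bsub>W\<^esub> a" unfolding M_alg_carrier by blast
    then show ?case using P(1) Q(1) PQ by (simp add: f g inv[OF H_ideal_left])
  next
    case (6 m)
    then obtain a where "a \<in> carrier W" "m = ?H' +>\<^bsub>W\<^esub> a" unfolding M_alg_carrier by blast
    then show ?case using P(1) Q(1) QP by (simp add: f g inv[OF H_ideal_left])
  qed
qed

lemma iso_if_E_set_eq:
  assumes E: "\<And>\<tau>. is_face \<tau> (cone_of A) \<Longrightarrow> E_set A \<tau> \<beta> = E_set A \<tau> \<beta>'"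
  shows "isomorphic_modules D_sheaf (D_tensor (M_alg A \<beta>)) (D_tensor (M_alg A \<beta>'))"
proof -
  obtain f where f: "polyfn f" "f \<beta> = 1"
    "\<And>k. \<not> (\<exists>b. amap A (emb b) = amap A (emb k) + (\<beta>' - \<beta>)) \<Longrightarrow> f (amap A (emb k)) = 0"
    using sep_poly[OF E] by blast
  obtain g where g: "polyfn g" "g \<beta>' = 1"
    "\<And>k. \<not> (\<exists>b. amap A (emb b) = amap A (emb k) + (\<beta> - \<beta>')) \<Longrightarrow> g (amap A (emb k)) = 0"
    using sep_poly[OF E[symmetric]] by blast
  have "f \<beta> * g \<beta>' = 1" using f g by simp
  from contiguity[OF f(1,3) g(1,3) this]
  obtain P Q where "P \<in> carrier W" "Q \<in> carrier W"
    "\<forall>h\<in>H_ideal A \<beta>. h \<otimes>\<^bsub>W\<^esub> P \<in> H_ideal A \<beta>'" "\<forall>h\<in>H_ideal A \<beta>'. h \<otimes>\<^bsub>W\<^esub> Q \<in> H_ideal A \<beta>"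
    "P \<otimes>\<^bsub>W\<^esub> Q \<ominus>\<^bsub>W\<^esub> \<one>\<^bsub>W\<^esub> \<in> H_ideal A \<beta>" "Q \<otimes>\<^bsub>W\<^esub> P \<ominus>\<^bsub>W\<^esub> \<one>\<^bsub>W\<^esub> \<in> H_ideal A \<beta>'" by blast
  then show ?thesis by (intro M_alg_iso) auto
qed

section \<open>Functionals on the stalk at the origin\<close>

text \<open>
  The additive extension to the free abelian group of a function \<open>h\<close> on its basis, with values in
  functions of exponents.
\<close>

definition evf :: "('p \<Rightarrow> complex^'n \<Rightarrow> complex) \<Rightarrow> ('p \<Rightarrow>\<^sub>0 int) \<Rightarrow> complex^'n \<Rightarrow> complex" where
  "evf h X w = (\<Sum>p\<in>Poly_Mapping.keys X. of_int (Poly_Mapping.lookup X p) * h p w)"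

lemma evf_superset:
  assumes "finite K" "Poly_Mapping.keys X \<subseteq> K"
  shows "evf h X w = (\<Sum>p\<in>K. of_int (Poly_Mapping.lookup X p) * h p w)"
  unfolding evf_def by (rule sum.mono_neutral_left) (use assms in \<open>auto simp: in_keys_iff\<close>)

lemma evf_diff: "evf h (X - Y) = (\<lambda>w. evf h X w - evf h Y w)"
proof
  fix w
  let ?K = "Poly_Mapping.keys X \<union> Poly_Mapping.keys Y"
  have "evf h (X - Y) w = (\<Sum>p\<in>?K. of_int (Poly_Mapping.lookup (X - Y) p) * h p w)"
    by (rule evf_superset) (use keys_diff[of X Y] in auto)
  also have "\<dots> = (\<Sum>p\<in>?K. of_int (Poly_Mapping.lookup X p) * h p w) - (\<Sum>p\<in>?K. of_int (Poly_Mapping.lookup Y p) * h p w)"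
    by (simp add: lookup_minus left_diff_distrib sum_subtractf)
  also have "\<dots> = evf h X w - evf h Y w" by (simp add: evf_superset[of ?K])
  finally show "evf h (X - Y) w = evf h X w - evf h Y w" .
qed

lemma evf_0 [simp]: "evf h 0 = (\<lambda>w. 0)" by (simp add: evf_def fun_eq_iff)
lemma evf_of [simp]: "evf h (frag_of p) = h p" by (simp add: evf_def fun_eq_iff)

lemma bdd_diff: "bdd c \<Longrightarrow> bdd c' \<Longrightarrow> bdd (\<lambda>w. c w - c' w)"
  using bdd_add[of c "\<lambda>w. (-1) * c' w"] bdd_cmult[of c' "-1"] by simp

lemma act_diff_fun:
  assumes U: "open U" "0 \<in> U" and P: "P \<in> carrier (diff_ops U)" and c: "bdd c" "bdd c'"
  shows "act P (\<lambda>w. c w - c' w) = (\<lambda>w. act P c w - act P c' w)"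
proof -
  have "act P (\<lambda>w. (c w - c' w) + c' w) = (\<lambda>w. act P (\<lambda>w. c w - c' w) w + act P c' w)"
    by (rule act_add_fun[OF U P bdd_diff[OF c] c(2)])
  then have "act P c w = act P (\<lambda>w. c w - c' w) w + act P c' w" for w by (simp add: fun_eq_iff)
  then show ?thesis by (simp add: fun_eq_iff)
qed

lemma act_weyl_add: "P \<in> carrier W \<Longrightarrow> Q \<in> carrier W \<Longrightarrow> bdd d \<Longrightarrow> act (P \<oplus>\<^bsub>W\<^esub> Q) d = (\<lambda>w. act P d w + act Q d w)"
  using act_add[OF open_UNIV UNIV_I weyl_diff_ops weyl_diff_ops] by (simp add: weyl_fields)

lemma act_weyl_mult: "P \<in> carrier W \<Longrightarrow> Q \<in> carrier W \<Longrightarrow> bdd d \<Longrightarrow> act (P \<otimes>\<^bsub>W\<^esub> Q) d = act P (act Q d)"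
  using act_mult[OF open_UNIV UNIV_I weyl_diff_ops weyl_diff_ops] by (simp add: weyl_fields)

lemma act_weyl_bdd: "P \<in> carrier W \<Longrightarrow> bdd d \<Longrightarrow> bdd (act P d)"
  by (rule act_bdd[OF open_UNIV UNIV_I weyl_diff_ops])

text \<open>
  A function \<open>c\<close> of exponents that is killed by \<open>H\<^sub>A(\<beta>)\<close> on a stable set \<open>S\<close>. It induces a
  \<open>\<D>\<^sub>0\<close>-linear map from the stalk of \<open>\<M>\<^sub>A(\<beta>)\<close> at the origin to functions on \<open>S\<close>, which
  sends \<open>s \<otimes> m\<close> to \<open>s (m c)\<close>.
\<close>

locale solution =
  fixes A :: "int^'n^'d" and \<beta> :: "complex^'d" and S :: "(complex^'n) set" and c :: "complex^'n \<Rightarrow> complex"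
  assumes S: "stab S" and c: "bdd c" and kill: "\<And>h w. h \<in> H_ideal A \<beta> \<Longrightarrow> w \<in> S \<Longrightarrow> act h c w = 0"
begin

abbreviation "H \<equiv> H_ideal A \<beta>"
abbreviation "M \<equiv> M_alg A \<beta>"

sublocale wmod M by (rule M_alg_wmod)
sublocale psh PF by (rule PF_psh)

text \<open>A representative in the Weyl algebra of an element of \<open>M\<^sub>A(\<beta>)\<close>.\<close>

definition rp :: "'n opr set \<Rightarrow> 'n opr" where
  "rp m = (SOME r. r \<in> m)"

lemma rp: assumes "a \<in> carrier W" shows "rp (H +>\<^bsub>W\<^esub> a) \<in> carrier W" "rp (H +>\<^bsub>W\<^esub> a) \<ominus>\<^bsub>W\<^esub> a \<in> H"
proof -
  have "rp (H +>\<^bsub>W\<^esub> a) \<in> H +>\<^bsub>W\<^esub> a"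
    unfolding rp_def
    by (rule someI[of "\<lambda>r. r \<in> H +>\<^bsub>W\<^esub> a", OF coset_self[OF H_ideal_left[of A \<beta>] assms]])
  then show "rp (H +>\<^bsub>W\<^esub> a) \<in> carrier W" "rp (H +>\<^bsub>W\<^esub> a) \<ominus>\<^bsub>W\<^esub> a \<in> H"
    using coset_memD[OF H_ideal_left assms] by blast+
qed

text \<open>
  The result of applying \<open>m\<close> to \<open>c\<close>. On \<open>S\<close> it does not depend on the chosen representative.
\<close>

definition mc :: "'n opr set \<Rightarrow> complex^'n \<Rightarrow> complex" where
  "mc m = act (rp m) c"

lemma mc_bdd: "m \<in> carrier M \<Longrightarrow> bdd (mc m)"
  unfolding mc_def M_alg_carrier using act_weyl_bdd[OF rp(1) c] by blast

lemma mc_coset: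
  assumes a: "a \<in> carrier W" and w: "w \<in> S" shows "mc (H +>\<^bsub>W\<^esub> a) w = act a c w"
proof -
  let ?r = "rp (H +>\<^bsub>W\<^esub> a)"
  have r: "?r \<in> carrier W" "?r \<ominus>\<^bsub>W\<^esub> a \<in> H" using rp[OF a] by auto
  have "?r = (?r \<ominus>\<^bsub>W\<^esub> a) \<oplus>\<^bsub>W\<^esub> a" using r a by (simp add: a_minus_def weyl.a_assoc weyl.l_neg)
  then have "act ?r c w = act ((?r \<ominus>\<^bsub>W\<^esub> a) \<oplus>\<^bsub>W\<^esub> a) c w" by simp
  also have "\<dots> = act (?r \<ominus>\<^bsub>W\<^esub> a) c w + act a c w" using act_weyl_add[OF _ a c, of "?r \<ominus>\<^bsub>W\<^esub> a"] r a by simp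
  finally show ?thesis unfolding mc_def using kill[OF r(2) w] by simp
qed

text \<open>
  The induced map, on representatives in the free abelian group.
\<close>

abbreviation ev where "ev \<equiv> evf (\<lambda>(s, m). act s (mc m))"

lemma ev_bdd:
  assumes U: "open U" "0 \<in> U" and X: "X \<in> FG U"
  shows "bdd (ev X)"
  using X unfolding FG_iff
proof (induction X rule: frag_induction)
  case (one x)
  then show ?case using act_bdd[OF U _ mc_bdd] by (cases x rule: prod.exhaust) simp
next
  case (diff a b)
  then show ?case by (simp add: evf_diff bdd_diff)
qed simp

lemma ev_rel:
  assumes U: "open U" "0 \<in> U" and X: "X \<in> rel U" and w: "w \<in> S"
  shows "ev X w = 0"
  using X
proof (induction rule: group_closure.induct)
  case (diff s t) then show ?case by (simp add: evf_diff)
next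
  case (base X)
  have add_M: "mc (m \<oplus>\<^bsub>M\<^esub> m') w = mc m w + mc m' w" if "m \<in> carrier M" "m' \<in> carrier M" "w \<in> S" for m m' w
  proof -
    obtain a b where "a \<in> carrier W" "m = H +>\<^bsub>W\<^esub> a" "b \<in> carrier W" "m' = H +>\<^bsub>W\<^esub> b"
      using \<open>m \<in> carrier M\<close> \<open>m' \<in> carrier M\<close> unfolding M_alg_carrier by blast
    then show ?thesis using act_weyl_add[OF _ _ c, of a b] \<open>w \<in> S\<close> by (simp add: M_alg_add mc_coset)
  qed
  have sm_M: "mc (r \<odot>\<^bsub>M\<^esub> m) w = act r (mc m) w" if "r \<in> carrier W" "m \<in> carrier M" "w \<in> S" for r m w
  proof -
    obtain a where a: "a \<in> carrier W" "m = H +>\<^bsub>W\<^esub> a" using \<open>m \<in> carrier M\<close> unfolding M_alg_carrier by blast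
    have "mc (r \<odot>\<^bsub>M\<^esub> m) w = act r (act a c) w"
      using act_weyl_mult[OF that(1) a(1) c] that a by (simp add: M_alg_smult mc_coset)
    also have "\<dots> = act r (mc m) w"
      by (rule act_stab[OF open_UNIV UNIV_I weyl_diff_ops[OF that(1)] S act_weyl_bdd[OF a(1) c] mc_bdd[OF that(2)] _ that(3)])
        (simp add: a mc_coset)
    finally show ?thesis .
  qed
  consider "X = 0" | s s' m where "X = frag_of (s \<oplus>\<^bsub>End_hol U\<^esub> s', m) - frag_of (s, m) - frag_of (s', m)"
      "s \<in> carrier (diff_ops U)" "s' \<in> carrier (diff_ops U)" "m \<in> carrier M"
    | s m m' where "X = frag_of (s, m \<oplus>\<^bsub>M\<^esub> m') - frag_of (s, m) - frag_of (s, m')"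
      "s \<in> carrier (diff_ops U)" "m \<in> carrier M" "m' \<in> carrier M"
    | s r m where "X = frag_of (s \<otimes>\<^bsub>End_hol U\<^esub> restrict r (opens_in U), m) - frag_of (s, r \<odot>\<^bsub>M\<^esub> m)"
      "s \<in> carrier (diff_ops U)" "r \<in> carrier W" "m \<in> carrier M"
    using base unfolding relgen_def by (elim insertE UnE CollectE exE conjE) simp_all
  then show ?case
  proof cases
    case 2
    then show ?thesis using act_add[OF U 2(2,3) mc_bdd[OF 2(4)]] by (simp add: evf_diff)
  next
    case 3
    have "act s (mc (m \<oplus>\<^bsub>M\<^esub> m')) w = act s (\<lambda>w. mc m w + mc m' w) w"
      by (rule act_stab[OF U 3(2) S mc_bdd[OF madd[OF 3(3,4)]] bdd_add[OF mc_bdd[OF 3(3)] mc_bdd[OF 3(4)]] _ w])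
        (simp add: add_M 3)
    also have "\<dots> = act s (mc m) w + act s (mc m') w"
      using act_add_fun[OF U 3(2) mc_bdd[OF 3(3)] mc_bdd[OF 3(4)]] by simp
    finally show ?thesis unfolding 3(1) by (simp add: evf_diff)
  next
    case 4
    have rU: "restrict r (opens_in U) \<in> carrier (diff_ops U)"
      using restrict_diff_ops[OF weyl_diff_ops[OF 4(3)], of U] U by simp
    have e1: "act (s \<otimes>\<^bsub>End_hol U\<^esub> restrict r (opens_in U)) (mc m) = act s (act (restrict r (opens_in U)) (mc m))"
      by (rule act_mult[OF U 4(2) rU mc_bdd[OF 4(4)]])
    have e2: "act (restrict r (opens_in U)) (mc m) = act r (mc m)"
      by (rule act_restrict[OF open_UNIV UNIV_I weyl_diff_ops[OF 4(3)] U mc_bdd[OF 4(4)]])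
    have "act (s \<otimes>\<^bsub>End_hol U\<^esub> restrict r (opens_in U)) (mc m) w = act s (act r (mc m)) w"
      by (simp only: e1 e2)
    also have "act s (act r (mc m)) w = act s (mc (r \<odot>\<^bsub>M\<^esub> m)) w"
      by (rule act_stab[OF U 4(2) S act_weyl_bdd[OF 4(3) mc_bdd[OF 4(4)]] mc_bdd[OF msm[OF 4(3,4)]] _ w])
        (simp add: sm_M 4)
    finally show ?thesis unfolding 4(1) by (simp add: evf_diff)
  qed simp
qed

lemma ev_smult:
  assumes U: "open U" "0 \<in> U" and a: "a \<in> carrier (diff_ops U)" and X: "X \<in> FG U"
  shows "ev (mp (\<lambda>s. a \<otimes>\<^bsub>End_hol U\<^esub> s) (\<lambda>m. m) X) = act a (ev X)"
proof -
  have "ev (mp (\<lambda>s. a \<otimes>\<^bsub>End_hol U\<^esub> s) (\<lambda>m. m) X) = act a (ev X) \<and> bdd (ev X)"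
    using X unfolding FG_iff
  proof (induction X rule: frag_induction)
    case zero
    have "act a (\<lambda>w. 0) = (\<lambda>w. 0)" by (rule LP_0[OF rep_LP[OF rep_act[OF U a]]])
    then show ?case by (simp add: mp_def)
  next
    case (one x)
    obtain s m where x: "x = (s, m)" by (cases x rule: prod.exhaust)
    then show ?case using one act_mult[OF U a _ mc_bdd, of s m] act_bdd[OF U _ mc_bdd, of s m] by simp
  next
    case (diff x y)
    then show ?case using act_diff_fun[OF U a, of "ev x" "ev y"] by (simp add: mp_diff evf_diff bdd_diff)
  qed
  then show ?thesis by simp
qed

lemma ev_res:
  assumes U: "open U" "0 \<in> U" and V: "open V" "0 \<in> V" and X: "X \<in> FG U"
  shows "ev (mp (\<lambda>P. restrict P (opens_in V)) (\<lambda>m. m) X) = ev X"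
  using X unfolding FG_iff
proof (induction X rule: frag_induction)
  case (one x)
  obtain s m where x: "x = (s, m)" by (cases x rule: prod.exhaust)
  then show ?case using one act_restrict[OF U _ V mc_bdd, of s m] by (simp del: restrict_apply)
next
  case (diff x y)
  then show ?case by (simp add: mp_diff evf_diff)
qed (simp add: mp_def)

lemma ev_germ:
  assumes U: "open U" "0 \<in> U" "X \<in> FG U" and V: "open V" "0 \<in> V" "Y \<in> FG V"
    and eq: "germ PF 0 U (X +o rel U) = germ PF 0 V (Y +o rel V)" and w: "w \<in> S"
  shows "ev X w = ev Y w"
proof -
  have "(V, Y +o rel V) \<in> germ PF 0 U (X +o rel U)"
    unfolding eq by (rule germ_self[OF V(1,2)]) (use V(3) in \<open>auto simp: PF_carrier\<close>)
  then obtain Z where Z: "open Z" "0 \<in> Z" "Z \<subseteq> U" "Z \<subseteq> V" "res PF U Z (X +o rel U) = res PF V Z (Y +o rel V)"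
    unfolding germ_iff by blast
  let ?r = "mp (\<lambda>P. restrict P (opens_in Z)) (\<lambda>m. m)"
  have "?r X - ?r Y \<in> rel Z"
    using Z(5) unfolding res_coset[OF U(1) Z(1,3)] res_coset[OF V(1) Z(1,4)] coset_eq_iff .
  then have "ev (?r X - ?r Y) w = 0" by (rule ev_rel[OF Z(1,2) _ w])
  then show ?thesis using ev_res[OF U(1,2) Z(1,2) U(3)] ev_res[OF V(1,2) Z(1,2) V(3)] by (simp add: evf_diff)
qed

end

section \<open>The Euler operators and the generating section\<close>

text \<open>
  The representative \<open>1 \<otimes> 1\<close> of the generator over \<open>U\<close>.
\<close>

definition one_elt :: "int^'n^'d \<Rightarrow> complex^'d \<Rightarrow> (complex^'n) set \<Rightarrow> ('n::finite opr \<times> 'n opr set \<Rightarrow>\<^sub>0 int)" where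
  "one_elt A \<beta> U = frag_of (\<one>\<^bsub>End_hol U\<^esub>, H_ideal A \<beta> +>\<^bsub>W\<^esub> \<one>\<^bsub>W\<^esub>)"

lemma act_Eop:
  assumes c: "bdd c"
  shows "act (Eop A i) c w = amap A w $ i * c w"
proof -
  let ?t = "\<lambda>j. const_op (of_int (A $ i $ j)) \<otimes>\<^bsub>W\<^esub> (x_op j \<otimes>\<^bsub>W\<^esub> d_op j)"
  have t: "act (?t j) c = (\<lambda>w. of_int (A $ i $ j) * (w $ j * c w))" for j
  proof -
    have dc: "bdd (act (d_op j) c)" by (rule act_weyl_bdd[OF d_op_weyl c])
    have "act (?t j) c = act (const_op (of_int (A $ i $ j))) (act (x_op j) (act (d_op j) c))"
      using act_weyl_mult[OF const_op_weyl weyl.m_closed[OF x_op_weyl d_op_weyl] c] act_weyl_mult[OF x_op_weyl d_op_weyl c] by simp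
    also have "\<dots> = (\<lambda>w. of_int (A $ i $ j) * act (x_op j) (act (d_op j) c) w)"
      by (rule act_const_op[OF act_weyl_bdd[OF x_op_weyl dc]])
    also have "\<dots> = (\<lambda>w. of_int (A $ i $ j) * (w $ j * c w))"
      unfolding act_x_op[OF dc] by (simp add: act_d_op[OF c])
    finally show ?thesis .
  qed
  have "act (finsum W ?t J) c w = (\<Sum>j\<in>J. of_int (A $ i $ j) * (w $ j * c w))" if "finite J" for J
    using that
  proof (induction J rule: finite_induct)
    case empty
    show ?case using act_zero[OF open_UNIV UNIV_I c] by (simp add: weyl_fields)
  next
    case (insert j J)
    have cl: "?t \<in> J \<rightarrow> carrier W" "?t j \<in> carrier W" by auto
    have "finsum W ?t (insert j J) = ?t j \<oplus>\<^bsub>W\<^esub> finsum W ?t J"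
      by (rule weyl.finsum_insert[OF insert.hyps cl])
    then show ?case
      using insert act_weyl_add[OF cl(2) weyl.finsum_closed[OF cl(1)] c] t[of j] by simp
  qed
  then show ?thesis unfolding Eop_def by (simp add: amap_def sum_distrib_right mult.assoc)
qed

lemma act_euler_op:
  assumes c: "bdd c"
  shows "act (euler_op A \<beta> i) c w = (amap A w $ i - \<beta> $ i) * c w"
proof -
  have "euler_op A \<beta> i = Eop A i \<oplus>\<^bsub>W\<^esub> const_op (- \<beta> $ i)"
    by (simp add: euler_op_eq a_minus_def const_op_neg)
  then have "act (euler_op A \<beta> i) c = (\<lambda>w. act (Eop A i) c w + act (const_op (- \<beta> $ i)) c w)"
    using act_weyl_add[OF Eop_weyl const_op_weyl c] by simp
  then show ?thesis using act_Eop[OF c] act_const_op[OF c] by (simp add: algebra_simps)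
qed

text \<open>
  The sheaf \<open>\<M>\<^sub>A(\<beta>)\<close>, with its presheaf of tensor products.
\<close>

locale hyp_module =
  fixes A :: "int^'n^'d" and \<beta> :: "complex^'d"
begin

abbreviation "M \<equiv> M_alg A \<beta>"
abbreviation "u1 U \<equiv> one_elt A \<beta> U"

sublocale wmod M by (rule M_alg_wmod)
sublocale psh PF by (rule PF_psh)

text \<open>
  The generating global section of \<open>\<M>\<^sub>A(\<beta>)\<close>.
\<close>

definition \<sigma>1 where "\<sigma>1 = gsec UNIV (u1 UNIV +o rel UNIV)"

lemma one_FG: "open U \<Longrightarrow> u1 U \<in> FG U"
proof -
  assume U: "open U"
  interpret R: ring "diff_ops U" by (rule diff_ops_ring[OF U])
  show ?thesis unfolding one_elt_def FG_iff using R.one_closed weyl.one_closed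
    by (auto simp: M_alg_carrier simp del: weyl.one_closed)
qed

lemma one_carrier: "open U \<Longrightarrow> u1 U +o rel U \<in> carrier (sections PF U)"
  unfolding PF_carrier using one_FG by blast

lemma \<sigma>1_carrier: "\<sigma>1 \<in> carrier (sec UNIV)"
  unfolding \<sigma>1_def by (rule gsec_carrier[OF open_UNIV one_carrier[OF open_UNIV]])

lemma \<sigma>1_restrict: "open V \<Longrightarrow> restrict \<sigma>1 V = gsec V (u1 V +o rel V)"
proof -
  assume V: "open V"
  have "mp (\<lambda>P. restrict P (opens_in V)) (\<lambda>m. m) (u1 UNIV) = u1 V"
    unfolding one_elt_def mp_of restrict_op_one[OF iffD2[OF opens_in_UNIV V]] ..
  then show ?thesis
    unfolding \<sigma>1_def gsec_res[OF open_UNIV V subset_UNIV one_carrier[OF open_UNIV]] res_coset[OF open_UNIV V subset_UNIV]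
    by simp
qed

lemma smult_one:
  assumes a: "a \<in> carrier W"
  shows "a \<odot>\<^bsub>sections PF UNIV\<^esub> (u1 UNIV +o rel UNIV) = frag_of (\<one>\<^bsub>End_hol UNIV\<^esub>, H_ideal A \<beta> +>\<^bsub>W\<^esub> a) +o rel UNIV"
proof -
  have ad: "a \<in> carrier (diff_ops UNIV)" by (rule weyl_diff_ops[OF a])
  have ext: "restrict a (opens_in UNIV) = a"
    using weyl_End[OF a] by (auto simp: End_hol_carrier_iff PiE_def extensional_restrict)
  have 1: "a \<otimes>\<^bsub>End_hol UNIV\<^esub> \<one>\<^bsub>End_hol UNIV\<^esub> = \<one>\<^bsub>End_hol UNIV\<^esub> \<otimes>\<^bsub>End_hol UNIV\<^esub> restrict a (opens_in UNIV)"
    using weyl.l_one[OF a] weyl.r_one[OF a] unfolding ext by (simp add: weyl_fields)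
  have m: "H_ideal A \<beta> +>\<^bsub>W\<^esub> \<one>\<^bsub>W\<^esub> \<in> carrier M" using weyl.one_closed by (auto simp: M_alg_carrier)
  have o: "\<one>\<^bsub>End_hol UNIV\<^esub> \<in> carrier (diff_ops UNIV)" using weyl_diff_ops[OF weyl.one_closed] by (simp add: weyl_fields)
  have am: "a \<odot>\<^bsub>M\<^esub> (H_ideal A \<beta> +>\<^bsub>W\<^esub> \<one>\<^bsub>W\<^esub>) = H_ideal A \<beta> +>\<^bsub>W\<^esub> a"
    using M_alg_smult[OF a weyl.one_closed] weyl.r_one[OF a] by simp
  have "frag_of (\<one>\<^bsub>End_hol UNIV\<^esub> \<otimes>\<^bsub>End_hol UNIV\<^esub> restrict a (opens_in UNIV), H_ideal A \<beta> +>\<^bsub>W\<^esub> \<one>\<^bsub>W\<^esub>)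
      - frag_of (\<one>\<^bsub>End_hol UNIV\<^esub>, a \<odot>\<^bsub>M\<^esub> (H_ideal A \<beta> +>\<^bsub>W\<^esub> \<one>\<^bsub>W\<^esub>)) \<in> relgen UNIV"
    unfolding relgen_def using o a m by blast
  then have "frag_of (a \<otimes>\<^bsub>End_hol UNIV\<^esub> \<one>\<^bsub>End_hol UNIV\<^esub>, H_ideal A \<beta> +>\<^bsub>W\<^esub> \<one>\<^bsub>W\<^esub>) - frag_of (\<one>\<^bsub>End_hol UNIV\<^esub>, H_ideal A \<beta> +>\<^bsub>W\<^esub> a) \<in> rel UNIV"
    unfolding 1[symmetric] am
    by (intro group_closure.base) simp
  then show ?thesis
    unfolding smult_coset[OF open_UNIV ad] one_elt_def mp_of coset_eq_iff .
qed

lemma \<sigma>1_euler: "euler_op A \<beta> i \<odot>\<^bsub>sec UNIV\<^esub> \<sigma>1 = \<zero>\<^bsub>End_hol UNIV\<^esub> \<odot>\<^bsub>sec UNIV\<^esub> \<sigma>1"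
proof -
  have z: "\<zero>\<^bsub>W\<^esub> = \<zero>\<^bsub>End_hol UNIV\<^esub>" by (simp add: weyl_fields)
  have "H_ideal A \<beta> +>\<^bsub>W\<^esub> euler_op A \<beta> i = H_ideal A \<beta> +>\<^bsub>W\<^esub> \<zero>\<^bsub>W\<^esub>"
    using coset_zero[OF H_ideal_left[of A \<beta>] euler_in_H[of A \<beta> i]]
      coset_zero[OF H_ideal_left[of A \<beta>] left_idealD(2)[OF H_ideal_left[of A \<beta>]]] by simp
  then have "euler_op A \<beta> i \<odot>\<^bsub>sections PF UNIV\<^esub> (u1 UNIV +o rel UNIV) = \<zero>\<^bsub>W\<^esub> \<odot>\<^bsub>sections PF UNIV\<^esub> (u1 UNIV +o rel UNIV)"
    unfolding smult_one[OF euler_op_weyl] smult_one[OF weyl.zero_closed] by simp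
  then show ?thesis
    unfolding \<sigma>1_def z[symmetric]
      gsec_smult[OF open_UNIV weyl_diff_ops[OF euler_op_weyl] one_carrier[OF open_UNIV]]
      gsec_smult[OF open_UNIV weyl_diff_ops[OF weyl.zero_closed] one_carrier[OF open_UNIV]]
    by simp
qed

lemma generated:
  assumes V: "open V" and c: "c \<in> FG V"
  shows "\<exists>P\<in>carrier (diff_ops V). c - frag_of (P, H_ideal A \<beta> +>\<^bsub>W\<^esub> \<one>\<^bsub>W\<^esub>) \<in> rel V"
proof -
  interpret R: ring "diff_ops V" by (rule diff_ops_ring[OF V])
  let ?o = "H_ideal A \<beta> +>\<^bsub>W\<^esub> \<one>\<^bsub>W\<^esub>"
  have m: "?o \<in> carrier M" using weyl.one_closed by (auto simp: M_alg_carrier)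
  have addrel: "frag_of (s \<oplus>\<^bsub>End_hol V\<^esub> s', ?o) - frag_of (s, ?o) - frag_of (s', ?o) \<in> rel V"
    if "s \<in> carrier (diff_ops V)" "s' \<in> carrier (diff_ops V)" for s s'
  proof -
    have "frag_of (s \<oplus>\<^bsub>End_hol V\<^esub> s', ?o) - frag_of (s, ?o) - frag_of (s', ?o) \<in> relgen V"
      unfolding relgen_def using that m by blast
    then show ?thesis by (intro group_closure.base) simp
  qed
  show ?thesis
    using c unfolding FG_iff
  proof (induction c rule: frag_induction)
    case zero
    have "frag_of (\<zero>\<^bsub>End_hol V\<^esub> \<oplus>\<^bsub>End_hol V\<^esub> \<zero>\<^bsub>End_hol V\<^esub>, ?o) - frag_of (\<zero>\<^bsub>End_hol V\<^esub>, ?o) - frag_of (\<zero>\<^bsub>End_hol V\<^esub>, ?o) \<in> rel V"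
      using addrel[OF R.zero_closed R.zero_closed] by simp
    moreover have "\<zero>\<^bsub>End_hol V\<^esub> \<oplus>\<^bsub>End_hol V\<^esub> \<zero>\<^bsub>End_hol V\<^esub> = \<zero>\<^bsub>End_hol V\<^esub>" using R.l_zero[OF R.zero_closed] by simp
    ultimately have "0 - frag_of (\<zero>\<^bsub>End_hol V\<^esub>, ?o) \<in> rel V" by simp
    then show ?case using R.zero_closed by (intro bexI[of _ "\<zero>\<^bsub>End_hol V\<^esub>"]) simp_all
  next
    case (one x)
    then obtain s m where x: "x = (s, m)" "s \<in> carrier (diff_ops V)" "m \<in> carrier M" by auto
    then obtain r where r: "r \<in> carrier W" "m = H_ideal A \<beta> +>\<^bsub>W\<^esub> r" unfolding M_alg_carrier by blast
    have rV: "restrict r (opens_in V) \<in> carrier (diff_ops V)"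
      using restrict_diff_ops[OF weyl_diff_ops[OF r(1)], of V] V by simp
    have rm: "r \<odot>\<^bsub>M\<^esub> ?o = m" using M_alg_smult[OF r(1) weyl.one_closed] weyl.r_one[OF r(1)] r(2) by simp
    have "frag_of (s \<otimes>\<^bsub>End_hol V\<^esub> restrict r (opens_in V), ?o) - frag_of (s, r \<odot>\<^bsub>M\<^esub> ?o) \<in> relgen V"
      unfolding relgen_def using x(2) r(1) \<open>?o \<in> carrier M\<close> by blast
    then have "frag_of (s \<otimes>\<^bsub>End_hol V\<^esub> restrict r (opens_in V), ?o) - frag_of x \<in> rel V"
      unfolding rm x(1) by (intro group_closure.base) simp
    then have "frag_of x - frag_of (s \<otimes>\<^bsub>End_hol V\<^esub> restrict r (opens_in V), ?o) \<in> rel V"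
      using group_closure_minus_iff[of "frag_of x - frag_of (s \<otimes>\<^bsub>End_hol V\<^esub> restrict r (opens_in V), ?o)" "relgen V"] by simp
    then show ?case using R.m_closed[OF x(2) rV] by (intro bexI[of _ "s \<otimes>\<^bsub>End_hol V\<^esub> restrict r (opens_in V)"]) simp_all
  next
    case (diff a b)
    then obtain P Q where P: "P \<in> carrier (diff_ops V)" "a - frag_of (P, ?o) \<in> rel V"
      and Q: "Q \<in> carrier (diff_ops V)" "b - frag_of (Q, ?o) \<in> rel V" by blast
    let ?R = "P \<ominus>\<^bsub>diff_ops V\<^esub> Q"
    have Rc: "?R \<in> carrier (diff_ops V)" by (rule R.minus_closed[OF P(1) Q(1)])
    have "?R \<oplus>\<^bsub>diff_ops V\<^esub> Q = P" using P(1) Q(1) by (simp add: a_minus_def R.a_assoc R.l_neg del: diff_ops_fields)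
    then have "frag_of (P, ?o) - frag_of (?R, ?o) - frag_of (Q, ?o) \<in> rel V" using addrel[OF Rc Q(1)] by simp
    then have "(a - frag_of (P, ?o)) - (b - frag_of (Q, ?o)) + (frag_of (P, ?o) - frag_of (?R, ?o) - frag_of (Q, ?o)) \<in> rel V"
      by (intro group_closure_add[OF group_closure.diff[OF P(2) Q(2)]])
    then have "a - b - frag_of (?R, ?o) \<in> rel V" by (simp add: algebra_simps)
    then show ?case using Rc by blast
  qed
qed

text \<open>
  Near the origin every section of \<open>\<M>\<^sub>A(\<beta>)\<close> is a multiple of the generator.
\<close>

lemma sec_multiple:
  assumes \<sigma>: "\<sigma> \<in> carrier (sec UNIV)"
  shows "\<exists>V P. open V \<and> 0 \<in> V \<and> P \<in> carrier (diff_ops V) \<and> restrict \<sigma> V = P \<odot>\<^bsub>sec V\<^esub> restrict \<sigma>1 V"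
proof -
  obtain V s where V: "open V" "0 \<in> V" "s \<in> carrier (sections PF V)" "\<forall>y\<in>V. \<sigma> y = germ PF y V s"
    using conjunct2[OF iffD1[OF sec_carrier \<sigma>], rule_format, OF UNIV_I, of 0] by (elim exE conjE)
  obtain c where c: "c \<in> FG V" "s = c +o rel V" using V(3) unfolding PF_carrier by blast
  obtain P where P: "P \<in> carrier (diff_ops V)" "c - frag_of (P, H_ideal A \<beta> +>\<^bsub>W\<^esub> \<one>\<^bsub>W\<^esub>) \<in> rel V"
    using generated[OF V(1) c(1)] by blast
  have "P \<otimes>\<^bsub>End_hol V\<^esub> \<one>\<^bsub>End_hol V\<^esub> = P"
    using monoid.r_one[OF ring.is_monoid[OF diff_ops_ring[OF V(1)]] P(1)] by simp
  then have "P \<odot>\<^bsub>sections PF V\<^esub> (u1 V +o rel V) = frag_of (P, H_ideal A \<beta> +>\<^bsub>W\<^esub> \<one>\<^bsub>W\<^esub>) +o rel V"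
    unfolding smult_coset[OF V(1) P(1)] one_elt_def by simp
  also have "\<dots> = s" using P(2) unfolding c(2) coset_eq_iff[symmetric] by simp
  finally have Ps: "P \<odot>\<^bsub>sections PF V\<^esub> (u1 V +o rel V) = s" .
  have "restrict \<sigma> V = gsec V s" using V(4) by (auto simp: gsec_def fun_eq_iff)
  also have "\<dots> = P \<odot>\<^bsub>sec V\<^esub> restrict \<sigma>1 V"
    unfolding \<sigma>1_restrict[OF V(1)] gsec_smult[OF V(1) P(1) one_carrier[OF V(1)]] Ps ..
  finally show ?thesis using V P by blast
qed

end

context solution
begin

abbreviation "u1 U \<equiv> one_elt A \<beta> U"

text \<open>
  Let \<open>\<sigma>\<close> be a global section satisfying the Euler equations with parameter \<open>\<beta>'\<close>, of which the
  generator is a multiple near the origin. The solution \<open>c\<close> sends the germ of \<open>\<sigma>\<close> to a function \<open>d\<close>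
  with \<open>(A' w - \<beta>') d(w) = 0\<close> on \<open>S\<close>. It does not vanish on \<open>S\<close>, since \<open>c\<close>, the value at the
  generator, is obtained from it.
\<close>

lemma exponent_of_generator:
  assumes \<sigma>: "\<sigma> \<in> carrier (sec UNIV)"
    and E: "\<And>i. euler_op A' \<beta>' i \<odot>\<^bsub>sec UNIV\<^esub> \<sigma> = \<zero>\<^bsub>End_hol UNIV\<^esub> \<odot>\<^bsub>sec UNIV\<^esub> \<sigma>"
    and V: "open V" "0 \<in> V" and P: "P \<in> carrier (diff_ops V)"
    and eq: "restrict (gsec UNIV (u1 UNIV +o rel UNIV)) V = P \<odot>\<^bsub>sec V\<^esub> restrict \<sigma> V"
    and w0: "w0 \<in> S" "c w0 \<noteq> 0"
  shows "\<exists>w\<in>S. amap A' w = \<beta>'"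
proof -
  obtain V1 s where V1: "open V1" "0 \<in> V1" "s \<in> carrier (sections PF V1)" "\<forall>y\<in>V1. \<sigma> y = germ PF y V1 s"
    using conjunct2[OF iffD1[OF sec_carrier \<sigma>], rule_format, OF UNIV_I, of 0] by (elim exE conjE)
  obtain c0 where c0: "c0 \<in> FG V1" "s = c0 +o rel V1" using V1(3) unfolding PF_carrier by blast
  have \<sigma>0: "\<sigma> 0 = germ PF 0 V1 s" using V1 by blast
  define d where "d = ev c0"
  have d: "bdd d" unfolding d_def by (rule ev_bdd[OF V1(1,2) c0(1)])
  have sm: "germ PF 0 V1 (mp (\<lambda>s. restrict a (opens_in V1) \<otimes>\<^bsub>End_hol V1\<^esub> s) (\<lambda>m. m) c0 +o rel V1) = (a \<odot>\<^bsub>sec UNIV\<^esub> \<sigma>) 0"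
    and smc: "ev (mp (\<lambda>s. restrict a (opens_in V1) \<otimes>\<^bsub>End_hol V1\<^esub> s) (\<lambda>m. m) c0) = act a d"
    and smF: "mp (\<lambda>s. restrict a (opens_in V1) \<otimes>\<^bsub>End_hol V1\<^esub> s) (\<lambda>m. m) c0 \<in> FG V1"
    if a: "a \<in> carrier (diff_ops UNIV)" for a
  proof -
    have aV: "restrict a (opens_in V1) \<in> carrier (diff_ops V1)"
      using restrict_diff_ops[OF a, of V1] V1(1) by simp
    show "germ PF 0 V1 (mp (\<lambda>s. restrict a (opens_in V1) \<otimes>\<^bsub>End_hol V1\<^esub> s) (\<lambda>m. m) c0 +o rel V1) = (a \<odot>\<^bsub>sec UNIV\<^esub> \<sigma>) 0"
      unfolding sec_smult_germ[where \<sigma> = \<sigma>, OF open_UNIV a V1(1) subset_UNIV V1(2,3) \<sigma>0] c0(2) smult_coset[OF V1(1) aV] ..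
    show "mp (\<lambda>s. restrict a (opens_in V1) \<otimes>\<^bsub>End_hol V1\<^esub> s) (\<lambda>m. m) c0 \<in> FG V1"
      by (rule sm_FG[OF V1(1) aV c0(1)])
    show "ev (mp (\<lambda>s. restrict a (opens_in V1) \<otimes>\<^bsub>End_hol V1\<^esub> s) (\<lambda>m. m) c0) = act a d"
      unfolding ev_smult[OF V1(1,2) aV c0(1)] d_def[symmetric]
      by (rule act_restrict[OF open_UNIV UNIV_I a V1(1,2) d])
  qed
  have z: "\<zero>\<^bsub>End_hol UNIV\<^esub> \<in> carrier (diff_ops UNIV)"
    using weyl_diff_ops[OF weyl.zero_closed] by (simp add: weyl_fields)
  have kill_d: "act (euler_op A' \<beta>' i) d w = 0" if w: "w \<in> S" for i w
  proof -
    have e: "euler_op A' \<beta>' i \<in> carrier (diff_ops UNIV)" by (rule weyl_diff_ops[OF euler_op_weyl])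
    have "act (euler_op A' \<beta>' i) d w = act \<zero>\<^bsub>End_hol UNIV\<^esub> d w"
      unfolding smc[OF e, symmetric] smc[OF z, symmetric]
      by (rule ev_germ[OF V1(1,2) smF[OF e] V1(1,2) smF[OF z] _ w]) (simp only: sm[OF e] sm[OF z] E)
    then show ?thesis using act_zero[OF open_UNIV UNIV_I d] by simp
  qed
  have "\<exists>w\<in>S. d w \<noteq> 0"
  proof (rule ccontr)
    assume no: "\<not> (\<exists>w\<in>S. d w \<noteq> 0)"
    define Z where "Z = V \<inter> V1"
    have Z: "open Z" "0 \<in> Z" "Z \<subseteq> V" "Z \<subseteq> V1" using V V1 by (auto simp: Z_def)
    let ?r = "mp (\<lambda>P. restrict P (opens_in Z)) (\<lambda>m. m) c0"
    have PZ: "restrict P (opens_in Z) \<in> carrier (diff_ops Z)"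
      using restrict_diff_ops[OF P, of Z] Z by (simp add: opens_in_def)
    have rF: "?r \<in> FG Z" by (rule rs_FG[OF V1(1) Z(1,4) c0(1)])
    have rc: "?r +o rel Z \<in> carrier (sections PF Z)" unfolding PF_carrier using rF by blast
    have "restrict \<sigma> V 0 = germ PF 0 Z (?r +o rel Z)"
      using germ_res[OF V1(1) Z(1,4,2) V1(3)] \<sigma>0 V(2) unfolding c0(2) res_coset[OF V1(1) Z(1,4)] by simp
    from sec_smult_germ[where \<sigma> = "restrict \<sigma> V", OF V(1) P Z(1,3,2) rc this]
    have "germ PF 0 UNIV (u1 UNIV +o rel UNIV) = germ PF 0 Z (mp (\<lambda>s. restrict P (opens_in Z) \<otimes>\<^bsub>End_hol Z\<^esub> s) (\<lambda>m. m) ?r +o rel Z)"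
      unfolding eq[symmetric] smult_coset[OF Z(1) PZ] using V(2) by (simp add: gsec_def)
    from ev_germ[OF open_UNIV UNIV_I hyp_module.one_FG[OF open_UNIV] Z(1,2) sm_FG[OF Z(1) PZ rF] this w0(1)]
    have "ev (u1 UNIV) w0 = act (restrict P (opens_in Z)) d w0"
      unfolding ev_smult[OF Z(1,2) PZ rF] ev_res[OF V1(1,2) Z(1,2) c0(1)] d_def .
    also have "\<dots> = act (restrict P (opens_in Z)) (\<lambda>w. 0) w0"
      by (rule act_stab[OF Z(1,2) PZ S d bdd_0 _ w0(1)]) (use no in blast)
    also have "\<dots> = 0" using LP_0[OF rep_LP[OF rep_act[OF Z(1,2) PZ]]] by simp
    finally have "ev (u1 UNIV) w0 = 0" .
    moreover have "ev (u1 UNIV) w0 = c w0"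
    proof -
      have m: "H +>\<^bsub>W\<^esub> \<one>\<^bsub>W\<^esub> \<in> carrier M" using weyl.one_closed by (auto simp: M_alg_carrier)
      have "ev (u1 UNIV) w0 = mc (H +>\<^bsub>W\<^esub> \<one>\<^bsub>W\<^esub>) w0"
        unfolding one_elt_def using act_one[OF open_UNIV UNIV_I mc_bdd[OF m]] by simp
      also have "\<dots> = act \<one>\<^bsub>W\<^esub> c w0" by (rule mc_coset[OF weyl.one_closed w0(1)])
      also have "\<dots> = c w0" using act_one[OF open_UNIV UNIV_I c] by (simp add: weyl_fields)
      finally show ?thesis .
    qed
    ultimately show False using w0(2) by simp
  qed
  then obtain w where w: "w \<in> S" "d w \<noteq> 0" by blast
  have "amap A' w $ i = \<beta>' $ i" for i
    using kill_d[OF w(1), of i] w(2) unfolding act_euler_op[OF d] by simp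
  then show ?thesis using w(1) by (auto simp: vec_eq_iff)
qed

end

text \<open>
  An isomorphism carries the generator of one sheaf to a section of the other that satisfies the
  Euler equations of the first and of which the generator of the second is locally a multiple.
  Hence every stable set supporting a solution for one parameter contains an exponent for the other.
\<close>

lemma iso_exponents:
  assumes iso: "isomorphic_modules D_sheaf (D_tensor (M_alg A \<beta>)) (D_tensor (M_alg A \<beta>'))"
  shows "solution A \<beta>' S c \<Longrightarrow> w0 \<in> S \<Longrightarrow> c w0 \<noteq> 0 \<Longrightarrow> \<exists>w\<in>S. amap A w = \<beta>"
    and "solution A \<beta> S c \<Longrightarrow> w0 \<in> S \<Longrightarrow> c w0 \<noteq> 0 \<Longrightarrow> \<exists>w\<in>S. amap A w = \<beta>'"
proof -
  interpret F: hyp_module A \<beta> .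
  interpret G: hyp_module A \<beta>' .
  note zW = weyl_diff_ops[OF weyl.zero_closed, unfolded weyl_fields]
  note eW = weyl_diff_ops[OF euler_op_weyl]
  obtain \<phi> where
    bij: "\<And>U. open U \<Longrightarrow> bij_betw (\<phi> U) (carrier (F.sec U)) (carrier (G.sec U))" and
    sm: "\<And>U a s. open U \<Longrightarrow> a \<in> carrier (diff_ops U) \<Longrightarrow> s \<in> carrier (F.sec U) \<Longrightarrow> \<phi> U (a \<odot>\<^bsub>F.sec U\<^esub> s) = a \<odot>\<^bsub>G.sec U\<^esub> \<phi> U s" and
    rs: "\<And>U V s. open U \<Longrightarrow> open V \<Longrightarrow> V \<subseteq> U \<Longrightarrow> s \<in> carrier (F.sec U) \<Longrightarrow> \<phi> V (restrict s V) = restrict (\<phi> U s) V"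
  proof -
    have "\<exists>\<phi>. (\<forall>U. open U \<longrightarrow> bij_betw (\<phi> U) (carrier (F.sec U)) (carrier (G.sec U)) \<and>
           (\<forall>s\<in>carrier (F.sec U). \<forall>t\<in>carrier (F.sec U). \<phi> U (s \<oplus>\<^bsub>F.sec U\<^esub> t) = \<phi> U s \<oplus>\<^bsub>G.sec U\<^esub> \<phi> U t) \<and>
           (\<forall>a\<in>carrier (diff_ops U). \<forall>s\<in>carrier (F.sec U). \<phi> U (a \<odot>\<^bsub>F.sec U\<^esub> s) = a \<odot>\<^bsub>G.sec U\<^esub> \<phi> U s)) \<and>
        (\<forall>U V. open U \<longrightarrow> open V \<longrightarrow> V \<subseteq> U \<longrightarrow>
           (\<forall>s\<in>carrier (F.sec U). \<phi> V (restrict s V) = restrict (\<phi> U s) V))"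
      using iso unfolding isomorphic_modules_def D_tensor_def F.sec_res G.sec_res D_sheaf_simps .
    then show ?thesis
    proof (elim exE conjE)
      fix \<phi>
      assume 1: "\<forall>U. open U \<longrightarrow> bij_betw (\<phi> U) (carrier (F.sec U)) (carrier (G.sec U)) \<and>
           (\<forall>s\<in>carrier (F.sec U). \<forall>t\<in>carrier (F.sec U). \<phi> U (s \<oplus>\<^bsub>F.sec U\<^esub> t) = \<phi> U s \<oplus>\<^bsub>G.sec U\<^esub> \<phi> U t) \<and>
           (\<forall>a\<in>carrier (diff_ops U). \<forall>s\<in>carrier (F.sec U). \<phi> U (a \<odot>\<^bsub>F.sec U\<^esub> s) = a \<odot>\<^bsub>G.sec U\<^esub> \<phi> U s)"
        and 2: "\<forall>U V. open U \<longrightarrow> open V \<longrightarrow> V \<subseteq> U \<longrightarrow>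
           (\<forall>s\<in>carrier (F.sec U). \<phi> V (restrict s V) = restrict (\<phi> U s) V)"
      show thesis
      proof (rule that[of \<phi>])
        show "bij_betw (\<phi> U) (carrier (F.sec U)) (carrier (G.sec U))" if "open U" for U
          using 1[rule_format, OF that] by (rule conjunct1)
        show "\<phi> U (a \<odot>\<^bsub>F.sec U\<^esub> s) = a \<odot>\<^bsub>G.sec U\<^esub> \<phi> U s"
          if "open U" "a \<in> carrier (diff_ops U)" "s \<in> carrier (F.sec U)" for U a s
          by (rule bspec[OF bspec[OF conjunct2[OF conjunct2[OF spec[OF 1, THEN mp, OF that(1)]]] that(2)] that(3)])
        show "\<phi> V (restrict s V) = restrict (\<phi> U s) V"
          if "open U" "open V" "V \<subseteq> U" "s \<in> carrier (F.sec U)" for U V s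
          by (rule 2[rule_format, OF that])
      qed
    qed
  qed
  have "G.\<sigma>1 \<in> \<phi> UNIV ` carrier (F.sec UNIV)"
    unfolding bij_betw_imp_surj_on[OF bij[OF open_UNIV]] by (rule G.\<sigma>1_carrier)
  then obtain \<sigma>0 where \<sigma>0: "\<sigma>0 \<in> carrier (F.sec UNIV)" "\<phi> UNIV \<sigma>0 = G.\<sigma>1"
    by (elim imageE) (rule that, assumption, rule sym)
  have \<phi>1: "\<phi> UNIV F.\<sigma>1 \<in> carrier (G.sec UNIV)"
    by (rule bij_betw_apply[OF bij[OF open_UNIV] F.\<sigma>1_carrier])
  show "\<exists>w\<in>S. amap A w = \<beta>" if sol: "solution A \<beta>' S c" and w0: "w0 \<in> S" "c w0 \<noteq> 0"
  proof -
    interpret S: solution A \<beta>' S c by fact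
    obtain V P where V: "open V" "0 \<in> V" "P \<in> carrier (diff_ops V)" "restrict \<sigma>0 V = P \<odot>\<^bsub>F.sec V\<^esub> restrict F.\<sigma>1 V"
      using F.sec_multiple[OF \<sigma>0(1)] by (elim exE conjE)
    have "restrict G.\<sigma>1 V = \<phi> V (restrict \<sigma>0 V)"
      using rs[OF open_UNIV V(1) subset_UNIV \<sigma>0(1)] \<sigma>0(2) by simp
    also have "\<dots> = P \<odot>\<^bsub>G.sec V\<^esub> \<phi> V (restrict F.\<sigma>1 V)"
      unfolding V(4) by (rule sm[OF V(1,3) F.sec_res_cl[OF open_UNIV V(1) subset_UNIV F.\<sigma>1_carrier]])
    also have "\<phi> V (restrict F.\<sigma>1 V) = restrict (\<phi> UNIV F.\<sigma>1) V"
      by (rule rs[OF open_UNIV V(1) subset_UNIV F.\<sigma>1_carrier])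
    finally have eq: "restrict G.\<sigma>1 V = P \<odot>\<^bsub>G.sec V\<^esub> restrict (\<phi> UNIV F.\<sigma>1) V" .
    show ?thesis
    proof (rule S.exponent_of_generator[OF \<phi>1 _ V(1,2,3) _ w0])
      show "euler_op A \<beta> i \<odot>\<^bsub>G.sec UNIV\<^esub> \<phi> UNIV F.\<sigma>1 = \<zero>\<^bsub>End_hol UNIV\<^esub> \<odot>\<^bsub>G.sec UNIV\<^esub> \<phi> UNIV F.\<sigma>1" for i
        unfolding sm[OF open_UNIV eW F.\<sigma>1_carrier, symmetric] sm[OF open_UNIV zW F.\<sigma>1_carrier, symmetric] F.\<sigma>1_euler ..
      show "restrict (G.gsec UNIV (G.u1 UNIV +o G.rel UNIV)) V = P \<odot>\<^bsub>G.sec V\<^esub> restrict (\<phi> UNIV F.\<sigma>1) V"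
        using eq unfolding G.\<sigma>1_def .
    qed
  qed
  show "\<exists>w\<in>S. amap A w = \<beta>'" if sol: "solution A \<beta> S c" and w0: "w0 \<in> S" "c w0 \<noteq> 0"
  proof -
    interpret S: solution A \<beta> S c by fact
    obtain V P where V: "open V" "0 \<in> V" "P \<in> carrier (diff_ops V)"
      "restrict (\<phi> UNIV F.\<sigma>1) V = P \<odot>\<^bsub>G.sec V\<^esub> restrict G.\<sigma>1 V"
      using G.sec_multiple[OF \<phi>1] by (elim exE conjE)
    have r0: "restrict \<sigma>0 V \<in> carrier (F.sec V)" by (rule F.sec_res_cl[OF open_UNIV V(1) subset_UNIV \<sigma>0(1)])
    have r1: "restrict F.\<sigma>1 V \<in> carrier (F.sec V)" by (rule F.sec_res_cl[OF open_UNIV V(1) subset_UNIV F.\<sigma>1_carrier])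
    have "\<phi> V (restrict F.\<sigma>1 V) = P \<odot>\<^bsub>G.sec V\<^esub> restrict (\<phi> UNIV \<sigma>0) V"
      using rs[OF open_UNIV V(1) subset_UNIV F.\<sigma>1_carrier] V(4) \<sigma>0(2) by simp
    also have "\<dots> = \<phi> V (P \<odot>\<^bsub>F.sec V\<^esub> restrict \<sigma>0 V)"
      using rs[OF open_UNIV V(1) subset_UNIV \<sigma>0(1)] sm[OF V(1,3) r0] by simp
    finally have eq: "restrict F.\<sigma>1 V = P \<odot>\<^bsub>F.sec V\<^esub> restrict \<sigma>0 V"
      using inj_onD[OF bij_betw_imp_inj_on[OF bij[OF V(1)]] _ r1 F.sec_smult_cl[OF V(1,3) r0]] by simp
    show ?thesis
    proof (rule S.exponent_of_generator[OF \<sigma>0(1) _ V(1,2,3) _ w0])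
      fix i
      have "\<phi> UNIV (euler_op A \<beta>' i \<odot>\<^bsub>F.sec UNIV\<^esub> \<sigma>0) = \<phi> UNIV (\<zero>\<^bsub>End_hol UNIV\<^esub> \<odot>\<^bsub>F.sec UNIV\<^esub> \<sigma>0)"
        unfolding sm[OF open_UNIV eW \<sigma>0(1)] sm[OF open_UNIV zW \<sigma>0(1)] \<sigma>0(2) by (rule G.\<sigma>1_euler)
      then show "euler_op A \<beta>' i \<odot>\<^bsub>F.sec UNIV\<^esub> \<sigma>0 = \<zero>\<^bsub>End_hol UNIV\<^esub> \<odot>\<^bsub>F.sec UNIV\<^esub> \<sigma>0"
        by (rule inj_onD[OF bij_betw_imp_inj_on[OF bij[OF open_UNIV]] _ F.sec_smult_cl[OF open_UNIV eW \<sigma>0(1)] F.sec_smult_cl[OF open_UNIV zW \<sigma>0(1)]])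
      show "restrict (F.gsec UNIV (F.u1 UNIV +o F.rel UNIV)) V = P \<odot>\<^bsub>F.sec V\<^esub> restrict \<sigma>0 V"
        using eq unfolding F.\<sigma>1_def .
    qed
  qed
qed

section \<open>Test functions for the faces\<close>

text \<open>
  The exponents congruent to \<open>v\<close> modulo \<open>\<int>\<close> in the coordinates of the columns on \<open>\<tau>\<close> and lying in
  \<open>\<nat>\<close> in the others.
\<close>

definition face_exps :: "int^'n^'d \<Rightarrow> (rat^'d) set \<Rightarrow> complex^'n \<Rightarrow> (complex^'n) set" where
  "face_exps A \<tau> v = {w. \<forall>j. if mcol A j \<in> \<tau> then w $ j - v $ j \<in> \<int> else w $ j \<in> \<nat>}"

lemma face_exps_shift: "w \<in> face_exps A \<tau> v \<Longrightarrow> w + emb u \<in> face_exps A \<tau> v"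
  unfolding face_exps_def
proof (intro CollectI allI)
  fix j assume "w \<in> {w. \<forall>j. if mcol A j \<in> \<tau> then w $ j - v $ j \<in> \<int> else w $ j \<in> \<nat>}"
  then have j: "if mcol A j \<in> \<tau> then w $ j - v $ j \<in> \<int> else w $ j \<in> \<nat>" by blast
  have e: "(w + emb u) $ j - v $ j = (w $ j - v $ j) + of_nat (u $ j)" by simp
  then show "if mcol A j \<in> \<tau> then (w + emb u) $ j - v $ j \<in> \<int> else (w + emb u) $ j \<in> \<nat>"
    using j unfolding e by (auto intro: Ints_add Nats_add)
qed

lemma stab_face_exps: "stab (face_exps A \<tau> v)"
  unfolding stab_def
proof (intro ballI allI impI)
  fix w \<gamma> assume w: "w \<in> face_exps A \<tau> v" "\<forall>j. \<gamma> $ j \<in> \<int>" "w + \<gamma> \<notin> face_exps A \<tau> v"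
  obtain j where j: "\<not> (if mcol A j \<in> \<tau> then (w + \<gamma>) $ j - v $ j \<in> \<int> else (w + \<gamma>) $ j \<in> \<nat>)"
    using w(3) unfolding face_exps_def by blast
  have wj: "if mcol A j \<in> \<tau> then w $ j - v $ j \<in> \<int> else w $ j \<in> \<nat>" using w(1) unfolding face_exps_def by blast
  have e: "(w + \<gamma>) $ j - v $ j = (w $ j - v $ j) + \<gamma> $ j" by simp
  have "mcol A j \<notin> \<tau>"
  proof
    assume m: "mcol A j \<in> \<tau>"
    then have "(w + \<gamma>) $ j - v $ j \<in> \<int>" unfolding e using wj w(2) by (intro Ints_add) simp_all
    then show False using j m by simp
  qed
  then show "\<exists>j. w $ j \<in> \<nat> \<and> (w + \<gamma>) $ j \<notin> \<nat>" using j wj by (intro exI[of _ j]) simp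
qed

text \<open>
  If the columns lie on a hyperplane not through the origin, the degree of an exponent \<open>w\<close> is
  determined by \<open>A w\<close>.
\<close>

lemma homogeneous_sum:
  fixes A :: "int^'n^'d" and h :: "rat^'d"
  assumes "b \<noteq> 0" "\<And>j. (\<Sum>i\<in>UNIV. h $ i * mcol A j $ i) = b"
  shows "(\<Sum>j\<in>UNIV. w $ j) = (\<Sum>i\<in>UNIV. of_rat (h $ i) * amap A w $ i) / of_rat b"
proof -
  have b: "(\<Sum>i\<in>UNIV. of_rat (h $ i) * of_int (A $ i $ j)) = (of_rat b :: complex)" for j
  proof -
    have "(of_rat b :: complex) = of_rat (\<Sum>i\<in>UNIV. h $ i * mcol A j $ i)" by (simp only: assms(2))
    then show ?thesis by (simp add: of_rat_sum of_rat_mult mcol_def)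
  qed
  have "(\<Sum>i\<in>UNIV. of_rat (h $ i) * amap A w $ i) = (\<Sum>i\<in>UNIV. \<Sum>j\<in>UNIV. of_rat (h $ i) * of_int (A $ i $ j) * w $ j)"
    by (simp add: amap_def sum_distrib_left mult.assoc)
  also have "\<dots> = (\<Sum>j\<in>UNIV. \<Sum>i\<in>UNIV. of_rat (h $ i) * of_int (A $ i $ j) * w $ j)" by (rule sum.swap)
  also have "\<dots> = (\<Sum>j\<in>UNIV. of_rat b * w $ j)" unfolding sum_distrib_right[symmetric] b ..
  also have "\<dots> = of_rat b * (\<Sum>j\<in>UNIV. w $ j)" by (rule sum_distrib_left[symmetric])
  finally show ?thesis using assms(1) by simp
qed

text \<open>
  The indicator function of the exponents \<open>w\<close> in this set with \<open>A w = \<beta>\<close> is a solution there: \<open>\<partial>\<^sup>u\<close>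
  shifts by \<open>u\<close>, which changes \<open>A w\<close> only through \<open>A u\<close>, and the Euler operators multiply by \<open>A w - \<beta>\<close>.
\<close>

lemma solution_face_exps:
  fixes A :: "int^'n^'d" and h :: "rat^'d"
  assumes b: "b \<noteq> 0" "\<And>j. (\<Sum>i\<in>UNIV. h $ i * mcol A j $ i) = b"
  shows "solution A \<beta> (face_exps A \<tau> v) (\<lambda>w. if w \<in> face_exps A \<tau> v \<and> amap A w = \<beta> then 1 else 0)"
    (is "solution A \<beta> ?S ?c")
proof
  show "stab ?S" by (rule stab_face_exps)
  have "bd (Re ((\<Sum>i\<in>UNIV. of_rat (h $ i) * \<beta> $ i) / of_rat b)) ?c"
    unfolding bd_def wdeg_def by (auto simp: homogeneous_sum[OF b])
  then show c: "bdd ?c" unfolding bdd_def by blast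
  fix r :: "'n opr" and w assume r: "r \<in> H_ideal A \<beta>" and w: "w \<in> ?S"
  define I where "I = {r \<in> carrier W. \<forall>w\<in>?S. act r ?c w = 0}"
  have "left_ideal I W"
  proof (rule left_idealI)
    show "I \<subseteq> carrier W" by (auto simp: I_def)
    show "\<zero>\<^bsub>W\<^esub> \<in> I" unfolding I_def using act_zero[OF open_UNIV UNIV_I c] weyl.zero_closed by (simp add: weyl_fields)
    show "x \<oplus>\<^bsub>W\<^esub> y \<in> I" if "x \<in> I" "y \<in> I" for x y
      using that act_weyl_add[OF _ _ c, of x y] weyl.a_closed[of x y] unfolding I_def by simp
    show "p \<otimes>\<^bsub>W\<^esub> x \<in> I" if p: "p \<in> carrier W" and x: "x \<in> I" for p x
    proof -
      have xW: "x \<in> carrier W" and xw: "\<And>w. w \<in> ?S \<Longrightarrow> act x ?c w = 0" using x unfolding I_def by blast+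
      have "act (p \<otimes>\<^bsub>W\<^esub> x) ?c w = 0" if w: "w \<in> ?S" for w
      proof -
        have "act p (act x ?c) w = act p (\<lambda>w. 0) w"
          by (rule act_stab[OF open_UNIV UNIV_I weyl_diff_ops[OF p] stab_face_exps act_weyl_bdd[OF xW c] bdd_0 xw w])
        also have "\<dots> = 0" using LP_0[OF rep_LP[OF rep_act[OF open_UNIV UNIV_I weyl_diff_ops[OF p]]]] by simp
        finally show ?thesis unfolding act_weyl_mult[OF p xW c] .
      qed
      then show ?thesis unfolding I_def using weyl.m_closed[OF p xW] by blast
    qed
  qed
  then have "H_ideal A \<beta> \<subseteq> I"
  proof (rule H_ideal_least)
    fix u u' assume e: "amap A (emb u) = amap A (emb u')"
    have "act (d_monom u \<ominus>\<^bsub>W\<^esub> d_monom u') ?c w = 0" if w: "w \<in> ?S" for w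
    proof -
      have "act (d_monom u) ?c w = act ((d_monom u \<ominus>\<^bsub>W\<^esub> d_monom u') \<oplus>\<^bsub>W\<^esub> d_monom u') ?c w"
        by (simp add: a_minus_def weyl.a_assoc weyl.l_neg)
      also have "\<dots> = act (d_monom u \<ominus>\<^bsub>W\<^esub> d_monom u') ?c w + act (d_monom u') ?c w"
        using act_weyl_add[OF _ _ c, of "d_monom u \<ominus>\<^bsub>W\<^esub> d_monom u'" "d_monom u'"] by simp
      finally show ?thesis
        unfolding act_d_monom[OF c] by (simp add: face_exps_shift[OF w] amap_add e)
    qed
    then show "d_monom u \<ominus>\<^bsub>W\<^esub> d_monom u' \<in> I" unfolding I_def by simp
  next
    fix i
    show "euler_op A \<beta> i \<in> I" unfolding I_def using act_euler_op[OF c, of A \<beta> i] by (simp add: euler_op_weyl)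
  qed
  then show "act r ?c w = 0" using r w unfolding I_def by blast
qed

lemma face_space_exp:
  assumes "l \<in> face_space A \<tau>"
  obtains v where "\<And>j. mcol A j \<notin> \<tau> \<Longrightarrow> v $ j = 0" "amap A v = l"
proof -
  let ?X = "{l. \<exists>v. (\<forall>j. mcol A j \<notin> \<tau> \<longrightarrow> v $ j = 0) \<and> amap A v = l}"
  have "face_space A \<tau> \<subseteq> ?X"
    unfolding face_space_def
  proof (rule vec.span_minimal)
    show "face_cols A \<tau> \<subseteq> ?X"
    proof
      fix x assume "x \<in> face_cols A \<tau>"
      then obtain j where j: "x = mcol A j" "mcol A j \<in> \<tau>" unfolding face_cols_def by blast
      have "\<forall>i. mcol A i \<notin> \<tau> \<longrightarrow> axis j 1 $ i = (0 :: complex)" using j by (auto simp: axis_def)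
      moreover have "amap A (axis j 1) = x" unfolding amap_axis j ..
      ultimately show "x \<in> ?X" by blast
    qed
    show "vec.subspace ?X"
    proof (rule vec.subspaceI)
      show "0 \<in> ?X" by (intro CollectI exI[of _ 0]) simp
      show "x + y \<in> ?X" if xy: "x \<in> ?X" "y \<in> ?X" for x y
      proof -
        obtain v v' where "\<forall>j. mcol A j \<notin> \<tau> \<longrightarrow> v $ j = 0" "amap A v = x" "\<forall>j. mcol A j \<notin> \<tau> \<longrightarrow> v' $ j = 0" "amap A v' = y"
          using xy by blast
        then show ?thesis by (intro CollectI exI[of _ "v + v'"]) (simp add: amap_add)
      qed
      show "a *s x \<in> ?X" if x: "x \<in> ?X" for a x
      proof -
        obtain v where "\<forall>j. mcol A j \<notin> \<tau> \<longrightarrow> v $ j = 0" "amap A v = x" using x by blast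
        then show ?thesis by (intro CollectI exI[of _ "a *s v"]) (simp add: amap_smult)
      qed
    qed
  qed
  then show thesis using assms that by blast
qed

lemma group_closure_int_smult:
  fixes x :: "complex^'d"
  assumes x: "x \<in> group_closure S" and "a \<in> \<int>" shows "a *s x \<in> group_closure S"
proof -
  have n: "of_nat n *s x \<in> group_closure S" for n
  proof (induction n)
    case (Suc n)
    have "of_nat (Suc n) *s x = x + of_nat n *s x" by (simp add: vec_eq_iff algebra_simps)
    then show ?case using group_closure_add[OF x Suc] by simp
  qed simp
  obtain k where k: "a = of_int k" using assms(2) by (rule Ints_cases)
  show ?thesis
  proof (cases k rule: int_cases)
    case (nonneg n) then show ?thesis using n[of n] k by simp
  next
    case (neg n)
    have "a *s x = - (of_nat (Suc n) *s x)" unfolding k neg of_int_minus of_int_of_nat_eq by (simp add: vec_eq_iff)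
    then show ?thesis using n[of "Suc n"] by (simp only: group_closure_minus_iff)
  qed
qed

lemma face_lattice_iff:
  fixes A :: "int^'n^'d"
  shows "z \<in> face_lattice A \<tau> \<longleftrightarrow> (\<exists>u. (\<forall>j. u $ j \<in> \<int>) \<and> (\<forall>j. mcol A j \<notin> \<tau> \<longrightarrow> u $ j = 0) \<and> amap A u = z)"
proof
  assume "z \<in> face_lattice A \<tau>"
  then show "\<exists>u. (\<forall>j. u $ j \<in> \<int>) \<and> (\<forall>j. mcol A j \<notin> \<tau> \<longrightarrow> u $ j = 0) \<and> amap A u = z"
    unfolding face_lattice_def
  proof (induction rule: group_closure.induct)
    case (base x)
    show ?case
    proof (cases "x = 0")
      case True then show ?thesis by (intro exI[of _ 0]) simp
    next
      case False
      then obtain j where "x = mcol A j" "mcol A j \<in> \<tau>" using base unfolding face_cols_def by blast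
      then have "\<forall>i. axis j 1 $ i \<in> (\<int> :: complex set)" "\<forall>i. mcol A i \<notin> \<tau> \<longrightarrow> axis j 1 $ i = (0 :: complex)"
        "amap A (axis j 1) = x" by (auto simp: axis_def) (simp only: amap_axis axis_def[symmetric])
      then show ?thesis by blast
    qed
  next
    case (diff x y)
    then obtain u u' where "\<forall>j. u $ j \<in> \<int>" "\<forall>j. mcol A j \<notin> \<tau> \<longrightarrow> u $ j = 0" "amap A u = x"
      "\<forall>j. u' $ j \<in> \<int>" "\<forall>j. mcol A j \<notin> \<tau> \<longrightarrow> u' $ j = 0" "amap A u' = y" by blast
    then show ?case by (intro exI[of _ "u - u'"]) (simp add: amap_diff)
  qed
next
  assume "\<exists>u. (\<forall>j. u $ j \<in> \<int>) \<and> (\<forall>j. mcol A j \<notin> \<tau> \<longrightarrow> u $ j = 0) \<and> amap A u = z"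
  then obtain u where u: "\<forall>j. u $ j \<in> \<int>" "\<forall>j. mcol A j \<notin> \<tau> \<longrightarrow> u $ j = 0" "amap A u = z" by blast
  have "u $ j *s mcol A j \<in> face_lattice A \<tau>" for j
  proof (cases "mcol A j \<in> \<tau>")
    case True
    then have "mcol A j \<in> face_lattice A \<tau>" unfolding face_lattice_def face_cols_def by (intro group_closure.base) blast
    then show ?thesis using u(1) unfolding face_lattice_def by (intro group_closure_int_smult) simp_all
  next
    case False
    then have e: "u $ j *s mcol A j = (0 :: complex^'d)" using u(2) by simp
    show ?thesis unfolding e face_lattice_def by simp
  qed
  then have "(\<Sum>j\<in>J. u $ j *s mcol A j) \<in> face_lattice A \<tau>" for J
    by (induction J rule: infinite_finite_induct) (simp_all add: face_lattice_def group_closure_add)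
  then show "z \<in> face_lattice A \<tau>" unfolding u(3)[symmetric] amap_eq_sum .
qed

text \<open>
  For \<open>v\<close> supported on the columns in \<open>\<tau>\<close>, the class of \<open>A v\<close> belongs to \<open>E\<^sub>\<tau>(\<beta>)\<close> if and only if \<open>\<beta>\<close>
  is the image of an exponent in the set attached to \<open>v\<close>.
\<close>

lemma face_exps_hit:
  assumes v: "\<And>j. mcol A j \<notin> \<tau> \<Longrightarrow> v $ j = 0"
  shows "(\<exists>w\<in>face_exps A \<tau> v. amap A w = \<beta>) \<longleftrightarrow> \<beta> - amap A v \<in> col_monoid A + face_lattice A \<tau>"
proof
  assume "\<exists>w\<in>face_exps A \<tau> v. amap A w = \<beta>"
  then obtain w where w: "w \<in> face_exps A \<tau> v" "amap A w = \<beta>" by blast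
  have w1: "w $ j - v $ j \<in> \<int>" if "mcol A j \<in> \<tau>" for j
    using w(1) that unfolding face_exps_def by (auto split: if_splits dest: spec[of _ j])
  have w2: "w $ j \<in> \<nat>" if "mcol A j \<notin> \<tau>" for j
    using w(1) that unfolding face_exps_def by (auto split: if_splits dest: spec[of _ j])
  define u where "u = (\<chi> j. if mcol A j \<in> \<tau> then w $ j - v $ j else 0)"
  have "\<forall>j. \<exists>n. mcol A j \<notin> \<tau> \<longrightarrow> w $ j = of_nat n" using w2 by (auto elim: Nats_cases)
  then obtain b where b: "\<And>j. mcol A j \<notin> \<tau> \<Longrightarrow> w $ j = of_nat (b j)" by metis
  have e: "w - v = emb (\<chi> j. if mcol A j \<in> \<tau> then 0 else b j) + u"
    using v by (simp add: vec_eq_iff u_def b)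
  have "amap A u \<in> face_lattice A \<tau>"
    unfolding face_lattice_iff by (rule exI[of _ u]) (simp add: u_def w1)
  then show "\<beta> - amap A v \<in> col_monoid A + face_lattice A \<tau>"
    unfolding w(2)[symmetric] amap_diff[symmetric] e amap_add col_monoid_eq by (intro set_plus_intro) simp_all
next
  assume "\<beta> - amap A v \<in> col_monoid A + face_lattice A \<tau>"
  then obtain b z where bz: "\<beta> - amap A v = amap A (emb b) + z" "z \<in> face_lattice A \<tau>"
    unfolding set_plus_def col_monoid_eq by blast
  then obtain u where u: "\<forall>j. u $ j \<in> \<int>" "\<forall>j. mcol A j \<notin> \<tau> \<longrightarrow> u $ j = 0" "amap A u = z"
    unfolding face_lattice_iff by blast
  have "v + u \<in> face_exps A \<tau> v" unfolding face_exps_def using u v by auto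
  then have "v + u + emb b \<in> face_exps A \<tau> v" by (rule face_exps_shift)
  moreover have "amap A (v + u + emb b) = \<beta>" using bz(1) u(3) by (simp add: amap_add algebra_simps)
  ultimately show "\<exists>w\<in>face_exps A \<tau> v. amap A w = \<beta>" by blast
qed

lemma E_set_subset:
  assumes "\<And>v. \<exists>w\<in>face_exps A \<tau> v. amap A w = \<beta> \<Longrightarrow> \<exists>w\<in>face_exps A \<tau> v. amap A w = \<beta>'"
  shows "E_set A \<tau> \<beta> \<subseteq> E_set A \<tau> \<beta>'"
proof
  fix X assume "X \<in> E_set A \<tau> \<beta>"
  then obtain l where l: "X = l +o face_lattice A \<tau>" "l \<in> face_space A \<tau>" "\<beta> - l \<in> col_monoid A + face_lattice A \<tau>"
    unfolding E_set_def by blast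
  obtain v where v: "\<And>j. mcol A j \<notin> \<tau> \<Longrightarrow> v $ j = 0" "amap A v = l" using face_space_exp[OF l(2)] by blast
  have "\<exists>w\<in>face_exps A \<tau> v. amap A w = \<beta>'"
    by (rule assms, rule iffD2[OF face_exps_hit[OF v(1)]]) (simp_all add: v(2) l(3))
  then have "\<beta>' - l \<in> col_monoid A + face_lattice A \<tau>"
    using face_exps_hit[of A \<tau> v, OF v(1), of \<beta>'] v(2) by simp
  then show "X \<in> E_set A \<tau> \<beta>'" unfolding E_set_def using l by blast
qed

theorem theorem7p3:
  fixes A :: "int^'n^'d" and \<beta> \<beta>' :: "complex^'d"
  assumes "rank (\<chi> i j. of_int (A $ i $ j) :: rat^'n^'d) = CARD('d)"
    and "\<exists>(h :: rat^'d) b. h \<noteq> 0 \<and> b \<noteq> 0 \<and> (\<forall>j. (\<Sum>i\<in>UNIV. h $ i * mcol A j $ i) = b)"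
  shows "isomorphic_modules D_sheaf (D_tensor (M_alg A \<beta>)) (D_tensor (M_alg A \<beta>')) \<longleftrightarrow>
         (\<forall>\<tau>. is_face \<tau> (cone_of A) \<longrightarrow> E_set A \<tau> \<beta> = E_set A \<tau> \<beta>')"
proof
  assume iso: "isomorphic_modules D_sheaf (D_tensor (M_alg A \<beta>)) (D_tensor (M_alg A \<beta>'))"
  obtain h :: "rat^'d" and b where hb: "b \<noteq> 0" "\<And>j. (\<Sum>i\<in>UNIV. h $ i * mcol A j $ i) = b"
    using assms(2) by blast
  have 1: "\<exists>w\<in>face_exps A \<tau> v. amap A w = \<beta>" if "\<exists>w\<in>face_exps A \<tau> v. amap A w = \<beta>'" for \<tau> v
  proof -
    from that obtain w0 where w0: "w0 \<in> face_exps A \<tau> v" "amap A w0 = \<beta>'" by blast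
    show ?thesis
      by (rule iso_exponents(1)[OF iso solution_face_exps[OF hb] w0(1)]) (simp add: w0)
  qed
  have 2: "\<exists>w\<in>face_exps A \<tau> v. amap A w = \<beta>'" if "\<exists>w\<in>face_exps A \<tau> v. amap A w = \<beta>" for \<tau> v
  proof -
    from that obtain w0 where w0: "w0 \<in> face_exps A \<tau> v" "amap A w0 = \<beta>" by blast
    show ?thesis
      by (rule iso_exponents(2)[OF iso solution_face_exps[OF hb] w0(1)]) (simp add: w0)
  qed
  show "\<forall>\<tau>. is_face \<tau> (cone_of A) \<longrightarrow> E_set A \<tau> \<beta> = E_set A \<tau> \<beta>'"
    by (intro allI impI subset_antisym) (rule E_set_subset, erule 2, rule E_set_subset, erule 1)
next
  assume "\<forall>\<tau>. is_face \<tau> (cone_of A) \<longrightarrow> E_set A \<tau> \<beta> = E_set A \<tau> \<beta>'"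
  then show "isomorphic_modules D_sheaf (D_tensor (M_alg A \<beta>)) (D_tensor (M_alg A \<beta>'))"
    by (intro iso_if_E_set_eq) blast
qed

end
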